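(* Let $(M,J,\overline g,\overline\omega)$ be a Kähler manifold of real dimension $2n$ with negative (definite) Ricci curvature, let $L$ be a smooth compact oriented $n$-dimensional manifold, and let $\iota:L\to M$ be a $J$-minimal immersion. Then $\iota$ is locally unique, in the sense that there exists an open $C^{2,a}$-neighbourhood of $\iota$ containing no other $J$-minimal immersions (where $a\in(0,1)$, and immersions differing by a reparametrisation of $L$ are identified).
   Context: Let $h=\overline g-i\overline\omega$ be the Hermitian metric of $M$. An immersion $\iota:L\to M$ is totally real if $T_{\iota(p)}M=\iota_*(T_pL)\oplus J\iota_*(T_pL)$ for all $p\in L$. Let $g=\iota^*\overline g$ with volume form $\mathrm{vol}_g$ on the oriented manifold $L$. For a $g$-orthonormal basis $e_1,\dots,e_n$ of $T_pL$ (identified with its image) set $\rho_J(p)=\big(\det_{\mathbb C}h(e_i,e_j)\big)^{1/2}=\sqrt{\mathrm{vol}_{\overline g}(e_1,\dots,e_n,Je_1,\dots,Je_n)}$ (with the sign of the orientation chosen so that the quantity under the root is positive). The $J$-volume form is $\mathrm{vol}_J[\iota]=\rho_J\,\mathrm{vol}_g$ and the $J$-volume functional on totally real immersions is $\mathrm{Vol}_J(\iota)=\int_L\mathrm{vol}_J[\iota]$. A totally real immersion is $J$-minimal if it is a critical point of $\mathrm{Vol}_J$ on the space of totally real immersions of $L$ in $M$. *)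

theory Defs
  imports "HOL-Analysis.Analysis"
begin

section \<open>Smooth functions on open subsets of Euclidean spaces\<close>

fun iterated_deriv ::
  "'a::euclidean_space list \<Rightarrow> ('a \<Rightarrow> 'b::real_normed_vector) \<Rightarrow> 'a \<Rightarrow> 'b" where
  "iterated_deriv [] f = f"
| "iterated_deriv (v # vs) f = (\<lambda>x. frechet_derivative (iterated_deriv vs f) (at x) v)"

text \<open>Only meant for open \<open>S\<close>, where it is the usual notion of a \<open>C\<close>-infinity function on \<open>S\<close>.\<close>

definition smooth_on ::
  "'a::euclidean_space set \<Rightarrow> ('a \<Rightarrow> 'b::real_normed_vector) \<Rightarrow> bool" where
  "smooth_on S f \<longleftrightarrow> (\<forall>vs. \<forall>x\<in>S. iterated_deriv vs f differentiable (at x))"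

definition pd :: "'k::finite \<Rightarrow> (real^'k \<Rightarrow> 'b::real_normed_vector) \<Rightarrow> real^'k \<Rightarrow> 'b" where
  "pd i f x = frechet_derivative f (at x) (axis i 1)"


section \<open>Smooth manifolds\<close>

text \<open>
  A \<open>k\<close>-dimensional smooth manifold is a Hausdorff, second countable topological space (these two
  properties are expressed by the sort of the type of points) together with a smooth atlas; the
  dimension is \<open>CARD('k)\<close>. The atlas need not be maximal.
\<close>

type_synonym ('x, 'k) chart = "'x set \<times> ('x \<Rightarrow> real^'k)"

definition chart_dom :: "('x, 'k) chart \<Rightarrow> 'x set" where
  "chart_dom c = fst c"

definition chart_map :: "('x, 'k) chart \<Rightarrow> 'x \<Rightarrow> real^'k" where
  "chart_map c = snd c"

definition chart_img :: "('x, 'k) chart \<Rightarrow> (real^'k) set" where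
  "chart_img c = chart_map c ` chart_dom c"

definition chart_inv :: "('x, 'k) chart \<Rightarrow> real^'k \<Rightarrow> 'x" where
  "chart_inv c = inv_into (chart_dom c) (chart_map c)"

definition is_chart :: "('x::topological_space, 'k::finite) chart \<Rightarrow> bool" where
  "is_chart c \<longleftrightarrow> open (chart_dom c) \<and> open (chart_img c) \<and>
     homeomorphism (chart_dom c) (chart_img c) (chart_map c) (chart_inv c)"

definition transition :: "('x, 'k) chart \<Rightarrow> ('x, 'k) chart \<Rightarrow> real^'k \<Rightarrow> real^'k" where
  "transition c d = chart_map d \<circ> chart_inv c"

definition overlap :: "('x, 'k) chart \<Rightarrow> ('x, 'k) chart \<Rightarrow> (real^'k) set" where
  "overlap c d = chart_map c ` (chart_dom c \<inter> chart_dom d)"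

definition smooth_atlas ::
  "('x::{t2_space, second_countable_topology}, 'k::finite) chart set \<Rightarrow> bool" where
  "smooth_atlas A \<longleftrightarrow> (\<forall>c\<in>A. is_chart c) \<and> (\<Union>c\<in>A. chart_dom c) = UNIV \<and>
     (\<forall>c\<in>A. \<forall>d\<in>A. smooth_on (overlap c d) (transition c d))"

text \<open>An orientation is given by an atlas whose transition maps preserve orientation.\<close>

definition oriented_atlas ::
  "('x::{t2_space, second_countable_topology}, 'k::finite) chart set \<Rightarrow> bool" where
  "oriented_atlas A \<longleftrightarrow> smooth_atlas A \<and>
     (\<forall>c\<in>A. \<forall>d\<in>A. \<forall>x\<in>overlap c d. det (jacobian (transition c d) (at x)) > 0)"

definition chart_at :: "('x, 'k) chart set \<Rightarrow> 'x \<Rightarrow> ('x, 'k) chart" where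
  "chart_at A p = (SOME c. c \<in> A \<and> p \<in> chart_dom c)"


section \<open>Smooth maps\<close>

definition local_rep ::
  "('x \<Rightarrow> 'y) \<Rightarrow> ('x, 'k) chart \<Rightarrow> ('y, 'm) chart \<Rightarrow> real^'k \<Rightarrow> real^'m" where
  "local_rep f c d = chart_map d \<circ> f \<circ> chart_inv c"

definition local_dom ::
  "('x \<Rightarrow> 'y) \<Rightarrow> ('x, 'k) chart \<Rightarrow> ('y, 'm) chart \<Rightarrow> (real^'k) set" where
  "local_dom f c d = chart_map c ` (chart_dom c \<inter> f -` chart_dom d)"

definition smooth_map ::
  "('x::topological_space, 'k::finite) chart set \<Rightarrow> ('y::topological_space, 'm::finite) chart set \<Rightarrow>
   ('x \<Rightarrow> 'y) \<Rightarrow> bool" where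
  "smooth_map A B f \<longleftrightarrow> continuous_on UNIV f \<and>
     (\<forall>c\<in>A. \<forall>d\<in>B. smooth_on (local_dom f c d) (local_rep f c d))"

definition immersion ::
  "('x::topological_space, 'k::finite) chart set \<Rightarrow> ('y::topological_space, 'm::finite) chart set \<Rightarrow>
   ('x \<Rightarrow> 'y) \<Rightarrow> bool" where
  "immersion A B f \<longleftrightarrow> smooth_map A B f \<and>
     (\<forall>c\<in>A. \<forall>d\<in>B. \<forall>x\<in>local_dom f c d. inj (frechet_derivative (local_rep f c d) (at x)))"

text \<open>Reparametrisations of an oriented manifold: orientation preserving diffeomorphisms.\<close>

definition reparametrisation ::
  "('x::topological_space, 'k::finite) chart set \<Rightarrow> ('x \<Rightarrow> 'x) \<Rightarrow> bool" where
  "reparametrisation A \<phi> \<longleftrightarrow> bij \<phi> \<and> smooth_map A A \<phi> \<and> smooth_map A A (inv \<phi>) \<and>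
     (\<forall>c\<in>A. \<forall>d\<in>A. \<forall>x\<in>local_dom \<phi> c d. det (jacobian (local_rep \<phi> c d) (at x)) > 0)"


section \<open>Tensor fields, Kaehler structures and Ricci curvature\<close>

text \<open>
  A tensor field of rank two assigns to every chart \<open>c\<close> of the atlas and every point \<open>x\<close> of the
  coordinate domain \<open>chart_img c\<close> its matrix with respect to the coordinate frame of \<open>c\<close>; matrices
  belonging to different charts are related by the transformation law of the type of the tensor.
  A bilinear form \<open>b\<close> has entries \<open>b(\<partial>\<^sub>i, \<partial>\<^sub>j)\<close>, an endomorphism acts on column vectors.
\<close>

type_synonym ('x, 'k) tensor2 = "('x, 'k) chart \<Rightarrow> real^'k \<Rightarrow> real^'k^'k"

definition bilinear_form_field ::
  "('x, 'k::finite) chart set \<Rightarrow> ('x, 'k) tensor2 \<Rightarrow> bool" where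
  "bilinear_form_field A b \<longleftrightarrow> (\<forall>c\<in>A. smooth_on (chart_img c) (b c)) \<and>
     (\<forall>c\<in>A. \<forall>d\<in>A. \<forall>x\<in>overlap c d.
        let D = jacobian (transition c d) (at x)
        in b c x = transpose D ** b d (transition c d x) ** D)"

definition endomorphism_field ::
  "('x, 'k::finite) chart set \<Rightarrow> ('x, 'k) tensor2 \<Rightarrow> bool" where
  "endomorphism_field A J \<longleftrightarrow> (\<forall>c\<in>A. smooth_on (chart_img c) (J c)) \<and>
     (\<forall>c\<in>A. \<forall>d\<in>A. \<forall>x\<in>overlap c d.
        let D = jacobian (transition c d) (at x)
        in D ** J c x = J d (transition c d x) ** D)"

definition riemannian_metric ::
  "('x, 'k::finite) chart set \<Rightarrow> ('x, 'k) tensor2 \<Rightarrow> bool" where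
  "riemannian_metric A g \<longleftrightarrow> bilinear_form_field A g \<and>
     (\<forall>c\<in>A. \<forall>x\<in>chart_img c. transpose (g c x) = g c x \<and> (\<forall>v. v \<noteq> 0 \<longrightarrow> v \<bullet> (g c x *v v) > 0))"

text \<open>
  Components \<open>N\<^sup>k\<^sub>i\<^sub>j\<close> of the Nijenhuis tensor
  \<open>N(X, Y) = [JX, JY] - J [JX, Y] - J [X, JY] - [X, Y]\<close>.
\<close>

definition nijenhuis ::
  "(real^'k::finite \<Rightarrow> real^'k^'k) \<Rightarrow> 'k \<Rightarrow> 'k \<Rightarrow> 'k \<Rightarrow> real^'k \<Rightarrow> real" where
  "nijenhuis J k i j x =
     (\<Sum>l\<in>UNIV. J x $ l $ i * pd l (\<lambda>y. J y $ k $ j) x - J x $ l $ j * pd l (\<lambda>y. J y $ k $ i) x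
       + J x $ k $ l * (pd j (\<lambda>y. J y $ l $ i) x - pd i (\<lambda>y. J y $ l $ j) x))"

definition complex_structure ::
  "('x, 'k::finite) chart set \<Rightarrow> ('x, 'k) tensor2 \<Rightarrow> bool" where
  "complex_structure A J \<longleftrightarrow> endomorphism_field A J \<and>
     (\<forall>c\<in>A. \<forall>x\<in>chart_img c. J c x ** J c x = - mat 1 \<and> (\<forall>k i j. nijenhuis (J c) k i j x = 0))"

definition closed_two_form ::
  "('x, 'k::finite) chart set \<Rightarrow> ('x, 'k) tensor2 \<Rightarrow> bool" where
  "closed_two_form A \<omega> \<longleftrightarrow> bilinear_form_field A \<omega> \<and>
     (\<forall>c\<in>A. \<forall>x\<in>chart_img c. transpose (\<omega> c x) = - \<omega> c x \<and>
        (\<forall>i j k. pd i (\<lambda>y. \<omega> c y $ j $ k) x + pd j (\<lambda>y. \<omega> c y $ k $ i) x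
               + pd k (\<lambda>y. \<omega> c y $ i $ j) x = 0))"

text \<open>
  The convention \<open>\<omega>(X, Y) = g(JX, Y)\<close> is the one for which \<open>h = g - i \<omega>\<close> is complex linear in
  its first argument.
\<close>

definition kaehler ::
  "('x::{t2_space, second_countable_topology}, 'k::finite) chart set \<Rightarrow>
   ('x, 'k) tensor2 \<Rightarrow> ('x, 'k) tensor2 \<Rightarrow> ('x, 'k) tensor2 \<Rightarrow> bool" where
  "kaehler A J g \<omega> \<longleftrightarrow> smooth_atlas A \<and> complex_structure A J \<and> riemannian_metric A g \<and>
     closed_two_form A \<omega> \<and>
     (\<forall>c\<in>A. \<forall>x\<in>chart_img c.
        transpose (J c x) ** g c x ** J c x = g c x \<and> \<omega> c x = transpose (J c x) ** g c x)"

definition christoffel ::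
  "(real^'k::finite \<Rightarrow> real^'k^'k) \<Rightarrow> 'k \<Rightarrow> 'k \<Rightarrow> 'k \<Rightarrow> real^'k \<Rightarrow> real" where
  "christoffel g k i j x = (1/2) * (\<Sum>l\<in>UNIV. matrix_inv (g x) $ k $ l *
     (pd i (\<lambda>y. g y $ j $ l) x + pd j (\<lambda>y. g y $ i $ l) x - pd l (\<lambda>y. g y $ i $ j) x))"

text \<open>The sign is the one for which round spheres have positive Ricci curvature.\<close>

definition ricci :: "(real^'k::finite \<Rightarrow> real^'k^'k) \<Rightarrow> real^'k \<Rightarrow> real^'k^'k" where
  "ricci g x = (\<chi> i j.
     (\<Sum>k\<in>UNIV. pd k (christoffel g k i j) x - pd j (christoffel g k i k) x) +
     (\<Sum>k\<in>UNIV. \<Sum>l\<in>UNIV. christoffel g k k l x * christoffel g l i j x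
                          - christoffel g k j l x * christoffel g l i k x))"

definition negative_ricci :: "('x, 'k::finite) chart set \<Rightarrow> ('x, 'k) tensor2 \<Rightarrow> bool" where
  "negative_ricci A g \<longleftrightarrow> (\<forall>c\<in>A. \<forall>x\<in>chart_img c. \<forall>v. v \<noteq> 0 \<longrightarrow> v \<bullet> (ricci (g c) x *v v) < 0)"


section \<open>Totally real immersions and the J-volume\<close>

text \<open>The condition is \<open>T M = f\<^sub>* T L \<oplus> J f\<^sub>* T L\<close> at every point, in local coordinates.\<close>

definition totally_real_immersion ::
  "('l::topological_space, 'n::finite) chart set \<Rightarrow> ('p::topological_space, 'm::finite) chart set \<Rightarrow>
   ('p, 'm) tensor2 \<Rightarrow> ('l \<Rightarrow> 'p) \<Rightarrow> bool" where
  "totally_real_immersion AL AM J f \<longleftrightarrow> immersion AL AM f \<and>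
     (\<forall>c\<in>AL. \<forall>d\<in>AM. \<forall>x\<in>local_dom f c d.
        let T = range (frechet_derivative (local_rep f c d) (at x));
            JT = (\<lambda>v. J d (local_rep f c d x) *v v) ` T
        in T \<inter> JT = {0} \<and> {u + v |u v. u \<in> T \<and> v \<in> JT} = UNIV)"

text \<open>The Hermitian form \<open>h = g - i \<omega>\<close>.\<close>

definition hermitian_form ::
  "('p, 'm::finite) tensor2 \<Rightarrow> ('p, 'm) tensor2 \<Rightarrow> ('p, 'm) chart \<Rightarrow> real^'m \<Rightarrow>
   real^'m \<Rightarrow> real^'m \<Rightarrow> complex" where
  "hermitian_form g \<omega> d y u v = Complex (u \<bullet> (g d y *v v)) (- (u \<bullet> (\<omega> d y *v v)))"

text \<open>
  The following three definitions describe objects on \<open>L\<close> in the coordinates of a chart \<open>c\<close>; the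
  target chart is an arbitrary one around the image point, on which nothing depends.
\<close>

definition induced_metric ::
  "('p, 'm::finite) chart set \<Rightarrow> ('p, 'm) tensor2 \<Rightarrow> ('l \<Rightarrow> 'p) \<Rightarrow> ('l, 'n::finite) tensor2" where
  "induced_metric AM g f c x =
     (let d = chart_at AM (f (chart_inv c x)); D = jacobian (local_rep f c d) (at x)
      in transpose D ** g d (local_rep f c d x) ** D)"

text \<open>
  \<open>e\<close> is an orthonormal basis for the induced metric, with members \<open>e $ i\<close>. Since \<open>h(e\<^sub>i, e\<^sub>j)\<close> is a
  Hermitian matrix, its determinant is real.
\<close>

definition rho_J ::
  "('p, 'm::finite) chart set \<Rightarrow> ('p, 'm) tensor2 \<Rightarrow> ('p, 'm) tensor2 \<Rightarrow> ('l \<Rightarrow> 'p) \<Rightarrow>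
   ('l, 'n::finite) chart \<Rightarrow> real^'n \<Rightarrow> real" where
  "rho_J AM g \<omega> f c x =
     (let d = chart_at AM (f (chart_inv c x));
          D = frechet_derivative (local_rep f c d) (at x);
          e = (SOME e :: real^'n^'n. \<forall>i j.
                 e $ i \<bullet> (induced_metric AM g f c x *v e $ j) = (if i = j then 1 else 0));
          H = (\<chi> i j. hermitian_form g \<omega> d (local_rep f c d x) (D (e $ i)) (D (e $ j)))
                :: complex^'n^'n
      in sqrt (Re (det H)))"

text \<open>
  The coefficient of \<open>vol\<^sub>J = \<rho>\<^sub>J vol\<^sub>g\<close> with respect to \<open>dx\<^sub>1 \<and> \<dots> \<and> dx\<^sub>n\<close> in a positively oriented
  chart.
\<close>

definition vol_J_form ::
  "('p, 'm::finite) chart set \<Rightarrow> ('p, 'm) tensor2 \<Rightarrow> ('p, 'm) tensor2 \<Rightarrow> ('l \<Rightarrow> 'p) \<Rightarrow>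
   ('l, 'n::finite) chart \<Rightarrow> real^'n \<Rightarrow> real" where
  "vol_J_form AM g \<omega> f c x = rho_J AM g \<omega> f c x * sqrt (det (induced_metric AM g f c x))"

definition partition_of_unity ::
  "('l::topological_space, 'n::finite) chart set \<Rightarrow>
   ('l, 'n) chart set \<times> (('l, 'n) chart \<Rightarrow> 'l \<Rightarrow> real) \<Rightarrow> bool" where
  "partition_of_unity A P \<longleftrightarrow> (case P of (F, \<theta>) \<Rightarrow>
     finite F \<and> F \<subseteq> A \<and>
     (\<forall>c\<in>F. (\<forall>p. 0 \<le> \<theta> c p) \<and> closure {p. \<theta> c p \<noteq> 0} \<subseteq> chart_dom c \<and>
        (\<forall>d\<in>A. smooth_on (chart_img d) (\<theta> c \<circ> chart_inv d))) \<and>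
     (\<forall>p. (\<Sum>c\<in>F. \<theta> c p) = 1))"

text \<open>
  The integral over a compact oriented manifold of the top degree form whose coefficient in the chart
  \<open>c\<close> is \<open>\<alpha> c\<close>. As usual, it is defined by a partition of unity, on the choice of which it does
  not depend.
\<close>

definition form_integral ::
  "('l::topological_space, 'n::finite) chart set \<Rightarrow> (('l, 'n) chart \<Rightarrow> real^'n \<Rightarrow> real) \<Rightarrow> real" where
  "form_integral A \<alpha> = (case (SOME P. partition_of_unity A P) of (F, \<theta>) \<Rightarrow>
     (\<Sum>c\<in>F. integral (chart_img c) (\<lambda>x. \<theta> c (chart_inv c x) * \<alpha> c x)))"

definition Vol_J ::
  "('l::topological_space, 'n::finite) chart set \<Rightarrow> ('p, 'm::finite) chart set \<Rightarrow>
   ('p, 'm) tensor2 \<Rightarrow> ('p, 'm) tensor2 \<Rightarrow> ('l \<Rightarrow> 'p) \<Rightarrow> real" where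
  "Vol_J AL AM g \<omega> f = form_integral AL (vol_J_form AM g \<omega> f)"


section \<open>J-minimal immersions\<close>

text \<open>A smooth curve of totally real immersions is smooth as a map \<open>(-\<epsilon>, \<epsilon>) \<times> L \<rightarrow> M\<close>.\<close>

definition totally_real_variation ::
  "('l::topological_space, 'n::finite) chart set \<Rightarrow> ('p::topological_space, 'm::finite) chart set \<Rightarrow>
   ('p, 'm) tensor2 \<Rightarrow> ('l \<Rightarrow> 'p) \<Rightarrow> real \<Rightarrow> (real \<Rightarrow> 'l \<Rightarrow> 'p) \<Rightarrow> bool" where
  "totally_real_variation AL AM J f \<epsilon> F \<longleftrightarrow> F 0 = f \<and>
     (\<forall>s\<in>{-\<epsilon><..<\<epsilon>}. totally_real_immersion AL AM J (F s)) \<and>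
     continuous_on ({-\<epsilon><..<\<epsilon>} \<times> UNIV) (\<lambda>(s, p). F s p) \<and>
     (\<forall>c\<in>AL. \<forall>d\<in>AM.
        smooth_on {(s, x). s \<in> {-\<epsilon><..<\<epsilon>} \<and> x \<in> local_dom (F s) c d}
          (\<lambda>(s, x). local_rep (F s) c d x))"

definition J_minimal ::
  "('l::topological_space, 'n::finite) chart set \<Rightarrow> ('p::topological_space, 'm::finite) chart set \<Rightarrow>
   ('p, 'm) tensor2 \<Rightarrow> ('p, 'm) tensor2 \<Rightarrow> ('p, 'm) tensor2 \<Rightarrow> ('l \<Rightarrow> 'p) \<Rightarrow> bool" where
  "J_minimal AL AM J g \<omega> f \<longleftrightarrow> totally_real_immersion AL AM J f \<and>
     (\<forall>\<epsilon>>0. \<forall>F. totally_real_variation AL AM J f \<epsilon> F \<longrightarrow>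
        ((\<lambda>s. Vol_J AL AM g \<omega> (F s)) has_real_derivative 0) (at 0))"


section \<open>The Hoelder topology on the space of smooth maps\<close>

definition C2_hoelder_norm ::
  "real \<Rightarrow> (real^'n::finite) set \<Rightarrow> (real^'n \<Rightarrow> 'b::real_normed_vector) \<Rightarrow> real" where
  "C2_hoelder_norm a K u =
     (SUP x\<in>K. norm (u x)) + (\<Sum>i\<in>UNIV. SUP x\<in>K. norm (pd i u x)) +
     (\<Sum>i\<in>UNIV. \<Sum>j\<in>UNIV. (SUP x\<in>K. norm (pd i (pd j u) x)) +
        (SUP (x, y)\<in>K \<times> K. norm (pd i (pd j u) x - pd i (pd j u) y) / dist x y powr a))"

text \<open>
  The topology on the set of all smooth maps \<open>L \<rightarrow> M\<close> that is induced by the \<open>C\<^sup>2\<^sup>,\<^sup>a\<close> topology: as for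
  the \<open>C\<^sup>r\<close> topologies, it is generated by the maps that are close to a given one in local coordinates
  over a compact subset of a chart domain.
\<close>

definition C2_hoelder_basic ::
  "('l::topological_space, 'n::finite) chart set \<Rightarrow> ('p::topological_space, 'm::finite) chart set \<Rightarrow>
   real \<Rightarrow> ('l \<Rightarrow> 'p) \<Rightarrow> ('l, 'n) chart \<Rightarrow> ('p, 'm) chart \<Rightarrow> 'l set \<Rightarrow> real \<Rightarrow> ('l \<Rightarrow> 'p) set" where
  "C2_hoelder_basic AL AM a f c d K \<epsilon> =
     {f'. smooth_map AL AM f' \<and> f' ` K \<subseteq> chart_dom d \<and>
          C2_hoelder_norm a (chart_map c ` K) (\<lambda>x. local_rep f' c d x - local_rep f c d x) < \<epsilon>}"

definition C2_hoelder_topology ::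
  "('l::topological_space, 'n::finite) chart set \<Rightarrow> ('p::topological_space, 'm::finite) chart set \<Rightarrow>
   real \<Rightarrow> ('l \<Rightarrow> 'p) topology" where
  "C2_hoelder_topology AL AM a = topology_generated_by
     {C2_hoelder_basic AL AM a f c d K \<epsilon> |f c d K \<epsilon>.
        smooth_map AL AM f \<and> c \<in> AL \<and> d \<in> AM \<and> compact K \<and> K \<noteq> {} \<and> K \<subseteq> chart_dom c \<and>
        f ` K \<subseteq> chart_dom d \<and> \<epsilon> > 0}"

end

theory Submission
 imports Defs "HOL-Computational_Algebra.Polynomial"
begin

text \<open>
  Write \<open>T\<close> for the tangent bundle of \<open>L\<close>. The first variation in the direction \<open>J df(X)\<close> shows that a totally
  real immersion \<open>f\<close> is \<open>J\<close>-minimal only if its Maslov form vanishes, that is, the imaginary part of the trace of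
  the complex connection form of the frame \<open>df\<close>. Around the graph of the given immersion \<open>\<iota>\<close> there is a gauge function
  \<open>\<Phi>(p, y) \<in> T\<^sub>p\<close> that agrees to second order with the tangential part of the Riemannian logarithm of \<open>y\<close> at \<open>\<iota>(p)\<close>.
  For \<open>f\<close> close to \<open>\<iota>\<close> the equation \<open>\<Phi>(\<psi>(q), f(q)) = 0\<close> defines a map \<open>\<psi>\<close> close to the identity, and the complex
  linear extension \<open>T\<^sub>\<Phi>\<close> of the vertical derivative of \<open>\<Phi>\<close> gives a phase \<open>S = Im log det (T\<^sub>\<Phi> df)\<close> on \<open>L\<close>. As both Maslov
  forms vanish, \<open>dS\<close> is to first order the Ricci form paired with \<open>w = f - \<iota> \<circ> \<psi>\<close>. Since the Ricci curvature is definite,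
  \<open>w = 0\<close> at the critical points of \<open>S\<close>, and the sign of its Hessian forces \<open>S \<le> 0\<close> at a maximum and \<open>S \<ge> 0\<close> at a
  minimum. Hence \<open>S = 0\<close>, every point is critical and \<open>f = \<iota> \<circ> \<psi>\<close>.
\<close>

section \<open>Smooth calculus\<close>

text \<open>A reparametrised critical point is again critical, so \<open>f\<close> cannot be
  compared with \<open>\<iota>\<close> point by point; the gauge equation divides this group out.
  The conditions on \<open>\<Phi>\<close> along the graph (value 0, vertical derivative the
  projection onto \<open>T\<close> along \<open>JT\<close>, vanishing vertical covariant Hessian)
  are affine, so local solutions can be patched by weights depending on \<open>p\<close> alone. The
  Hessian condition kills the connection form of \<open>T_\<Phi>\<close> on vertical vectors along
  the graph, and the Maslov equation of \<open>\<iota>\<close> kills the imaginary part of its trace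
  on vectors tangent to the graph. Hence the form that gives \<open>dS\<close> vanishes on the
  graph, and its vertical derivative on tangential directions is curvature. With
  \<open>a = d\<psi>\<close> close to 1 and \<open>b = df - d\<iota> d\<psi>\<close> equal to
  \<open>J\<close> times \<open>B\<close> on the frame, the phase at a critical point is
  \<open>det (a + iB)\<close> and the Hessian of \<open>S\<close> is \<open>B G'\<close>, where
  \<open>G'\<close> is close to a matrix with positive quadratic form coming from the curvature.
  Multiplying \<open>a + iB\<close> by \<open>G'\<close> makes its imaginary part the Hessian
  itself; this is why the sign of the Hessian decides the sign of \<open>S\<close>.\<close>

abbreviation "fd f x == frechet_derivative f (at x)"
abbreviation "rep == local_rep"
abbreviation "ldom == local_dom"
abbreviation "cm == chart_map"
abbreviation "ci == chart_inv"
abbreviation "cdom == chart_dom"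
abbreviation "cimg == chart_img"
abbreviation "trn == transition"

lemmas hd_cong = has_derivative_transform_within_open

text \<open>\<open>iterated_deriv\<close> adds new derivatives on the outside, whereas the rules of
  calculus describe the first derivative of a composite map. Taking the derivative of
  \<open>f\<close> itself first makes these rules provable by induction on \<open>k\<close>. The
  derivatives of order below \<open>k\<close> are required to be differentiable, so
  \<open>kdiff 0\<close> says nothing.\<close>

fun kdiff :: "nat => 'a::euclidean_space set => ('a => 'b::real_normed_vector) => bool" where
 "kdiff 0 S f = True"
| "kdiff (Suc k) S f = ((\<forall>x\<in>S. f differentiable (at x)) \<and>
   (\<forall>v. kdiff k S (%x. fd f x v)))"

lemma iterated_deriv_snoc:
 "iterated_deriv (vs @ [v]) f = iterated_deriv vs (%x. fd f x v)"
 by (induction vs) auto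

lemma kdiff_iff:
 fixes f :: "'a::euclidean_space => 'b::real_normed_vector"
 shows "kdiff k S f \<longleftrightarrow> (\<forall>vs. length vs < k --> (\<forall>x\<in>S. iterated_deriv vs f differentiable (at x)))"
proof (induction k arbitrary: f)
 case 0 thus ?case by simp
next
 case (Suc k)
 show ?case (is "_ = ?R")
 proof
  assume L: "kdiff (Suc k) S f"
  show ?R
  proof (intro allI impI ballI)
   fix vs :: "'a list" and x assume len: "length vs < Suc k" and x: "x\<in>S"
   show "iterated_deriv vs f differentiable (at x)"
   proof (cases vs rule: rev_cases)
    case Nil thus ?thesis using L x by auto
   next
    case (snoc ws w)
    thus ?thesis using L x len Suc.IH by (auto simp: iterated_deriv_snoc)
   qed
  qed
 next
  assume R: ?R
  have "f differentiable (at x)" if "x\<in>S" for x using R[rule_format, of "[]"] that by simp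
  moreover have "kdiff k S (%x. fd f x v)" for v
   unfolding Suc.IH using R by (metis iterated_deriv_snoc length_append_singleton not_less_eq)
  ultimately show "kdiff (Suc k) S f" by simp
 qed
qed

lemma smooth_kdiff: "smooth_on S f \<longleftrightarrow> (\<forall>k. kdiff k S f)"
 unfolding smooth_on_def kdiff_iff by blast

lemma smooth_iff:
 "smooth_on S f \<longleftrightarrow> (\<forall>x\<in>S. f differentiable (at x)) \<and>
   (\<forall>v. smooth_on S (%x. fd f x v))"
proof
 assume "smooth_on S f"
 hence "kdiff (Suc k) S f" for k by (simp only: smooth_kdiff)
 thus "(\<forall>x\<in>S. f differentiable (at x)) \<and> (\<forall>v. smooth_on S (%x. fd f x v))"
  by (auto simp: smooth_kdiff)
next
 assume *: "(\<forall>x\<in>S. f differentiable (at x)) \<and> (\<forall>v. smooth_on S (%x. fd f x v))"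
 have "kdiff k S f" for k using * by (cases k) (auto simp: smooth_kdiff)
 thus "smooth_on S f" unfolding smooth_kdiff by blast
qed

lemma smooth_differentiable: "smooth_on S f ==> x\<in>S ==> f differentiable (at x)"
 using smooth_iff by blast

lemma smooth_deriv: "smooth_on S f ==> smooth_on S (%x. fd f x v)"
 using smooth_iff by blast

lemma smooth_hd:
 "smooth_on S f ==> x\<in>S ==> (f has_derivative fd f x) (at x)"
 using smooth_differentiable frechet_derivative_works by blast

lemma smooth_subset: "smooth_on S f ==> T \<subseteq> S ==> smooth_on T f"
 unfolding smooth_on_def by blast

lemma smooth_isCont: "smooth_on S f ==> x\<in>S ==> isCont f x"
 using smooth_differentiable differentiable_imp_continuous_within by blast

lemma smooth_cont: "smooth_on S f ==> continuous_on S f"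
 by (simp add: continuous_at_imp_continuous_on smooth_isCont)

lemma kdiff_mono: "kdiff (Suc k) S f ==> kdiff k S f"
 unfolding kdiff_iff by auto

lemma fd_cong:
 assumes "open S" "x\<in>S" "!!y. y\<in>S ==> f y = g y"
 shows "fd f x = fd g x"
proof -
 have "(f has_derivative D) (at x) \<longleftrightarrow> (g has_derivative D) (at x)" for D
  using hd_cong[OF _ assms(1,2)] assms(3) by (metis (full_types))
 thus ?thesis unfolding frechet_derivative_def by simp
qed

lemma differentiable_cong_open:
 assumes "open S" "x\<in>S" "!!y. y\<in>S ==> f y = g y" "f differentiable (at x)"
 shows "g differentiable (at x)"
 using assms hd_cong[OF _ assms(1,2)]
 unfolding differentiable_def by metis

lemma kdiff_cong:
 assumes "open S" "!!x. x\<in>S ==> f x = g x" "kdiff k S f"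
 shows "kdiff k S g"
 using assms(2,3)
proof (induction k arbitrary: f g)
 case (Suc k)
 have "g differentiable (at x)" if "x\<in>S" for x
  using differentiable_cong_open[OF assms(1) that Suc.prems(1)] Suc.prems(2) that by auto
 moreover have "kdiff k S (%x. fd g x v)" for v
  by (rule Suc.IH[of "%x. fd f x v"])
   (use Suc.prems fd_cong[OF assms(1)] in \<open>metis kdiff.simps(2)\<close>)+
 ultimately show ?case by simp
qed auto

lemma smooth_cong:
 assumes "open S" "!!x. x\<in>S ==> f x = g x"
 shows "smooth_on S f \<longleftrightarrow> smooth_on S g"
 unfolding smooth_kdiff using kdiff_cong[OF assms(1)] assms(2) by metis

lemma smooth_cong': "smooth_on S f ==> open S ==> (!!x. x\<in>S ==> g x = f x) ==> smooth_on S g"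
 using smooth_cong[of S f g] by simp

lemma smooth_locally:
 assumes "!!x. x\<in>S ==> \<exists>U. x\<in>U \<and> smooth_on U f"
 shows "smooth_on S f"
 using assms unfolding smooth_on_def by blast

lemmas fd_works = frechet_derivative_works[THEN iffD1]

lemma kdiff_const: "kdiff k S (%x. c)"
 by (induction k arbitrary: c) (auto simp: frechet_derivative_const)

lemma smooth_const [intro, simp]: "smooth_on S (%x. c)"
 by (simp add: smooth_kdiff kdiff_const)

lemma fdI: "(f has_derivative D) (at x) ==> fd f x = D"
 using frechet_derivative_at by metis

lemma kdiff_linear:
 assumes "bounded_linear h"
 shows "kdiff k S h"
proof (cases k)
 case (Suc j)
 have "fd h x = h" for x
  using assms bounded_linear_imp_has_derivative fdI by blast
 thus ?thesis unfolding Suc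
  using assms bounded_linear_imp_differentiable by (auto simp: kdiff_const)
qed auto

lemma smooth_linear: "bounded_linear h ==> smooth_on S h"
 by (simp add: smooth_kdiff kdiff_linear)

lemma smooth_id [intro, simp]: "smooth_on S (%x. x)"
 by (rule smooth_linear) simp

lemma kdiff_bounded_linear:
 assumes "bounded_linear h" "open S" "kdiff k S f"
 shows "kdiff k S (%x. h (f x))"
 using assms(3)
proof (induction k arbitrary: f)
 case (Suc k)
 have d: "((%x. h (f x)) has_derivative (%v. h (fd f x v))) (at x)" if "x\<in>S" for x
  using Suc.prems that bounded_linear.has_derivative[OF assms(1)] frechet_derivative_works by fastforce
 have "kdiff k S (%x. fd (%x. h (f x)) x v)" for v
  by (rule kdiff_cong[OF assms(2) _ Suc.IH[of "%x. fd f x v"]])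
   (use Suc.prems fdI[OF d] in auto)
 thus ?case using d by (auto intro: differentiableI)
qed auto

lemma kdiff_add:
 assumes "open S" "kdiff k S f" "kdiff k S g"
 shows "kdiff k S (%x. f x + g x)"
 using assms(2,3)
proof (induction k arbitrary: f g)
 case (Suc k)
 have d: "((%x. f x + g x) has_derivative (%v. fd f x v + fd g x v)) (at x)" if "x\<in>S" for x
  using Suc.prems that by (intro has_derivative_add fd_works) auto
 have "kdiff k S (%x. fd (%x. f x + g x) x v)" for v
  by (rule kdiff_cong[OF assms(1) _ Suc.IH[of "%x. fd f x v" "%x. fd g x v"]])
   (use Suc.prems fdI[OF d] in auto)
 thus ?case using d by (auto intro: differentiableI)
qed auto

lemma kdiff_sum:
 assumes "open S" "!!i. i\<in>I ==> kdiff k S (f i)"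
 shows "kdiff k S (%x. \<Sum>i\<in>I. f i x)"
 using assms(2)
 by (induction I rule: infinite_finite_induct) (auto intro!: kdiff_const kdiff_add[OF assms(1)])

lemma kdiff_bilinear:
 assumes "bounded_bilinear h" "open S" "kdiff k S f" "kdiff k S g"
 shows "kdiff k S (%x. h (f x) (g x))"
 using assms(3,4)
proof (induction k arbitrary: f g)
 case (Suc k)
 have d: "((%x. h (f x) (g x)) has_derivative (%v. h (f x) (fd g x v) + h (fd f x v) (g x))) (at x)" if "x\<in>S" for x
  using Suc.prems that
  by (intro bounded_bilinear.FDERIV[OF assms(1)] fd_works) auto
 have "kdiff k S (%x. h (f x) (fd g x v) + h (fd f x v) (g x))" for v
  using Suc.prems by (intro kdiff_add[OF assms(2)] Suc.IH) (auto intro: kdiff_mono)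
 hence "kdiff k S (%x. fd (%x. h (f x) (g x)) x v)" for v
  by (rule kdiff_cong[OF assms(2), rotated]) (use fdI[OF d] in auto)
 thus ?case using d by (auto intro: differentiableI)
qed auto

lemma smooth_bounded_linear:
 "bounded_linear h ==> open S ==> smooth_on S f ==> smooth_on S (%x. h (f x))"
 by (simp add: smooth_kdiff kdiff_bounded_linear)

lemma smooth_add: "open S ==> smooth_on S f ==> smooth_on S g ==> smooth_on S (%x. f x + g x)"
 by (simp add: smooth_kdiff kdiff_add)

lemma smooth_sum:
 "open S ==> (!!i. i\<in>I ==> smooth_on S (f i)) ==> smooth_on S (%x. \<Sum>i\<in>I. f i x)"
 by (simp add: smooth_kdiff kdiff_sum)

lemma smooth_bilinear:
 "bounded_bilinear h ==> open S ==> smooth_on S f ==> smooth_on S g ==> smooth_on S (%x. h (f x) (g x))"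
 by (simp add: smooth_kdiff kdiff_bilinear)

lemmas smooth_scaleR = smooth_bilinear[OF bounded_bilinear_scaleR]
lemmas smooth_mult = smooth_bilinear[OF bounded_bilinear_mult]
lemmas smooth_inner = smooth_bilinear[OF bounded_bilinear_inner]
lemmas smooth_minus = smooth_bounded_linear[OF bounded_linear_minus[OF bounded_linear_ident]]

lemma smooth_diff: "open S ==> smooth_on S f ==> smooth_on S g ==> smooth_on S (%x. f x - g x)"
 using smooth_add[of S f "%x. - g x"] smooth_minus[of S g] by simp

lemma smooth_prod:
 fixes f :: "'i => 'a::euclidean_space => 'b::{real_normed_algebra_1, comm_monoid_mult}"
 assumes "open S" "!!i. i\<in>I ==> smooth_on S (f i)"
 shows "smooth_on S (%x. \<Prod>i\<in>I. f i x)"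
 using assms(2)
 by (induction I rule: infinite_finite_induct) (auto intro!: smooth_mult[OF assms(1)])

lemma kdiff_inverse:
 fixes f :: "'a::euclidean_space => 'b::real_normed_field"
 assumes "open S" "!!x. x\<in>S ==> f x \<noteq> 0" "kdiff k S f"
 shows "kdiff k S (%x. inverse (f x))"
 using assms(3)
proof (induction k)
 case (Suc k)
 have d: "((%x. inverse (f x)) has_derivative (%v. - (inverse (f x) * fd f x v * inverse (f x)))) (at x)" if "x\<in>S" for x
  using Suc.prems that assms(2)
  by (intro Deriv.has_derivative_inverse fd_works) auto
 have i: "kdiff k S (%x. inverse (f x))" using Suc kdiff_mono by blast
 have "kdiff k S (%x. - (inverse (f x) * fd f x v * inverse (f x)))" for v
  using Suc.prems
  by (intro kdiff_bounded_linear[OF bounded_linear_minus[OF bounded_linear_ident]] assms(1)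
    kdiff_bilinear[OF bounded_bilinear_mult] i) auto
 hence "kdiff k S (%x. fd (%x. inverse (f x)) x v)" for v
  by (rule kdiff_cong[OF assms(1), rotated]) (use fdI[OF d] in auto)
 thus ?case using d by (auto intro: differentiableI)
qed auto

lemma smooth_inverse:
 fixes f :: "'a::euclidean_space => 'b::real_normed_field"
 shows "open S ==> smooth_on S f ==> (!!x. x\<in>S ==> f x \<noteq> 0) ==> smooth_on S (%x. inverse (f x))"
 by (simp add: smooth_kdiff kdiff_inverse)

lemma smooth_divide:
 fixes f :: "'a::euclidean_space => 'b::real_normed_field"
 shows "open S ==> smooth_on S f ==> smooth_on S g ==> (!!x. x\<in>S ==> g x \<noteq> 0) ==> smooth_on S (%x. f x / g x)"
 unfolding divide_inverse by (intro smooth_mult smooth_inverse) auto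

text \<open>\<open>kdiff\<close> speaks of derivatives in fixed directions only. Expansion in a
  basis replaces a direction that moves with the point by scalar coefficients, which the induction
  for compositions can handle.\<close>

lemma frechet_derivative_basis:
 fixes f :: "'a::euclidean_space => 'b::real_normed_vector"
 assumes "f differentiable (at x)"
 shows "fd f x v = (\<Sum>b\<in>Basis. (v \<bullet> b) *\<^sub>R fd f x b)"
proof -
 interpret linear "fd f x" by (rule linear_frechet_derivative[OF assms])
 have "fd f x v = fd f x (\<Sum>b\<in>Basis. (v \<bullet> b) *\<^sub>R b)"
  by (simp add: euclidean_representation)
 also have "\<dots> = (\<Sum>b\<in>Basis. (v \<bullet> b) *\<^sub>R fd f x b)"
  by (simp only: sum scale)
 finally show ?thesis .
qed

lemma kdiff_compose:
 assumes "open S" "open T" "kdiff k T f" "kdiff k S g" "g ` S \<subseteq> T"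
 shows "kdiff k S (%x. f (g x))"
 using assms(3,4)
proof (induction k arbitrary: f)
 case (Suc k)
 let ?D = "%x v. \<Sum>b\<in>Basis. (fd g x v \<bullet> b) *\<^sub>R fd f (g x) b"
 have d: "((%x. f (g x)) has_derivative ?D x) (at x)" if "x\<in>S" for x
 proof -
  have fd: "f differentiable (at (g x))" using Suc.prems assms(5) that by auto
  hence "(f has_derivative (fd f (g x))) (at (g x))"
   using frechet_derivative_works by blast
  moreover have "(g has_derivative (fd g x)) (at x)"
   using Suc.prems that by (intro fd_works) auto
  ultimately have "((%x. f (g x)) has_derivative
    (%v. fd f (g x) (fd g x v))) (at x)"
   using has_derivative_compose by blast
  thus ?thesis unfolding frechet_derivative_basis[OF fd, symmetric] .
 qed
 have "kdiff k S (%x. ?D x v)" for v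
 proof (intro kdiff_sum[OF assms(1)] kdiff_bilinear[OF bounded_bilinear_scaleR] assms(1))
  fix b :: 'b
  show "kdiff k S (%x. fd g x v \<bullet> b)"
   using Suc.prems by (intro kdiff_bounded_linear[OF bounded_linear_inner_left] assms(1)) auto
  show "kdiff k S (%x. fd f (g x) b)"
   by (rule Suc.IH) (use Suc.prems kdiff_mono in auto)
 qed
 hence "kdiff k S (%x. fd (%x. f (g x)) x v)" for v
  by (rule kdiff_cong[OF assms(1), rotated]) (use fdI[OF d] in auto)
 thus ?case using d by (auto intro: differentiableI)
qed auto

lemma smooth_compose:
 "smooth_on T f ==> smooth_on S g ==> open S ==> open T ==> (!!x. x\<in>S ==> g x\<in>T) ==> smooth_on S (%x. f (g x))"
 by (simp add: smooth_kdiff kdiff_compose image_subset_iff)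

lemma smooth_vec_lambda:
 fixes f :: "'i::finite => 'a::euclidean_space => 'b::real_normed_vector"
 assumes "open S" "!!i. smooth_on S (f i)"
 shows "smooth_on S (%x. \<chi> i. f i x)"
proof -
 define e :: "'i => 'b => 'b^'i" where "e = (%i b. \<chi> j. if j = i then b else 0)"
 have bl: "bounded_linear (e i)" for i
 proof (rule bounded_linear_intro[where K=1])
  fix b :: 'b
  show "norm (e i b) \<le> norm b * 1"
   unfolding e_def norm_vec_def L2_set_def by (simp add: if_distrib[of norm] if_distrib[of "%x. x\<^sup>2"] cong: if_cong)
 qed (auto simp: e_def vec_eq_iff)
 have "(%x. \<chi> i. f i x) = (%x. \<Sum>i\<in>UNIV. e i (f i x))"
  by (auto simp: e_def vec_eq_iff sum.delta')
 thus ?thesis using assms by (simp add: smooth_sum smooth_bounded_linear[OF bl])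
qed

lemma smooth_vec_nth: "open S ==> smooth_on S f ==> smooth_on S (%x. f x$i)"
 by (rule smooth_bounded_linear[OF bounded_linear_vec_nth])

lemma kdiff_Pair:
 assumes "open S" "kdiff k S f" "kdiff k S g"
 shows "kdiff k S (%x. (f x, g x))"
proof -
 have 1: "bounded_linear (%x. (x, 0 :: 'c))" and 2: "bounded_linear (%y. (0 :: 'b, y))"
  by (intro bounded_linear_Pair bounded_linear_ident bounded_linear_zero)+
 have "kdiff k S (%x. (f x, 0) + (0, g x))"
  using kdiff_add[OF assms(1) kdiff_bounded_linear[OF 1 assms(1,2)] kdiff_bounded_linear[OF 2 assms(1,3)]] by simp
 thus ?thesis by simp
qed

lemma smooth_Pair:
 "open S ==> smooth_on S f ==> smooth_on S g ==> smooth_on S (%x. (f x, g x))"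
 by (simp add: smooth_kdiff kdiff_Pair)

lemmas smooth_fst = smooth_bounded_linear[OF bounded_linear_fst]
lemmas smooth_snd = smooth_bounded_linear[OF bounded_linear_snd]

lemma smooth_matrix_vector_mult:
 fixes A :: "'a::euclidean_space => real^'k^'m"
 assumes "open S" "smooth_on S A" "smooth_on S u"
 shows "smooth_on S (%x. A x *v u x)"
 unfolding matrix_vector_mult_def
 by (intro smooth_vec_lambda smooth_sum smooth_mult smooth_vec_nth assms)

lemma smooth_matrix_mult:
 fixes A :: "'a::euclidean_space => 'f::real_normed_field^'k^'m" and B :: "'a => 'f^'j^'k"
 assumes "open S" "smooth_on S A" "smooth_on S B"
 shows "smooth_on S (%x. A x ** B x)"
 unfolding matrix_matrix_mult_def
 by (intro smooth_vec_lambda smooth_sum smooth_mult smooth_vec_nth assms)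

lemma smooth_det:
 fixes A :: "'a::euclidean_space => 'f::real_normed_field^'k^'k"
 assumes "open S" "!!i j. smooth_on S (%x. A x$i$j)"
 shows "smooth_on S (%x. det (A x))"
 unfolding det_def by (intro smooth_sum smooth_mult smooth_prod assms) auto

lemma matrix_inv_both:
 fixes A :: "'f::semiring_1^'n^'m"
 assumes "invertible A"
 shows "A ** matrix_inv A = mat 1 \<and> matrix_inv A ** A = mat 1"
 unfolding matrix_inv_def by (rule someI_ex) (use assms in \<open>simp add: invertible_def\<close>)

lemmas matrix_inv_right = matrix_inv_both[THEN conjunct1]
lemmas matrix_inv_left = matrix_inv_both[THEN conjunct2]

text \<open>Column \<open>l\<close> of the inverse solves \<open>A x = e_l\<close>. Cramer's rule
  makes its entries quotients of determinants, and this is how the inverse matrix becomes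
  smooth.\<close>

lemma matrix_inv_cramer:
 fixes A :: "'f::field^'k^'k"
 assumes "det A \<noteq> 0"
 shows "matrix_inv A$k$l = det (\<chi> i j. if j = k then axis l 1$i else A$i$j) / det A"
proof -
 have "A *v (matrix_inv A *v axis l 1) = axis l 1"
  using matrix_inv_right[of A] assms invertible_det_nz[of A]
  by (simp add: matrix_vector_mul_assoc)
 hence "(matrix_inv A *v axis l 1)$k = det (\<chi> i j. if j = k then axis l 1$i else A$i$j) / det A"
  unfolding cramer[OF assms] by simp
 moreover have "(matrix_inv A *v axis l 1)$k = matrix_inv A$k$l"
  unfolding matrix_vector_mult_def axis_def by (simp add: if_distrib cong: if_cong)
 ultimately show ?thesis by simp
qed

lemma smooth_matrix_inv:
 fixes A :: "'a::euclidean_space => 'f::real_normed_field^'k^'k"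
 assumes "open S" "!!i j. smooth_on S (%x. A x$i$j)" "!!x. x\<in>S ==> det (A x) \<noteq> 0"
 shows "smooth_on S (%x. matrix_inv (A x))"
proof -
 have "smooth_on S (%x. det (\<chi> i j. if j = k then axis l 1$i else A x$i$j) / det (A x))" for k l
 proof (intro smooth_divide smooth_det assms)
  show "smooth_on S (%x. (\<chi> i j. if j = k then axis l 1$i else A x$i$j)$i$j)" for i j
   using assms(2) by (cases "j = k") auto
 qed
 hence "smooth_on S (%x. \<chi> k l. det (\<chi> i j. if j = k then axis l 1$i else A x$i$j) / det (A x))"
  by (intro smooth_vec_lambda assms(1))
 thus ?thesis
  by (rule smooth_cong') (use assms in \<open>auto simp: vec_eq_iff matrix_inv_cramer\<close>)
qed

lemma linear_deriv: "smooth_on S f ==> x\<in>S ==> linear (fd f x)"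
 using linear_frechet_derivative smooth_differentiable by blast

lemma has_derivative_line:
 assumes "f differentiable (at (x + t *\<^sub>R v))"
 shows "((%t. f (x + t *\<^sub>R v)) has_vector_derivative fd f (x + t *\<^sub>R v) v) (at t)"
proof -
 have 1: "((%t. x + t *\<^sub>R v) has_derivative (%t. t *\<^sub>R v)) (at t)"
  by (auto intro!: derivative_eq_intros)
 have "((%t. f (x + t *\<^sub>R v)) has_derivative (%t'. fd f (x + t *\<^sub>R v) (t' *\<^sub>R v))) (at t)"
  using has_derivative_compose[OF 1 fd_works[OF assms]] by simp
 thus ?thesis unfolding has_vector_derivative_def
  by (simp add: linear_scale[OF linear_frechet_derivative[OF assms]])
qed

text \<open>Both mixed partial derivatives are limits of the same second difference quotient.\<close>

lemma second_difference:
 fixes f :: "'a::euclidean_space => real"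
 assumes S: "smooth_on S f" and h: "h > 0"
  and sub: "!!s t. s\<in>{0..h} ==> t\<in>{0..h} ==> x + s *\<^sub>R u + t *\<^sub>R v\<in>S"
 shows "\<exists>s\<in>{0..h}. \<exists>t\<in>{0..h}. f (x + h *\<^sub>R u + h *\<^sub>R v) - f (x + h *\<^sub>R u) - f (x + h *\<^sub>R v) + f x
  = h * h * fd (%y. fd f y u) (x + s *\<^sub>R u + t *\<^sub>R v) v"
proof -
 have d1: "((%s. f (x + s *\<^sub>R u + t *\<^sub>R v)) has_real_derivative
   fd f (x + s *\<^sub>R u + t *\<^sub>R v) u) (at s)" if "s\<in>{0..h}" "t\<in>{0..h}" for s t
  using has_derivative_line[of f "x + t *\<^sub>R v" s u] smooth_differentiable[OF S sub[OF that]]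
  by (simp add: has_real_derivative_iff_has_vector_derivative algebra_simps)
 have "\<exists>z>0. z < h \<and> (f (x + h *\<^sub>R u + h *\<^sub>R v) - f (x + h *\<^sub>R u + 0 *\<^sub>R v))
    - (f (x + 0 *\<^sub>R u + h *\<^sub>R v) - f (x + 0 *\<^sub>R u + 0 *\<^sub>R v))
   = (h - 0) * (fd f (x + z *\<^sub>R u + h *\<^sub>R v) u
     - fd f (x + z *\<^sub>R u + 0 *\<^sub>R v) u)"
  using h by (intro MVT2 DERIV_diff d1) auto
 then obtain s where s: "0 < s" "s < h"
  and e1: "f (x + h *\<^sub>R u + h *\<^sub>R v) - f (x + h *\<^sub>R u) - f (x + h *\<^sub>R v) + f x
   = h * (fd f (x + s *\<^sub>R u + h *\<^sub>R v) u - fd f (x + s *\<^sub>R u) u)"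
  by (auto simp: algebra_simps)
 have d2: "((%t. fd f (x + s *\<^sub>R u + t *\<^sub>R v) u) has_real_derivative
   fd (%y. fd f y u) (x + s *\<^sub>R u + t *\<^sub>R v) v) (at t)"
  if "t\<in>{0..h}" for t
  using has_derivative_line[of "%y. fd f y u" "x + s *\<^sub>R u" t v]
   smooth_differentiable[OF smooth_deriv[OF S] sub[OF _ that, of s]] s
  by (simp add: has_real_derivative_iff_has_vector_derivative)
 have "\<exists>z>0. z < h \<and> fd f (x + s *\<^sub>R u + h *\<^sub>R v) u - fd f (x + s *\<^sub>R u + 0 *\<^sub>R v) u
   = (h - 0) * fd (%y. fd f y u) (x + s *\<^sub>R u + z *\<^sub>R v) v"
  using h by (intro MVT2 d2) auto
 then obtain t where "0 < t" "t < h" "fd f (x + s *\<^sub>R u + h *\<^sub>R v) u - fd f (x + s *\<^sub>R u) u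
   = h * fd (%y. fd f y u) (x + s *\<^sub>R u + t *\<^sub>R v) v"
  by auto
 thus ?thesis using e1 s by (intro bexI[of _ s] bexI[of _ t]) (auto simp: algebra_simps)
qed

lemma smooth_mixed_real:
 fixes f :: "'a::euclidean_space => real"
 assumes S: "open S" "smooth_on S f" and x: "x\<in>S"
 shows "fd (%y. fd f y u) x v
    = fd (%y. fd f y v) x u" (is "?A x = ?B x")
proof (rule ccontr)
 assume ne: "?A x \<noteq> ?B x"
 define e where "e = \<bar>?A x - ?B x\<bar> / 2"
 have e: "e > 0" using ne by (simp add: e_def)
 have cA: "isCont ?A x" and cB: "isCont ?B x"
  using smooth_isCont[OF smooth_deriv[OF smooth_deriv[OF S(2)]] x] by blast+
 obtain d1 where d1: "d1 > 0" "!!y. dist y x < d1 ==> dist (?A y) (?A x) < e"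
  using cA e unfolding continuous_at_eps_delta by blast
 obtain d2 where d2: "d2 > 0" "!!y. dist y x < d2 ==> dist (?B y) (?B x) < e"
  using cB e unfolding continuous_at_eps_delta by blast
 obtain d3 where d3: "d3 > 0" "ball x d3 \<subseteq> S" using S(1) x open_contains_ball by blast
 define d where "d = min d1 (min d2 d3)"
 have d: "d > 0" using d1 d2 d3 by (simp add: d_def)
 \<comment> \<open>The summand 1 covers \<open>u = v = 0\<close>; the factor 1/2 in \<open>h\<close>
   keeps the closed parallelogram strictly inside the ball of radius \<open>d\<close>.\<close>
 define c where "c = norm u + norm v + 1"
 define h where "h = d / c / 2"
 have pos: "c > 0" using norm_ge_zero[of u] norm_ge_zero[of v] unfolding c_def by linarith
 have h: "h > 0" using d pos by (simp add: h_def)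
 have hb: "h * (norm u + norm v) < d"
 proof -
  have "h * (norm u + norm v) \<le> h * c" using h by (intro mult_left_mono) (auto simp: c_def)
  also have "\<dots> = d / 2" using pos by (simp add: h_def)
  finally show ?thesis using d by simp
 qed
 have close: "dist (x + s *\<^sub>R u + t *\<^sub>R v) x < d" if "s\<in>{0..h}" "t\<in>{0..h}" for s t
 proof -
  have "dist (x + s *\<^sub>R u + t *\<^sub>R v) x = norm (s *\<^sub>R u + t *\<^sub>R v)" by (simp add: dist_norm)
  also have "\<dots> \<le> s * norm u + t * norm v" using that norm_triangle_ineq[of "s *\<^sub>R u" "t *\<^sub>R v"] by simp
  also have "\<dots> \<le> h * norm u + h * norm v" using that by (intro add_mono mult_right_mono) auto
  finally show ?thesis using hb by (simp add: algebra_simps)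
 qed
 have sub1: "x + s *\<^sub>R u + t *\<^sub>R v\<in>S" and sub2: "x + s *\<^sub>R v + t *\<^sub>R u\<in>S"
  if "s\<in>{0..h}" "t\<in>{0..h}" for s t
  using close[OF that] close[OF that(2,1)] d3 by (auto simp: d_def dist_commute subset_iff algebra_simps)
 obtain s t where st: "s\<in>{0..h}" "t\<in>{0..h}"
  "f (x + h *\<^sub>R u + h *\<^sub>R v) - f (x + h *\<^sub>R u) - f (x + h *\<^sub>R v) + f x = h * h * ?A (x + s *\<^sub>R u + t *\<^sub>R v)"
  using second_difference[OF S(2) h, of x u v] sub1 by blast
 obtain s' t' where st': "s'\<in>{0..h}" "t'\<in>{0..h}"
  "f (x + h *\<^sub>R v + h *\<^sub>R u) - f (x + h *\<^sub>R v) - f (x + h *\<^sub>R u) + f x = h * h * ?B (x + s' *\<^sub>R v + t' *\<^sub>R u)"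
  using second_difference[OF S(2) h, of x v u] sub2 by blast
 have "x + h *\<^sub>R v + h *\<^sub>R u = x + h *\<^sub>R u + h *\<^sub>R v" by simp
 hence "h * h * ?A (x + s *\<^sub>R u + t *\<^sub>R v) = h * h * ?B (x + s' *\<^sub>R v + t' *\<^sub>R u)"
  using st(3) st'(3) by (simp only:)
 hence eq: "?A (x + s *\<^sub>R u + t *\<^sub>R v) = ?B (x + s' *\<^sub>R v + t' *\<^sub>R u)" using h by simp
 have "dist (?A (x + s *\<^sub>R u + t *\<^sub>R v)) (?A x) < e"
  using close[OF st(1,2)] by (intro d1) (simp add: d_def)
 moreover have "dist (?B (x + s' *\<^sub>R v + t' *\<^sub>R u)) (?B x) < e"
  using close[OF st'(2,1)] by (intro d2) (simp add: d_def algebra_simps)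
 ultimately have "dist (?A x) (?B x) < e + e"
  using dist_triangle2[of "?A x" "?B x" "?A (x + s *\<^sub>R u + t *\<^sub>R v)"] unfolding eq
  by (simp only: dist_commute)
 thus False by (simp add: dist_real_def e_def)
qed

lemma smooth_mixed:
 fixes f :: "'a::euclidean_space => 'b::euclidean_space"
 assumes S: "open S" "smooth_on S f" and x: "x\<in>S"
 shows "fd (%y. fd f y u) x v
    = fd (%y. fd f y v) x u"
proof (rule euclidean_eqI)
 fix b :: 'b
 have c: "fd (%y. g y \<bullet> b) y w = fd g y w \<bullet> b"
  if "smooth_on S g" "y\<in>S" for g :: "'a => 'b" and y w
  using fdI[OF has_derivative_inner_left[OF smooth_hd[OF that]], of b] by simp
 have fb: "smooth_on S (%y. f y \<bullet> b)" using S by (intro smooth_inner) auto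
 have c2: "fd (%y. fd (%y. f y \<bullet> b) y u) x v
   = fd (%y. fd f y u) x v \<bullet> b" for u v
  using fd_cong[OF S(1) x c[OF S(2)]] c[OF smooth_deriv[OF S(2)] x] by simp
 show "fd (%y. fd f y u) x v \<bullet> b
   = fd (%y. fd f y v) x u \<bullet> b"
  using smooth_mixed_real[OF S(1) fb x, of u v] by (simp add: c2)
qed

section \<open>Bump functions\<close>

text \<open>For \<open>p = 1\<close> this is \<open>exp (-1/t)\<close> extended by 0. Its
  derivatives are polynomials in \<open>1/t\<close> times itself, so the induction runs over the
  whole family in \<open>p\<close>, which is closed under differentiation.\<close>

definition flat :: "real poly => real => real" where
 "flat p t = (if t > 0 then poly p (1 / t) * exp (- (1 / t)) else 0)"

lemma poly_times_exp_tendsto_0: "((%s. s ^ k * poly p s * exp (- s)) \<longlongrightarrow> (0::real)) at_top"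
proof (induction p arbitrary: k)
 case 0 thus ?case by simp
next
 case (pCons a p)
 have "((%s. a * (s ^ k / exp s) + s ^ Suc k * poly p s * exp (- s)) \<longlongrightarrow> a * 0 + 0) at_top"
  by (intro tendsto_add tendsto_mult tendsto_const tendsto_power_div_exp_0 pCons.IH)
 thus ?case by (simp add: algebra_simps exp_minus divide_inverse)
qed

lemma flat_tendsto_0: "(flat p \<longlongrightarrow> 0) (at 0)"
proof -
 have "((%t. poly p (1 / t) * exp (- (1 / t))) \<longlongrightarrow> 0) (at_right 0)"
  using filterlim_compose[OF poly_times_exp_tendsto_0[of 0 p] filterlim_inverse_at_top_right]
  by (simp add: inverse_eq_divide)
 hence "(flat p \<longlongrightarrow> 0) (at_right 0)"
  by (rule Lim_transform_eventually) (auto simp: flat_def eventually_at_filter)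
 moreover have "(flat p \<longlongrightarrow> 0) (at_left 0)"
  by (rule Lim_transform_eventually[OF tendsto_const]) (auto simp: flat_def eventually_at_filter)
 ultimately show ?thesis using filterlim_at_split by blast
qed

lemma flat_DERIV: "(flat p has_real_derivative flat (monom 1 2 * (p - pderiv p)) t) (at t)"
proof (cases "t > 0")
 case True
 have "((%t. poly p (1 / t) * exp (- (1 / t))) has_real_derivative flat (monom 1 2 * (p - pderiv p)) t) (at t)"
  using True by (auto intro!: derivative_eq_intros poly_DERIV[THEN DERIV_chain2] simp: flat_def poly_monom field_simps power2_eq_square)
 thus ?thesis
  by (rule DERIV_cong_ev[THEN iffD1, rotated 3])
   (use True eventually_nhds_in_open[of "{0<..}" t] in \<open>auto simp: flat_def elim!: eventually_mono\<close>)
next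
 case False
 show ?thesis
 proof (cases "t = 0")
  case True
  \<comment> \<open>The difference quotient at 0 is \<open>flat p h / h\<close>, and division by
    \<open>h\<close> multiplies the polynomial in \<open>1/h\<close> by its variable.\<close>
  have "((%h. flat (pCons 0 p) h) \<longlongrightarrow> 0) (at 0)" by (rule flat_tendsto_0)
  hence "((%h. (flat p (0 + h) - flat p 0) / h) \<longlongrightarrow> 0) (at 0)"
   by (rule Lim_transform_eventually) (auto simp: flat_def eventually_at_filter)
  thus ?thesis using True by (simp add: DERIV_def flat_def)
 next
  case f: False
  have "((%t. 0) has_real_derivative flat (monom 1 2 * (p - pderiv p)) t) (at t)"
   using False by (simp add: flat_def)
  thus ?thesis
   by (rule DERIV_cong_ev[THEN iffD1, rotated 3])
    (use False f eventually_nhds_in_open[of "{..<0}" t] in \<open>auto simp: flat_def elim!: eventually_mono\<close>)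
 qed
qed

lemma kdiff_flat: "kdiff k UNIV (flat p)"
proof (induction k arbitrary: p)
 case (Suc k)
 have d: "(flat p has_derivative (*) (flat (monom 1 2 * (p - pderiv p)) t)) (at t)" for t
  using flat_DERIV unfolding has_field_derivative_def .
 have "kdiff k UNIV (%t. flat (monom 1 2 * (p - pderiv p)) t * v)" for v
  by (intro kdiff_bounded_linear[OF bounded_linear_mult_left] Suc) auto
 thus ?case using d by (auto intro: differentiableI simp: fdI[OF d])
qed auto

definition bump :: "'a::euclidean_space => real => 'a => real" where
 "bump a r x = flat 1 (r\<^sup>2 - (x - a) \<bullet> (x - a))"

lemma smooth_bump: "smooth_on S (bump a r)"
proof -
 have "smooth_on UNIV (%x. flat 1 (r\<^sup>2 - (x - a) \<bullet> (x - a)))"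
  by (rule smooth_compose[where T=UNIV])
   (auto intro!: smooth_diff smooth_inner simp: smooth_kdiff[of _ "flat 1"] kdiff_flat)
 thus ?thesis unfolding bump_def[abs_def] using smooth_subset by blast
qed

lemma bump_nonneg: "bump a r x \<ge> 0"
 by (simp add: bump_def flat_def)

lemma bump_pos: "dist a x < r ==> bump a r x > 0"
proof -
 assume "dist a x < r"
 hence "(norm (x - a))\<^sup>2 < r\<^sup>2" by (intro power_strict_mono) (auto simp: dist_norm norm_minus_commute)
 thus ?thesis by (simp add: bump_def flat_def power2_norm_eq_inner)
qed

lemma bump_eq_0: "0 \<le> r ==> r \<le> dist a x ==> bump a r x = 0"
proof -
 assume "0 \<le> r" "r \<le> dist a x"
 hence "r\<^sup>2 \<le> (norm (x - a))\<^sup>2" by (intro power_mono) (auto simp: dist_norm norm_minus_commute)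
 thus ?thesis by (simp add: bump_def flat_def power2_norm_eq_inner)
qed

section \<open>The derivative of the determinant\<close>

text \<open>The derivative of the determinant at \<open>A\<close> in the direction \<open>X\<close>:
  by multilinearity one row is differentiated at a time.\<close>

definition det_deriv :: "'f::comm_ring_1^'n^'n => 'f^'n^'n => 'f" where
 "det_deriv A X = (\<Sum>i\<in>UNIV. det (\<chi> r. if r = i then X$r else A$r))"

lemma has_derivative_det:
 fixes A :: "'a::real_normed_vector => 'f::real_normed_field^'n^'n"
 assumes d: "!!i j. ((%x. A x$i$j) has_derivative (%v. A' v$i$j)) (at x)"
 shows "((%x. det (A x)) has_derivative (%v. det_deriv (A x) (A' v))) (at x)"
proof -
 let ?P = "{p. p permutes (UNIV :: 'n set)}"
 have "((%x. \<Sum>p\<in>?P. of_int (sign p) * (\<Prod>i\<in>UNIV. A x$i$p i)) has_derivative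
   (%v. \<Sum>p\<in>?P. of_int (sign p) * (\<Sum>i\<in>UNIV. A' v$i$p i * (\<Prod>j\<in>UNIV - {i}. A x$j$p j)))) (at x)"
  by (intro has_derivative_sum has_derivative_mult_right has_derivative_prod d)
 moreover have "(\<Sum>p\<in>?P. of_int (sign p) * (\<Sum>i\<in>UNIV. A' v$i$p i * (\<Prod>j\<in>UNIV - {i}. A x$j$p j)))
   = det_deriv (A x) (A' v)" for v
 proof -
  have "(\<Prod>r\<in>UNIV. (\<chi> r. if r = i then A' v$r else A x$r)$r$p r)
    = A' v$i$p i * (\<Prod>j\<in>UNIV - {i}. A x$j$p j)" for i and p :: "'n => 'n"
   by (subst prod.remove[of _ i]) (auto intro!: prod.cong)
  thus ?thesis unfolding det_deriv_def det_def
   by (subst sum.swap) (simp add: sum_distrib_left)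
 qed
 ultimately show ?thesis unfolding det_def[of "A _"] by simp
qed

lemma det_deriv_add: "det_deriv A (X + Y) = det_deriv A X + det_deriv A Y"
proof -
 have "det (\<chi> r. if r = i then (X + Y)$r else A$r)
   = det (\<chi> r. if r = i then X$r else A$r) + det (\<chi> r. if r = i then Y$r else A$r)" for i
  unfolding vector_add_component by (rule det_row_add)
 thus ?thesis by (simp add: det_deriv_def sum.distrib)
qed

text \<open>Row \<open>i\<close> of \<open>C ** A\<close> is a combination of the rows of
  \<open>A\<close>. In the determinant with row \<open>i\<close> replaced, only the multiple of row
  \<open>i\<close> itself survives, since all others repeat a row.\<close>

lemma det_deriv_mult_left: "det_deriv A (C ** A) = trace C * det A"
proof -
 have "det (\<chi> r. if r = i then (C ** A)$r else A$r) = C$i$i * det A" for i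
 proof -
  have row: "(C ** A)$r = (\<Sum>k\<in>UNIV. C$r$k *s A$k)" for r
   by (simp add: vec_eq_iff matrix_matrix_mult_def)
  have "det (\<chi> r. if r = i then (C ** A)$r else A$r)
    = (\<Sum>k\<in>UNIV. det (\<chi> r. if r = i then C$r$k *s A$k else A$r))"
   unfolding row using det_linear_row_sum[of UNIV i "%r k. C$r$k *s A$k" "%r. A$r"] by simp
  also have "\<dots> = (\<Sum>k\<in>UNIV. C$i$k * det (\<chi> r. if r = i then A$k else A$r))"
  proof (rule sum.cong)
   fix k
   have "(\<chi> r. if r = i then C$r$k *s A$k else A$r) = (\<chi> r. if r = i then C$i$k *s A$k else A$r)"
    by (simp add: vec_eq_iff)
   thus "det (\<chi> r. if r = i then C$r$k *s A$k else A$r) = C$i$k * det (\<chi> r. if r = i then A$k else A$r)"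
    using det_row_mul[of i "C$i$k" "%r. A$k" "%r. A$r"] by simp
  qed simp
  also have "\<dots> = (\<Sum>k\<in>UNIV. if k = i then C$i$i * det A else 0)"
  proof (rule sum.cong)
   fix k
   have "det (\<chi> r. if r = i then A$k else A$r) = 0" if "k \<noteq> i"
    using that by (intro det_identical_rows[of i k]) (auto simp: row_def vec_eq_iff)
   moreover have "(\<chi> r. if r = i then A$i else A$r) = A" by (simp add: vec_eq_iff)
   ultimately show "C$i$k * det (\<chi> r. if r = i then A$k else A$r) = (if k = i then C$i$i * det A else 0)"
    by auto
  qed simp
  finally show ?thesis by simp
 qed
 thus ?thesis by (simp add: det_deriv_def trace_def sum_distrib_right)
qed

text \<open>Conjugation by \<open>A\<close> turns the right factor into a left factor of the same
  trace.\<close>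

lemma det_deriv_mult_right:
 fixes A :: "'f::field^'n^'n"
 assumes "det A \<noteq> 0"
 shows "det_deriv A (A ** D) = trace D * det A"
proof -
 have inv: "matrix_inv A ** A = mat 1" using assms invertible_det_nz matrix_inv_left by blast
 have "A ** D = (A ** D ** matrix_inv A) ** A"
  by (metis inv matrix_mul_assoc matrix_mul_rid)
 hence "det_deriv A (A ** D) = trace (A ** D ** matrix_inv A) * det A"
  using det_deriv_mult_left by metis
 also have "trace (A ** D ** matrix_inv A) = trace (matrix_inv A ** (A ** D))"
  by (rule trace_mul_sym)
 also have "matrix_inv A ** (A ** D) = D" by (simp add: matrix_mul_assoc inv)
 finally show ?thesis .
qed

section \<open>Smooth implicit functions\<close>

text \<open>The map \<open>(x, y)\<close> to \<open>(\<Phi> (x, y), y)\<close> is inverted locally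
  by the inverse function theorem, and \<open>\<pi> y\<close> is the first component of its inverse
  \<open>g\<close> at \<open>(0, y)\<close>. This gives one derivative of \<open>\<pi>\<close>; the
  higher ones come from the formula for that derivative.\<close>

lemma smooth_implicit_function:
 fixes \<Phi> :: "(real^'n::finite) \<times> 'y::euclidean_space => real^'n"
 assumes W: "open W" "smooth_on W \<Phi>" "(x0, y0)\<in>W" and z: "\<Phi> (x0, y0) = 0"
  and inj: "!!v. fd \<Phi> (x0, y0) (v, 0) = 0 ==> v = 0"
 obtains U V \<pi> where "open U" "open V" "x0\<in>U" "y0\<in>V" "U \<times> V \<subseteq> W" "smooth_on V \<pi>" "\<pi> ` V \<subseteq> U"
  "!!x y. x\<in>U ==> y\<in>V ==> \<Phi> (x, y) = 0 \<longleftrightarrow> x = \<pi> y"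
proof -
 let ?D = "%p. fd \<Phi> p"
 let ?F = "%p. (\<Phi> p, snd p)"
 let ?F' = "%p. (%v. (?D p v, snd v))"
 have bl: "bounded_linear (?D p)" if "p\<in>W" for p
  using linear_deriv[OF W(2) that] linear_conv_bounded_linear by blast
 have blF: "bounded_linear (?F' p)" if "p\<in>W" for p
  by (intro bounded_linear_Pair bl that bounded_linear_snd)
 have dF: "(?F has_derivative blinfun_apply (Blinfun (?F' p))) (at p)" if "p\<in>W" for p
  unfolding bounded_linear_Blinfun_apply[OF blF[OF that]]
  by (intro has_derivative_Pair smooth_hd[OF W(2) that] has_derivative_snd has_derivative_ident)
 have cont: "continuous_on W (%p. Blinfun (?F' p))"
 proof (rule continuous_on_blinfun_componentwise)
  fix b :: "(real^'n) \<times> 'y"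
  have "continuous_on W (%p. ?F' p b)"
   by (intro continuous_intros smooth_cont[OF smooth_deriv[OF W(2)]])
  thus "continuous_on W (%p. blinfun_apply (Blinfun (?F' p)) b)"
   by (rule continuous_on_eq) (simp add: bounded_linear_Blinfun_apply[OF blF])
 qed
 have inj0: "inj (?F' (x0, y0))"
  unfolding linear_injective_0[OF bounded_linear.linear[OF blF[OF W(3)]]]
  using inj by (metis (no_types, lifting) prod.collapse prod.inject zero_prod_def)
 obtain G where G: "linear G" "G \<circ> ?F' (x0, y0) = id"
  using linear_injective_left_inverse[OF bounded_linear.linear[OF blF[OF W(3)]] inj0] by blast
 have Gb: "bounded_linear G" using G(1) linear_conv_bounded_linear by blast
 have invf: "Blinfun G o\<^sub>L Blinfun (?F' (x0, y0)) = id_blinfun"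
  using fun_cong[OF G(2)]
  by (intro blinfun_eqI) (simp add: bounded_linear_Blinfun_apply[OF Gb] bounded_linear_Blinfun_apply[OF blF[OF W(3)]] o_def split_beta)
 obtain U' V' g g' where g: "open U'" "U' \<subseteq> W" "(x0, y0)\<in>U'" "open V'" "?F (x0, y0)\<in>V'"
  "homeomorphism U' V' ?F g" "!!y. y\<in>V' ==> (g has_derivative g' y) (at y)"
  "!!y. y\<in>V' ==> bij (blinfun_apply (Blinfun (?F' (g y))))"
  by (rule inverse_function_theorem[OF W(1) dF cont W(3) invf], assumption, rule that, assumption+)
 obtain A B where AB: "open A" "open B" "x0\<in>A" "y0\<in>B" "A \<times> B \<subseteq> U'"
  using g(1,3) by (metis SigmaE mem_Sigma_iff open_prod_elim)
 have gF: "g (?F p) = p" if "p\<in>U'" for p using g(6) that unfolding homeomorphism_def by auto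
 have Fg: "?F (g q) = q" "g q\<in>U'" if "q\<in>V'" for q using g(6) that unfolding homeomorphism_def by auto
 define \<pi> where "\<pi> y = fst (g (0, y))" for y
 \<comment> \<open>These conditions put \<open>(0, y)\<close> into the domain of \<open>g\<close>
   and \<open>(\<pi> y, y)\<close> into \<open>A \<times> B\<close>, where \<open>g\<close> inverts
   the map.\<close>
 define V where "V = B \<inter> ((%y. (0, y)) -` V' \<inter> \<pi> -` A)"
 have gc: "continuous_on V' g" using g(6) unfolding homeomorphism_def by auto
 have opV1: "open ((%y. (0::real^'n, y)) -` V')"
  by (intro open_vimage g(4) continuous_intros)
 have "open ((%y. (0::real^'n, y)) -` V' \<inter> \<pi> -` A)"
 proof (rule continuous_open_preimage[OF _ opV1 AB(1)])
  show "continuous_on ((%y. (0, y)) -` V') \<pi>"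
   unfolding \<pi>_def by (intro continuous_intros continuous_on_compose2[OF gc]) auto
 qed
 hence opV: "open V" unfolding V_def using AB(2) by (rule open_Int[rotated])
 have gpi: "g (0, y) = (\<pi> y, y)" if "y\<in>V" for y
  using Fg(1)[of "(0, y)"] that by (auto simp: V_def \<pi>_def intro: prod_eqI)
 have inW: "(\<pi> y, y)\<in>W" if "y\<in>V" for y
  using Fg(2)[of "(0, y)"] gpi[OF that] that g(2) by (auto simp: V_def)
 have zero: "\<Phi> (\<pi> y, y) = 0" if "y\<in>V" for y
  using Fg(1)[of "(0, y)"] gpi[OF that] that by (auto simp: V_def)
 define M where "M p = (\<chi> i j. ?D p (axis j 1, 0)$i)" for p
 have M: "M p *v v = ?D p (v, 0)" if "p\<in>W" for p v
 proof -
  have lin: "linear (%v. ?D p (v, 0))"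
   using linear_compose[OF _ linear_deriv[OF W(2) that], of "%v. (v, 0)"]
   by (simp add: o_def bounded_linear.linear bounded_linear_Pair)
  have "M p = matrix (%v. ?D p (v, 0))" by (simp add: M_def matrix_def)
  thus ?thesis using fun_cong[OF matrix_vector_mul(2)[OF lin], of v] by simp
 qed
 have detM: "det (M (\<pi> y, y)) \<noteq> 0" if y: "y\<in>V" for y
 proof -
  have "bij (?F' (\<pi> y, y))"
   using g(8)[of "(0, y)"] gpi[OF y] y bounded_linear_Blinfun_apply[OF blF[OF inW[OF y]]] by (simp add: V_def)
  hence ij: "inj (?F' (\<pi> y, y))" by (rule bij_is_inj)
  have "v = 0" if "?D (\<pi> y, y) (v, 0) = 0" for v
  proof -
   have "?F' (\<pi> y, y) (v, 0) = ?F' (\<pi> y, y) (0, 0)"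
    using that linear_0[OF linear_deriv[OF W(2) inW[OF y]]] by (simp add: zero_prod_def)
   hence "(v, 0 :: 'y) = (0, 0)" by (rule injD[OF ij])
   thus ?thesis by simp
  qed
  hence "!!v. M (\<pi> y, y) *v v = 0 ==> v = 0" using M[OF inW[OF y]] by simp
  thus ?thesis using invertible_det_nz invertible_left_inverse matrix_left_invertible_ker by blast
 qed
 define W' where "W' = {p\<in>W. det (M p) \<noteq> 0}"
 have smM: "smooth_on W (%p. M p$i$j)" for i j
  unfolding M_def by (auto intro!: smooth_vec_nth smooth_deriv W)
 have "open (W \<inter> (%p. det (M p)) -` (- {0}))"
  by (intro continuous_open_preimage smooth_cont[OF smooth_det] W smM) auto
 hence opW': "open W'" unfolding W'_def by (simp add: vimage_def Int_def)
 have pidiff: "\<pi> differentiable (at y)" if "y\<in>V" for y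
 proof -
  have "(g has_derivative g' (0, y)) (at (0, y))" using g(7) that by (auto simp: V_def)
  hence "((%y. g (0, y)) has_derivative (%v. g' (0, y) (0, v))) (at y)"
   by (rule has_derivative_compose[rotated]) (auto intro!: derivative_eq_intros)
  thus ?thesis unfolding \<pi>_def using has_derivative_fst differentiableI by blast
 qed
 have pider: "fd \<pi> y w = - (matrix_inv (M (\<pi> y, y)) *v ?D (\<pi> y, y) (0, w))" if y: "y\<in>V" for y w
 proof -
  have "((%y. \<Phi> (\<pi> y, y)) has_derivative (%w. ?D (\<pi> y, y) (fd \<pi> y w, w))) (at y)"
   by (rule has_derivative_compose[OF has_derivative_Pair[OF fd_works[OF pidiff[OF y]] has_derivative_ident]
      smooth_hd[OF W(2) inW[OF y]]])
  moreover have "((%y. \<Phi> (\<pi> y, y)) has_derivative (%w. 0)) (at y)"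
   by (rule hd_cong[OF has_derivative_const opV y]) (simp add: zero)
  ultimately have "(%w. ?D (\<pi> y, y) (fd \<pi> y w, w)) = (%w. 0)"
   by (rule has_derivative_unique)
  from fun_cong[OF this, of w] have zD: "?D (\<pi> y, y) (fd \<pi> y w, w) = 0" .
  have "?D (\<pi> y, y) (fd \<pi> y w, w)
    = ?D (\<pi> y, y) (fd \<pi> y w, 0) + ?D (\<pi> y, y) (0, w)"
   using linear_add[OF linear_deriv[OF W(2) inW[OF y]], of "(fd \<pi> y w, 0)" "(0, w)"] by simp
  hence "M (\<pi> y, y) *v fd \<pi> y w = - ?D (\<pi> y, y) (0, w)"
   unfolding M[OF inW[OF y]] zD by (simp only: eq_neg_iff_add_eq_0)
  hence "matrix_inv (M (\<pi> y, y)) *v (M (\<pi> y, y) *v fd \<pi> y w)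
    = matrix_inv (M (\<pi> y, y)) *v (- ?D (\<pi> y, y) (0, w))" by simp
  thus ?thesis using matrix_inv_left[of "M (\<pi> y, y)"] detM[OF y] invertible_det_nz[of "M (\<pi> y, y)"]
   by (simp add: matrix_vector_mul_assoc linear_neg[OF matrix_vector_mul_linear])
 qed
 \<comment> \<open>Bootstrapping: by \<open>pider\<close> the derivative of \<open>\<pi>\<close> is
   a smooth function of \<open>(\<pi> y, y)\<close>, so order \<open>k\<close> of
   \<open>\<pi>\<close> gives order \<open>k + 1\<close>.\<close>
 have "kdiff k V \<pi>" for k
 proof (induction k)
  case (Suc k)
  have "kdiff k V (%y. - (matrix_inv (M (\<pi> y, y)) *v ?D (\<pi> y, y) (0, w)))" for w
  proof (rule kdiff_compose[OF opV opW', where g="%y. (\<pi> y, y)" and f="%p. - (matrix_inv (M p) *v ?D p (0, w))"])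
   have "smooth_on W' (%p. - (matrix_inv (M p) *v ?D p (0, w)))"
    by (intro smooth_minus smooth_matrix_vector_mult smooth_matrix_inv opW'
      smooth_subset[OF smM] smooth_subset[OF smooth_deriv[OF W(2)]]) (auto simp: W'_def)
   thus "kdiff k W' (%p. - (matrix_inv (M p) *v ?D p (0, w)))" by (simp only: smooth_kdiff)
   show "kdiff k V (%y. (\<pi> y, y))"
    by (intro kdiff_Pair opV Suc.IH) (use smooth_kdiff[of V "%x. x"] in auto)
   show "(%y. (\<pi> y, y)) ` V \<subseteq> W'" using inW detM by (auto simp: W'_def)
  qed
  hence "kdiff k V (%y. fd \<pi> y w)" for w
   by (rule kdiff_cong[OF opV, rotated]) (simp add: pider)
  thus ?case using pidiff by simp
 qed auto
 hence sm: "smooth_on V \<pi>" unfolding smooth_kdiff by blast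
 have y0: "y0\<in>V"
  using gF[OF g(3)] z g(5) AB by (auto simp: V_def \<pi>_def)
 show thesis
 proof (rule that[OF AB(1) opV AB(3) y0 _ sm])
  show "A \<times> V \<subseteq> W" using AB(5) g(2) by (auto simp: V_def)
  show "\<pi> ` V \<subseteq> A" by (auto simp: V_def)
  show "\<Phi> (x, y) = 0 \<longleftrightarrow> x = \<pi> y" if "x\<in>A" "y\<in>V" for x y
  proof
   assume "\<Phi> (x, y) = 0"
   moreover have "(x, y)\<in>U'" using that AB(5) by (auto simp: V_def)
   ultimately show "x = \<pi> y" using gF[of "(x, y)"] by (simp add: \<pi>_def)
  qed (use zero that in simp)
 qed
qed

section \<open>Kaehler geometry in a chart\<close>

lemma bounded_bilinear_mv: "bounded_bilinear ((*v) :: real^'k^'m => real^'k => real^'m)"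
 unfolding bilinear_conv_bounded_bilinear[symmetric] bilinear_def
 by (auto intro!: linearI simp: matrix_vector_mult_add_rdistrib matrix_vector_right_distrib
   scaleR_matrix_vector_assoc matrix_vector_mult_scaleR)

lemmas has_derivative_mv = bounded_bilinear.FDERIV[OF bounded_bilinear_mv]
lemmas smooth_mv = smooth_matrix_vector_mult

lemma mv_minus_left: "(- A) *v u = - (A *v u)" for A :: "real^'k^'m"
 by (simp add: matrix_vector_mult_def vec_eq_iff sum_negf)

lemma mv_minus_right: "A *v (- u) = - (A *v u)" for A :: "real^'k^'m"
 by (simp add: matrix_vector_mult_def vec_eq_iff sum_negf)

lemma mv_diff: "A *v (u - v) = A *v u - A *v v" for A :: "real^'k^'m"
 by (simp add: matrix_vector_mult_def vec_eq_iff sum_subtractf algebra_simps)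

lemma linear_zero_axis:
 fixes f :: "real^'k => 'b::real_vector"
 assumes "linear f" "!!i. f (axis i 1) = 0"
 shows "f v = 0"
proof -
 have "f v = f (\<Sum>i\<in>UNIV. v$i *\<^sub>R axis i 1)"
  using basis_expansion[of v] by (simp add: scalar_mult_eq_scaleR)
 thus ?thesis by (simp add: linear_sum[OF assms(1)] linear_scale[OF assms(1)] assms(2))
qed

lemma axis_expansion:
 fixes f :: "real^'k => 'b::real_vector"
 assumes "linear f"
 shows "f v = (\<Sum>i\<in>UNIV. v$i *\<^sub>R f (axis i 1))"
proof -
 have "f v = f (\<Sum>i\<in>UNIV. v$i *\<^sub>R axis i 1)"
  using basis_expansion[of v] by (simp add: scalar_mult_eq_scaleR)
 thus ?thesis by (simp add: linear_sum[OF assms(1)] linear_scale[OF assms(1)])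
qed

lemma pd_entry:
 assumes "smooth_on S F" "y\<in>S"
 shows "pd l (%y. F y$i$j) y = fd F y (axis l 1)$i$j"
proof -
 have bl: "bounded_linear (%A. A$i$j)"
  using bounded_linear_compose[OF bounded_linear_vec_nth bounded_linear_vec_nth] by blast
 show ?thesis unfolding pd_def
  using fdI[OF bounded_linear.has_derivative[OF bl smooth_hd[OF assms]]] by simp
qed

definition ltrace :: "(real^'k => real^'k) => real" where
 "ltrace L = (\<Sum>k\<in>UNIV. L (axis k 1)$k)"

lemma ltrace_diff: "ltrace (%x. K x - L x) = ltrace K - ltrace L"
 by (simp add: ltrace_def sum_subtractf)

lemma ltrace_minus: "ltrace (%x. - K x) = - ltrace K"
 by (simp add: ltrace_def sum_negf)

text \<open>The Kaehler structure in the coordinates of one chart. The Kaehler form is no separate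
  parameter: \<open>transpose J ** G\<close> is the matrix of \<open>g(Ju, v)\<close>, and
  \<open>clo\<close> is its closedness.\<close>

locale kaehler_chart =
 fixes Y :: "(real^'m::finite) set" and J G :: "real^'m => real^'m^'m"
 assumes Y: "open Y" and sJ: "smooth_on Y J" and sG: "smooth_on Y G"
  and Gsym: "y\<in>Y ==> transpose (G y) = G y"
  and Gpos: "y\<in>Y ==> v \<noteq> 0 ==> v \<bullet> (G y *v v) > 0"
  and JJ: "y\<in>Y ==> J y ** J y = - mat 1"
  and nij: "y\<in>Y ==> nijenhuis J k i j y = 0"
  and comp: "y\<in>Y ==> transpose (J y) ** G y ** J y = G y"
  and clo: "y\<in>Y ==> pd i (%y. (transpose (J y) ** G y)$j$k) y
   + pd j (%y. (transpose (J y) ** G y)$k$i) y + pd k (%y. (transpose (J y) ** G y)$i$j) y = 0"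
begin

definition DJ where "DJ y w u = fd J y w *v u"
definition gg where "gg y u v = u \<bullet> (G y *v v)"
definition dG where "dG y w u v = u \<bullet> (fd G y w *v v)"
text \<open>The Christoffel symbols as a bilinear map: \<open>Gam y u v\<close> is the covariant
  derivative of the constant field \<open>v\<close> in the direction \<open>u\<close>.\<close>

definition Gam where "Gam y u v = (1/2) *\<^sub>R (matrix_inv (G y) *v
 (fd G y u *v v + fd G y v *v u
  - (\<chi> l. u \<bullet> (fd G y (axis l 1) *v v))))"

lemma JJv: "y\<in>Y ==> J y *v (J y *v u) = - u"
 using JJ by (simp add: matrix_vector_mul_assoc mv_minus_left)

lemma linJ: "linear (fd J y)" and linG: "linear (fd G y)" if "y\<in>Y"
 using linear_deriv[OF sJ that] linear_deriv[OF sG that] by auto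

lemma gg_bil: "gg y (u + v) w = gg y u w + gg y v w" "gg y u (v + w) = gg y u v + gg y u w"
 "gg y (c *\<^sub>R u) w = c * gg y u w" "gg y u (c *\<^sub>R w) = c * gg y u w"
 "gg y (- u) w = - gg y u w" "gg y u (- w) = - gg y u w"
 "gg y (u - v) w = gg y u w - gg y v w" "gg y u (v - w) = gg y u v - gg y u w"
 "gg y 0 w = 0" "gg y u 0 = 0"
 by (simp_all add: gg_def inner_add_left inner_diff_left matrix_vector_right_distrib inner_add_right
   matrix_vector_mult_scaleR mv_minus_right mv_diff inner_diff_right)

lemma inner_mv_transpose: "u \<bullet> (A *v v) = (transpose A *v u) \<bullet> (v::real^'m)" for A :: "real^'m^'m"
 by (metis dot_lmul_matrix vector_transpose_matrix transpose_transpose)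

lemma gg_sym: "y\<in>Y ==> gg y u v = gg y v u"
 unfolding gg_def by (subst inner_mv_transpose) (simp add: Gsym inner_commute)

lemma gg_pos: "y\<in>Y ==> v \<noteq> 0 ==> gg y v v > 0"
 by (simp add: gg_def Gpos)

lemma gg_eqI: "y\<in>Y ==> (!!z. gg y u z = gg y v z) ==> u = v"
 using gg_pos[of y "u - v"] gg_bil(7) by (metis less_irrefl right_minus_eq)

lemma gg_JJ: "y\<in>Y ==> gg y (J y *v u) (J y *v v) = gg y u v"
 using comp[of y] unfolding gg_def
 by (metis inner_mv_transpose matrix_vector_mul_assoc transpose_transpose matrix_mul_assoc)

lemma gg_J: "y\<in>Y ==> gg y (J y *v u) v = - gg y u (J y *v v)"
 using gg_JJ[of y u "J y *v v"] by (simp add: JJv gg_bil)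

lemma invG: "y\<in>Y ==> G y ** matrix_inv (G y) = mat 1" "y\<in>Y ==> det (G y) \<noteq> 0"
proof -
 assume y: "y\<in>Y"
 have "v = 0" if "G y *v v = 0" for v using Gpos[OF y, of v] that by force
 hence "invertible (G y)"
  using invertible_left_inverse matrix_left_invertible_ker by blast
 thus "G y ** matrix_inv (G y) = mat 1" "det (G y) \<noteq> 0"
  using matrix_inv_right invertible_det_nz by blast+
qed

lemma DG_sym: "y\<in>Y ==> dG y w u v = dG y w v u"
proof -
 assume y: "y\<in>Y"
 have "((%y. u \<bullet> (G y *v v)) has_derivative (%w. dG y w u v)) (at y)" for u v
  unfolding dG_def
  by (rule has_derivative_eq_rhs[OF has_derivative_inner_right[OF has_derivative_mv[OF smooth_hd[OF sG y] has_derivative_const[of v]], of u]])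
   simp
 moreover have "((%y. u \<bullet> (G y *v v)) has_derivative (%w. dG y w v u)) (at y)"
  by (rule hd_cong[OF calculation[of v u] Y y])
   (use gg_sym in \<open>simp add: gg_def\<close>)
 ultimately have "(%w. dG y w u v) = (%w. dG y w v u)" using has_derivative_unique by blast
 thus ?thesis by (rule fun_cong)
qed

lemma dG_lin1: "y\<in>Y ==> linear (%w. dG y w u v)"
 unfolding dG_def
 by (auto intro!: linearI simp: linear_add[OF linG] linear_scale[OF linG] matrix_vector_mult_add_rdistrib inner_add_right
   scaleR_matrix_vector_assoc[symmetric])

lemma dG_lin2: "linear (%u. dG y w u v)" "linear (%v. dG y w u v)"
 unfolding dG_def
 by (auto intro!: linearI simp: inner_add_left matrix_vector_right_distrib matrix_vector_mult_scaleR inner_add_right)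

lemma koszul: "y\<in>Y ==> 2 * gg y (Gam y u v) z = dG y u v z + dG y v u z - dG y z u v"
proof -
 assume y: "y\<in>Y"
 let ?k = "fd G y u *v v + fd G y v *v u
  - (\<chi> l. u \<bullet> (fd G y (axis l 1) *v v))"
 have "2 * gg y (Gam y u v) z = 2 * (z \<bullet> (G y *v Gam y u v))"
  using gg_sym[OF y] by (simp add: gg_def)
 also have "\<dots> = z \<bullet> ((G y ** matrix_inv (G y)) *v ?k)"
  by (simp add: Gam_def matrix_vector_mult_scaleR matrix_vector_mul_assoc)
 also have "\<dots> = z \<bullet> ?k" by (simp add: invG(1)[OF y])
 also have "\<dots> = dG y u z v + dG y v z u - (\<Sum>l\<in>UNIV. z$l *\<^sub>R dG y (axis l 1) u v)"
  by (simp add: dG_def inner_add_right inner_diff_right) (simp add: inner_vec_def)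
 also have "(\<Sum>l\<in>UNIV. z$l *\<^sub>R dG y (axis l 1) u v) = dG y z u v"
  by (rule axis_expansion[OF dG_lin1[OF y], symmetric])
 finally show ?thesis using DG_sym[OF y] by metis
qed

text \<open>The metric is nondegenerate, so Koszul's formula determines the Christoffel symbols.
  Symmetry, bilinearity and the behaviour under a change of coordinates are all deduced from
  this.\<close>

lemma Gam_unique:
 assumes "y\<in>Y" "!!z. 2 * gg y c z = dG y u v z + dG y v u z - dG y z u v"
 shows "c = Gam y u v"
 using koszul[OF assms(1), of u v] assms by (intro gg_eqI[of y]) (metis mult_cancel_left zero_neq_numeral)+

lemma Gam_sym: "y\<in>Y ==> Gam y u v = Gam y v u"
 using koszul[of y v u] DG_sym by (intro Gam_unique[symmetric]) (auto simp: algebra_simps)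

lemma Gam_add1: "y\<in>Y ==> Gam y (u + u') v = Gam y u v + Gam y u' v"
proof (rule Gam_unique[symmetric])
 fix z assume y: "y\<in>Y"
 show "2 * gg y (Gam y u v + Gam y u' v) z = dG y (u + u') v z + dG y v (u + u') z - dG y z (u + u') v"
  using koszul[OF y, of u v z] koszul[OF y, of u' v z]
  by (simp add: gg_bil linear_add[OF dG_lin1[OF y]] linear_add[OF dG_lin2(1)])
qed

lemma Gam_scale1: "y\<in>Y ==> Gam y (c *\<^sub>R u) v = c *\<^sub>R Gam y u v"
proof (rule Gam_unique[symmetric])
 fix z assume y: "y\<in>Y"
 have "2 * gg y (c *\<^sub>R Gam y u v) z = c * (2 * gg y (Gam y u v) z)" by (simp add: gg_bil)
 also have "\<dots> = dG y (c *\<^sub>R u) v z + dG y v (c *\<^sub>R u) z - dG y z (c *\<^sub>R u) v"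
  unfolding koszul[OF y] using y
  by (simp add: linear_scale[OF dG_lin1] linear_scale[OF dG_lin2(1)] algebra_simps)
 finally show "2 * gg y (c *\<^sub>R Gam y u v) z = dG y (c *\<^sub>R u) v z + dG y v (c *\<^sub>R u) z - dG y z (c *\<^sub>R u) v" .
qed

lemma Gam_lin1: "y\<in>Y ==> linear (%u. Gam y u v)"
 by (rule linearI) (auto simp: Gam_add1 Gam_scale1)

lemma Gam_lin2: "y\<in>Y ==> linear (Gam y u)"
 using Gam_lin1[of y u] Gam_sym by (metis (no_types, lifting) ext)

text \<open>In the sum of Koszul's formulas for \<open>(w, u, v)\<close> and
  \<open>(w, v, u)\<close> the derivatives in the directions \<open>u\<close> and \<open>v\<close>
  cancel.\<close>

lemma metric_compat: "y\<in>Y ==> dG y w u v = gg y (Gam y w u) v + gg y u (Gam y w v)"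
 using koszul[of y w u v] koszul[of y w v u] DG_sym[of y] gg_sym[of y u "Gam y w v"] by (auto simp: algebra_simps)

lemma DJ_lin: "y\<in>Y ==> linear (%w. DJ y w u)" "linear (DJ y w)"
 unfolding DJ_def
 by (auto intro!: linearI simp: linear_add[OF linJ] linear_scale[OF linJ] matrix_vector_mult_add_rdistrib
   scaleR_matrix_vector_assoc[symmetric] matrix_vector_right_distrib matrix_vector_mult_scaleR)

lemma has_derivative_J: "y\<in>Y ==> ((%y. J y *v u) has_derivative (%w. DJ y w u)) (at y)"
 using has_derivative_mv[OF smooth_hd[OF sJ] has_derivative_const[of u]] by (simp add: DJ_def)

lemma has_derivative_gg:
 assumes "y\<in>Y" "(a has_derivative a') (at y)" "(b has_derivative b') (at y)"
 shows "((%y. gg y (a y) (b y)) has_derivative (%w. dG y w (a y) (b y) + gg y (a' w) (b y) + gg y (a y) (b' w))) (at y)"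
 unfolding gg_def dG_def
 by (rule has_derivative_eq_rhs[OF has_derivative_inner[OF assms(2) has_derivative_mv[OF smooth_hd[OF sG assms(1)] assms(3)]]])
  (auto simp: inner_add_right)

lemma DJ_J: "y\<in>Y ==> DJ y w (J y *v u) = - (J y *v DJ y w u)"
proof -
 assume y: "y\<in>Y"
 have "((%y. J y *v (J y *v u)) has_derivative (%w. J y *v DJ y w u + DJ y w (J y *v u))) (at y)"
  using has_derivative_mv[OF smooth_hd[OF sJ y] has_derivative_J[OF y, of u]] by (simp add: DJ_def)
 moreover have "((%y. J y *v (J y *v u)) has_derivative (%w. 0)) (at y)"
  by (rule hd_cong[OF has_derivative_const Y y]) (simp add: JJv)
 ultimately have "(%w. J y *v DJ y w u + DJ y w (J y *v u)) = (%w. 0)" by (rule has_derivative_unique)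
 from fun_cong[OF this, of w] show ?thesis by (simp add: eq_neg_iff_add_eq_0 add.commute)
qed

lemma DJ_skew: "y\<in>Y ==> dG y w (J y *v u) v + gg y (DJ y w u) v = - (dG y w u (J y *v v) + gg y u (DJ y w v))"
proof -
 assume y: "y\<in>Y"
 have "((%y. gg y (J y *v u) v) has_derivative (%w. dG y w (J y *v u) v + gg y (DJ y w u) v)) (at y)"
  using has_derivative_gg[OF y has_derivative_J[OF y, of u] has_derivative_const[of v]] by (simp add: gg_bil)
 moreover have "((%y. - gg y u (J y *v v)) has_derivative (%w. - (dG y w u (J y *v v) + gg y u (DJ y w v)))) (at y)"
  using has_derivative_minus[OF has_derivative_gg[OF y has_derivative_const[of u] has_derivative_J[OF y, of v]]] by (simp add: gg_bil)
 hence "((%y. gg y (J y *v u) v) has_derivative (%w. - (dG y w u (J y *v v) + gg y u (DJ y w v)))) (at y)"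
  by (rule hd_cong[OF _ Y y]) (simp add: gg_J)
 ultimately have "(%w. dG y w (J y *v u) v + gg y (DJ y w u) v) = (%w. - (dG y w u (J y *v v) + gg y u (DJ y w v)))"
  by (rule has_derivative_unique)
 from fun_cong[OF this, of w] show ?thesis .
qed

text \<open>The expression is the Nijenhuis tensor on constant fields, whose brackets vanish, so
  only derivatives of \<open>J\<close> occur. By bilinearity the coordinate frame suffices, where
  its components are those of \<open>nijenhuis\<close>.\<close>

lemma nij_bil: "y\<in>Y ==> DJ y (J y *v u) v - DJ y (J y *v v) u + J y *v (DJ y v u - DJ y u v) = 0"
proof -
 assume y: "y\<in>Y"
 let ?N = "%u v. DJ y (J y *v u) v - DJ y (J y *v v) u + J y *v (DJ y v u - DJ y u v)"
 have l1: "linear (%u. ?N u v)" and l2: "linear (?N u)" for u v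
  by (auto intro!: linearI simp: linear_add[OF DJ_lin(1)[OF y]] linear_add[OF DJ_lin(2)] linear_scale[OF DJ_lin(1)[OF y]]
    linear_scale[OF DJ_lin(2)] matrix_vector_right_distrib mv_diff matrix_vector_mult_scaleR algebra_simps)
 have "?N (axis i 1) (axis j 1) = 0" for i j
 proof (unfold vec_eq_iff, rule allI)
  fix k
  have e: "DJ y w (axis j 1)$k = fd J y w$k$j" for w j k
   by (simp add: DJ_def matrix_vector_mult_def axis_def if_distrib cong: if_cong)
  have c: "(J y *v axis i 1)$l = J y$l$i" for l i
   by (simp add: matrix_vector_mult_def axis_def if_distrib cong: if_cong)
  have ex: "DJ y (J y *v axis i 1) (axis j 1)$k
    = (\<Sum>l\<in>UNIV. J y$l$i * fd J y (axis l 1)$k$j)" for i j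
   unfolding axis_expansion[OF DJ_lin(1)[OF y], of "J y *v _"] by (simp add: e c)
  have "?N (axis i 1) (axis j 1)$k = nijenhuis J k i j y"
   unfolding nijenhuis_def pd_entry[OF sJ y]
   by (simp add: ex[unfolded e] e matrix_vector_mult_def[of "J y" "_ - _"] sum.distrib sum_subtractf)
  thus "?N (axis i 1) (axis j 1)$k = 0$k" using nij[OF y] by simp
 qed
 hence "?N (axis i 1) v = 0" for i v by (rule linear_zero_axis[OF l2])
 thus ?thesis by (rule linear_zero_axis[OF l1])
qed

text \<open>The derivative of the Kaehler form \<open>g(Ju, v)\<close> in the direction
  \<open>w\<close>, by the product rule.\<close>

definition dom where "dom y w u v = dG y w (J y *v u) v + gg y (DJ y w u) v"

lemma closed_bil: "y\<in>Y ==> dom y u v w + dom y v w u + dom y w u v = 0"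
proof -
 assume y: "y\<in>Y"
 let ?N = "%u v w. dom y u v w + dom y v w u + dom y w u v"
 have l: "linear (%w. dom y w u v)" "linear (%u. dom y w u v)" "linear (dom y w u)" for u v w
  unfolding dom_def
  by (auto intro!: linearI simp: linear_add[OF DJ_lin(1)[OF y]] linear_add[OF DJ_lin(2)] linear_scale[OF DJ_lin(1)[OF y]]
    linear_scale[OF DJ_lin(2)] linear_add[OF dG_lin1[OF y]] linear_scale[OF dG_lin1[OF y]]
    linear_add[OF dG_lin2(1)] linear_scale[OF dG_lin2(1)] linear_add[OF dG_lin2(2)] linear_scale[OF dG_lin2(2)]
    gg_bil matrix_vector_right_distrib matrix_vector_mult_scaleR algebra_simps)
 have L: "linear (%u. ?N u v w)" "linear (%v. ?N u v w)" "linear (%w. ?N u v w)" for u v w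
  by (intro linear_compose_add l)+
 have om: "((%y. (transpose (J y) ** G y)$j$k) has_derivative (%w. dom y w (axis j 1) (axis k 1))) (at y)" for j k
 proof -
  have "(transpose (J y) ** G y)$j$k = gg y (J y *v axis j 1) (axis k 1)" for y
   by (simp add: gg_def inner_vec_def matrix_matrix_mult_def transpose_def matrix_vector_mult_def axis_def if_distrib cong: if_cong)
  thus ?thesis
   using has_derivative_gg[OF y has_derivative_J[OF y, of "axis j 1"] has_derivative_const[of "axis k 1"]]
   by (simp add: dom_def gg_bil)
 qed
 have "?N (axis i 1) (axis j 1) (axis k 1) = 0" for i j k
  using clo[OF y, of i j k] unfolding pd_def fdI[OF om] by simp
 hence "?N (axis i 1) (axis j 1) w = 0" for i j w by (rule linear_zero_axis[OF L(3)])
 hence "?N (axis i 1) v w = 0" for i v w by (rule linear_zero_axis[OF L(2)])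
 thus ?thesis by (rule linear_zero_axis[OF L(1)])
qed

text \<open>The covariant derivative of the tensor \<open>J\<close> in the direction
  \<open>w\<close>, applied to \<open>u\<close>.\<close>

definition nabJ where "nabJ y w u = DJ y w u + Gam y w (J y *v u) - J y *v Gam y w u"

lemma nabJ_skew: "y\<in>Y ==> gg y (nabJ y w u) v = - gg y u (nabJ y w v)"
 using DJ_skew[of y w u v] metric_compat[of y w "J y *v u" v] metric_compat[of y w u "J y *v v"]
  gg_J[of y "Gam y w u" v] gg_J[of y u "Gam y w v"]
 by (simp add: nabJ_def gg_bil)

lemma nabJ_J: "y\<in>Y ==> nabJ y w (J y *v u) = - (J y *v nabJ y w u)"
 by (simp add: nabJ_def DJ_J JJv matrix_vector_right_distrib mv_diff
   linear_neg[OF Gam_lin2])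

text \<open>Closedness of the Kaehler form in covariant terms: the Christoffel terms cancel in pairs
  because \<open>Gam\<close> is symmetric and \<open>g(Ju, v)\<close> is skew.\<close>

lemma nabJ_cyclic: "y\<in>Y ==> gg y (nabJ y u v) w + gg y (nabJ y v w) u + gg y (nabJ y w u) v = 0"
proof -
 assume y: "y\<in>Y"
 have d: "dom y w u v = gg y (nabJ y w u) v + gg y (J y *v Gam y w u) v + gg y (J y *v u) (Gam y w v)" for u v w
  by (simp add: dom_def nabJ_def gg_bil metric_compat[OF y])
 have s: "gg y (J y *v a) b = - gg y (J y *v b) a" for a b
  using gg_J[OF y, of a b] gg_sym[OF y, of a "J y *v b"] by simp
 show ?thesis
  using closed_bil[OF y, of u v w] s[of "Gam y u v" w] s[of "Gam y v w" u] s[of "Gam y w u" v]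
   Gam_sym[OF y, of u v] Gam_sym[OF y, of v w] Gam_sym[OF y, of w u] by (simp add: d)
qed

lemma nabJ_nij: "y\<in>Y ==> nabJ y (J y *v u) v - nabJ y (J y *v v) u + J y *v (nabJ y v u - nabJ y u v) = 0"
 using nij_bil[of y u v] Gam_sym[of y "J y *v u" "J y *v v"] Gam_sym[of y "J y *v u" v] Gam_sym[of y "J y *v v" u]
  Gam_sym[of y u v]
 by (simp add: nabJ_def matrix_vector_right_distrib mv_diff JJv algebra_simps)

text \<open>Up to \<open>d\<omega>\<close>, \<open>2 g((\<nabla>\<^sub>X J) Y, Z)\<close> is \<open>g(N(Y, Z), JX)\<close>.\<close>

lemma nabJ_0: "y\<in>Y ==> nabJ y u v = 0"
proof (rule gg_eqI[of y])
 fix w assume y: "y\<in>Y"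
 have QJ: "gg y (nabJ y a (J y *v b)) c = gg y (nabJ y a b) (J y *v c)" for a b c
  using gg_J[OF y, of "nabJ y a b" c] by (simp add: nabJ_J[OF y] gg_bil)
 have sk: "gg y (nabJ y a b) c = - gg y (nabJ y a c) b" for a b c
  using nabJ_skew[OF y, of a b c] gg_sym[OF y] by simp
 have 1: "gg y (nabJ y u (J y *v v)) (J y *v w) = - gg y (nabJ y u v) w"
  using QJ[of u v "J y *v w"] by (simp add: JJv[OF y] gg_bil)
 have 2: "gg y (nabJ y (J y *v v) w - nabJ y (J y *v w) v + J y *v (nabJ y w v - nabJ y v w)) (J y *v u) = 0"
  using nabJ_nij[OF y, of v w] by (simp add: gg_bil)
 \<comment> \<open>The cyclic identities for \<open>(u, v, w)\<close> and \<open>(u, Jv, Jw)\<close>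
   and the integrability identity paired with \<open>Ju\<close> are linear in such terms;
   eliminating the others leaves twice this one.\<close>
 have "gg y (nabJ y u v) w = 0"
  using nabJ_cyclic[OF y, of u v w] nabJ_cyclic[OF y, of u "J y *v v" "J y *v w"] 1 2
   QJ[of "J y *v v" w u] QJ[of "J y *v w" u v] QJ[of "J y *v w" v u]
   sk[of "J y *v w" v "J y *v u"] sk[of v w u] sk[of w u v]
  by (simp add: gg_bil gg_JJ[OF y])
 thus "gg y (nabJ y u v) w = gg y 0 w" by (simp add: gg_bil)
qed simp

lemma DJ_eq: "y\<in>Y ==> DJ y w u = J y *v Gam y w u - Gam y w (J y *v u)"
 using nabJ_0[of y w u] by (simp add: nabJ_def algebra_simps)

lemma smooth_Gam: "smooth_on Y (%y. Gam y u v)"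
 unfolding Gam_def
 by (intro smooth_scaleR smooth_mv smooth_matrix_inv smooth_add smooth_diff smooth_vec_lambda
   smooth_inner smooth_deriv smooth_vec_nth Y sG smooth_const) (use invG(2) in auto)

section \<open>Curvature and its trace against the complex structure\<close>

definition dGam where "dGam y w u v = fd (%y. Gam y u v) y w"
text \<open>The sign is that of \<open>R(w, v)u = D_w D_v u - D_v D_w u\<close> on constant fields;
  accordingly \<open>Ric\<close> will be the trace over the first slot.\<close>

definition Riem where "Riem y w v u = dGam y w v u - dGam y v w u + Gam y w (Gam y v u) - Gam y v (Gam y w u)"

lemma dGam_has: "y\<in>Y ==> ((%y. Gam y u v) has_derivative (%w. dGam y w u v)) (at y)"
 unfolding dGam_def using smooth_hd[OF smooth_Gam] .

lemma dGam_lin1: "y\<in>Y ==> linear (%w. dGam y w u v)"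
 using dGam_has has_derivative_linear by blast

lemma dGam_lin2: "y\<in>Y ==> linear (%u. dGam y w u v)"
proof (rule linearI)
 fix u u' c assume y: "y\<in>Y"
 have "((%y. Gam y (u + u') v) has_derivative (%w. dGam y w u v + dGam y w u' v)) (at y)"
  by (rule hd_cong[OF has_derivative_add[OF dGam_has[OF y] dGam_has[OF y]] Y y])
   (simp add: Gam_add1)
 from fun_cong[OF fdI[OF this], of w]
 show "dGam y w (u + u') v = dGam y w u v + dGam y w u' v" by (simp add: dGam_def)
 have "((%y. Gam y (c *\<^sub>R u) v) has_derivative (%w. c *\<^sub>R dGam y w u v)) (at y)"
  by (rule hd_cong[OF has_derivative_scaleR_right[OF dGam_has[OF y]] Y y])
   (simp add: Gam_scale1)
 from fun_cong[OF fdI[OF this], of w]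
 show "dGam y w (c *\<^sub>R u) v = c *\<^sub>R dGam y w u v" by (simp add: dGam_def)
qed

lemma dGam_sym: "y\<in>Y ==> dGam y w u v = dGam y w v u"
 unfolding dGam_def using fd_cong[OF Y, of y "%y. Gam y u v" "%y. Gam y v u"] Gam_sym by metis

lemma dGam_lin3: "y\<in>Y ==> linear (dGam y w u)"
 using dGam_lin2[of y w u] dGam_sym by (metis (no_types, lifting) ext)

lemma Gam_field_has:
 assumes "y\<in>Y" "(a has_derivative a') (at y)" "(b has_derivative b') (at y)"
 shows "((%y. Gam y (a y) (b y)) has_derivative (%w. dGam y w (a y) (b y) + Gam y (a' w) (b y) + Gam y (a y) (b' w))) (at y)"
proof -
 have e: "Gam z u v = (\<Sum>i\<in>UNIV. \<Sum>j\<in>UNIV. (u$i * v$j) *\<^sub>R Gam z (axis i 1) (axis j 1))" if "z\<in>Y" for z u v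
 proof -
  have 1: "Gam z u v = (\<Sum>i\<in>UNIV. u$i *\<^sub>R Gam z (axis i 1) v)"
   by (rule axis_expansion[OF Gam_lin1[OF that]])
  have 2: "Gam z (axis i 1) v = (\<Sum>j\<in>UNIV. v$j *\<^sub>R Gam z (axis i 1) (axis j 1))" for i
   by (rule axis_expansion[OF Gam_lin2[OF that]])
  show ?thesis unfolding 1 unfolding 2 by (simp add: scaleR_sum_right)
 qed
 have e': "dGam y w u v = (\<Sum>i\<in>UNIV. \<Sum>j\<in>UNIV. (u$i * v$j) *\<^sub>R dGam y w (axis i 1) (axis j 1))" for w u v
 proof -
  have 1: "dGam y w u v = (\<Sum>i\<in>UNIV. u$i *\<^sub>R dGam y w (axis i 1) v)"
   by (rule axis_expansion[OF dGam_lin2[OF assms(1)]])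
  have 2: "dGam y w (axis i 1) v = (\<Sum>j\<in>UNIV. v$j *\<^sub>R dGam y w (axis i 1) (axis j 1))" for i
   by (rule axis_expansion[OF dGam_lin3[OF assms(1)]])
  show ?thesis unfolding 1 unfolding 2 by (simp add: scaleR_sum_right)
 qed
 have n: "((%y. a y$i) has_derivative (%w. a' w$i)) (at y)" "((%y. b y$i) has_derivative (%w. b' w$i)) (at y)" for i
  using assms(2,3) bounded_linear.has_derivative[OF bounded_linear_vec_nth] by blast+
 have "((%z. \<Sum>i\<in>UNIV. \<Sum>j\<in>UNIV. (a z$i * b z$j) *\<^sub>R Gam z (axis i 1) (axis j 1)) has_derivative
   (%w. \<Sum>i\<in>UNIV. \<Sum>j\<in>UNIV. (a y$i * b y$j) *\<^sub>R dGam y w (axis i 1) (axis j 1)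
    + (a y$i * b' w$j + a' w$i * b y$j) *\<^sub>R Gam y (axis i 1) (axis j 1))) (at y)"
  by (intro has_derivative_sum has_derivative_scaleR has_derivative_mult n dGam_has assms(1))
 hence "((%z. Gam z (a z) (b z)) has_derivative
   (%w. \<Sum>i\<in>UNIV. \<Sum>j\<in>UNIV. (a y$i * b y$j) *\<^sub>R dGam y w (axis i 1) (axis j 1)
    + (a y$i * b' w$j + a' w$i * b y$j) *\<^sub>R Gam y (axis i 1) (axis j 1))) (at y)"
  by (rule hd_cong[OF _ Y assms(1)]) (simp add: e[symmetric])
 moreover have "(\<Sum>i\<in>UNIV. \<Sum>j\<in>UNIV. (a y$i * b y$j) *\<^sub>R dGam y w (axis i 1) (axis j 1)
    + (a y$i * b' w$j + a' w$i * b y$j) *\<^sub>R Gam y (axis i 1) (axis j 1))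
   = dGam y w (a y) (b y) + Gam y (a' w) (b y) + Gam y (a y) (b' w)" for w
  unfolding e'[of w "a y"] e[OF assms(1), of "a' w"] e[OF assms(1), of "a y"]
  by (simp add: sum.distrib scaleR_add_left)
 ultimately show ?thesis by simp
qed

lemma Riem_lin: "y\<in>Y ==> linear (%w. Riem y w v u)" "y\<in>Y ==> linear (%v. Riem y w v u)" "y\<in>Y ==> linear (Riem y w v)"
 unfolding Riem_def
 by (auto intro!: linearI simp: linear_add[OF dGam_lin1] linear_add[OF dGam_lin2] linear_add[OF dGam_lin3] linear_add[OF Gam_lin1]
   linear_add[OF Gam_lin2] linear_scale[OF dGam_lin1] linear_scale[OF dGam_lin2] linear_scale[OF dGam_lin3] linear_scale[OF Gam_lin1]
   linear_scale[OF Gam_lin2] algebra_simps)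

lemma Riem_skew: "Riem y w v u = - Riem y v w u"
 by (simp add: Riem_def)

lemma bianchi: "y\<in>Y ==> Riem y u v w + Riem y v w u + Riem y w u v = 0"
 using dGam_sym[of y] Gam_sym[of y] by (simp add: Riem_def)

text \<open>By \<open>DJ_eq\<close> the first derivatives of \<open>J u\<close> consist of
  Christoffel terms. Differentiating once more and equating the mixed derivatives is the Ricci
  identity for the parallel tensor \<open>J\<close>.\<close>

lemma Riem_J: "y\<in>Y ==> Riem y w v (J y *v u) = J y *v Riem y w v u"
proof -
 assume y: "y\<in>Y"
 have sJu: "smooth_on Y (%y. J y *v u)" by (intro smooth_mv Y sJ smooth_const)
 have fJ: "fd (%y. J y *v u) z v = J z *v Gam z v u - Gam z v (J z *v u)" if "z\<in>Y" for z v
  using fdI[OF has_derivative_J[OF that]] DJ_eq[OF that] by simp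
 have "((%z. J z *v Gam z v u - Gam z v (J z *v u)) has_derivative (%w. (J y *v dGam y w v u + DJ y w (Gam y v u))
   - (dGam y w v (J y *v u) + Gam y v (DJ y w u)))) (at y)" for v
  using has_derivative_diff[OF has_derivative_mv[OF smooth_hd[OF sJ y] dGam_has[OF y, of v u]]
    Gam_field_has[OF y has_derivative_const[of v] has_derivative_J[OF y, of u]]]
  by (simp add: DJ_def linear_0[OF Gam_lin1[OF y]])
 hence D1: "((%z. fd (%y. J y *v u) z v) has_derivative (%w. (J y *v dGam y w v u + DJ y w (Gam y v u))
   - (dGam y w v (J y *v u) + Gam y v (DJ y w u)))) (at y)" for v
  by (rule hd_cong[OF _ Y y]) (simp add: fJ)
 have D2: "fd (%z. fd (%y. J y *v u) z v) y w = (J y *v dGam y w v u + DJ y w (Gam y v u))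
   - (dGam y w v (J y *v u) + Gam y v (DJ y w u))" for v w
  using fun_cong[OF fdI[OF D1[of v]], of w] .
 have "fd (%z. fd (%y. J y *v u) z v) y w
   = fd (%z. fd (%y. J y *v u) z w) y v"
  by (rule smooth_mixed[OF Y sJu y])
 hence E: "(J y *v dGam y w v u + DJ y w (Gam y v u)) - (dGam y w v (J y *v u) + Gam y v (DJ y w u))
   = (J y *v dGam y v w u + DJ y v (Gam y w u)) - (dGam y v w (J y *v u) + Gam y w (DJ y v u))"
  by (simp only: D2)
 have Gd: "Gam y a (b - c) = Gam y a b - Gam y a c" for a b c by (rule linear_diff[OF Gam_lin2[OF y]])
 show ?thesis using E
  by (simp add: DJ_eq[OF y] Riem_def matrix_vector_right_distrib mv_diff Gd algebra_simps)
qed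

definition Ric where "Ric y a b = ltrace (%x. Riem y x a b)"

text \<open>The first Bianchi identity, with \<open>J\<close> moved across the curvature, turns the
  trace into Ricci terms. The left-hand side is a multiple of the Ricci form.\<close>

lemma ltrace_J_Riem: "y\<in>Y ==> ltrace (%x. J y *v Riem y w v x) = Ric y v (J y *v w) - Ric y w (J y *v v)"
proof -
 assume y: "y\<in>Y"
 have "J y *v Riem y w v x = - Riem y x w (J y *v v) + Riem y x v (J y *v w)" for x
 proof -
  have "J y *v (Riem y w v x + Riem y v x w + Riem y x w v) = 0" using bianchi[OF y, of w v x] by simp
  hence "J y *v Riem y w v x + Riem y v x (J y *v w) + Riem y x w (J y *v v) = 0"
   by (simp add: matrix_vector_right_distrib Riem_J[OF y])
  thus ?thesis using Riem_skew[of y v x] by (simp add: algebra_simps eq_neg_iff_add_eq_0)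
 qed
 thus ?thesis by (simp add: ltrace_diff Ric_def)
qed

lemma christoffel_Gam: "y\<in>Y ==> christoffel G k i j y = Gam y (axis i 1) (axis j 1)$k"
proof -
 assume y: "y\<in>Y"
 have e: "axis i 1 \<bullet> (A *v axis j 1) = A$i$j" "(A *v axis j 1)$i = A$i$j" for A :: "real^'m^'m" and i j
  by (simp_all add: matrix_vector_mult_basis column_def inner_axis')
 have s: "fd G y w$i$j = fd G y w$j$i" for w i j
  using DG_sym[OF y, of w "axis i 1" "axis j 1"] by (simp add: dG_def e)
 have "Gam y (axis i 1) (axis j 1)$k = (1/2) * (\<Sum>l\<in>UNIV. matrix_inv (G y)$k$l *
   (fd G y (axis i 1)$l$j + fd G y (axis j 1)$l$i
    - fd G y (axis l 1)$i$j))"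
  unfolding Gam_def by (simp add: matrix_vector_mult_def[of "matrix_inv _"] e)
 also have "\<dots> = christoffel G k i j y"
  unfolding christoffel_def pd_entry[OF sG y]
  by (intro arg_cong[where f="(*) (1/2)"] sum.cong arg_cong2[where f="(*)"] arg_cong2[where f="(-)"] arg_cong2[where f="(+)"] s refl)
 finally show ?thesis by simp
qed

lemma ricci_Ric: "y\<in>Y ==> v \<bullet> (ricci G y *v v) = Ric y v v"
proof -
 assume y: "y\<in>Y"
 have d: "pd l (christoffel G k i j) y = dGam y (axis l 1) (axis i 1) (axis j 1)$k" for l k i j
 proof -
  have "((%y. Gam y (axis i 1) (axis j 1)$k) has_derivative (%w. dGam y w (axis i 1) (axis j 1)$k)) (at y)"
   using bounded_linear.has_derivative[OF bounded_linear_vec_nth dGam_has[OF y]] .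
  hence "(christoffel G k i j has_derivative (%w. dGam y w (axis i 1) (axis j 1)$k)) (at y)"
   by (rule hd_cong[OF _ Y y]) (simp add: christoffel_Gam)
  from fdI[OF this] show ?thesis by (simp add: pd_def)
 qed
 have GG: "(\<Sum>l\<in>UNIV. Gam y (axis a 1) (axis l 1)$k * Gam y u v$l) = Gam y (axis a 1) (Gam y u v)$k" for a k u v
  unfolding axis_expansion[OF Gam_lin2[OF y], of "axis a 1" "Gam y u v"] by (simp add: mult.commute)
 \<comment> \<open>The two indices are interchanged, which is harmless for the quadratic
   form.\<close>
 have r: "ricci G y$i$j = Ric y (axis j 1) (axis i 1)" for i j
  unfolding ricci_def Ric_def ltrace_def Riem_def
  using dGam_sym[OF y] Gam_sym[OF y]
  by (simp add: d christoffel_Gam[OF y] sum.distrib sum_subtractf GG)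
 have lin: "linear (%a. Ric y a b)" "linear (Ric y a)" for a b
  unfolding Ric_def ltrace_def
  by (auto intro!: linearI simp: linear_add[OF Riem_lin(2)[OF y]] linear_add[OF Riem_lin(3)[OF y]]
    linear_scale[OF Riem_lin(2)[OF y]] linear_scale[OF Riem_lin(3)[OF y]] sum.distrib sum_distrib_left)
 show ?thesis
 proof -
  have 1: "Ric y v v = (\<Sum>j\<in>UNIV. v$j * Ric y (axis j 1) v)"
   using axis_expansion[OF lin(1), of v v] by simp
  have 2: "Ric y (axis j 1) v = (\<Sum>i\<in>UNIV. v$i * Ric y (axis j 1) (axis i 1))" for j
   using axis_expansion[OF lin(2), of "axis j 1" v] by simp
  have "v \<bullet> (ricci G y *v v) = (\<Sum>i\<in>UNIV. \<Sum>j\<in>UNIV. v$j * (v$i * Ric y (axis j 1) (axis i 1)))"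
   by (simp add: inner_vec_def matrix_vector_mult_def r sum_distrib_left algebra_simps)
  also have "\<dots> = Ric y v v"
   unfolding 1 unfolding 2 sum_distrib_left by (rule sum.swap)
  finally show ?thesis .
 qed
qed

text \<open>By \<open>ltrace_J_Riem\<close> this trace is \<open>- Ric(a, a) - Ric(Ja, Ja)\<close>.
  The sign of the Ricci curvature enters the proof through it.\<close>

lemma J_curvature_pos:
 assumes y: "y\<in>Y" and neg: "!!v. v \<noteq> 0 ==> v \<bullet> (ricci G y *v v) < 0" and a: "a \<noteq> 0"
 shows "ltrace (%x. J y *v Riem y (J y *v a) a x) > 0"
proof -
 have "J y *v a \<noteq> 0" using JJv[OF y, of a] a by auto
 hence "Ric y (J y *v a) (J y *v a) < 0" "Ric y a a < 0"
  using neg[of "J y *v a"] neg[OF a] by (simp_all add: ricci_Ric[OF y])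
 moreover have "Ric y a (- a) = - Ric y a a"
  unfolding Ric_def by (simp add: linear_neg[OF Riem_lin(3)[OF y]] ltrace_minus)
 ultimately show ?thesis unfolding ltrace_J_Riem[OF y] by (simp add: JJv[OF y])
qed

end

section \<open>Linear algebra\<close>

lemma inner_transpose_mv: "u \<bullet> (transpose A *v v) = (A *v u) \<bullet> v" for A :: "real^'n^'m"
 unfolding inner_vec_def matrix_vector_mult_def transpose_def
 by (simp add: sum_distrib_left sum_distrib_right) (subst sum.swap, simp add: algebra_simps)

lemma transpose_form: "u \<bullet> (transpose A *v u) = u \<bullet> (A *v u)" for A :: "real^'n^'n"
 by (simp only: inner_transpose_mv inner_commute)

lemma invertible_transposeI: "invertible A ==> invertible (transpose A)" for A :: "'f::field^'n^'n"
 by (simp add: invertible_det_nz det_transpose)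

lemma norm_vec_le_sum: "norm x \<le> (\<Sum>i\<in>UNIV. norm (x$i))"
 unfolding norm_vec_def by (rule L2_set_le_sum) simp

lemma gram_schmidt_form:
 fixes A :: "real^'n^'n"
 assumes sym: "transpose A = A" and pos: "!!v. v \<noteq> 0 ==> v \<bullet> (A *v v) > 0"
 obtains e :: "'n => real^'n" where "!!i j. e i \<bullet> (A *v e j) = (if i = j then 1 else 0)"
proof -
 have symv: "u \<bullet> (A *v v) = v \<bullet> (A *v u)" for u v
  by (metis inner_transpose_mv sym inner_commute)
 have "\<exists>e::'n => real^'n. \<forall>i\<in>I. \<forall>j\<in>I. e i \<bullet> (A *v e j) = (if i = j then 1 else 0)" for I :: "'n set"
  using finite[of I]
 proof (induction I rule: finite_induct)
  case empty thus ?case by simp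
 next
  case (insert k I)
  then obtain e :: "'n => real^'n" where e: "!!i j. i\<in>I ==> j\<in>I ==> e i \<bullet> (A *v e j) = (if i = j then 1 else 0)"
   by blast
  have "card I < CARD('n)" using insert(2) by (intro psubset_card_mono) auto
  hence "dim (e ` I) < DIM(real^'n)"
   using dim_le_card'[of "e ` I"] card_image_le[of I e] by simp
  hence "span (e ` I) \<noteq> UNIV" by (metis dim_span dim_UNIV less_irrefl)
  then obtain v where v: "v \<notin> span (e ` I)" by blast
  define v' where "v' = v - (\<Sum>i\<in>I. (e i \<bullet> (A *v v)) *\<^sub>R e i)"
  have "v' \<noteq> 0"
  proof
   assume "v' = 0"
   hence "v = (\<Sum>i\<in>I. (e i \<bullet> (A *v v)) *\<^sub>R e i)" by (simp add: v'_def)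
   also have "\<dots>\<in>span (e ` I)" by (intro span_sum span_scale span_base) auto
   finally show False using v by simp
  qed
  hence p: "v' \<bullet> (A *v v') > 0" by (rule pos)
  have o: "e j \<bullet> (A *v v') = 0" if "j\<in>I" for j
  proof -
   have "e j \<bullet> (A *v v') = e j \<bullet> (A *v v) - (\<Sum>i\<in>I. (e i \<bullet> (A *v v)) * (e j \<bullet> (A *v e i)))"
    unfolding v'_def mv_diff by (simp add: inner_diff_right linear_sum[OF matrix_vector_mul_linear] inner_sum_right matrix_vector_mult_scaleR)
   also have "(\<Sum>i\<in>I. (e i \<bullet> (A *v v)) * (e j \<bullet> (A *v e i))) = (\<Sum>i\<in>I. if i = j then e i \<bullet> (A *v v) else 0)"
    by (rule sum.cong) (auto simp: e that)
   also have "\<dots> = e j \<bullet> (A *v v)" using that by simp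
   finally show ?thesis by simp
  qed
  define w where "w = (1 / sqrt (v' \<bullet> (A *v v'))) *\<^sub>R v'"
  have ww: "w \<bullet> (A *v w) = 1"
   using p by (simp add: w_def matrix_vector_mult_scaleR power2_eq_square[symmetric] divide_simps)
  have we: "e j \<bullet> (A *v w) = 0" "w \<bullet> (A *v e j) = 0" if "j\<in>I" for j
   using o[OF that] symv[of v' "e j"] by (simp_all add: w_def matrix_vector_mult_scaleR)
  show ?case
  proof (intro exI ballI)
   fix i j assume "i\<in>insert k I" "j\<in>insert k I"
   thus "(e(k := w)) i \<bullet> (A *v (e(k := w)) j) = (if i = j then 1 else 0)"
    using insert(2) e ww we by auto
  qed
 qed
 from this[of UNIV] show thesis using that by auto
qed

text \<open>Only the symmetric part of \<open>Y\<close> pairs with the symmetric \<open>H\<close>.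
  It is positive definite, hence of the form \<open>C ** transpose C\<close>, and the sum becomes
  the sum of the form \<open>H\<close> over the columns of \<open>C\<close>.\<close>

lemma sum_mult_neg_pos_form:
 fixes H Y :: "real^'n^'n"
 assumes sym: "!!i j. H$i$j = H$j$i" and neg: "!!u. u \<bullet> (H *v u) \<le> 0"
  and pos: "!!u. u \<noteq> 0 ==> u \<bullet> (Y *v u) > 0"
 shows "(\<Sum>i\<in>UNIV. \<Sum>j\<in>UNIV. H$i$j * Y$i$j) \<le> 0"
proof -
 define A where "A = (1/2) *\<^sub>R (Y + transpose Y)"
 have tr: "u \<bullet> (transpose Y *v u) = u \<bullet> (Y *v u)" for u
  by (rule transpose_form)
 have "u \<bullet> (A *v u) = u \<bullet> (Y *v u)" for u
  by (simp add: A_def scaleR_matrix_vector_assoc[symmetric] matrix_vector_mult_add_rdistrib inner_add_right tr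
    del: transpose_matrix_vector)
 then obtain e :: "'n => real^'n" where e: "!!i j. e i \<bullet> (A *v e j) = (if i = j then 1 else 0)"
  using gram_schmidt_form[of A] pos by (auto simp: A_def transpose_def vec_eq_iff add.commute)
 define E :: "real^'n^'n" where "E = (\<chi> i. e i)"
 have "E ** A ** transpose E = mat 1"
 proof -
  have "(E ** A ** transpose E)$i$j = e i \<bullet> (A *v e j)" for i j
   unfolding matrix_mul_assoc[symmetric]
   by (simp add: E_def matrix_matrix_mult_def inner_vec_def matrix_vector_mult_def transpose_def)
  thus ?thesis by (simp add: e vec_eq_iff mat_def)
 qed
 hence 1: "E ** (A ** transpose E) = mat 1" by (simp add: matrix_mul_assoc)
 hence 2: "A ** transpose E ** E = mat 1" using matrix_left_right_inverse by blast
 define C where "C = A ** transpose E"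
 have "transpose C ** transpose E = mat 1"
  using 1 by (metis C_def matrix_transpose_mul transpose_mat)
 hence 3: "transpose E ** transpose C = mat 1" using matrix_left_right_inverse by blast
 have "A = C ** transpose C"
 proof -
  have "C ** transpose C = A ** (transpose E ** transpose C)" by (simp add: C_def matrix_mul_assoc)
  thus ?thesis by (simp add: 3)
 qed
 hence A: "A$i$j = (\<Sum>k\<in>UNIV. C$i$k * C$j$k)" for i j
  by (simp add: matrix_matrix_mult_def transpose_def)
 have "(\<Sum>i\<in>UNIV. \<Sum>j\<in>UNIV. H$i$j * Y$i$j) = (\<Sum>i\<in>UNIV. \<Sum>j\<in>UNIV. H$i$j * A$i$j)"
 proof -
  have "(\<Sum>i\<in>UNIV. \<Sum>j\<in>UNIV. H$i$j * Y$j$i) = (\<Sum>i\<in>UNIV. \<Sum>j\<in>UNIV. H$i$j * Y$i$j)"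
   by (subst sum.swap) (simp add: sym)
  thus ?thesis
   by (simp add: A_def transpose_def distrib_left sum.distrib sum_distrib_left[symmetric] mult.left_commute[of _ "1/2"]
     sum_divide_distrib[symmetric])
 qed
 also have "\<dots> = (\<Sum>k\<in>UNIV. column k C \<bullet> (H *v column k C))"
 proof -
  have "(\<Sum>k\<in>UNIV. column k C \<bullet> (H *v column k C)) = (\<Sum>k\<in>UNIV. \<Sum>i\<in>UNIV. \<Sum>j\<in>UNIV. H$i$j * (C$i$k * C$j$k))"
   by (simp add: inner_vec_def matrix_vector_mult_def column_def sum_distrib_left algebra_simps)
  also have "\<dots> = (\<Sum>i\<in>UNIV. \<Sum>k\<in>UNIV. \<Sum>j\<in>UNIV. H$i$j * (C$i$k * C$j$k))" by (rule sum.swap)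
  also have "\<dots> = (\<Sum>i\<in>UNIV. \<Sum>j\<in>UNIV. \<Sum>k\<in>UNIV. H$i$j * (C$i$k * C$j$k))"
   by (intro sum.cong refl sum.swap)
  finally show ?thesis by (simp add: A sum_distrib_left)
 qed
 also have "\<dots> \<le> 0" by (intro sum_nonpos neg)
 finally show ?thesis .
qed

lemma pos_form_bound:
 fixes Y :: "real^'n^'n"
 assumes "!!u. u \<noteq> 0 ==> u \<bullet> (Y *v u) > 0"
 obtains c where "c > 0" "!!u. c * (norm u)\<^sup>2 \<le> u \<bullet> (Y *v u)"
proof -
 have "continuous_on (sphere 0 1) (%u. u \<bullet> (Y *v u))"
  by (intro continuous_intros linear_continuous_on matrix_vector_mul_bounded_linear)
 moreover have "sphere (0::real^'n) 1 \<noteq> {}" by simp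
 ultimately obtain u0 where u0: "u0\<in>sphere 0 1" "!!u. u\<in>sphere 0 1 ==> u0 \<bullet> (Y *v u0) \<le> u \<bullet> (Y *v u)"
  using continuous_attains_inf[OF compact_sphere] by blast
 show thesis
 proof (rule that[of "u0 \<bullet> (Y *v u0)"])
  show "u0 \<bullet> (Y *v u0) > 0" using u0(1) by (intro assms) auto
  show "u0 \<bullet> (Y *v u0) * (norm u)\<^sup>2 \<le> u \<bullet> (Y *v u)" for u
  proof (cases "u = 0")
   case False
   have "u0 \<bullet> (Y *v u0) \<le> (u /\<^sub>R norm u) \<bullet> (Y *v (u /\<^sub>R norm u))"
    using False by (intro u0(2)) simp
   also have "\<dots> = (u \<bullet> (Y *v u)) / (norm u)\<^sup>2"
    by (simp add: matrix_vector_mult_scaleR power2_eq_square divide_inverse)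
   finally show ?thesis using False by (simp add: divide_simps)
  qed simp
 qed
qed

lemma continuous_on_det:
 fixes A :: "'a::topological_space => 'f::real_normed_field^'n^'n"
 assumes "!!i j. continuous_on S (%x. A x$i$j)"
 shows "continuous_on S (%x. det (A x))"
 unfolding det_def by (intro continuous_intros assms)

lemma tendsto_det:
 fixes A :: "'a => 'f::real_normed_field^'n^'n"
 assumes "!!i j. ((%x. A x$i$j) \<longlongrightarrow> B$i$j) F"
 shows "((%x. det (A x)) \<longlongrightarrow> det B) F"
 unfolding det_def by (intro tendsto_intros assms)

text \<open>The cofactor, which by \<open>det_deriv_cof\<close> is the partial derivative of the
  determinant with respect to the entry at \<open>i\<close>, \<open>j\<close>.\<close>

definition cof :: "'f::comm_ring_1^'n^'n => 'n => 'n => 'f" where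
 "cof A i j = det (\<chi> r. if r = i then axis j 1 else A$r)"

lemma det_deriv_cof: "det_deriv A X = (\<Sum>i\<in>UNIV. \<Sum>j\<in>UNIV. X$i$j * cof A i j)"
proof -
 have "det (\<chi> r. if r = i then X$r else A$r) = (\<Sum>j\<in>UNIV. X$i$j * cof A i j)" for i
 proof -
  have "(%r. X$r) = (%r. \<Sum>j\<in>UNIV. X$r$j *s axis j 1)"
   by (rule ext) (simp add: vec_eq_iff axis_def if_distrib cong: if_cong)
  from arg_cong[OF this, of "%F. det (\<chi> r. if r = i then F r else A$r)"]
  have "det (\<chi> r. if r = i then X$r else A$r) = det (\<chi> r. if r = i then (\<Sum>j\<in>UNIV. X$r$j *s axis j 1) else A$r)" .
  also have "\<dots> = (\<Sum>j\<in>UNIV. det (\<chi> r. if r = i then X$r$j *s axis j 1 else A$r))"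
   using det_linear_row_sum[of UNIV i "%r j. X$r$j *s axis j 1" "%r. A$r"] by simp
  also have "\<dots> = (\<Sum>j\<in>UNIV. X$i$j * cof A i j)"
  proof (rule sum.cong)
   fix j
   have "(\<chi> r. if r = i then X$r$j *s axis j 1 else A$r) = (\<chi> r. if r = i then X$i$j *s axis j 1 else A$r)"
    by (simp add: vec_eq_iff)
   thus "det (\<chi> r. if r = i then X$r$j *s axis j 1 else A$r) = X$i$j * cof A i j"
    using det_row_mul[of i "X$i$j" "%r. axis j 1" "%r. A$r"] by (simp add: cof_def)
  qed simp
  finally show ?thesis .
 qed
 thus ?thesis by (simp add: det_deriv_def)
qed

definition cmat :: "real^'n^'m => complex^'n^'m" where
 "cmat A = (\<chi> i j. complex_of_real (A$i$j))"

lemma cmat_nth [simp]: "cmat A$i$j = complex_of_real (A$i$j)"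
 by (simp add: cmat_def)

lemma det_cmat: "det (cmat A) = complex_of_real (det A)"
 by (simp add: det_def)

lemma cof_cmat: "cof (cmat A) i j = complex_of_real (cof A i j)"
proof -
 have "(\<chi> r. if r = i then axis j 1 else cmat A$r) = cmat (\<chi> r. if r = i then axis j 1 else A$r)"
  by (simp add: vec_eq_iff axis_def)
 thus ?thesis by (simp add: cof_def det_cmat)
qed

text \<open>The cofactor matrix is \<open>det G\<close> times the inverse transpose, whose form is
  positive together with that of \<open>G\<close>. The extra factor \<open>det G\<close> makes a
  square, so that the sign of \<open>det G\<close> need not be known.\<close>

lemma cof_form_pos:
 fixes G :: "real^'n^'n"
 assumes pos: "!!u. u \<noteq> 0 ==> u \<bullet> (G *v u) > 0" and u: "u \<noteq> 0"
 shows "u \<bullet> ((\<chi> i j. det G * cof G i j) *v u) > 0" and "det G \<noteq> 0"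
proof -
 have tr: "u \<bullet> (transpose G *v u) = u \<bullet> (G *v u)" for u
  by (rule transpose_form)
 have "v = 0" if "G *v v = 0" for v using pos[of v] that by force
 hence inv: "invertible G" using invertible_left_inverse matrix_left_invertible_ker by blast
 thus d: "det G \<noteq> 0" using invertible_det_nz by blast
 have inv': "invertible (transpose G)" using inv by (rule invertible_transposeI)
 define v where "v = matrix_inv (transpose G) *v u"
 have v: "transpose G *v v = u" using matrix_inv_right[OF inv'] by (simp add: v_def matrix_vector_mul_assoc)
 have "cof G i j = det G * matrix_inv (transpose G)$i$j" for i j
 proof -
  have "cof G i j = det (\<chi> a b. if b = i then axis j 1$a else transpose G$a$b)"
   unfolding cof_def by (subst det_transpose[symmetric]) (simp add: transpose_def if_distrib[of "%x. x$_"] cong: if_cong)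
  moreover have "det (transpose G) \<noteq> 0" using d by (simp add: det_transpose)
  ultimately show ?thesis using d by (subst matrix_inv_cramer) (auto simp: det_transpose)
 qed
 hence "(\<chi> i j. det G * cof G i j) = (det G)\<^sup>2 *\<^sub>R matrix_inv (transpose G)"
  by (simp add: vec_eq_iff power2_eq_square)
 hence "u \<bullet> ((\<chi> i j. det G * cof G i j) *v u) = (det G)\<^sup>2 * (u \<bullet> v)"
  by (simp add: v_def scaleR_matrix_vector_assoc[symmetric])
 also have "u \<bullet> v = v \<bullet> (G *v v)" using tr[of v] v by (simp add: inner_commute)
 finally show "u \<bullet> ((\<chi> i j. det G * cof G i j) *v u) > 0"
  using d pos[of v] v u by (metis linear_0 matrix_vector_mul_linear mult_pos_pos zero_less_power2)
qed

text \<open>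
 To first order in \<open>H\<close>, \<open>Im det (K + iH)\<close> is the trace of \<open>H\<close> against the cofactors of \<open>K\<close>, hence has the sign
 of \<open>H\<close> times that of \<open>det G\<close>.
\<close>

lemma Im_det_perturbation:
 fixes G :: "real^'n^'n"
 assumes pos: "!!u. u \<noteq> 0 ==> u \<bullet> (G *v u) > 0"
 obtains \<delta> where "\<delta> > 0"
  "!!K H :: real^'n^'n. (!!i j. \<bar>K$i$j - G$i$j\<bar> < \<delta>) ==> (!!i j. \<bar>H$i$j\<bar> < \<delta>) ==> (!!i j. H$i$j = H$j$i) ==>
   (!!u. u \<bullet> (H *v u) \<le> 0) ==> Im (det (\<chi> i j. Complex (K$i$j) (H$i$j))) * det G \<le> 0"
proof -
 define W where "W = (\<chi> i j. det G * cof G i j)"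
 have Wpos: "u \<bullet> (W *v u) > 0" if "u \<noteq> 0" for u
  unfolding W_def by (rule cof_form_pos[OF pos that])
 obtain c where c: "c > 0" "!!u. c * (norm u)\<^sup>2 \<le> u \<bullet> (W *v u)"
  using pos_form_bound[of W] Wpos by metis
 define N where "N = real CARD('n)"
 have N: "N > 0" by (simp add: N_def)
 \<comment> \<open>Up to the factor \<open>det G\<close> the derivative of \<open>Im det\<close>
   with respect to the imaginary part of the entry at \<open>i\<close>, \<open>j\<close>; at
   \<open>cmat G\<close> it is \<open>W\<close>.\<close>
 define Yf where "Yf A i j = det G * Re (cof A i j)" for A :: "complex^'n^'n" and i j
 have "\<forall>i j. \<exists>d>0. \<forall>A. dist A (cmat G) < d --> dist (Yf A i j) (Yf (cmat G) i j) < c / (2 * N)"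
 proof (intro allI)
  fix i j
  have "isCont (%A. Yf A i j) (cmat G)"
   unfolding Yf_def cof_def isCont_def
   by (intro tendsto_intros tendsto_det) (auto intro!: tendsto_intros)
  thus "\<exists>d>0. \<forall>A. dist A (cmat G) < d --> dist (Yf A i j) (Yf (cmat G) i j) < c / (2 * N)"
   unfolding continuous_at_eps_delta using c(1) N by auto
 qed
 then obtain d where d: "!!i j. d i j > 0" "!!i j A. dist A (cmat G) < d i j ==> dist (Yf A i j) (Yf (cmat G) i j) < c / (2 * N)"
  by metis
 define D where "D = Min (range (%(i, j). d i j))"
 have D: "D > 0" "!!i j. D \<le> d i j" unfolding D_def using d(1) by (auto intro!: Min_le simp: Min_gr_iff)
 \<comment> \<open>\<open>A t\<close> will differ from \<open>cmat G\<close> by at most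
   \<open>2 * \<delta>\<close> in each of the \<open>N * N\<close> entries; the summand 1 makes the
   total strictly less than \<open>D\<close>.\<close>
 define \<delta> where "\<delta> = D / (2 * N * N + 1)"
 have \<delta>: "\<delta> > 0" using D N by (auto simp: \<delta>_def intro!: divide_pos_pos add_pos_pos)
 show thesis
 proof (rule that[OF \<delta>])
  fix K H :: "real^'n^'n"
  assume K: "!!i j. \<bar>K$i$j - G$i$j\<bar> < \<delta>" and Hs: "!!i j. \<bar>H$i$j\<bar> < \<delta>"
   and sym: "!!i j. H$i$j = H$j$i" and neg: "!!u. u \<bullet> (H *v u) \<le> 0"
  \<comment> \<open>A homotopy from the real matrix \<open>K\<close>, whose determinant has no
    imaginary part, to \<open>K + iH\<close>. The derivative along it is the pairing of
    \<open>H\<close> with \<open>Yf\<close>, whose form is still positive on the whole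
    segment.\<close>
  define A :: "real => complex^'n^'n" where "A t = (\<chi> i j. Complex (K$i$j) (t * H$i$j))" for t
  have close: "dist (A t) (cmat G) < D" if "t\<in>{0..1}" for t
  proof -
   have "norm (A t - cmat G) \<le> (\<Sum>i\<in>UNIV. \<Sum>j\<in>UNIV. norm ((A t - cmat G)$i$j))"
    by (rule order_trans[OF norm_vec_le_sum sum_mono]) (rule norm_vec_le_sum)
   also have "\<dots> \<le> (\<Sum>i\<in>(UNIV::'n set). \<Sum>j\<in>(UNIV::'n set). 2 * \<delta>)"
   proof (intro sum_mono)
    fix i j
    have "(A t - cmat G)$i$j = Complex (K$i$j - G$i$j) (t * H$i$j)"
     by (simp add: A_def complex_eq_iff)
    hence "norm ((A t - cmat G)$i$j) \<le> \<bar>K$i$j - G$i$j\<bar> + \<bar>t * H$i$j\<bar>"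
     using cmod_le[of "Complex (K$i$j - G$i$j) (t * H$i$j)"] by simp
    also have "\<dots> \<le> \<delta> + 1 * \<delta>"
     unfolding abs_mult using K[of i j] Hs[of i j] that by (intro add_mono mult_mono) auto
    finally show "norm ((A t - cmat G)$i$j) \<le> 2 * \<delta>" by simp
   qed
   also have "\<dots> = 2 * N * N * \<delta>" by (simp add: N_def)
   also have "\<dots> < D"
   proof -
    have "(2 * N * N + 1) * \<delta> = D" using N by (simp add: \<delta>_def add_pos_pos less_imp_neq[symmetric])
    thus ?thesis using \<delta> by (simp add: algebra_simps)
   qed
   finally show ?thesis by (simp add: dist_norm)
  qed
  have Ypos: "u \<bullet> ((\<chi> i j. Yf (A t) i j) *v u) > 0" if t: "t\<in>{0..1}" and u: "u \<noteq> 0" for t u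
  proof -
   have W: "W$i$j = Yf (cmat G) i j" for i j by (simp add: W_def Yf_def cof_cmat)
   have "u \<bullet> (W *v u) - u \<bullet> ((\<chi> i j. Yf (A t) i j) *v u)
     = (\<Sum>i\<in>UNIV. \<Sum>j\<in>UNIV. u$i * u$j * (Yf (cmat G) i j - Yf (A t) i j))"
    by (simp add: inner_vec_def matrix_vector_mult_def W sum_distrib_left sum_subtractf[symmetric] algebra_simps)
   \<comment> \<open>By \<open>2 |u_i u_j| \<le> u_i^2 + u_j^2\<close> an error of
     \<open>c / (2 * N)\<close> in every entry costs at most half of the lower bound
     \<open>c * norm u ^ 2\<close>.\<close>
   also have "\<dots> \<le> (\<Sum>i\<in>(UNIV::'n set). \<Sum>j\<in>(UNIV::'n set). ((u$i)\<^sup>2 + (u$j)\<^sup>2) / 2 * (c / (2 * N)))"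
   proof (intro sum_mono)
    fix i j
    have "\<bar>Yf (cmat G) i j - Yf (A t) i j\<bar> \<le> c / (2 * N)"
     using d(2)[of "A t" i j] close[OF t] D(2)[of i j] by (simp add: dist_real_def abs_minus_commute)
    moreover have "\<bar>u$i * u$j\<bar> \<le> ((u$i)\<^sup>2 + (u$j)\<^sup>2) / 2"
     using sum_squares_bound[of "\<bar>u$i\<bar>" "\<bar>u$j\<bar>"] by (simp add: abs_mult)
    ultimately have "\<bar>u$i * u$j\<bar> * \<bar>Yf (cmat G) i j - Yf (A t) i j\<bar> \<le> ((u$i)\<^sup>2 + (u$j)\<^sup>2) / 2 * (c / (2 * N))"
     by (intro mult_mono) auto
    thus "u$i * u$j * (Yf (cmat G) i j - Yf (A t) i j) \<le> ((u$i)\<^sup>2 + (u$j)\<^sup>2) / 2 * (c / (2 * N))"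
     using abs_ge_self[of "(u$i * u$j) * (Yf (cmat G) i j - Yf (A t) i j)"]
     unfolding abs_mult[of "u$i * u$j"] by linarith
   qed
   also have "\<dots> = (\<Sum>i\<in>(UNIV::'n set). \<Sum>j\<in>(UNIV::'n set). (u$i)\<^sup>2 + (u$j)\<^sup>2) * (c / (4 * N))"
    unfolding sum_distrib_right by (intro sum.cong refl) (simp add: field_simps)
   also have "(\<Sum>i\<in>(UNIV::'n set). \<Sum>j\<in>(UNIV::'n set). (u$i)\<^sup>2 + (u$j)\<^sup>2) = 2 * N * (norm u)\<^sup>2"
    using power2_norm_eq_inner[of u]
    by (simp add: sum.distrib N_def sum_distrib_left[symmetric] inner_vec_def power2_eq_square)
   also have "2 * N * (norm u)\<^sup>2 * (c / (4 * N)) = c * (norm u)\<^sup>2 / 2" using N by simp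
   finally have "u \<bullet> ((\<chi> i j. Yf (A t) i j) *v u) \<ge> u \<bullet> (W *v u) - c * (norm u)\<^sup>2 / 2" by linarith
   moreover have "c * (norm u)\<^sup>2 > 0" using c(1) u by simp
   ultimately show ?thesis using c(2)[of u] by linarith
  qed
  define g where "g t = Im (det (A t)) * det G" for t
  have dg: "(g has_real_derivative (\<Sum>i\<in>UNIV. \<Sum>j\<in>UNIV. H$i$j * Yf (A t) i j)) (at t)" for t
  proof -
   have "((%t. A t$i$j) has_derivative (%s. (\<chi> i j. Complex 0 (s * H$i$j))$i$j)) (at t)" for i j
   proof -
    have "((%t. complex_of_real (K$i$j) + \<i> * complex_of_real (t * H$i$j)) has_derivative
      (%s. \<i> * complex_of_real (s * H$i$j))) (at t)"
     by (auto intro!: derivative_eq_intros)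
    thus ?thesis by (simp add: A_def Complex_eq)
   qed
   hence "((%t. det (A t)) has_derivative (%s. det_deriv (A t) (\<chi> i j. Complex 0 (s * H$i$j)))) (at t)"
    by (rule has_derivative_det)
   hence "(g has_derivative (%s. Im (det_deriv (A t) (\<chi> i j. Complex 0 (s * H$i$j))) * det G)) (at t)"
    unfolding g_def by (intro has_derivative_mult_left bounded_linear.has_derivative[OF bounded_linear_Im])
   moreover have "Im (det_deriv (A t) (\<chi> i j. Complex 0 (s * H$i$j))) * det G
     = (\<Sum>i\<in>UNIV. \<Sum>j\<in>UNIV. H$i$j * Yf (A t) i j) * s" for s
    by (simp add: det_deriv_cof Yf_def sum_distrib_right sum_distrib_left algebra_simps)
   ultimately show ?thesis unfolding has_field_derivative_def by simp
  qed
  have "g 1 \<le> g 0"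
  proof (rule DERIV_nonpos_imp_nonincreasing[where f=g and a=0 and b=1])
   fix t :: real assume t: "0 \<le> t" "t \<le> 1"
   have "(\<Sum>i\<in>UNIV. \<Sum>j\<in>UNIV. H$i$j * (\<chi> i j. Yf (A t) i j)$i$j) \<le> 0"
    by (rule sum_mult_neg_pos_form[OF sym neg Ypos]) (use t in auto)
   thus "\<exists>y. (g has_real_derivative y) (at t) \<and> y \<le> 0" using dg[of t] by auto
  qed simp
  moreover have "g 0 = 0"
  proof -
   have "A 0 = cmat K" by (simp add: A_def vec_eq_iff complex_eq_iff)
   thus ?thesis by (simp add: g_def det_cmat)
  qed
  ultimately have "g 1 \<le> 0" by simp
  thus "Im (det (\<chi> i j. Complex (K$i$j) (H$i$j))) * det G \<le> 0" by (simp add: g_def A_def)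
 qed
qed

section \<open>Complex linear algebra on a real vector space with a complex structure\<close>

text \<open>Multiplication by complex numbers with \<open>A\<close> in the role of the imaginary
  unit. Thus \<open>comb\<close> is a complex linear combination and \<open>cbasis\<close> says that
  \<open>e\<close> is a complex basis of the real space.\<close>

definition cscale :: "real^'m^'m => complex => real^'m => real^'m" where
 "cscale A z v = Re z *\<^sub>R v + Im z *\<^sub>R (A *v v)"

definition comb :: "real^'m^'m => ('n::finite => real^'m) => complex^'n => real^'m" where
 "comb A e z = (\<Sum>i\<in>UNIV. cscale A (z$i) (e i))"

definition cbasis :: "real^'m^'m => ('n::finite => real^'m) => bool" where
 "cbasis A e \<longleftrightarrow> bij (comb A e)"

definition clinear :: "real^'m^'m => (real^'m => complex) => bool" where
 "clinear A T \<longleftrightarrow> linear T \<and> (\<forall>u. T (A *v u) = \<i> * T u)"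

lemma linear_comb: "linear (comb A e)"
 by (rule linearI)
  (simp_all add: comb_def cscale_def scaleR_add_left sum.distrib scaleR_sum_right algebra_simps)

lemma comb_axis: "comb A e (axis i c) = cscale A c (e i)"
proof -
 have "comb A e (axis i c) = (\<Sum>j\<in>UNIV. if j = i then cscale A c (e i) else 0)"
  unfolding comb_def by (rule sum.cong) (auto simp: axis_def cscale_def)
 thus ?thesis by simp
qed

lemma cscale_mult: "A ** A = - mat 1 ==> cscale A z (cscale A w v) = cscale A (z * w) v"
proof -
 assume A: "A ** A = - mat 1"
 have "A *v (A *v v) = - v" using A by (simp add: matrix_vector_mul_assoc mv_minus_left)
 thus ?thesis
  by (simp add: cscale_def matrix_vector_right_distrib matrix_vector_mult_scaleR algebra_simps)
qed

lemma cscale_comb: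
 fixes A :: "real^'m^'m" and e :: "'n::finite => real^'m"
 assumes A: "A ** A = - mat 1"
 shows "cscale A c (comb A e z) = comb A e (c *s z)"
proof -
 have "cscale A c (\<Sum>i\<in>I. v i) = (\<Sum>i\<in>I. cscale A c (v i))" for I :: "'n set" and v :: "'n => real^'m"
  by (induction I rule: infinite_finite_induct) (auto simp: cscale_def matrix_vector_right_distrib algebra_simps)
 thus ?thesis by (simp add: comb_def cscale_mult[OF A])
qed

lemma J_comb: "A ** A = - mat 1 ==> A *v comb A e z = comb A e (\<i> *s z)"
 using cscale_comb[of A \<i> e z] by (simp add: cscale_def)

lemma clinear_cscale: "clinear A T ==> T (cscale A z v) = z * T v"
proof -
 assume T: "clinear A T"
 have "T (cscale A z v) = Re z *\<^sub>R T v + Im z *\<^sub>R (\<i> * T v)"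
  using T by (simp add: clinear_def cscale_def linear_add linear_scale)
 also have "\<dots> = complex_of_real (Re z) * T v + complex_of_real (Im z) * (\<i> * T v)"
  by (simp only: scaleR_conv_of_real)
 also have "\<dots> = (complex_of_real (Re z) + \<i> * complex_of_real (Im z)) * T v" by (simp add: algebra_simps)
 also have "\<dots> = z * T v" by (simp only: complex_eq[symmetric])
 finally show ?thesis .
qed

lemma clinear_comb: "clinear A T ==> T (comb A e z) = (\<Sum>i\<in>UNIV. z$i * T (e i))"
 unfolding comb_def using clinear_cscale[of A T] by (simp add: clinear_def linear_sum)

lemma sum_Basis_cvec:
 fixes g :: "complex^'n => 'b::comm_monoid_add"
 shows "(\<Sum>b\<in>Basis. g b) = (\<Sum>i\<in>UNIV. g (axis i 1) + g (axis i \<i>))"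
proof -
 have "(\<Sum>b\<in>Basis. g b) = (\<Sum>b\<in>(\<Union>i\<in>UNIV. {axis i 1, axis i \<i>}). g b)"
  by (rule sum.cong) (auto simp: Basis_vec_def Basis_complex_def)
 also have "\<dots> = (\<Sum>i\<in>UNIV. \<Sum>b\<in>{axis i 1, axis i \<i>}. g b)"
  by (rule sum.UNION_disjoint) (auto simp: axis_eq_axis)
 also have "\<dots> = (\<Sum>i\<in>UNIV. g (axis i 1) + g (axis i \<i>))"
  by (rule sum.cong) (auto simp: axis_eq_axis)
 finally show ?thesis .
qed

lemma ltrace_conjugate:
 fixes P :: "'a::euclidean_space => real^'m"
 assumes "linear P" "linear Q" "!!y. P (Q y) = y" "linear T"
 shows "ltrace T = (\<Sum>b\<in>Basis. Q (T (P b)) \<bullet> b)"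
proof -
 have "(\<Sum>b\<in>Basis. Q (T (P b)) \<bullet> b) = (\<Sum>b\<in>Basis. \<Sum>k\<in>UNIV. T (P b)$k * (Q (axis k 1) \<bullet> b))"
  unfolding axis_expansion[OF assms(2), of "T _"] by (simp add: inner_sum_left)
 also have "\<dots> = (\<Sum>k\<in>UNIV. \<Sum>b\<in>Basis. T (P b)$k * (Q (axis k 1) \<bullet> b))" by (rule sum.swap)
 also have "\<dots> = (\<Sum>k\<in>UNIV. T (P (Q (axis k 1)))$k)"
 proof (rule sum.cong)
  fix k
  have "T (P (Q (axis k 1))) = T (P (\<Sum>b\<in>Basis. (Q (axis k 1) \<bullet> b) *\<^sub>R b))" by (simp add: euclidean_representation)
  also have "\<dots> = (\<Sum>b\<in>Basis. (Q (axis k 1) \<bullet> b) *\<^sub>R T (P b))"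
   by (simp add: linear_sum[OF assms(1)] linear_sum[OF assms(4)] linear_scale[OF assms(1)] linear_scale[OF assms(4)])
  finally show "(\<Sum>b\<in>Basis. T (P b)$k * (Q (axis k 1) \<bullet> b)) = T (P (Q (axis k 1)))$k"
   by (simp add: mult.commute)
 qed simp
 finally show ?thesis by (simp add: ltrace_def assms(3))
qed

text \<open>The real trace of a complex linear map is twice the real part of its complex trace; for
  \<open>i K\<close> this is \<open>- 2 Im (trace K)\<close>.\<close>

lemma ltrace_complex:
 fixes e :: "'n::finite => real^'m"
 assumes A: "A ** A = - mat 1" and e: "cbasis A e" and T: "linear T" "!!u. T (A *v u) = A *v T u"
  and K: "!!i. T (e i) = comb A e (K$i)"
 shows "ltrace (%x. A *v T x) = - 2 * Im (trace K)"
proof -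
 obtain Q where Q: "linear Q" "!!z. Q (comb A e z) = z" "!!y. comb A e (Q y) = y"
 proof -
  have b: "bij (comb A e)" using e by (simp add: cbasis_def)
  have "linear (inv (comb A e))"
   using linear_injective_left_inverse[OF linear_comb bij_is_inj[OF b]]
   by (metis (no_types, lifting) b bij_is_surj comp_apply ext id_apply surj_f_inv_f)
  thus thesis using that b bij_is_inj bij_is_surj by (metis inv_f_f surj_f_inv_f)
 qed
 have TA: "linear (%x. A *v T x)" using linear_compose[OF T(1) matrix_vector_mul_linear[of A]] by (simp add: o_def)
 have Tc: "T (cscale A c u) = cscale A c (T u)" for c u
  by (simp add: cscale_def linear_add[OF T(1)] linear_scale[OF T(1)] T(2))
 have "Q (A *v T (comb A e (axis i c))) = (\<i> * c) *s K$i" for i c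
  by (simp add: comb_axis Tc K cscale_comb[OF A] J_comb[OF A] Q(2) vec.scale_scale)
 hence "ltrace (%x. A *v T x) = (\<Sum>i\<in>UNIV. ((\<i> *s K$i) \<bullet> axis i 1) + ((- 1) *s K$i) \<bullet> axis i \<i>)"
  unfolding ltrace_conjugate[OF linear_comb Q(1,3) TA] sum_Basis_cvec by simp
 also have "\<dots> = (\<Sum>i\<in>UNIV. - 2 * Im (K$i$i))"
  by (rule sum.cong) (simp_all add: inner_axis inner_complex_def)
 finally show ?thesis by (simp add: trace_def sum_distrib_left)
qed

text \<open>A complex relation between the \<open>e i\<close> is also one between the rows of the
  regular matrix, so \<open>comb\<close> is injective; the dimensions then make it
  bijective.\<close>

lemma cbasis_if_det:
 fixes e :: "'n::finite => real^'m" and T :: "'n => real^'m => complex"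
 assumes dims: "CARD('m) = 2 * CARD('n)" and T: "!!j. clinear A (T j)"
  and d: "det (\<chi> i j. T j (e i)) \<noteq> 0"
 shows "cbasis A e"
proof -
 let ?M = "\<chi> i j. T j (e i)"
 have "z = 0" if "comb A e z = 0" for z
 proof -
  have "(\<Sum>i\<in>UNIV. z$i * T j (e i)) = 0" for j
   using clinear_comb[OF T, of j e z] that T[of j] by (simp add: clinear_def linear_0)
  hence "transpose ?M *v z = 0"
   by (simp add: vec_eq_iff matrix_vector_mult_def transpose_def mult.commute)
  moreover have "invertible (transpose ?M)" by (intro invertible_transposeI) (simp add: invertible_det_nz d)
  ultimately show ?thesis
   by (metis invertible_left_inverse matrix_left_invertible_ker)
 qed
 hence inj: "inj (comb A e)" using linear_injective_0[OF linear_comb] by metis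
 have "DIM(complex^'n) = DIM(real^'m)" using dims by simp
 hence "dim (range (comb A e)) = DIM(real^'m)"
  using dim_image_eq[OF linear_comb, of A e UNIV] inj by simp
 hence "span (range (comb A e)) = UNIV" using dim_eq_full by blast
 hence "surj (comb A e)"
  using linear_subspace_image[OF linear_comb subspace_UNIV] span_eq_iff by metis
 with inj show ?thesis by (simp add: cbasis_def bij_def)
qed

section \<open>Phases of totally real immersions\<close>

context kaehler_chart
begin

text \<open>The ambient covariant derivative of the coordinate field \<open>pd i f\<close> along
  \<open>f\<close> in the direction \<open>k\<close>, not projected to tangential or normal
  part.\<close>

definition nab :: "(real^'n => real^'m) => 'n::finite => 'n => real^'n => real^'m" where
 "nab f k i x = pd k (pd i f) x + Gam (f x) (pd k f x) (pd i f x)"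

text \<open>The vanishing of the Maslov form, that is, of the imaginary part of the complex connection form of the frame \<open>pd i f\<close>.\<close>

definition xi0 :: "(real^'n => real^'m) => real^'n::finite => bool" where
 "xi0 f x \<longleftrightarrow> (\<forall>k. \<exists>C. (\<forall>i. nab f k i x = comb (J (f x)) (%l. pd l f x) (C$i)) \<and> Im (trace C) = 0)"

end

lemma smooth_pd: "smooth_on S f ==> smooth_on S (pd i f)"
 unfolding pd_def[abs_def] by (rule smooth_deriv)

lemma has_derivative_pd: "smooth_on S f ==> x\<in>S ==> (pd i f has_derivative fd (pd i f) x) (at x)"
 by (rule smooth_hd[OF smooth_pd])

lemma frechet_pd: "smooth_on S f ==> x\<in>S ==> fd f x v = (\<Sum>i\<in>UNIV. v$i *\<^sub>R pd i f x)"
 unfolding pd_def by (rule axis_expansion[OF linear_deriv])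

lemma smooth_Complex:
 assumes "open S" "smooth_on S a" "smooth_on S b"
 shows "smooth_on S (%x. Complex (a x) (b x))"
 unfolding Complex_eq
 by (intro smooth_add smooth_mult smooth_const smooth_bounded_linear[OF bounded_linear_of_real] assms)

text \<open>\<open>C1\<close> puts the graph into the zero set of \<open>\<Phi>\<close>. By
  \<open>C2\<close> and \<open>C2'\<close> the vertical derivative on the graph is the projection
  onto the tangent space along its image under \<open>J\<close>, and by \<open>C3\<close> the
  vertical covariant Hessian vanishes there.\<close>

locale gauge = kaehler_chart Y J G for Y :: "(real^'m::finite) set" and J G +
 fixes X :: "(real^'n::finite) set" and \<iota> :: "real^'n => real^'m"
  and W :: "((real^'n) \<times> (real^'m)) set" and \<Phi> :: "(real^'n) \<times> (real^'m) => real^'n"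
 assumes dims: "CARD('m) = 2 * CARD('n)" and X: "open X" and s\<iota>: "smooth_on X \<iota>"
  and \<xi>\<iota>: "x\<in>X ==> xi0 \<iota> x"
  and W: "open W" and WXY: "W \<subseteq> X \<times> Y" and graph: "x\<in>X ==> (x, \<iota> x)\<in>W" and s\<Phi>: "smooth_on W \<Phi>"
  and C1: "x\<in>X ==> \<Phi> (x, \<iota> x) = 0"
  and C2: "x\<in>X ==> fd \<Phi> (x, \<iota> x) (0, pd k \<iota> x) = axis k 1"
  and C2': "x\<in>X ==> fd \<Phi> (x, \<iota> x) (0, J (\<iota> x) *v pd k \<iota> x) = 0"
  and C3: "x\<in>X ==> fd (%p. fd \<Phi> p (0, u)) (x, \<iota> x) (0, v)
   = fd \<Phi> (x, \<iota> x) (0, Gam (\<iota> x) v u)"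
  and neg: "y\<in>Y ==> v \<noteq> 0 ==> v \<bullet> (ricci G y *v v) < 0"
begin

lemma \<iota>Y: "x\<in>X ==> \<iota> x\<in>Y"
 using graph WXY by auto

lemma WD: "p\<in>W ==> fst p\<in>X" "p\<in>W ==> snd p\<in>Y"
 using WXY by auto

definition Dy where "Dy p u = fd \<Phi> p (0, u)"
text \<open>That is, \<open>Dy u - i Dy (J u)\<close>; with this sign
  \<open>T (J u) = i T u\<close>.\<close>

definition T where "T p j u = Complex (Dy p u$j) (- (Dy p (J (snd p) *v u)$j))"
definition dT where "dT p h j u = fd (%p. T p j u) p h"
text \<open>The covariant derivative of the form \<open>T p j\<close> along \<open>h\<close>. Only
  the target component of \<open>h\<close> meets the connection, since \<open>T\<close> acts on
  vectors tangent to the target.\<close>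

definition nabT where "nabT p h j u = dT p h j u - T p j (Gam (snd p) (snd h) u)"

lemma smooth_Dy: "smooth_on W (%p. Dy p u)"
 unfolding Dy_def by (rule smooth_deriv[OF s\<Phi>])

lemma linear_Dy: "p\<in>W ==> linear (Dy p)"
 unfolding Dy_def
 using linear_compose[OF _ linear_deriv[OF s\<Phi>], of "%u. (0, u)" p]
 by (simp add: o_def bounded_linear.linear bounded_linear_Pair)

lemma clinear_T: "p\<in>W ==> clinear (J (snd p)) (T p j)"
 unfolding clinear_def
 by (auto intro!: linearI simp: T_def complex_eq_iff linear_add[OF linear_Dy] linear_scale[OF linear_Dy] linear_neg[OF linear_Dy]
   matrix_vector_right_distrib matrix_vector_mult_scaleR JJv WD)

lemma linear_T: "p\<in>W ==> linear (T p j)"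
 using clinear_T by (auto simp: clinear_def)

lemma smooth_T: "smooth_on W (%p. T p j u)"
proof -
 have sJ': "smooth_on W (%p. J (snd p) *v u)"
  by (intro smooth_mv smooth_compose[OF sJ, of _ snd] smooth_snd smooth_const W Y smooth_id WD)
 have "smooth_on W (%p. \<Sum>a\<in>UNIV. (J (snd p) *v u)$a *\<^sub>R Dy p (axis a 1))"
  by (intro smooth_sum smooth_scaleR W smooth_vec_nth sJ' smooth_Dy)
 hence "smooth_on W (%p. Dy p (J (snd p) *v u))"
  by (rule smooth_cong'[OF _ W]) (rule axis_expansion[OF linear_Dy])
 thus ?thesis unfolding T_def
  by (intro smooth_Complex smooth_minus smooth_vec_nth W smooth_Dy)
qed

lemma dT_has: "p\<in>W ==> ((%p. T p j u) has_derivative (%h. dT p h j u)) (at p)"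
 unfolding dT_def by (rule smooth_hd[OF smooth_T])

lemma dT_lin1: "p\<in>W ==> linear (%h. dT p h j u)"
 using dT_has has_derivative_linear by blast

lemma dT_lin2: "p\<in>W ==> linear (dT p h j)"
proof (rule linearI)
 fix u u' c assume p: "p\<in>W"
 have "((%p. T p j (u + u')) has_derivative (%h. dT p h j u + dT p h j u')) (at p)"
  by (rule hd_cong[OF has_derivative_add[OF dT_has[OF p] dT_has[OF p]] W p])
   (simp add: linear_add[OF linear_T])
 from fun_cong[OF fdI[OF this], of h]
 show "dT p h j (u + u') = dT p h j u + dT p h j u'" by (simp add: dT_def)
 have "((%p. T p j (c *\<^sub>R u)) has_derivative (%h. c *\<^sub>R dT p h j u)) (at p)"
  by (rule hd_cong[OF has_derivative_scaleR_right[OF dT_has[OF p]] W p])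
   (simp add: linear_scale[OF linear_T])
 from fun_cong[OF fdI[OF this], of h]
 show "dT p h j (c *\<^sub>R u) = c *\<^sub>R dT p h j u" by (simp add: dT_def)
qed

lemma T_field:
 fixes P :: "'a::euclidean_space => (real^'n) \<times> (real^'m)"
 assumes V: "open V" "x\<in>V" "!!y. y\<in>V ==> P y\<in>W"
  and P: "(P has_derivative P') (at x)" and b: "(b has_derivative b') (at x)"
 shows "((%y. T (P y) j (b y)) has_derivative (%v. dT (P x) (P' v) j (b x) + T (P x) j (b' v))) (at x)"
proof -
 have Px: "P x\<in>W" using V by blast
 have n: "((%y. b y$i) has_derivative (%v. b' v$i)) (at x)" for i
  using b bounded_linear.has_derivative[OF bounded_linear_vec_nth] by blast
 have c: "((%y. T (P y) j u) has_derivative (%v. dT (P x) (P' v) j u)) (at x)" for u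
  by (rule has_derivative_compose[OF P dT_has[OF Px]])
 have "((%y. \<Sum>i\<in>UNIV. b y$i *\<^sub>R T (P y) j (axis i 1)) has_derivative
   (%v. \<Sum>i\<in>UNIV. b x$i *\<^sub>R dT (P x) (P' v) j (axis i 1) + b' v$i *\<^sub>R T (P x) j (axis i 1))) (at x)"
  by (intro has_derivative_sum has_derivative_scaleR n c)
 hence "((%y. T (P y) j (b y)) has_derivative
   (%v. \<Sum>i\<in>UNIV. b x$i *\<^sub>R dT (P x) (P' v) j (axis i 1) + b' v$i *\<^sub>R T (P x) j (axis i 1))) (at x)"
  by (rule hd_cong[OF _ V(1,2)]) (metis axis_expansion[OF linear_T] V(3))
 thus ?thesis
  unfolding sum.distrib axis_expansion[OF dT_lin2[OF Px], of _ _ "b x", symmetric]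
   axis_expansion[OF linear_T[OF Px], symmetric] .
qed

lemma has_derivative_Jsnd: "p\<in>W ==> ((%p. J (snd p) *v u) has_derivative (%h. DJ (snd p) (snd h) u)) (at p)"
 using has_derivative_compose[OF has_derivative_snd[OF has_derivative_ident] has_derivative_J[OF WD(2)]] by auto

text \<open>Differentiate \<open>T (J u) = i T u\<close> and eliminate the derivative of
  \<open>J\<close> by its parallelism.\<close>

lemma clinear_nabT: "p\<in>W ==> clinear (J (snd p)) (nabT p h j)"
proof -
 assume p: "p\<in>W"
 have lin: "linear (nabT p h j)"
  unfolding nabT_def
  by (auto intro!: linearI simp: linear_add[OF dT_lin2[OF p]] linear_scale[OF dT_lin2[OF p]] linear_add[OF linear_T[OF p]]
    linear_scale[OF linear_T[OF p]] linear_add[OF Gam_lin2[OF WD(2)[OF p]]] linear_scale[OF Gam_lin2[OF WD(2)[OF p]]] algebra_simps)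
 have "nabT p h j (J (snd p) *v u) = \<i> * nabT p h j u" for u
 proof -
  have "((%p. T p j (J (snd p) *v u)) has_derivative (%h. dT p h j (J (snd p) *v u) + T p j (DJ (snd p) (snd h) u))) (at p)"
   using T_field[OF W p _ has_derivative_ident has_derivative_Jsnd[OF p, of u]] by simp
  moreover have "((%p. T p j (J (snd p) *v u)) has_derivative (%h. \<i> * dT p h j u)) (at p)"
   by (rule hd_cong[OF has_derivative_mult_right[OF dT_has[OF p]] W p])
    (use clinear_T in \<open>simp add: clinear_def\<close>)
  ultimately have "(%h. dT p h j (J (snd p) *v u) + T p j (DJ (snd p) (snd h) u)) = (%h. \<i> * dT p h j u)"
   by (rule has_derivative_unique)
  from fun_cong[OF this, of h]
  have 1: "dT p h j (J (snd p) *v u) = \<i> * dT p h j u - T p j (DJ (snd p) (snd h) u)" by (simp add: algebra_simps)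
  have 2: "T p j (J (snd p) *v v) = \<i> * T p j v" for v using clinear_T[OF p] by (simp add: clinear_def)
  show ?thesis
   unfolding nabT_def 1 DJ_eq[OF WD(2)[OF p]] linear_diff[OF linear_T[OF p]] 2 by (simp add: algebra_simps)
 qed
 thus ?thesis using lin by (simp add: clinear_def)
qed

definition M where "M e p = (\<chi> i j. T p j (e i))"
definition N where "N e p h = (\<chi> i j. nabT p h j (e i))"
text \<open>By \<open>nabT_expand\<close> this is the connection matrix of the coframe
  \<open>T\<close>. The constant vectors \<open>e\<close> merely serve to compute it by a formula
  that is smooth in \<open>p\<close>. The form \<open>kap\<close> is the one whose pull-back will be
  the differential of the phase.\<close>

definition Dt where "Dt e p h = matrix_inv (M e p) ** N e p h"
definition kap where "kap e p h = Im (trace (Dt e p h))"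
definition We where "We e = {p\<in>W. det (M e p) \<noteq> 0}"

lemma WeD: "p\<in>We e ==> p\<in>W" "p\<in>We e ==> det (M e p) \<noteq> 0"
 by (simp_all add: We_def)

lemma smooth_M: "smooth_on W (%p. M e p$i$j)"
 unfolding M_def by (simp add: smooth_T)

lemma open_We: "open (We e)"
proof -
 have "open (W \<inter> (%p. det (M e p)) -` (- {0}))"
  by (intro continuous_open_preimage smooth_cont[OF smooth_det] W smooth_M) auto
 thus ?thesis by (simp add: We_def vimage_def Int_def)
qed

lemma M_Dt: "p\<in>We e ==> M e p ** Dt e p h = N e p h"
 using matrix_inv_right[of "M e p"] invertible_det_nz[of "M e p"] by (simp add: Dt_def matrix_mul_assoc WeD)

lemma cbasis_e: "p\<in>We e ==> cbasis (J (snd p)) e"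
 by (rule cbasis_if_det[OF dims, of _ "T p"]) (use clinear_T WeD in \<open>auto simp: M_def\<close>)

lemma nabT_expand:
 assumes p: "p\<in>We e"
 shows "nabT p h j u = (\<Sum>l\<in>UNIV. Dt e p h$l$j * T p l u)"
proof -
 obtain z where u: "u = comb (J (snd p)) e z"
  using cbasis_e[OF p] by (metis bij_pointE cbasis_def)
 have N: "nabT p h j (e i) = (\<Sum>l\<in>UNIV. T p l (e i) * Dt e p h$l$j)" for i
 proof -
  have "nabT p h j (e i) = (M e p ** Dt e p h)$i$j" by (simp add: M_Dt[OF p] N_def)
  thus ?thesis by (simp add: matrix_matrix_mult_def M_def)
 qed
 have "nabT p h j u = (\<Sum>i\<in>UNIV. z$i * (\<Sum>l\<in>UNIV. T p l (e i) * Dt e p h$l$j))"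
  unfolding u clinear_comb[OF clinear_nabT[OF WeD(1)[OF p]]] N ..
 also have "\<dots> = (\<Sum>l\<in>UNIV. Dt e p h$l$j * (\<Sum>i\<in>UNIV. z$i * T p l (e i)))"
  unfolding sum_distrib_left by (subst sum.swap) (simp add: algebra_simps)
 also have "\<dots> = (\<Sum>l\<in>UNIV. Dt e p h$l$j * T p l u)"
  unfolding u clinear_comb[OF clinear_T[OF WeD(1)[OF p]]] ..
 finally show ?thesis .
qed

text \<open>The matrix \<open>Z\<close> of the forms \<open>T\<close> on the frame
  \<open>pd i f\<close> has derivative \<open>C ** Z + Z ** Dt\<close>, where \<open>C\<close> is
  the connection matrix of the frame and \<open>Dt\<close> that of the forms. By Jacobi's formula
  the logarithmic derivative of \<open>det Z\<close> is the sum of both traces, and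
  \<open>xi0\<close> removes the imaginary part of the first.\<close>

lemma phase_derivative:
 assumes V: "open V" "x\<in>V" and f: "smooth_on V f" and \<psi>: "smooth_on V \<psi>"
  and PW: "!!y. y\<in>V ==> (\<psi> y, f y)\<in>W" and p: "(\<psi> x, f x)\<in>We e" and xi: "xi0 f x"
  and z: "det (\<chi> i j. T (\<psi> x, f x) j (pd i f x)) \<noteq> 0"
 shows "\<exists>c. fd (%y. det (\<chi> i j. T (\<psi> y, f y) j (pd i f y))) x (axis k 1)
   = c * det (\<chi> i j. T (\<psi> x, f x) j (pd i f x)) \<and> Im c = kap e (\<psi> x, f x) (pd k \<psi> x, pd k f x)"
proof -
 let ?p = "(\<psi> x, f x)" and ?h = "(pd k \<psi> x, pd k f x)"
 let ?Z = "%y. (\<chi> i j. T (\<psi> y, f y) j (pd i f y))"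
 let ?Z' = "%v. (\<chi> i j. dT ?p (fd \<psi> x v, fd f x v) j (pd i f x)
   + T ?p j (fd (pd i f) x v))"
 obtain C where C: "!!i. nab f k i x = comb (J (f x)) (%l. pd l f x) (C$i)" "Im (trace C) = 0"
  using xi unfolding xi0_def by blast
 have pW: "?p\<in>W" using p WeD by blast
 have "((%y. T (\<psi> y, f y) j (pd i f y)) has_derivative (%v. ?Z' v$i$j)) (at x)" for i j
  using T_field[OF V PW has_derivative_Pair[OF smooth_hd[OF \<psi> V(2)] smooth_hd[OF f V(2)]]
    has_derivative_pd[OF f V(2), of i], of j] by simp
 hence "((%y. det (?Z y)) has_derivative (%v. det_deriv (?Z x) (?Z' v))) (at x)"
  by (intro has_derivative_det) simp
 hence 1: "fd (%y. det (?Z y)) x (axis k 1) = det_deriv (?Z x) (?Z' (axis k 1))"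
  by (simp add: fdI)
 have "?Z' (axis k 1) = C ** ?Z x + ?Z x ** Dt e ?p ?h"
 proof -
  have "?Z' (axis k 1)$i$j = (C ** ?Z x + ?Z x ** Dt e ?p ?h)$i$j" for i j
  proof -
   have "?Z' (axis k 1)$i$j = nabT ?p ?h j (pd i f x) + T ?p j (nab f k i x)"
    by (simp add: nabT_def nab_def pd_def linear_add[OF linear_T[OF pW]])
   also have "\<dots> = (\<Sum>l\<in>UNIV. Dt e ?p ?h$l$j * T ?p l (pd i f x)) + (\<Sum>l\<in>UNIV. C$i$l * T ?p j (pd l f x))"
    using clinear_comb[OF clinear_T[OF pW], of j "%l. pd l f x" "C$i"] unfolding nabT_expand[OF p] C(1) by simp
   finally show ?thesis by (simp add: matrix_matrix_mult_def algebra_simps)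
  qed
  thus ?thesis by (simp add: vec_eq_iff)
 qed
 hence "det_deriv (?Z x) (?Z' (axis k 1)) = (trace C + trace (Dt e ?p ?h)) * det (?Z x)"
  by (simp add: det_deriv_add det_deriv_mult_left det_deriv_mult_right[OF z] algebra_simps)
 thus ?thesis using 1 C(2) by (intro exI[of _ "trace C + trace (Dt e ?p ?h)"]) (simp add: kap_def)
qed

lemma T_graph: "x\<in>X ==> T (x, \<iota> x) j (pd i \<iota> x) = (if i = j then 1 else 0)"
 "x\<in>X ==> T (x, \<iota> x) j (J (\<iota> x) *v pd i \<iota> x) = (if i = j then \<i> else 0)"
 by (auto simp: T_def Dy_def C2 C2' axis_def JJv[OF \<iota>Y] complex_eq_iff linear_neg[OF linear_Dy[OF graph], unfolded Dy_def])

text \<open>\<open>C3\<close> gives the real part for every \<open>u\<close>. Complex linearity in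
  \<open>u\<close> then gives the imaginary part from the real part at \<open>J u\<close>.\<close>

lemma nabT_graph: "x\<in>X ==> nabT (x, \<iota> x) (0, v) j u = 0"
proof -
 assume x: "x\<in>X"
 let ?p = "(x, \<iota> x)"
 have R: "Re (nabT ?p (0, v) j u) = 0" for u
 proof -
  have "((%p. Re (T p j u)) has_derivative (%h. Re (dT ?p h j u))) (at ?p)"
   by (rule bounded_linear.has_derivative[OF bounded_linear_Re dT_has[OF graph[OF x]]])
  hence "((%p. Dy p u$j) has_derivative (%h. Re (dT ?p h j u))) (at ?p)" by (simp add: T_def)
  moreover have "((%p. Dy p u$j) has_derivative (%h. fd (%p. Dy p u) ?p h$j)) (at ?p)"
   by (rule bounded_linear.has_derivative[OF bounded_linear_vec_nth smooth_hd[OF smooth_Dy graph[OF x]]])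
  ultimately have "(%h. Re (dT ?p h j u)) = (%h. fd (%p. Dy p u) ?p h$j)"
   by (rule has_derivative_unique)
  from fun_cong[OF this, of "(0, v)"] have "Re (dT ?p (0, v) j u) = Dy ?p (Gam (\<iota> x) v u)$j"
   using C3[OF x, of u v] by (simp add: Dy_def[abs_def])
  thus ?thesis by (simp add: nabT_def T_def)
 qed
 have "nabT ?p (0, v) j (J (\<iota> x) *v u) = \<i> * nabT ?p (0, v) j u"
  using clinear_nabT[OF graph[OF x]] by (simp add: clinear_def)
 hence "Im (nabT ?p (0, v) j u) = 0" using R[of "J (\<iota> x) *v u"] by simp
 thus ?thesis using R[of u] by (simp add: complex_eq_iff)
qed

lemma kap_graph1: "x\<in>X ==> kap e (x, \<iota> x) (0, v) = 0"
proof -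
 assume x: "x\<in>X"
 have "N e (x, \<iota> x) (0, v) = 0" by (simp add: N_def nabT_graph[OF x] vec_eq_iff)
 hence "Dt e (x, \<iota> x) (0, v) = 0" by (simp add: Dt_def matrix_matrix_mult_def vec_eq_iff)
 thus ?thesis by (simp add: kap_def trace_def)
qed

lemma nabT_lin: "p\<in>W ==> linear (%h. nabT p h j u)"
 unfolding nabT_def
 by (rule linearI) (simp_all only: linear_add[OF dT_lin1] linear_scale[OF dT_lin1] linear_add[OF linear_T] linear_scale[OF linear_T]
   Gam_add1 Gam_scale1 WD snd_add snd_scaleR add_diff_add scaleR_diff_right)

lemma kap_lin: "p\<in>W ==> linear (kap e p)"
proof -
 assume p: "p\<in>W"
 have "kap e p h = Im (\<Sum>i\<in>UNIV. \<Sum>l\<in>UNIV. matrix_inv (M e p)$i$l * nabT p h i (e l))" for h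
  by (simp add: kap_def Dt_def trace_def N_def matrix_matrix_mult_def)
 thus ?thesis
  by (intro linearI)
   (simp_all only: linear_add[OF nabT_lin[OF p]] linear_scale[OF nabT_lin[OF p]] distrib_left sum.distrib plus_complex.sel
    mult_scaleR_right scaleR_sum_right[symmetric] scaleR_complex.sel real_scaleR_def)
qed

text \<open>Along the graph the forms \<open>T\<close> are constant on the frame of
  \<open>\<iota>\<close>, so \<open>Dt\<close> is minus the connection matrix of this frame, whose
  trace is real by the Maslov equation of \<open>\<iota>\<close>.\<close>

lemma kap_graph2: "x\<in>X ==> (x, \<iota> x)\<in>We e ==> kap e (x, \<iota> x) (axis k 1, pd k \<iota> x) = 0"
proof -
 assume x: "x\<in>X" and p: "(x, \<iota> x)\<in>We e"
 let ?p = "(x, \<iota> x)" and ?h = "(axis k 1, pd k \<iota> x)"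
 obtain C where C: "!!i. nab \<iota> k i x = comb (J (\<iota> x)) (%l. pd l \<iota> x) (C$i)" "Im (trace C) = 0"
  using \<xi>\<iota>[OF x] unfolding xi0_def by blast
 have "Dt e ?p ?h$i$j = - C$i$j" for i j
 proof -
  have "((%y. T (y, \<iota> y) j (pd i \<iota> y)) has_derivative
    (%v. dT ?p (v, fd \<iota> x v) j (pd i \<iota> x) + T ?p j (fd (pd i \<iota>) x v))) (at x)"
   by (rule T_field[OF X x graph has_derivative_Pair[OF has_derivative_ident smooth_hd[OF s\<iota> x]] has_derivative_pd[OF s\<iota> x]])
  moreover have "((%y. T (y, \<iota> y) j (pd i \<iota> y)) has_derivative (%v. 0)) (at x)"
   by (rule hd_cong[OF has_derivative_const[of "if i = j then 1 else 0"] X x]) (simp add: T_graph)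
  ultimately have "(%v. dT ?p (v, fd \<iota> x v) j (pd i \<iota> x) + T ?p j (fd (pd i \<iota>) x v)) = (%v. 0)"
   by (rule has_derivative_unique)
  from fun_cong[OF this, of "axis k 1"]
  have "nabT ?p ?h j (pd i \<iota> x) + T ?p j (nab \<iota> k i x) = 0"
   by (simp add: nabT_def nab_def pd_def linear_add[OF linear_T[OF graph[OF x]]])
  moreover have "T ?p j (nab \<iota> k i x) = C$i$j"
   using clinear_comb[OF clinear_T[OF graph[OF x]], of j "%l. pd l \<iota> x" "C$i"] unfolding C(1)
   by (simp add: T_graph[OF x] if_distrib cong: if_cong)
  moreover have "nabT ?p ?h j (pd i \<iota> x) = Dt e ?p ?h$i$j"
   unfolding nabT_expand[OF p] by (simp add: T_graph[OF x] if_distrib cong: if_cong)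
  ultimately show ?thesis by (simp add: eq_neg_iff_add_eq_0)
 qed
 thus ?thesis using C(2) by (simp add: kap_def trace_def sum_negf)
qed

lemma smooth_nabT: "smooth_on W (%p. nabT p h j u)"
proof -
 have sG': "smooth_on W (%p. Gam (snd p) (snd h) u)"
  by (intro smooth_compose[OF smooth_Gam, of _ snd] smooth_snd W Y smooth_id WD)
 have "smooth_on W (%p. \<Sum>a\<in>UNIV. Gam (snd p) (snd h) u$a *\<^sub>R T p j (axis a 1))"
  by (intro smooth_sum smooth_scaleR W smooth_vec_nth sG' smooth_T)
 hence "smooth_on W (%p. T p j (Gam (snd p) (snd h) u))"
  by (rule smooth_cong'[OF _ W]) (rule axis_expansion[OF linear_T])
 thus ?thesis unfolding nabT_def dT_def
  by (intro smooth_diff W smooth_deriv[OF smooth_T])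
qed

lemma smooth_Dt: "smooth_on (We e) (%p. Dt e p h)"
 unfolding Dt_def
 by (intro smooth_matrix_mult open_We smooth_matrix_inv smooth_subset[OF smooth_M] WeD)
  (auto simp: N_def WeD intro!: smooth_vec_lambda open_We smooth_subset[OF smooth_nabT])

lemma smooth_kap: "smooth_on (We e) (%p. kap e p h)"
 unfolding kap_def trace_def
 by (intro smooth_bounded_linear[OF bounded_linear_Im] open_We smooth_sum smooth_vec_nth smooth_Dt)

text \<open>
 The covariant derivatives in the direction \<open>w\<close> of the fibre and in the direction \<open>h\<close> of the graph
 commute up to the curvature.
\<close>

lemma kap_curvature:
 assumes x: "x\<in>X" and p: "(x, \<iota> x)\<in>We e"
 shows "fd (%p. kap e p (axis k 1, pd k \<iota> x)) (x, \<iota> x) (0, w)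
  = (1/2) * ltrace (%u. J (\<iota> x) *v Riem (\<iota> x) w (pd k \<iota> x) u)"
proof -
 let ?p = "(x, \<iota> x)" and ?h = "(axis k 1, pd k \<iota> x)" and ?v = "pd k \<iota> x"
 let ?R = "Riem (\<iota> x) w ?v"
 have pW: "?p\<in>W" using p WeD by blast
 have y: "\<iota> x\<in>Y" using \<iota>Y[OF x] .
 have dTw: "dT (z, \<iota> z) (0, w) j u = T (z, \<iota> z) j (Gam (\<iota> z) w u)" if "z\<in>X" for z j u
  using nabT_graph[OF that, of w j u] by (simp add: nabT_def)
 have Gs: "((%p. Gam (snd p) v u) has_derivative (%h. dGam (\<iota> x) (snd h) v u)) (at ?p)" for v u
  using has_derivative_compose[OF has_derivative_snd[OF has_derivative_ident] dGam_has[OF WD(2)[OF pW]]] by auto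
 have TG: "((%p. T p j (Gam (snd p) v u)) has_derivative
   (%h. dT ?p h j (Gam (\<iota> x) v u) + T ?p j (dGam (\<iota> x) (snd h) v u))) (at ?p)" for j v u
  using T_field[OF W pW _ has_derivative_ident Gs[of v u], of j] by simp
 have sm: "smooth_on W (%p. dT p h j u)" for h j u
  unfolding dT_def by (rule smooth_deriv[OF smooth_T])
 \<comment> \<open>On the graph the vertical derivative of \<open>T\<close> is known by
   \<open>nabT_graph\<close>. After interchanging the derivatives it is therefore enough to
   differentiate that known expression along the graph.\<close>
 have mixed: "fd (%p. dT p ?h j u) ?p (0, w)
   = dT ?p ?h j (Gam (\<iota> x) w u) + T ?p j (dGam (\<iota> x) ?v w u)" for j u
 proof -
  have "fd (%p. dT p ?h j u) ?p (0, w) = fd (%p. dT p (0, w) j u) ?p ?h"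
   unfolding dT_def by (rule smooth_mixed[OF W smooth_T pW])
  moreover have gr: "((%z. (z, \<iota> z)) has_derivative (%v. (v, fd \<iota> x v))) (at x)"
   by (intro has_derivative_Pair has_derivative_ident smooth_hd[OF s\<iota> x])
  have "((%z. dT (z, \<iota> z) (0, w) j u) has_derivative
    (%v. fd (%p. dT p (0, w) j u) ?p (v, fd \<iota> x v))) (at x)"
   by (rule has_derivative_compose[OF gr smooth_hd[OF sm pW]])
  moreover have "((%z. T (z, \<iota> z) j (Gam (\<iota> z) w u)) has_derivative
    (%v. dT ?p (v, fd \<iota> x v) j (Gam (\<iota> x) w u) + T ?p j (dGam (\<iota> x) (fd \<iota> x v) w u))) (at x)"
   using has_derivative_compose[OF gr TG[of j w u]] by simp
  hence "((%z. dT (z, \<iota> z) (0, w) j u) has_derivative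
    (%v. dT ?p (v, fd \<iota> x v) j (Gam (\<iota> x) w u) + T ?p j (dGam (\<iota> x) (fd \<iota> x v) w u))) (at x)"
   by (rule hd_cong[OF _ X x]) (simp add: dTw)
  ultimately have "(%v. fd (%p. dT p (0, w) j u) ?p (v, fd \<iota> x v))
    = (%v. dT ?p (v, fd \<iota> x v) j (Gam (\<iota> x) w u) + T ?p j (dGam (\<iota> x) (fd \<iota> x v) w u))"
   using has_derivative_unique by blast
  from fun_cong[OF this, of "axis k 1"]
  have "fd (%p. dT p (0, w) j u) ?p ?h = dT ?p ?h j (Gam (\<iota> x) w u) + T ?p j (dGam (\<iota> x) ?v w u)"
   by (simp add: pd_def)
  with \<open>fd (%p. dT p ?h j u) ?p (0, w) = fd (%p. dT p (0, w) j u) ?p ?h\<close>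
  show ?thesis by simp
 qed
 have dN: "fd (%p. nabT p ?h j u) ?p (0, w) = nabT ?p ?h j (Gam (\<iota> x) w u) - T ?p j (?R u)" for j u
 proof -
  have "((%p. nabT p ?h j u) has_derivative (%h. fd (%p. dT p ?h j u) ?p h
    - (dT ?p h j (Gam (\<iota> x) ?v u) + T ?p j (dGam (\<iota> x) (snd h) ?v u)))) (at ?p)"
   unfolding nabT_def using has_derivative_diff[OF smooth_hd[OF sm pW] TG[of j ?v u]] by simp
  from fun_cong[OF fdI[OF this], of "(0, w)"]
  show ?thesis
   by (simp add: mixed dTw[OF x] nabT_def Riem_def linear_add[OF linear_T[OF pW]] linear_diff[OF linear_T[OF pW]])
 qed
 have linR: "linear ?R" by (rule Riem_lin(3)[OF y])
 have cb: "bij (comb (J (\<iota> x)) e)" using cbasis_e[OF p] by (simp add: cbasis_def)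
 have "\<forall>i. \<exists>k. ?R (e i) = comb (J (\<iota> x)) e k" using cb by (metis bij_pointE)
 then obtain K0 where "\<forall>i. ?R (e i) = comb (J (\<iota> x)) e (K0 i)" by metis
 hence K: "?R (e i) = comb (J (\<iota> x)) e ((\<chi> i. K0 i)$i)" for i by simp
 define K where "K = (\<chi> i. K0 i)"
 define D' where "D' = fd (%p. Dt e p ?h) ?p (0, w)"
 have hD: "((%p. Dt e p ?h) has_derivative fd (%p. Dt e p ?h) ?p) (at ?p)"
  by (rule smooth_hd[OF smooth_Dt p])
 have hDn: "((%p. Dt e p ?h$l$j) has_derivative (%h. fd (%p. Dt e p ?h) ?p h$l$j)) (at ?p)" for l j
  using bounded_linear.has_derivative[OF bounded_linear_compose[OF bounded_linear_vec_nth bounded_linear_vec_nth] hD] .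
 \<comment> \<open>Differentiate the expansion of \<open>nabT\<close> in the forms \<open>T\<close>
   vertically. The terms with \<open>Gam w e_i\<close> cancel by the same expansion, and the
   curvature remains.\<close>
 have "M e ?p ** D' = - (K ** M e ?p)"
 proof -
  have "(M e ?p ** D')$i$j = (- (K ** M e ?p))$i$j" for i j
  proof -
   have "((%p. \<Sum>l\<in>UNIV. T p l (e i) * Dt e p ?h$l$j) has_derivative
     (%h. \<Sum>l\<in>UNIV. T ?p l (e i) * fd (%p. Dt e p ?h) ?p h$l$j + dT ?p h l (e i) * Dt e ?p ?h$l$j)) (at ?p)"
    by (intro has_derivative_sum has_derivative_mult dT_has pW hDn)
   hence "((%p. nabT p ?h j (e i)) has_derivative
     (%h. \<Sum>l\<in>UNIV. T ?p l (e i) * fd (%p. Dt e p ?h) ?p h$l$j + dT ?p h l (e i) * Dt e ?p ?h$l$j)) (at ?p)"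
    by (rule hd_cong[OF _ open_We p]) (simp add: nabT_expand mult.commute)
   from fun_cong[OF fdI[OF this], of "(0, w)"]
   have "nabT ?p ?h j (Gam (\<iota> x) w (e i)) - T ?p j (?R (e i))
     = (\<Sum>l\<in>UNIV. T ?p l (e i) * D'$l$j) + (\<Sum>l\<in>UNIV. T ?p l (Gam (\<iota> x) w (e i)) * Dt e ?p ?h$l$j)"
    by (simp add: dN D'_def dTw[OF x] sum.distrib)
   hence "- T ?p j (?R (e i)) = (\<Sum>l\<in>UNIV. T ?p l (e i) * D'$l$j)"
    unfolding nabT_expand[OF p] by (simp add: mult.commute)
   moreover have "T ?p j (?R (e i)) = (\<Sum>l\<in>UNIV. K$i$l * T ?p j (e l))"
    using clinear_comb[OF clinear_T[OF pW], of j e "K$i"] unfolding K by (simp add: K_def)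
   ultimately show ?thesis by (simp add: matrix_matrix_mult_def M_def)
  qed
  thus ?thesis by (simp add: vec_eq_iff)
 qed
 hence "matrix_inv (M e ?p) ** (M e ?p ** D') = matrix_inv (M e ?p) ** (- (K ** M e ?p))" by simp
 moreover have inv: "matrix_inv (M e ?p) ** M e ?p = mat 1"
  using matrix_inv_left invertible_det_nz WeD(2)[OF p] by blast
 ultimately have "D' = matrix_inv (M e ?p) ** (- (K ** M e ?p))" by (simp add: matrix_mul_assoc)
 hence "trace D' = trace ((- (K ** M e ?p)) ** matrix_inv (M e ?p))" by (metis trace_mul_sym)
 also have "(- (K ** M e ?p)) ** matrix_inv (M e ?p) = - (K ** (M e ?p ** matrix_inv (M e ?p)))"
  by (simp add: matrix_matrix_mult_def vec_eq_iff sum_negf matrix_mul_assoc) (simp add: sum_distrib_left sum_distrib_right matrix_matrix_mult_def, subst sum.swap, simp add: algebra_simps)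
 also have "M e ?p ** matrix_inv (M e ?p) = mat 1"
  using matrix_inv_right invertible_det_nz WeD(2)[OF p] by blast
 finally have tr: "trace D' = - trace K" by (simp add: trace_def sum_negf)
 have "((%p. kap e p ?h) has_derivative (%h. Im (\<Sum>l\<in>UNIV. fd (%p. Dt e p ?h) ?p h$l$l))) (at ?p)"
  unfolding kap_def trace_def by (intro bounded_linear.has_derivative[OF bounded_linear_Im] has_derivative_sum hDn)
 from fun_cong[OF fdI[OF this], of "(0, w)"]
 have "fd (%p. kap e p ?h) ?p (0, w) = Im (trace D')" by (simp add: trace_def D'_def)
 also have "\<dots> = - Im (trace K)" by (simp add: tr)
 also have "\<dots> = (1/2) * ltrace (%u. J (\<iota> x) *v ?R u)"
  using ltrace_complex[OF JJ[OF y], of e ?R K] cbasis_e[OF p] linR Riem_J[OF y] K by (simp add: K_def)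
 finally show ?thesis .
qed

end

section \<open>Estimates near a zero section and the second derivative test\<close>

lemma norm_nth_le': "norm (x$i) \<le> norm x"
 unfolding norm_vec_def by (rule member_le_L2_set) auto

lemma sum_axis: "(\<Sum>k\<in>UNIV. axis l (1::real)$k * F k) = F l"
 by (simp add: axis_def if_distrib[of "%z. z * _"] cong: if_cong)

text \<open>The linearisation is taken at the single point \<open>(x0, 0)\<close>, so that one
  linear map serves all nearby \<open>p\<close>. The mean value theorem on the segment from
  \<open>(x, 0)\<close> to \<open>(x, w)\<close> still gives an error proportional to
  \<open>norm w\<close> alone.\<close>

lemma vanishing_estimate:
 fixes k :: "(real^'n::finite) \<times> (real^'m::finite) => real"
 assumes Q: "open Q" "smooth_on Q k" "(x0, 0)\<in>Q" and e: "e > 0"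
 shows derivative_close: "\<forall>\<^sub>F p in nhds (x0, 0). p\<in>Q \<and>
   (\<forall>u. \<bar>fd k p (0, u) - fd k (x0, 0) (0, u)\<bar> \<le> e * norm u)" (is ?D)
  and "(!!x. (x, 0)\<in>Q ==> k (x, 0) = 0) ==>
   \<forall>\<^sub>F p in nhds (x0, 0). \<bar>k p - fd k (x0, 0) (0, snd p)\<bar> \<le> e * norm (snd p)"
proof -
 let ?D = "%p u. fd k p (0, u)"
 have lin: "linear (?D p)" if "p\<in>Q" for p
  using linear_compose[OF _ linear_deriv[OF Q(2) that], of "%u. (0, u)"]
  by (simp add: o_def bounded_linear.linear bounded_linear_Pair)
 define N where "N = real CARD('m)"
 have N: "N > 0" by (simp add: N_def)
 have 1: "\<forall>\<^sub>F p in nhds (x0, 0). \<forall>c. dist (?D p (axis c 1)) (?D (x0, 0) (axis c 1)) < e / N"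
 proof (rule eventually_all_finite)
  fix c
  have "isCont (%p. ?D p (axis c 1)) (x0, 0)"
   by (rule smooth_isCont[OF smooth_deriv[OF Q(2)] Q(3)])
  hence "((%p. ?D p (axis c 1)) \<longlongrightarrow> ?D (x0, 0) (axis c 1)) (nhds (x0, 0))"
   using tendsto_at_iff_tendsto_nhds[of "%p. ?D p (axis c 1)" "(x0, 0)"] unfolding isCont_def by blast
  thus "\<forall>\<^sub>F p in nhds (x0, 0). dist (?D p (axis c 1)) (?D (x0, 0) (axis c 1)) < e / N"
   using e N by (intro tendstoD) auto
 qed
 have 2: "\<forall>\<^sub>F p in nhds (x0, 0). p\<in>Q" using Q(1,3) by (rule eventually_nhds_in_open)
 show D: "\<forall>\<^sub>F p in nhds (x0, 0). p\<in>Q \<and> (\<forall>u. \<bar>?D p u - ?D (x0, 0) u\<bar> \<le> e * norm u)"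
  using 1 2
 proof eventually_elim
  case (elim p)
  have "\<bar>?D p u - ?D (x0, 0) u\<bar> \<le> e * norm u" for u
  proof -
   have "?D p u - ?D (x0, 0) u = (\<Sum>c\<in>UNIV. u$c * (?D p (axis c 1) - ?D (x0, 0) (axis c 1)))"
    using axis_expansion[OF lin[OF elim(2)], of u] axis_expansion[OF lin[OF Q(3)], of u]
    by (simp add: sum_subtractf algebra_simps)
   also have "\<bar>\<dots>\<bar> \<le> (\<Sum>c\<in>UNIV. \<bar>u$c * (?D p (axis c 1) - ?D (x0, 0) (axis c 1))\<bar>)"
    by (rule sum_abs)
   also have "\<dots> \<le> (\<Sum>c\<in>(UNIV::'m set). norm u * (e / N))"
   proof (rule sum_mono)
    fix c
    show "\<bar>u$c * (?D p (axis c 1) - ?D (x0, 0) (axis c 1))\<bar> \<le> norm u * (e / N)"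
     unfolding abs_mult using elim(1)[rule_format, of c]
     by (intro mult_mono component_le_norm_cart) (auto simp: dist_real_def)
   qed
   also have "\<dots> = e * norm u" using N by (simp add: N_def)
   finally show ?thesis .
  qed
  thus ?case using elim(2) by blast
 qed
 assume z: "!!x. (x, 0)\<in>Q ==> k (x, 0) = 0"
 obtain r where r: "r > 0" "!!p. dist p (x0, 0) < r ==> p\<in>Q \<and> (\<forall>u. \<bar>?D p u - ?D (x0, 0) u\<bar> \<le> e * norm u)"
  using D unfolding eventually_nhds_metric by metis
 show "\<forall>\<^sub>F p in nhds (x0, 0). \<bar>k p - fd k (x0, 0) (0, snd p)\<bar> \<le> e * norm (snd p)"
  unfolding eventually_nhds_metric
 proof (intro exI[of _ r] conjI allI impI r(1))
  fix p :: "(real^'n) \<times> (real^'m)" assume p: "dist p (x0, 0) < r"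
  obtain x w where xw: "p = (x, w)" by (cases p)
  have near: "dist (x, t *\<^sub>R w) (x0, 0) < r" if t: "0 \<le> t" "t \<le> 1" for t
  proof -
   have "norm (t *\<^sub>R w) \<le> norm w" using t by (simp add: mult_left_le_one_le)
   hence "dist (x, t *\<^sub>R w) (x0, 0) \<le> dist (x, w) (x0, 0)"
    by (simp add: dist_norm norm_Pair power_mono)
   thus ?thesis using p xw by simp
  qed
  have d: "((%t. k (x, t *\<^sub>R w)) has_real_derivative ?D (x, t *\<^sub>R w) w) (at t)" if t: "0 \<le> t" "t \<le> 1" for t
   using has_derivative_line[of k "(x, 0)" t "(0, w)"] smooth_differentiable[OF Q(2), of "(x, t *\<^sub>R w)"] r(2)[OF near[OF t]]
   by (simp add: has_real_derivative_iff_has_vector_derivative)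
  obtain s where s: "0 < s" "s < 1" "k (x, 1 *\<^sub>R w) - k (x, 0 *\<^sub>R w) = (1 - 0) * ?D (x, s *\<^sub>R w) w"
   using MVT2[of 0 1 "%t. k (x, t *\<^sub>R w)" "%t. ?D (x, t *\<^sub>R w) w"] d by auto
  have "(x, 0)\<in>Q" using r(2)[OF near[of 0]] by simp
  hence "k (x, w) = ?D (x, s *\<^sub>R w) w" using s z by simp
  thus "\<bar>k p - ?D (x0, 0) (snd p)\<bar> \<le> e * norm (snd p)"
   using r(2)[OF near[of s]] s by (simp add: xw)
 qed
qed

lemma deriv_first_zero:
 fixes k :: "(real^'n::finite) \<times> (real^'m::finite) => 'b::euclidean_space"
 assumes Q: "open Q" "smooth_on Q k" "(x, 0)\<in>Q" and z: "!!x. (x, 0)\<in>Q ==> k (x, 0) = 0"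
 shows "fd k (x, 0) (a, u) = fd k (x, 0) (0, u)"
proof -
 have op: "open ((%x. (x, 0::real^'m)) -` Q)" by (intro open_vimage Q(1) continuous_intros)
 have "((%x. k (x, 0)) has_derivative (%a. fd k (x, 0) (a, 0))) (at x)"
  by (rule has_derivative_compose[OF has_derivative_Pair[OF has_derivative_ident has_derivative_const] smooth_hd[OF Q(2,3)]])
 moreover have "((%x. k (x, 0)) has_derivative (%a. 0)) (at x)"
  by (rule hd_cong[OF has_derivative_const op]) (use Q(3) z in auto)
 ultimately have "(%a. fd k (x, 0) (a, 0)) = (%a. 0)" by (rule has_derivative_unique)
 from fun_cong[OF this, of a] have "fd k (x, 0) (a, 0) = 0" .
 thus ?thesis
  using linear_add[OF linear_deriv[OF Q(2,3)], of "(a, 0)" "(0, u)"] by simp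
qed

lemma second_derivative_max:
 fixes S :: "'a::euclidean_space => real"
 assumes V: "open V" "x\<in>V" and S: "smooth_on V S" and max: "!!y. y\<in>V ==> S y \<le> S x"
 shows "fd (%y. fd S y u) x u \<le> 0"
proof (rule ccontr)
 assume "\<not> ?thesis"
 hence pos: "fd (%y. fd S y u) x u > 0" by simp
 have z: "fd S x u = 0"
  using differential_zero_maxmin[OF V(2,1) smooth_hd[OF S V(2)]] max by (metis (no_types, lifting))
 have "open ((%t. x + t *\<^sub>R u) -` V)" by (intro open_vimage V(1) continuous_intros)
 then obtain r where r: "r > 0" "!!t. dist t 0 < r ==> x + t *\<^sub>R u\<in>V"
  using V(2) unfolding open_dist by (metis (no_types, lifting) add.right_neutral scale_zero_left vimage_eq)
 have d1: "((%t. S (x + t *\<^sub>R u)) has_real_derivative fd S (x + t *\<^sub>R u) u) (at t)" if "dist t 0 < r" for t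
  using has_derivative_line[OF smooth_differentiable[OF S r(2)[OF that]]] by (simp add: has_real_derivative_iff_has_vector_derivative)
 have "((%t. fd S (x + t *\<^sub>R u) u) has_real_derivative
   fd (%y. fd S y u) x u) (at 0)"
  using has_derivative_line[of "%y. fd S y u" x 0 u] smooth_differentiable[OF smooth_deriv[OF S] V(2)]
  by (simp add: has_real_derivative_iff_has_vector_derivative)
 from DERIV_pos_inc_right[OF this pos] obtain d where d: "d > 0"
  "!!h. 0 < h ==> h < d ==> 0 < fd S (x + h *\<^sub>R u) u"
  using z by auto
 define h where "h = min d r / 2"
 have h: "0 < h" "h < d" "h < r" using d(1) r(1) by (auto simp: h_def min_def)
 have "S (x + 0 *\<^sub>R u) < S (x + h *\<^sub>R u)"
 proof (rule DERIV_pos_imp_increasing_open[OF h(1), of "%t. S (x + t *\<^sub>R u)"])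
  show "\<exists>y. ((%t. S (x + t *\<^sub>R u)) has_real_derivative y) (at t) \<and> 0 < y" if "0 < t" "t < h" for t
   using d1[of t] d(2)[of t] that h by (auto simp: dist_real_def)
  show "continuous_on {0..h} (%t. S (x + t *\<^sub>R u))"
  proof (intro continuous_at_imp_continuous_on ballI)
   fix t assume "t\<in>{0..h}"
   thus "isCont (%t. S (x + t *\<^sub>R u)) t"
    using h by (intro DERIV_isCont[OF d1]) (auto simp: dist_real_def)
  qed
 qed
 thus False using max[OF r(2)[of h]] h by (simp add: dist_real_def)
qed

lemma smooth_Ln: "smooth_on {z. 0 < Re z} Ln"
proof -
 have d: "(Ln has_derivative (*) (inverse z)) (at z)" if "0 < Re z" for z
  using has_field_derivative_Ln[of z] that unfolding has_field_derivative_def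
  by (auto simp: complex_nonpos_Reals_iff)
 have op: "open {z. 0 < Re z}" by (rule open_halfspace_Re_gt)
 have "smooth_on {z. 0 < Re z} (%z. fd Ln z v)" for v
 proof (rule smooth_cong'[OF _ op])
  show "smooth_on {z. 0 < Re z} (%z. inverse z * v)"
   by (intro smooth_mult smooth_inverse op smooth_id smooth_const) auto
 qed (use fdI[OF d] in auto)
 moreover have "Ln differentiable (at z)" if "0 < Re z" for z
  using d[OF that] by (rule differentiableI)
 ultimately show ?thesis using smooth_iff[of "{z. 0 < Re z}" Ln] by simp
qed

lemma det_cnj: "det (\<chi> i j. cnj (A$i$j)) = cnj (det A)"
 by (simp add: det_def)

lemma Im_Ln_sign:
 assumes "Re z > 0"
 shows "Im z \<le> 0 ==> Im (Ln z) \<le> 0" and "Im z \<ge> 0 ==> Im (Ln z) \<ge> 0"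
proof -
 have nz: "z \<noteq> 0" using assms by auto
 show pos: "Im z \<ge> 0 ==> Im (Ln z) \<ge> 0" using Im_Ln_pos_le[OF nz] by blast
 assume le: "Im z \<le> 0"
 show "Im (Ln z) \<le> 0"
 proof (cases "Im z = 0")
  case True
  hence "z = complex_of_real (Re z)" by (simp add: complex_eq_iff)
  hence "Ln z = complex_of_real (ln (Re z))" using Ln_of_real[OF assms] by metis
  thus ?thesis by simp
 next
  case False
  thus ?thesis using le Im_Ln_pos_le[OF nz] Im_Ln_le_pi[OF nz] by linarith
 qed
qed

section \<open>The phase near the graph: critical points and extrema\<close>

context gauge
begin

text \<open>Coordinates \<open>(x, w)\<close> with \<open>y = \<iota> x + w\<close>, in which the
  graph is the zero section. In them \<open>k1\<close> and \<open>k2\<close> are the values of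
  \<open>kap\<close> on a frame adapted to the graph, and they vanish at
  \<open>w = 0\<close>.\<close>

definition shear where "shear p = (fst p, \<iota> (fst p) + snd p)"
definition k1 where "k1 e l p = kap e (shear p) (axis l 1, pd l \<iota> (fst p))"
definition k2 where "k2 e c p = kap e (shear p) (0, axis c 1)"
definition gq where "gq j p = \<Phi> (shear p)$j"
definition Q where "Q e = {p. fst p\<in>X \<and> shear p\<in>We e}"

lemma XU: "open (X \<times> (UNIV :: (real^'m) set))"
 using X by (simp add: open_Times)

lemma smooth_shear: "smooth_on (X \<times> UNIV) shear"
 unfolding shear_def
 by (intro smooth_Pair XU smooth_add smooth_compose[OF s\<iota>, of _ fst] smooth_fst smooth_snd smooth_id X) auto

lemma open_Q: "open (Q e)"
proof -
 have "open ((X \<times> UNIV) \<inter> shear -` We e)"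
  by (intro continuous_open_preimage smooth_cont[OF smooth_shear] XU open_We)
 thus ?thesis by (auto simp: Q_def vimage_def Int_def mem_Times_iff)
qed

lemma smooth_shear_Q: "smooth_on (Q e) shear"
 by (rule smooth_subset[OF smooth_shear]) (auto simp: Q_def)

lemma smooth_k2: "smooth_on (Q e) (k2 e c)"
 unfolding k2_def[abs_def]
 by (rule smooth_compose[OF smooth_kap smooth_shear_Q open_Q open_We]) (auto simp: Q_def)

text \<open>With \<open>b l = pd l \<iota>\<close> the remaining vertical vector measures how far
  \<open>df\<close> is from \<open>d\<iota>\<close> composed with \<open>d\<psi>\<close>. With
  \<open>b = 0\<close> the formula reduces \<open>k1\<close> to fixed directions.\<close>

lemma kap_split:
 assumes "p\<in>W"
 shows "kap e p (a, v) = (\<Sum>l\<in>UNIV. a$l * kap e p (axis l 1, b l)) + (\<Sum>c\<in>UNIV. (v - (\<Sum>l\<in>UNIV. a$l *\<^sub>R b l))$c * kap e p (0, axis c 1))"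
proof -
 note L = kap_lin[OF assms, of e]
 have L0: "linear (%u. kap e p (0, u))"
  using linear_compose[OF _ L, of "%u. (0, u)"] by (simp add: o_def bounded_linear.linear bounded_linear_Pair)
 have "(a, v) = (\<Sum>l\<in>UNIV. a$l *\<^sub>R (axis l 1, b l)) + (0, v - (\<Sum>l\<in>UNIV. a$l *\<^sub>R b l))"
  using basis_expansion[of a] by (simp add: prod_eq_iff fst_sum snd_sum scalar_mult_eq_scaleR)
 hence "kap e p (a, v) = kap e p ((\<Sum>l\<in>UNIV. a$l *\<^sub>R (axis l 1, b l)) + (0, v - (\<Sum>l\<in>UNIV. a$l *\<^sub>R b l)))" by simp
 also have "\<dots> = (\<Sum>l\<in>UNIV. a$l * kap e p (axis l 1, b l)) + kap e p (0, v - (\<Sum>l\<in>UNIV. a$l *\<^sub>R b l))"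
  unfolding linear_add[OF L] linear_sum[OF L] linear_scale[OF L] by simp
 also have "kap e p (0, v - (\<Sum>l\<in>UNIV. a$l *\<^sub>R b l)) = (\<Sum>c\<in>UNIV. (v - (\<Sum>l\<in>UNIV. a$l *\<^sub>R b l))$c * kap e p (0, axis c 1))"
  using axis_expansion[OF L0, of "v - (\<Sum>l\<in>UNIV. a$l *\<^sub>R b l)"] by simp
 finally show ?thesis .
qed

lemma smooth_k1: "smooth_on (Q e) (k1 e l)"
proof -
 have s: "smooth_on (Q e) (%p. pd l \<iota> (fst p))"
  by (rule smooth_compose[OF smooth_pd[OF s\<iota>] smooth_fst[OF open_Q smooth_id] open_Q X]) (auto simp: Q_def)
 have "smooth_on (Q e) (%p. kap e (shear p) (axis l 1, 0) + (\<Sum>c\<in>UNIV. pd l \<iota> (fst p)$c * k2 e c p))"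
  by (intro smooth_add smooth_sum smooth_mult smooth_vec_nth open_Q smooth_k2 s
    smooth_compose[OF smooth_kap smooth_shear_Q open_Q open_We]) (auto simp: Q_def)
 thus ?thesis
 proof (rule smooth_cong'[OF _ open_Q])
  fix p assume p: "p\<in>Q e"
  hence "shear p\<in>W" by (intro WeD(1)[of _ e]) (simp add: Q_def)
  from kap_split[OF this, of e "axis l 1" "pd l \<iota> (fst p)" "%_. 0"]
  show "k1 e l p = kap e (shear p) (axis l 1, 0) + (\<Sum>c\<in>UNIV. pd l \<iota> (fst p)$c * k2 e c p)"
   by (simp add: k1_def k2_def sum_axis)
 qed
qed

lemma smooth_gq: "smooth_on (Q e) (gq j)"
 unfolding gq_def[abs_def]
 by (intro smooth_vec_nth open_Q smooth_compose[OF s\<Phi> smooth_shear_Q open_Q W] WeD(1)[of _ e]) (simp add: Q_def)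

lemma Q0D: "(x, 0)\<in>Q e ==> x\<in>X" "(x, 0)\<in>Q e ==> (x, \<iota> x)\<in>We e"
 by (auto simp: Q_def shear_def)

lemma k1_0: "(x, 0)\<in>Q e ==> k1 e l (x, 0) = 0"
 using kap_graph2[OF Q0D] by (auto simp: k1_def shear_def)

lemma k2_0: "(x, 0)\<in>Q e ==> k2 e c (x, 0) = 0"
 using kap_graph1[OF Q0D(1)] by (auto simp: k2_def shear_def)

lemma gq_0: "(x, 0)\<in>Q e ==> gq j (x, 0) = 0"
 using C1[OF Q0D(1)] by (auto simp: gq_def shear_def)

lemma fibre_derivative:
 fixes k :: "(real^'n) \<times> (real^'m) => real"
 assumes k: "smooth_on (Q e) k" and F: "smooth_on S F" and eq: "!!w. k (x, w) = F (x, \<iota> x + w)"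
  and p: "(x, 0)\<in>Q e" "(x, \<iota> x)\<in>S"
 shows "fd k (x, 0) (0, w) = fd F (x, \<iota> x) (0, w)"
proof -
 have "((%w. k (x, w)) has_derivative (%w. fd k (x, 0) (0, w))) (at 0)"
  by (rule has_derivative_compose[OF has_derivative_Pair[OF has_derivative_const has_derivative_ident] smooth_hd[OF k p(1)]])
 moreover have "((%w. (x, \<iota> x + w)) has_derivative (%w. (0, w))) (at 0)"
  by (auto intro!: derivative_eq_intros has_derivative_Pair)
 hence "((%w. F (x, \<iota> x + w)) has_derivative (%w. fd F (x, \<iota> x) (0, w))) (at 0)"
  using has_derivative_compose[of "%w. (x, \<iota> x + w)" _ 0 UNIV F] smooth_hd[OF F p(2)] by simp
 ultimately have "(%w. fd k (x, 0) (0, w)) = (%w. fd F (x, \<iota> x) (0, w))"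
  unfolding eq by (rule has_derivative_unique)
 thus ?thesis by (rule fun_cong)
qed

lemma Dk1: "(x, 0)\<in>Q e ==> fd (k1 e l) (x, 0) (0, w)
  = (1/2) * ltrace (%u. J (\<iota> x) *v Riem (\<iota> x) w (pd l \<iota> x) u)"
 unfolding kap_curvature[OF Q0D, symmetric]
 by (rule fibre_derivative[OF smooth_k1 smooth_kap]) (auto simp: k1_def shear_def Q0D)

lemma Dgq: "(x, 0)\<in>Q e ==> fd (gq j) (x, 0) (0, w) = Dy (x, \<iota> x) w$j"
proof -
 assume p: "(x, 0)\<in>Q e"
 have pW: "(x, \<iota> x)\<in>W" using Q0D[OF p] WeD by blast
 have "fd (gq j) (x, 0) (0, w) = fd (%p. \<Phi> p$j) (x, \<iota> x) (0, w)"
  by (rule fibre_derivative[OF smooth_gq smooth_vec_nth[OF W s\<Phi>] _ p pW]) (auto simp: gq_def shear_def)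
 also have "\<dots> = Dy (x, \<iota> x) w$j"
  using fdI[OF bounded_linear.has_derivative[OF bounded_linear_vec_nth smooth_hd[OF s\<Phi> pW]]]
  by (simp add: Dy_def)
 finally show ?thesis .
qed

lemma cbasis_\<iota>: "x\<in>X ==> cbasis (J (\<iota> x)) (%i. pd i \<iota> x)"
proof -
 assume x: "x\<in>X"
 have "(\<chi> i j. T (x, \<iota> x) j (pd i \<iota> x)) = mat 1" by (simp add: T_graph[OF x] mat_def)
 hence "det (\<chi> i j. T (x, \<iota> x) j (pd i \<iota> x)) \<noteq> 0" by simp
 thus ?thesis using cbasis_if_det[OF dims, of "J (\<iota> x)" "T (x, \<iota> x)"] clinear_T[OF graph[OF x]] by simp
qed

text \<open>In the frame of \<open>\<iota>\<close> a vector in the kernel of \<open>Dy\<close> has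
  purely imaginary complex coordinates, so it lies in \<open>J\<close> times the tangent
  space.\<close>

lemma normal_expansion:
 assumes x: "x\<in>X" and v: "Dy (x, \<iota> x) v = 0"
 shows "v = J (\<iota> x) *v (\<Sum>l\<in>UNIV. Im (T (x, \<iota> x) l v) *\<^sub>R pd l \<iota> x)"
proof -
 obtain z where z: "v = comb (J (\<iota> x)) (%i. pd i \<iota> x) z"
  using cbasis_\<iota>[OF x] by (metis bij_pointE cbasis_def)
 have T: "T (x, \<iota> x) l v = z$l" for l
  using clinear_comb[OF clinear_T[OF graph[OF x]], of l "%i. pd i \<iota> x" z] unfolding z
  by (simp add: T_graph[OF x] if_distrib cong: if_cong)
 have "Re (z$l) = 0" for l
  using T[of l] v by (metis T_def complex.sel(1) zero_index)
 hence "cscale (J (\<iota> x)) (z$l) (pd l \<iota> x) = J (\<iota> x) *v (Im (T (x, \<iota> x) l v) *\<^sub>R pd l \<iota> x)" for l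
  by (simp add: cscale_def T matrix_vector_mult_scaleR)
 thus ?thesis unfolding z comb_def linear_sum[OF matrix_vector_mul_linear]
  by (metis (no_types, lifting) z T comb_def sum.cong)
qed

lemma \<iota>_indep: "x\<in>X ==> (\<Sum>l\<in>UNIV. u$l *\<^sub>R pd l \<iota> x) = 0 ==> u = 0"
proof -
 assume x: "x\<in>X" and 0: "(\<Sum>l\<in>UNIV. u$l *\<^sub>R pd l \<iota> x) = 0"
 have "u$j = 0" for j
 proof -
  have "T (x, \<iota> x) j (\<Sum>l\<in>UNIV. u$l *\<^sub>R pd l \<iota> x) = complex_of_real (u$j)"
   by (simp add: linear_sum[OF linear_T[OF graph[OF x]]] linear_scale[OF linear_T[OF graph[OF x]]] T_graph[OF x]
     of_real_def if_distrib cong: if_cong)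
  thus ?thesis using 0 by (simp add: linear_0[OF linear_T[OF graph[OF x]]])
 qed
 thus "u = 0" by (simp add: vec_eq_iff)
qed

text \<open>By \<open>Dk1\<close> the vertical derivative of \<open>k1\<close> at the zero section,
  that is, half of the trace treated in \<open>J_curvature_pos\<close> with one slot tangential.
  \<open>Gm\<close> is its matrix on the normal frame \<open>J pd l \<iota>\<close>.\<close>

definition Lc where "Lc x k w = (1/2) * ltrace (%u. J (\<iota> x) *v Riem (\<iota> x) w (pd k \<iota> x) u)"
definition Gm where "Gm x = (\<chi> l k. Lc x k (J (\<iota> x) *v pd l \<iota> x))"

lemma ltrace_Riem_lin:
 assumes y: "y\<in>Y"
 shows "linear (%w. ltrace (%u. J y *v Riem y w v u))" "linear (%v. ltrace (%u. J y *v Riem y w v u))"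
 unfolding ltrace_def
 by (auto intro!: linearI simp: linear_add[OF Riem_lin(1)[OF y]] linear_add[OF Riem_lin(2)[OF y]]
   linear_scale[OF Riem_lin(1)[OF y]] linear_scale[OF Riem_lin(2)[OF y]] sum.distrib sum_distrib_left
   matrix_vector_right_distrib matrix_vector_mult_scaleR)

lemma Lc_lin: "x\<in>X ==> linear (Lc x k)"
 unfolding Lc_def[abs_def] using linear_compose_scale_right[OF ltrace_Riem_lin(1)[OF \<iota>Y], of x "1/2"] by simp

lemma Lc_form:
 assumes x: "x\<in>X"
 defines "v u \<equiv> \<Sum>l\<in>UNIV. u$l *\<^sub>R pd l \<iota> x"
 shows "(\<Sum>k\<in>UNIV. u$k * Lc x k w) = (1/2) * ltrace (%z. J (\<iota> x) *v Riem (\<iota> x) w (v u) z)"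
proof -
 note L = ltrace_Riem_lin(2)[OF \<iota>Y[OF x], of w]
 show ?thesis unfolding v_def linear_sum[OF L] linear_scale[OF L] by (simp add: Lc_def sum_distrib_left algebra_simps)
qed

lemma Gm_pos: "x\<in>X ==> u \<noteq> 0 ==> u \<bullet> (Gm x *v u) > 0"
proof -
 assume x: "x\<in>X" and u: "u \<noteq> 0"
 let ?v = "\<Sum>l\<in>UNIV. u$l *\<^sub>R pd l \<iota> x"
 have v: "?v \<noteq> 0" using \<iota>_indep[OF x] u by blast
 have "u \<bullet> (Gm x *v u) = (\<Sum>k\<in>UNIV. \<Sum>l\<in>UNIV. u$k * (u$l * Lc x k (J (\<iota> x) *v pd l \<iota> x)))"
  by (subst sum.swap) (simp add: inner_vec_def matrix_vector_mult_def Gm_def sum_distrib_left algebra_simps)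
 also have "\<dots> = (\<Sum>k\<in>UNIV. u$k * Lc x k (J (\<iota> x) *v ?v))"
  by (simp add: linear_sum[OF matrix_vector_mul_linear] linear_sum[OF Lc_lin[OF x]] matrix_vector_mult_scaleR
    linear_scale[OF Lc_lin[OF x]] sum_distrib_left)
 also have "\<dots> = (1/2) * ltrace (%z. J (\<iota> x) *v Riem (\<iota> x) (J (\<iota> x) *v ?v) ?v z)" by (rule Lc_form[OF x])
 finally show ?thesis using J_curvature_pos[OF \<iota>Y[OF x] neg[OF \<iota>Y[OF x]] v] by simp
qed

lemma base_in_Q: "x0\<in>X ==> (x0, 0)\<in>Q (%i. pd i \<iota> x0)"
proof -
 assume x: "x0\<in>X"
 have "M (%i. pd i \<iota> x0) (x0, \<iota> x0) = mat 1" by (simp add: M_def T_graph[OF x] mat_def)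
 thus ?thesis using x graph[OF x] by (simp add: Q_def shear_def We_def)
qed

text \<open>For \<open>p = (\<psi>, f - \<iota> \<psi>)\<close>, \<open>a = d\<psi>\<close> and
  \<open>b = df - d\<iota> d\<psi>\<close> the sums are the partial derivatives of the phase: a
  critical point in the zero set of \<open>\<Phi>\<close> is to lie on the graph.\<close>

abbreviation "crit_cond e p a b \<equiv> \<Phi> (shear p) = 0 -->
 (\<forall>k. (\<Sum>l\<in>UNIV. a$k$l * k1 e l p) + (\<Sum>c\<in>UNIV. b$k$c * k2 e c p) = 0) --> snd p = 0"

text \<open>At \<open>a = 1\<close> and \<open>b = 0\<close> the linearised equations are
  \<open>Dy w = 0\<close> and \<open>Lc k w = 0\<close>. The former means \<open>w = J v\<close>
  with \<open>v\<close> tangential, and pairing the latter with \<open>v\<close> yields the positive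
  curvature trace. So the linear system is injective with a lower bound \<open>c0\<close>, which
  absorbs the error terms.\<close>

lemma critical_imp_zero:
 assumes x0: "x0\<in>X"
 defines "e \<equiv> %i. pd i \<iota> x0"
 shows "\<forall>\<^sub>F (p, a, b) in nhds ((x0, 0), (mat 1 :: real^'n^'n), (0 :: real^'m^'n)).
  crit_cond e p a b"
proof -
 have q0: "(x0, 0)\<in>Q e" unfolding e_def by (rule base_in_Q[OF x0])
 let ?L = "%w. (Dy (x0, \<iota> x0) w, \<chi> k. Lc x0 k w)"
 have lD: "linear (Dy (x0, \<iota> x0))" by (rule linear_Dy[OF graph[OF x0]])
 have linL: "linear ?L"
  by (rule linearI) (simp_all add: linear_add[OF lD] linear_scale[OF lD] linear_add[OF Lc_lin[OF x0]] linear_scale[OF Lc_lin[OF x0]] vec_eq_iff)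
 have "w = 0" if "?L w = 0" for w
 proof -
  have Dw: "Dy (x0, \<iota> x0) w = 0" and Lw: "!!k. Lc x0 k w = 0" using that by (auto simp: zero_prod_def vec_eq_iff)
  define u where "u = (\<chi> l. Im (T (x0, \<iota> x0) l w))"
  let ?v = "\<Sum>l\<in>UNIV. u$l *\<^sub>R pd l \<iota> x0"
  have w: "w = J (\<iota> x0) *v ?v" using normal_expansion[OF x0 Dw] by (simp add: u_def)
  have "(1/2) * ltrace (%z. J (\<iota> x0) *v Riem (\<iota> x0) w ?v z) = 0"
   using Lc_form[OF x0, of u w] Lw by simp
  hence "?v = 0" using J_curvature_pos[OF \<iota>Y[OF x0] neg[OF \<iota>Y[OF x0]], of ?v] w by fastforce
  thus ?thesis using w by simp
 qed
 hence "inj ?L" using linear_injective_0[OF linL] by blast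
 then obtain c0 where c0: "c0 > 0" "!!w. c0 * norm w \<le> norm (?L w)"
  using linear_inj_bounded_below_pos[OF linL] by (metis mult.commute)
 define K1 where "K1 l w = fd (k1 e l) (x0, 0) (0, w)" for l w
 define K2 where "K2 c w = fd (k2 e c) (x0, 0) (0, w)" for c w
 have lin: "linear (%w. fd k (x0, 0) (0, w))" if "smooth_on (Q e) k" for k :: "(real^'n) \<times> (real^'m) => real"
  using linear_compose[OF _ linear_deriv[OF that q0], of "%u. (0, u)"] by (simp add: o_def bounded_linear.linear bounded_linear_Pair)
 have bd: "\<exists>B. \<forall>w. \<bar>F w\<bar> \<le> B * norm w" if "linear F" for F :: "real^'m => real"
  using linear_bounded[OF that] by auto
 have "\<forall>l. \<exists>B. \<forall>w. \<bar>K1 l w\<bar> \<le> B * norm w" unfolding K1_def by (intro allI bd lin smooth_k1)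
 then obtain B1 where B1: "!!l w. \<bar>K1 l w\<bar> \<le> B1 l * norm w" by metis
 have "\<forall>c. \<exists>B. \<forall>w. \<bar>K2 c w\<bar> \<le> B * norm w" unfolding K2_def by (intro allI bd lin smooth_k2)
 then obtain B2 where B2: "!!c w. \<bar>K2 c w\<bar> \<le> B2 c * norm w" by metis
 define B where "B = (\<Sum>l\<in>UNIV. \<bar>B1 l\<bar>) + (\<Sum>c\<in>UNIV. \<bar>B2 c\<bar>)"
 have B1': "\<bar>K1 l w\<bar> \<le> B * norm w" and B2': "\<bar>K2 c w\<bar> \<le> B * norm w" for l c w
 proof -
  have "B1 l \<le> (\<Sum>l\<in>UNIV. \<bar>B1 l\<bar>)" "B2 c \<le> (\<Sum>c\<in>UNIV. \<bar>B2 c\<bar>)"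
   using member_le_sum[of l UNIV "%l. \<bar>B1 l\<bar>"] member_le_sum[of c UNIV "%c. \<bar>B2 c\<bar>"] by auto
  moreover have "0 \<le> (\<Sum>l\<in>UNIV. \<bar>B1 l\<bar>)" "0 \<le> (\<Sum>c\<in>UNIV. \<bar>B2 c\<bar>)" by (auto intro: sum_nonneg)
  ultimately have "B1 l \<le> B" "B2 c \<le> B" unfolding B_def by linarith+
  thus "\<bar>K1 l w\<bar> \<le> B * norm w" "\<bar>K2 c w\<bar> \<le> B * norm w"
   using B1[of l w] B2[of c w] by (meson mult_right_mono norm_ge_zero order_trans)+
 qed
 have B0: "B \<ge> 0" unfolding B_def by (intro add_nonneg_nonneg sum_nonneg) auto
 define n where "n = real CARD('n)"
 define m where "m = real CARD('m)"
 have nm: "n > 0" "m > 0" by (simp_all add: n_def m_def)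
 \<comment> \<open>The total of the error constants below: each of the \<open>n\<close> components
   of \<open>Dy w\<close> costs \<open>d * norm w\<close>, and each of the \<open>n\<close> numbers
   \<open>Lc k w\<close> costs this times \<open>1 + (n + m) * (B + 1)\<close>. The choice of
   \<open>d\<close> keeps the sum below \<open>c0 * norm w\<close>.\<close>
 define C where "C = n + n * (1 + (n + m) * (B + 1))"
 have C: "C > 0" unfolding C_def using nm B0 by (intro add_pos_nonneg mult_nonneg_nonneg) auto
 define d where "d = min 1 (c0 / (2 * C))"
 have d: "d > 0" "d \<le> 1" "d * C < c0"
 proof -
  show "d > 0" "d \<le> 1" using c0 C by (auto simp: d_def)
  have "d * C \<le> c0 / (2 * C) * C" unfolding d_def using C by (intro mult_right_mono) auto
  also have "\<dots> < c0" using C c0(1) by simp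
  finally show "d * C < c0" .
 qed
 have E1: "\<forall>\<^sub>F p in nhds (x0, 0). \<forall>l. \<bar>k1 e l p - K1 l (snd p)\<bar> \<le> d * norm (snd p)"
  unfolding K1_def by (intro eventually_all_finite vanishing_estimate(2)[OF open_Q smooth_k1 q0 d(1)] k1_0)
 have E2: "\<forall>\<^sub>F p in nhds (x0, 0). \<forall>c. \<bar>k2 e c p - K2 c (snd p)\<bar> \<le> d * norm (snd p)"
  unfolding K2_def by (intro eventually_all_finite vanishing_estimate(2)[OF open_Q smooth_k2 q0 d(1)] k2_0)
 have E3: "\<forall>\<^sub>F p in nhds (x0, 0). \<forall>j. \<bar>gq j p - Dy (x0, \<iota> x0) (snd p)$j\<bar> \<le> d * norm (snd p)"
  unfolding Dgq[OF q0, symmetric] by (intro eventually_all_finite vanishing_estimate(2)[OF open_Q smooth_gq q0 d(1)] gq_0)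
 have Ea: "\<forall>\<^sub>F a in nhds (mat 1 :: real^'n^'n). dist a (mat 1) < d"
  using d(1) eventually_nhds_metric by blast
 have Eb: "\<forall>\<^sub>F b in nhds (0 :: real^'m^'n). dist b 0 < d"
  using d(1) eventually_nhds_metric by blast
 have EP: "\<forall>\<^sub>F p in nhds (x0, 0). (\<forall>l. \<bar>k1 e l p - K1 l (snd p)\<bar> \<le> d * norm (snd p)) \<and>
   (\<forall>c. \<bar>k2 e c p - K2 c (snd p)\<bar> \<le> d * norm (snd p)) \<and> (\<forall>j. \<bar>gq j p - Dy (x0, \<iota> x0) (snd p)$j\<bar> \<le> d * norm (snd p))"
  using E1 E2 E3 by eventually_elim blast
 have "\<forall>\<^sub>F (p, a, b) in nhds (x0, 0) \<times>\<^sub>F (nhds (mat 1 :: real^'n^'n) \<times>\<^sub>F nhds (0 :: real^'m^'n)).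
  \<Phi> (shear p) = 0 --> (\<forall>k. (\<Sum>l\<in>UNIV. a$k$l * k1 e l p) + (\<Sum>c\<in>UNIV. b$k$c * k2 e c p) = 0) --> snd p = 0"
 proof -
  have main: "\<Phi> (shear p) = 0 --> (\<forall>k. (\<Sum>l\<in>UNIV. a$k$l * k1 e l p) + (\<Sum>c\<in>UNIV. b$k$c * k2 e c p) = 0) --> snd p = 0"
   if P: "(\<forall>l. \<bar>k1 e l p - K1 l (snd p)\<bar> \<le> d * norm (snd p)) \<and>
     (\<forall>c. \<bar>k2 e c p - K2 c (snd p)\<bar> \<le> d * norm (snd p)) \<and> (\<forall>j. \<bar>gq j p - Dy (x0, \<iota> x0) (snd p)$j\<bar> \<le> d * norm (snd p))"
    and a: "dist a (mat 1) < d" and b: "dist b 0 < d" for p and a :: "real^'n^'n" and b :: "real^'m^'n"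
  proof (intro impI)
   assume Z: "\<Phi> (shear p) = 0" and kz: "\<forall>k. (\<Sum>l\<in>UNIV. a$k$l * k1 e l p) + (\<Sum>c\<in>UNIV. b$k$c * k2 e c p) = 0"
   define w where "w = snd p"
   have k1b: "\<bar>k1 e l p\<bar> \<le> (B + 1) * norm w" for l
   proof -
    have "\<bar>k1 e l p\<bar> \<le> d * norm w + B * norm w"
    proof -
     have "\<bar>k1 e l p - K1 l w\<bar> \<le> d * norm w" using P by (simp add: w_def)
     thus ?thesis using B1'[of l w] by linarith
    qed
    also have "\<dots> \<le> (B + 1) * norm w" using d(2) mult_right_mono[of d 1 "norm w"] by (simp add: algebra_simps)
    finally show ?thesis .
   qed
   have k2b: "\<bar>k2 e c p\<bar> \<le> (B + 1) * norm w" for c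
   proof -
    have "\<bar>k2 e c p\<bar> \<le> d * norm w + B * norm w"
    proof -
     have "\<bar>k2 e c p - K2 c w\<bar> \<le> d * norm w" using P by (simp add: w_def)
     thus ?thesis using B2'[of c w] by linarith
    qed
    also have "\<dots> \<le> (B + 1) * norm w" using d(2) mult_right_mono[of d 1 "norm w"] by (simp add: algebra_simps)
    finally show ?thesis .
   qed
   have ab: "\<bar>(a - mat 1)$k$l\<bar> \<le> d" "\<bar>b$k$c\<bar> \<le> d" for k l c
   proof -
    have "\<bar>(a - mat 1)$k$l\<bar> \<le> norm (a - mat 1)" "\<bar>b$k$c\<bar> \<le> norm b"
     by (rule order_trans[OF component_le_norm_cart norm_nth_le'])+
    thus "\<bar>(a - mat 1)$k$l\<bar> \<le> d" "\<bar>b$k$c\<bar> \<le> d" using a b by (auto simp: dist_norm)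
   qed
   have Lk: "\<bar>Lc x0 k w\<bar> \<le> d * norm w * (1 + (n + m) * (B + 1))" for k
   proof -
    \<comment> \<open>The entries of \<open>a - mat 1\<close> and of \<open>b\<close> are at most
      \<open>d\<close>, while \<open>k1\<close> and \<open>k2\<close> are of the order of
      \<open>norm w\<close>; so the equation makes \<open>k1 e k p\<close> of the order of
      \<open>d * norm w\<close>.\<close>
    have "(\<Sum>l\<in>UNIV. a$k$l * k1 e l p) = k1 e k p + (\<Sum>l\<in>UNIV. (a - mat 1)$k$l * k1 e l p)"
     by (simp add: left_diff_distrib sum_subtractf mat_def if_distrib[of "%z. z * _"] cong: if_cong)
    hence "k1 e k p = - (\<Sum>l\<in>UNIV. (a - mat 1)$k$l * k1 e l p) - (\<Sum>c\<in>UNIV. b$k$c * k2 e c p)"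
     using kz[rule_format, of k] by linarith
    hence "\<bar>k1 e k p\<bar> \<le> \<bar>\<Sum>l\<in>UNIV. (a - mat 1)$k$l * k1 e l p\<bar> + \<bar>\<Sum>c\<in>UNIV. b$k$c * k2 e c p\<bar>"
     by linarith
    also have "\<dots> \<le> (\<Sum>l\<in>UNIV. \<bar>(a - mat 1)$k$l * k1 e l p\<bar>) + (\<Sum>c\<in>UNIV. \<bar>b$k$c * k2 e c p\<bar>)"
     by (intro add_mono sum_abs)
    also have "\<dots> \<le> (\<Sum>l\<in>(UNIV::'n set). d * ((B + 1) * norm w)) + (\<Sum>c\<in>(UNIV::'m set). d * ((B + 1) * norm w))"
     unfolding abs_mult using ab d(1) k1b k2b by (intro add_mono sum_mono mult_mono) auto
    also have "\<dots> = d * norm w * ((n + m) * (B + 1))" by (simp add: n_def m_def algebra_simps)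
    finally have "\<bar>k1 e k p\<bar> \<le> d * norm w * ((n + m) * (B + 1))" .
    moreover have "\<bar>k1 e k p - Lc x0 k w\<bar> \<le> d * norm w"
     using P Dk1[OF q0, of k w] unfolding w_def K1_def Lc_def by metis
    moreover have "d * norm w * (1 + (n + m) * (B + 1)) = d * norm w + d * norm w * ((n + m) * (B + 1))"
     by (simp add: algebra_simps)
    ultimately show ?thesis by linarith
   qed
   have Dk: "\<bar>Dy (x0, \<iota> x0) w$j\<bar> \<le> d * norm w" for j
    using P Z by (simp add: gq_def w_def)
   have "c0 * norm w \<le> norm (Dy (x0, \<iota> x0) w) + norm (\<chi> k. Lc x0 k w)"
    using c0(2)[of w] norm_Pair_le order_trans by blast
   also have "\<dots> \<le> (\<Sum>j\<in>UNIV. \<bar>Dy (x0, \<iota> x0) w$j\<bar>) + (\<Sum>k\<in>UNIV. \<bar>(\<chi> k. Lc x0 k w)$k\<bar>)"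
    by (intro add_mono norm_le_l1_cart)
   also have "\<dots> \<le> (\<Sum>j\<in>(UNIV::'n set). d * norm w) + (\<Sum>k\<in>(UNIV::'n set). d * norm w * (1 + (n + m) * (B + 1)))"
    using Dk Lk by (intro add_mono sum_mono) auto
   also have "\<dots> = d * C * norm w" by (simp add: C_def n_def algebra_simps)
   finally have "(c0 - d * C) * norm w \<le> 0" by (simp add: algebra_simps)
   hence "norm w \<le> 0" using d(3) by (simp add: mult_le_0_iff)
   thus "snd p = 0" by (simp add: w_def)
  qed
  from eventually_prodI[OF EP eventually_prodI[OF Ea Eb]] show ?thesis
  proof (rule eventually_mono)
   fix t :: "((real^'n) \<times> (real^'m)) \<times> (real^'n^'n) \<times> (real^'m^'n)"
   show "case t of (p, a, b) => \<Phi> (shear p) = 0 -->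
    (\<forall>k. (\<Sum>l\<in>UNIV. a$k$l * k1 e l p) + (\<Sum>c\<in>UNIV. b$k$c * k2 e c p) = 0) --> snd p = 0"
    if "((\<forall>l. \<bar>k1 e l (fst t) - K1 l (snd (fst t))\<bar> \<le> d * norm (snd (fst t))) \<and>
     (\<forall>c. \<bar>k2 e c (fst t) - K2 c (snd (fst t))\<bar> \<le> d * norm (snd (fst t))) \<and>
     (\<forall>j. \<bar>gq j (fst t) - Dy (x0, \<iota> x0) (snd (fst t))$j\<bar> \<le> d * norm (snd (fst t)))) \<and>
     dist (fst (snd t)) (mat 1) < d \<and> dist (snd (snd t)) 0 < d"
    unfolding case_prod_beta using that by (intro main) blast+
  qed
 qed
 thus ?thesis by (simp add: nhds_prod)
qed

end

lemma nonpos_of_mult_nonpos: "x * d \<le> 0 ==> 0 < d ==> x \<le> (0::real)"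
 by (simp add: mult_le_0_iff)

lemma nonneg_of_mult_nonneg: "0 \<le> x * d ==> 0 < d ==> 0 \<le> (x::real)"
 by (simp add: zero_le_mult_iff)

lemma tendsto_nhds_isCont: "isCont f a ==> (f \<longlongrightarrow> f a) (nhds a)"
 using tendsto_at_iff_tendsto_nhds[of f a] unfolding isCont_def by blast

lemma isCont_deriv_field:
 fixes k :: "'a::euclidean_space => real" and P :: "'c::t2_space => 'a" and v :: "'c => real^'m::finite"
 assumes k: "smooth_on S k" and P: "isCont P x" "P x\<in>S" "open S" and v: "isCont v x" and L: "bounded_linear L"
 shows "isCont (%x. fd k (P x) (L (v x))) x"
proof -
 have lin: "linear (%u. fd k p (L u))" if "p\<in>S" for p
  using linear_compose[OF bounded_linear.linear[OF L] linear_deriv[OF k that]] by (simp add: o_def)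
 have "isCont (%y. \<Sum>c\<in>UNIV. v y$c * fd k (P y) (L (axis c 1))) x"
  by (intro continuous_intros v isCont_o2[OF P(1)] smooth_isCont[OF smooth_deriv[OF k]] P(2))
 moreover have "\<forall>\<^sub>F y in nhds x. P y\<in>S"
  using P(1) tendsto_nhds_isCont topological_tendstoD[OF _ P(3,2)] by blast
 hence "\<forall>\<^sub>F y in nhds x. (\<Sum>c\<in>UNIV. v y$c * fd k (P y) (L (axis c 1))) = fd k (P y) (L (v y))"
 proof eventually_elim
  case (elim y)
  thus ?case using axis_expansion[OF lin[OF elim], of "v y"] by simp
 qed
 ultimately show ?thesis by (rule isCont_cong[THEN iffD1, rotated])
qed

context gauge
begin

text \<open>If the rows of \<open>b\<close> lie in the kernel of \<open>Dy\<close>, these are their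
  coordinates in the normal frame \<open>J pd l \<iota>\<close>, by
  \<open>normal_expansion\<close>.\<close>

definition Bm where "Bm x b = (\<chi> j l. Im (T (x, \<iota> x) l (b$j)))" for b :: "real^'m^'n"
text \<open>\<open>Gm\<close> perturbed: the vertical derivatives of \<open>k1\<close> and
  \<open>k2\<close> on the normal frame, combined with the coefficients \<open>a\<close> and
  \<open>b\<close> of a nearby jet instead of the identity and 0.\<close>

definition Gp where "Gp e x a b = (\<chi> l k. (\<Sum>r\<in>UNIV. a$k$r * fd (k1 e r) (x, 0) (0, J (\<iota> x) *v pd l \<iota> x))
 + (\<Sum>c\<in>UNIV. b$k$c * fd (k2 e c) (x, 0) (0, J (\<iota> x) *v pd l \<iota> x)))"
 for a :: "real^'n^'n" and b :: "real^'m^'n"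

abbreviation "cdet a b \<equiv> det (\<chi> i j. Complex (a$i$j) (b$i$j))"

text \<open>At a critical point on the graph \<open>Bm ** Gp\<close> is the Hessian of
  \<open>S\<close> and \<open>cdet a (Bm x b)\<close> the complex number whose argument is
  \<open>S\<close>.\<close>

abbreviation "sign_cond e x a b \<equiv>
 (\<forall>i j. (Bm x b ** Gp e x a b)$i$j = (Bm x b ** Gp e x a b)$j$i) -->
 ((\<forall>u. u \<bullet> ((Bm x b ** Gp e x a b) *v u) \<le> 0) --> Im (cdet a (Bm x b)) \<le> 0) \<and>
 ((\<forall>u. u \<bullet> ((Bm x b ** Gp e x a b) *v u) \<ge> 0) --> Im (cdet a (Bm x b)) \<ge> 0)"

lemma isCont_T:
 assumes "isCont P x" "P x\<in>W" "isCont v x"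
 shows "isCont (%x. T (P x) j (v x)) x"
proof -
 have "isCont (%y. \<Sum>a\<in>UNIV. v y$a *\<^sub>R T (P y) j (axis a 1)) x"
  by (intro continuous_intros assms(3) isCont_o2[OF assms(1)] smooth_isCont[OF smooth_T] assms(2))
 moreover have "\<forall>\<^sub>F y in nhds x. P y\<in>W"
  using assms(1) tendsto_nhds_isCont topological_tendstoD[OF _ W assms(2)] by blast
 hence "\<forall>\<^sub>F y in nhds x. (\<Sum>a\<in>UNIV. v y$a *\<^sub>R T (P y) j (axis a 1)) = T (P y) j (v y)"
 proof eventually_elim
  case (elim y)
  thus ?case using axis_expansion[OF linear_T[OF elim], of j "v y"] by simp
 qed
 ultimately show ?thesis by (rule isCont_cong[THEN iffD1, rotated])
qed

lemma isCont_J\<iota>: "x\<in>X ==> isCont (%x. J (\<iota> x) *v pd l \<iota> x) x"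
proof (rule smooth_isCont[of X])
 show "smooth_on X (%x. J (\<iota> x) *v pd l \<iota> x)"
  by (intro smooth_mv X smooth_compose[OF sJ s\<iota> X Y] smooth_pd[OF s\<iota>] \<iota>Y)
qed

text \<open>Multiplying \<open>a + i Bm\<close> by \<open>Gp\<close> from the right makes the
  imaginary part the Hessian and keeps the real part close to \<open>Gm\<close>, whose form is
  positive; this is the situation of \<open>Im_det_perturbation\<close>. The determinant gains the
  real factor \<open>det Gp\<close>, which has the sign of \<open>det Gm\<close>.\<close>

lemma extremum_sign:
 assumes x0: "x0\<in>X"
 defines "e \<equiv> %i. pd i \<iota> x0"
 shows "\<forall>\<^sub>F (x, a, b) in nhds (x0, mat 1 :: real^'n^'n, 0 :: real^'m^'n).
  sign_cond e x a b"
proof -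
 let ?G = "Gm x0"
 let ?t = "(x0, mat 1 :: real^'n^'n, 0 :: real^'m^'n)"
 have q0: "(x0, 0)\<in>Q e" unfolding e_def by (rule base_in_Q[OF x0])
 have cf: "isCont fst ?t" and ca: "isCont (%t. fst (snd t)) ?t" and cb: "isCont (%t. snd (snd t)) ?t"
  by (intro continuous_intros)+
 have cJ: "isCont (%t. J (\<iota> (fst t)) *v pd l \<iota> (fst t)) ?t" for l
  using isCont_o2[OF cf, of "%x. J (\<iota> x) *v pd l \<iota> x"] isCont_J\<iota>[OF x0] by simp
 have bl: "bounded_linear (%u. (0 :: real^'n, u :: real^'m))"
  by (intro bounded_linear_Pair bounded_linear_zero bounded_linear_ident)
 have cD: "isCont (%t. fd k (fst t, 0) (0, J (\<iota> (fst t)) *v pd l \<iota> (fst t))) ?t"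
  if "smooth_on (Q e) k" for k :: "(real^'n) \<times> (real^'m) => real" and l
  using isCont_deriv_field[OF that, where P="%t. (fst t, 0)" and x="?t", OF _ _ open_Q cJ bl] q0 cf by (simp add: continuous_Pair)
 have cG: "isCont (%t. Gp e (fst t) (fst (snd t)) (snd (snd t))$l$k) ?t" for l k
  unfolding Gp_def by (simp, intro continuous_intros cD smooth_k1 smooth_k2 ca cb)
 have cB: "isCont (%t. Bm (fst t) (snd (snd t))$j$l) ?t" for j l
 proof -
  have "isCont (%x. (x, \<iota> x)) x0"
   using smooth_isCont[OF s\<iota> x0] by (intro continuous_intros)
  hence "isCont (%t. (fst t, \<iota> (fst t))) ?t" using isCont_o2[OF cf, of "%x. (x, \<iota> x)"] by simp
  moreover have "isCont (%t. snd (snd t)$j) ?t" by (intro continuous_intros)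
  ultimately have "isCont (%t. T (fst t, \<iota> (fst t)) l (snd (snd t)$j)) ?t"
   using graph[OF x0] by (intro isCont_T) auto
  from bounded_linear.isCont[OF bounded_linear_Im this] show ?thesis by (simp add: Bm_def)
 qed
 have mat1: "(\<Sum>r\<in>UNIV. (mat 1 :: real^'n^'n)$k$r * F r) = F k" for k F
  by (simp add: mat_def if_distrib[of "%z. z * _"] cong: if_cong)
 have G0: "Gp e x0 (mat 1) 0 = ?G"
  by (simp add: mat1 Gp_def Gm_def vec_eq_iff Dk1[OF q0, folded Lc_def])
 have B0: "Bm x0 0 = 0" by (simp add: Bm_def vec_eq_iff linear_0[OF linear_T[OF graph[OF x0]]])
 obtain \<delta> where \<delta>: "\<delta> > 0" "!!K H :: real^'n^'n. (!!i j. \<bar>K$i$j - ?G$i$j\<bar> < \<delta>) ==> (!!i j. \<bar>H$i$j\<bar> < \<delta>) ==>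
   (!!i j. H$i$j = H$j$i) ==> (!!u. u \<bullet> (H *v u) \<le> 0) ==> Im (cdet K H) * det ?G \<le> 0"
  by (rule Im_det_perturbation[OF Gm_pos[OF x0]], assumption, rule that, assumption, blast)
 have dG: "det ?G \<noteq> 0" using cof_form_pos(2)[OF Gm_pos[OF x0], of 1] by (simp add: vec_eq_iff)
 have EK: "\<forall>\<^sub>F t in nhds ?t. \<forall>i j. \<bar>(fst (snd t) ** Gp e (fst t) (fst (snd t)) (snd (snd t)))$i$j - ?G$i$j\<bar> < \<delta>"
 proof (intro eventually_all_finite)
  fix i j
  have "isCont (%t. (fst (snd t) ** Gp e (fst t) (fst (snd t)) (snd (snd t)))$i$j) ?t"
   unfolding matrix_matrix_mult_def by (simp, intro continuous_intros cG)
  from tendstoD[OF tendsto_nhds_isCont[OF this] \<delta>(1)]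
  show "\<forall>\<^sub>F t in nhds ?t. \<bar>(fst (snd t) ** Gp e (fst t) (fst (snd t)) (snd (snd t)))$i$j - ?G$i$j\<bar> < \<delta>"
   by (simp add: G0 dist_real_def)
 qed
 have EH: "\<forall>\<^sub>F t in nhds ?t. \<forall>i j. \<bar>(Bm (fst t) (snd (snd t)) ** Gp e (fst t) (fst (snd t)) (snd (snd t)))$i$j\<bar> < \<delta>"
 proof (intro eventually_all_finite)
  fix i j
  have "isCont (%t. (Bm (fst t) (snd (snd t)) ** Gp e (fst t) (fst (snd t)) (snd (snd t)))$i$j) ?t"
   unfolding matrix_matrix_mult_def by (simp, intro continuous_intros cG cB)
  from tendstoD[OF tendsto_nhds_isCont[OF this] \<delta>(1)]
  show "\<forall>\<^sub>F t in nhds ?t. \<bar>(Bm (fst t) (snd (snd t)) ** Gp e (fst t) (fst (snd t)) (snd (snd t)))$i$j\<bar> < \<delta>"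
   by (simp add: B0 dist_real_def)
 qed
 have ED: "\<forall>\<^sub>F t in nhds ?t. 0 < det (Gp e (fst t) (fst (snd t)) (snd (snd t))) * det ?G"
 proof -
  have "((%t. det (Gp e (fst t) (fst (snd t)) (snd (snd t))) * det ?G) \<longlongrightarrow> det ?G * det ?G) (nhds ?t)"
  proof (intro tendsto_mult tendsto_const tendsto_det)
   fix i j
   show "((%t. Gp e (fst t) (fst (snd t)) (snd (snd t))$i$j) \<longlongrightarrow> ?G$i$j) (nhds ?t)"
    using tendsto_nhds_isCont[OF cG, of i j] by (simp add: G0)
  qed
  moreover have "0 < det ?G * det ?G" using dG by (metis not_real_square_gt_zero)
  ultimately show ?thesis by (rule order_tendstoD(1))
 qed
 have "\<forall>\<^sub>F t in nhds ?t. sign_cond e (fst t) (fst (snd t)) (snd (snd t))"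
  using EK EH ED
 proof eventually_elim
  case (elim t)
  define a where "a = fst (snd t)"
  define B where "B = Bm (fst t) (snd (snd t))"
  define G' where "G' = Gp e (fst t) (fst (snd t)) (snd (snd t))"
  define K where "K = a ** G'"
  define H where "H = B ** G'"
  have e1: "!!i j. \<bar>K$i$j - ?G$i$j\<bar> < \<delta>" and e2: "!!i j. \<bar>H$i$j\<bar> < \<delta>" and e3: "0 < det G' * det ?G"
   using elim by (simp_all add: K_def H_def a_def B_def G'_def)
  have prod: "cdet K H = cdet a B * complex_of_real (det G')"
  proof -
   have "(\<chi> i j. Complex (K$i$j) (H$i$j)) = (\<chi> i j. Complex (a$i$j) (B$i$j)) ** cmat G'"
    by (simp add: vec_eq_iff matrix_matrix_mult_def K_def H_def complex_eq_iff)
   thus ?thesis by (simp add: det_mul det_cmat)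
  qed
  \<comment> \<open>Replacing \<open>H\<close> by \<open>-H\<close> conjugates the matrix, which
    reduces a positive semidefinite Hessian to a negative semidefinite one.\<close>
  have cn: "(\<chi> i j. Complex (K$i$j) ((- H)$i$j)) = (\<chi> i j. cnj ((\<chi> i j. Complex (K$i$j) (H$i$j))$i$j))"
   by (simp add: vec_eq_iff complex_eq_iff)
  have neg: "Im (cdet a B) \<le> 0"
   if sym: "\<forall>i j. H$i$j = H$j$i" and le: "\<forall>u. u \<bullet> (H *v u) \<le> 0"
  proof -
   have "Im (cdet K H) * det ?G \<le> 0"
    using \<delta>(2)[OF e1 e2] sym le by blast
   hence "Im (cdet a B) * (det G' * det ?G) \<le> 0"
    by (simp add: prod mult.assoc)
   thus ?thesis by (rule nonpos_of_mult_nonpos[OF _ e3])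
  qed
  have pos: "Im (cdet a B) \<ge> 0"
   if sym: "\<forall>i j. H$i$j = H$j$i" and ge: "\<forall>u. u \<bullet> (H *v u) \<ge> 0"
  proof -
   have "Im (cdet K (- H)) * det ?G \<le> 0"
   proof (rule \<delta>(2)[OF e1])
    show "\<bar>(- H)$i$j\<bar> < \<delta>" for i j using e2 by simp
    show "(- H)$i$j = (- H)$j$i" for i j using sym by simp
    show "u \<bullet> ((- H) *v u) \<le> 0" for u using ge[rule_format, of u] by (simp add: mv_minus_left)
   qed
   hence "Im (cdet a B) * (det G' * det ?G) \<ge> 0"
    unfolding cn det_cnj prod by (simp add: mult.assoc)
   thus ?thesis by (rule nonneg_of_mult_nonneg[OF _ e3])
  qed
  show ?case using neg pos unfolding H_def B_def G'_def a_def by blast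
 qed
 thus ?thesis by (rule eventually_mono) (simp only: case_prod_beta)
qed

definition phase where "phase f \<psi> y = det (\<chi> i j. T (\<psi> y, f y) j (pd i f y))"

lemma smooth_T_field:
 assumes V: "open V" and P: "smooth_on V P" "!!y. y\<in>V ==> P y\<in>W" and v: "smooth_on V v"
 shows "smooth_on V (%y. T (P y) j (v y))"
proof -
 have "smooth_on V (%y. \<Sum>a\<in>UNIV. v y$a *\<^sub>R T (P y) j (axis a 1))"
  by (intro smooth_sum smooth_scaleR V smooth_vec_nth v smooth_compose[OF smooth_T P(1) V W P(2)])
 thus ?thesis
  by (rule smooth_cong'[OF _ V]) (rule axis_expansion[OF linear_T[OF P(2)]])
qed

text \<open>The differential of \<open>S\<close> is a combination of \<open>k1\<close> and
  \<open>k2\<close> at \<open>P y\<close>, the coordinates of \<open>(\<psi> y, f y)\<close>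
  relative to the graph. At an extremum \<open>crit\<close> puts the point on the graph; there
  \<open>k1\<close> and \<open>k2\<close> vanish, the Hessian comes from their derivatives alone,
  and \<open>sgn\<close> applies.\<close>

lemma phase_estimates:
 fixes f :: "real^'n => real^'m" and \<psi> :: "real^'n => real^'n"
 assumes x0: "x0\<in>X" and V: "open V" "x\<in>V" and f: "smooth_on V f" and \<psi>: "smooth_on V \<psi>"
  and PW: "!!y. y\<in>V ==> (\<psi> y, f y)\<in>W" and \<Phi>0: "!!y. y\<in>V ==> \<Phi> (\<psi> y, f y) = 0" and xi: "!!y. y\<in>V ==> xi0 f y"
 defines "e \<equiv> %i. pd i \<iota> x0" and "a \<equiv> \<chi> k. pd k \<psi> x"
  and "b \<equiv> \<chi> k. pd k f x - (\<Sum>l\<in>UNIV. pd k \<psi> x$l *\<^sub>R pd l \<iota> (\<psi> x))"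
 assumes pWe: "(\<psi> x, f x)\<in>We e" and Rez: "Re (phase f \<psi> x) > 0"
  and crit: "crit_cond e (\<psi> x, f x - \<iota> (\<psi> x)) a b"
  and sgn: "sign_cond e (\<psi> x) a b"
 defines "S \<equiv> %y. Im (Ln (phase f \<psi> y))"
 shows phase_max: "open U ==> x\<in>U ==> (!!y. y\<in>U ==> S y \<le> S x) ==> S x \<le> 0 \<and> f x = \<iota> (\<psi> x)"
  and phase_min: "open U ==> x\<in>U ==> (!!y. y\<in>U ==> S x \<le> S y) ==> S x \<ge> 0 \<and> f x = \<iota> (\<psi> x)"
proof -
 let ?z = "phase f \<psi>"
 have sP: "smooth_on V (%y. (\<psi> y, f y))" by (rule smooth_Pair[OF V(1) \<psi> f])
 have sz: "smooth_on V ?z"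
  unfolding phase_def by (intro smooth_det V(1)) (simp add: smooth_T_field[OF V(1) sP PW smooth_pd[OF f]])
 define V1 where "V1 = V \<inter> ((%y. (\<psi> y, f y)) -` We e) \<inter> (V \<inter> ?z -` {z. Re z > 0})"
 have V1: "open V1" "x\<in>V1" "V1 \<subseteq> V"
 proof -
  have "open (V \<inter> (%y. (\<psi> y, f y)) -` We e)"
   by (intro continuous_open_preimage smooth_cont[OF sP] V(1) open_We)
  moreover have "open (V \<inter> ?z -` {z. Re z > 0})"
   by (intro continuous_open_preimage smooth_cont[OF sz] V(1) open_halfspace_Re_gt)
  ultimately show "open V1" unfolding V1_def by (rule open_Int)
  show "x\<in>V1" "V1 \<subseteq> V" using V(2) pWe Rez by (auto simp: V1_def)
 qed
 have We1: "(\<psi> y, f y)\<in>We e" and Re1: "Re (?z y) > 0" if "y\<in>V1" for y using that by (auto simp: V1_def)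
 have sS: "smooth_on V1 S"
  unfolding S_def
  by (intro smooth_bounded_linear[OF bounded_linear_Im] V1(1) smooth_compose[OF smooth_Ln smooth_subset[OF sz V1(3)]]
    open_halfspace_Re_gt) (use Re1 in auto)
 have dS: "pd k S y = kap e (\<psi> y, f y) (pd k \<psi> y, pd k f y)" if y: "y\<in>V1" for k y
 proof -
  have yV: "y\<in>V" using y V1(3) by blast
  have nz: "?z y \<noteq> 0" using Re1[OF y] by auto
  obtain c where c: "fd ?z y (axis k 1) = c * ?z y" "Im c = kap e (\<psi> y, f y) (pd k \<psi> y, pd k f y)"
   using phase_derivative[OF V(1) yV f \<psi> PW We1[OF y] xi[OF yV]] nz unfolding phase_def[abs_def] by blast
  have "?z y \<notin> \<real>\<^sub>\<le>\<^sub>0" using Re1[OF y] by (auto simp: complex_nonpos_Reals_iff)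
  hence L: "(Ln has_derivative (*) (inverse (?z y))) (at (?z y))"
   using has_field_derivative_Ln unfolding has_field_derivative_def by blast
  have "(S has_derivative (%v. Im (inverse (?z y) * fd ?z y v))) (at y)"
   unfolding S_def
   by (intro bounded_linear.has_derivative[OF bounded_linear_Im] has_derivative_compose[OF smooth_hd[OF sz yV] L])
  note fun_cong[OF fdI[OF this], of "axis k 1"]
  hence "pd k S y = Im (inverse (?z y) * (c * ?z y))" by (simp only: pd_def[of k S] c(1)[symmetric])
  moreover have "inverse (?z y) * (c * ?z y) = c" using nz by simp
  ultimately show ?thesis by (simp only: c(2))
 qed
 define P where "P y = (\<psi> y, f y - \<iota> (\<psi> y))" for y
 define \<beta> where "\<beta> k y = pd k f y - (\<Sum>l\<in>UNIV. pd k \<psi> y$l *\<^sub>R pd l \<iota> (\<psi> y))" for k y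
 have shP: "shear (P y) = (\<psi> y, f y)" for y by (simp add: shear_def P_def)
 have \<psi>X: "\<psi> y\<in>X" if "y\<in>V" for y using WD(1)[OF PW[OF that]] by simp
 have PQ: "P y\<in>Q e" if "y\<in>V1" for y
  using We1[OF that] \<psi>X that V1(3) shP[of y] by (auto simp: Q_def P_def)
 have dS': "pd k S y = (\<Sum>l\<in>UNIV. pd k \<psi> y$l * k1 e l (P y)) + (\<Sum>c\<in>UNIV. \<beta> k y$c * k2 e c (P y))" if "y\<in>V1" for k y
  unfolding dS[OF that] kap_split[OF WeD(1)[OF We1[OF that]], of e "pd k \<psi> y" "pd k f y" "%l. pd l \<iota> (\<psi> y)"]
  by (simp add: k1_def k2_def shP \<beta>_def) (simp add: P_def)
 have ba: "a$k = pd k \<psi> x" "b$k = \<beta> k x" for k by (simp_all add: a_def b_def \<beta>_def)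
 have crit': "f x = \<iota> (\<psi> x)" if z: "fd S x = (%v. 0)"
 proof -
  have "pd k S x = 0" for k by (simp add: pd_def z)
  hence "\<forall>k. (\<Sum>l\<in>UNIV. a$k$l * k1 e l (P x)) + (\<Sum>c\<in>UNIV. b$k$c * k2 e c (P x)) = 0"
   using dS'[OF V1(2)] by (simp add: ba)
  moreover have "\<Phi> (shear (P x)) = 0" using \<Phi>0[OF V(2)] by (simp add: shP)
  ultimately show ?thesis using crit unfolding P_def by auto
 qed
 have hess: "\<exists>H. H = Bm (\<psi> x) b ** Gp e (\<psi> x) a b \<and> (\<forall>i j. H$i$j = H$j$i) \<and>
   (\<forall>u. u \<bullet> (H *v u) = fd (%y. fd S y u) x u) \<and>
   ?z x = cdet a (Bm (\<psi> x) b)" if w0: "f x = \<iota> (\<psi> x)"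
 proof -
  let ?P = "%v. (fd \<psi> x v, fd f x v - fd \<iota> (\<psi> x) (fd \<psi> x v))"
  have Px: "P x = (\<psi> x, 0)" by (simp add: P_def w0)
  have q: "(\<psi> x, 0)\<in>Q e" using PQ[OF V1(2)] Px by simp
  have xX: "\<psi> x\<in>X" using \<psi>X V(2) by blast
  have hP: "(P has_derivative (%v. (?P v))) (at x)"
   unfolding P_def
   by (intro has_derivative_Pair has_derivative_diff smooth_hd[OF \<psi> V(2)] smooth_hd[OF f V(2)]
     has_derivative_compose[OF smooth_hd[OF \<psi> V(2)] smooth_hd[OF s\<iota> xX]])
  have hPj: "(fd \<psi> x (axis j 1), fd f x (axis j 1)
    - fd \<iota> (\<psi> x) (fd \<psi> x (axis j 1))) = (a$j, b$j)" for j
   unfolding frechet_pd[OF s\<iota> xX] by (simp add: a_def b_def pd_def)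
  have kP: "((%y. k (P y)) has_derivative (%v. fd k (\<psi> x, 0) (?P v))) (at x)"
   if "smooth_on (Q e) k" for k :: "(real^'n) \<times> (real^'m) => real"
   by (rule has_derivative_compose[OF hP]) (use smooth_hd[OF that q] Px in simp)
  \<comment> \<open>Differentiating \<open>\<Phi> (\<psi>, f) = 0\<close> at a point of the graph
    leaves \<open>Dy b = 0\<close>, so the rows of \<open>b\<close> are normal there.\<close>
  have bD: "Dy (\<psi> x, \<iota> (\<psi> x)) (b$j) = 0" for j
  proof -
   have "Dy (\<psi> x, \<iota> (\<psi> x)) (b$j)$i = 0" for i
   proof -
    have "((%y. gq i (P y)) has_derivative (%v. 0)) (at x)"
     by (rule hd_cong[OF has_derivative_const V]) (simp add: gq_def shP \<Phi>0)
    from fun_cong[OF has_derivative_unique[OF kP[OF smooth_gq] this], of "axis j 1"]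
    have "fd (gq i) (\<psi> x, 0) (a$j, b$j) = 0"
     unfolding hPj .
    thus ?thesis
     by (simp add: deriv_first_zero[OF open_Q smooth_gq q gq_0] Dgq[OF q])
   qed
   thus ?thesis by (simp add: vec_eq_iff)
  qed
  have bexp: "b$j = (\<Sum>l\<in>UNIV. Bm (\<psi> x) b$j$l *\<^sub>R (J (\<iota> (\<psi> x)) *v pd l \<iota> (\<psi> x)))" for j
   using normal_expansion[OF xX bD[of j]]
   by (simp add: Bm_def linear_sum[OF matrix_vector_mul_linear] matrix_vector_mult_scaleR)
  define H where "H = (\<chi> j k. fd (pd k S) x (axis j 1))"
  have Hval: "H$j$k = (Bm (\<psi> x) b ** Gp e (\<psi> x) a b)$j$k" for j k
  proof -
   have sa: "smooth_on V1 (%y. pd k \<psi> y$l)" for l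
    by (intro smooth_vec_nth V1(1) smooth_subset[OF smooth_pd[OF \<psi>] V1(3)])
   have s\<beta>: "smooth_on V1 (%y. \<beta> k y$c)" for c
    unfolding \<beta>_def
    by (intro smooth_vec_nth V1(1) smooth_diff smooth_sum smooth_scaleR smooth_subset[OF smooth_pd[OF f] V1(3)]
      sa smooth_compose[OF smooth_pd[OF s\<iota>] smooth_subset[OF \<psi> V1(3)] V1(1) X]) (use \<psi>X V1(3) in auto)
   \<comment> \<open>As \<open>k\<close> vanishes at \<open>(\<psi> x, 0)\<close>, the derivative of
     the coefficient \<open>A\<close> does not contribute.\<close>
   have prod: "((%y. A y * k (P y)) has_derivative (%v. A x * fd k (\<psi> x, 0) (?P v))) (at x)"
    if "smooth_on V1 A" "smooth_on (Q e) k" "k (\<psi> x, 0) = 0" for A :: "real^'n => real" and k :: "(real^'n) \<times> (real^'m) => real"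
    using has_derivative_mult[OF smooth_hd[OF that(1) V1(2)] kP[OF that(2)]] that(3) Px by simp
   have z1: "fd (k1 e l) (\<psi> x, 0) (a$j, b$j) = fd (k1 e l) (\<psi> x, 0) (0, b$j)" for l
    by (rule deriv_first_zero[OF open_Q smooth_k1 q k1_0])
   have z2: "fd (k2 e c) (\<psi> x, 0) (a$j, b$j) = fd (k2 e c) (\<psi> x, 0) (0, b$j)" for c
    by (rule deriv_first_zero[OF open_Q smooth_k2 q k2_0])
   have "((%y. (\<Sum>l\<in>UNIV. pd k \<psi> y$l * k1 e l (P y)) + (\<Sum>c\<in>UNIV. \<beta> k y$c * k2 e c (P y))) has_derivative
     (%v. (\<Sum>l\<in>UNIV. pd k \<psi> x$l * fd (k1 e l) (\<psi> x, 0) (?P v))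
      + (\<Sum>c\<in>UNIV. \<beta> k x$c * fd (k2 e c) (\<psi> x, 0) (?P v)))) (at x)"
    by (intro has_derivative_add has_derivative_sum prod sa s\<beta> smooth_k1 smooth_k2 k1_0[OF q] k2_0[OF q])
   hence "(pd k S has_derivative
     (%v. (\<Sum>l\<in>UNIV. pd k \<psi> x$l * fd (k1 e l) (\<psi> x, 0) (?P v))
      + (\<Sum>c\<in>UNIV. \<beta> k x$c * fd (k2 e c) (\<psi> x, 0) (?P v)))) (at x)"
    by (rule hd_cong[OF _ V1(1,2)]) (simp add: dS')
   from fun_cong[OF fdI[OF this], of "axis j 1"]
   have "H$j$k = (\<Sum>l\<in>UNIV. a$k$l * fd (k1 e l) (\<psi> x, 0) (0, b$j))
     + (\<Sum>c\<in>UNIV. b$k$c * fd (k2 e c) (\<psi> x, 0) (0, b$j))"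
    unfolding hPj z1 z2 by (simp add: H_def ba)
   also have "\<dots> = (Bm (\<psi> x) b ** Gp e (\<psi> x) a b)$j$k"
   proof -
    have ex: "fd k (\<psi> x, 0) (0, b$j)
      = (\<Sum>l\<in>UNIV. Bm (\<psi> x) b$j$l * fd k (\<psi> x, 0) (0, J (\<iota> (\<psi> x)) *v pd l \<iota> (\<psi> x)))"
     if "smooth_on (Q e) k" for k :: "(real^'n) \<times> (real^'m) => real"
    proof -
     have L: "linear (%u. fd k (\<psi> x, 0) (0, u))"
      using linear_compose[OF _ linear_deriv[OF that q], of "%u. (0, u)"] by (simp add: o_def bounded_linear.linear bounded_linear_Pair)
     show ?thesis by (subst bexp) (simp add: linear_sum[OF L] linear_scale[OF L])
    qed
    show ?thesis
     unfolding ex[OF smooth_k1] ex[OF smooth_k2]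
     by (simp add: matrix_matrix_mult_def Gp_def distrib_left sum.distrib sum_distrib_left mult.left_commute)
      (simp add: sum.swap[of _ "UNIV :: 'n set" "UNIV :: 'm set"], subst sum.swap, simp)
   qed
   finally show ?thesis .
  qed
  have Hsym: "H$i$j = H$j$i" for i j
   unfolding H_def pd_def[abs_def] using smooth_mixed[OF V1(1) sS V1(2)] by simp
  have Hform: "u \<bullet> (H *v u) = fd (%y. fd S y u) x u" for u
  proof -
   have "((%y. \<Sum>k\<in>UNIV. u$k *\<^sub>R pd k S y) has_derivative (%v. \<Sum>k\<in>UNIV. u$k *\<^sub>R fd (pd k S) x v)) (at x)"
    by (intro has_derivative_sum has_derivative_scaleR_right has_derivative_pd[OF sS V1(2)])
   hence "((%y. fd S y u) has_derivative (%v. \<Sum>k\<in>UNIV. u$k *\<^sub>R fd (pd k S) x v)) (at x)"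
    by (rule hd_cong[OF _ V1(1,2)]) (simp add: frechet_pd[OF sS])
   from fun_cong[OF fdI[OF this], of u]
   have "fd (%y. fd S y u) x u = (\<Sum>k\<in>UNIV. u$k * fd (pd k S) x u)" by simp
   also have "\<dots> = (\<Sum>k\<in>UNIV. \<Sum>j\<in>UNIV. u$k * (u$j * H$j$k))"
    using axis_expansion[OF linear_deriv[OF smooth_pd[OF sS] V1(2)], of _ u]
    by (simp add: H_def sum_distrib_left)
   also have "\<dots> = u \<bullet> (H *v u)"
    by (subst sum.swap) (simp add: inner_vec_def matrix_vector_mult_def sum_distrib_left algebra_simps)
   finally show ?thesis by simp
  qed
  \<comment> \<open>On the graph the forms \<open>T\<close> are dual to the tangent frame and purely
    imaginary on the normal vector \<open>b$i\<close>.\<close>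
  have "T (\<psi> x, f x) j (pd i f x) = Complex (a$i$j) (Bm (\<psi> x) b$i$j)" for i j
  proof -
   have g: "(\<psi> x, \<iota> (\<psi> x))\<in>W" by (rule graph[OF xX])
   have "pd i f x = (\<Sum>l\<in>UNIV. a$i$l *\<^sub>R pd l \<iota> (\<psi> x)) + b$i" by (simp add: a_def b_def)
   hence "T (\<psi> x, f x) j (pd i f x) = complex_of_real (a$i$j) + T (\<psi> x, \<iota> (\<psi> x)) j (b$i)"
    by (simp add: w0 linear_add[OF linear_T[OF g]] linear_sum[OF linear_T[OF g]] linear_scale[OF linear_T[OF g]] T_graph[OF xX]
      of_real_def if_distrib cong: if_cong)
   moreover have "Re (T (\<psi> x, \<iota> (\<psi> x)) j (b$i)) = 0" by (simp add: T_def bD)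
   ultimately show ?thesis by (simp add: complex_eq_iff Bm_def)
  qed
  hence "?z x = cdet a (Bm (\<psi> x) b)" by (simp add: phase_def)
  moreover have "H = Bm (\<psi> x) b ** Gp e (\<psi> x) a b" using Hval by (simp add: vec_eq_iff)
  ultimately show ?thesis using Hsym Hform by blast
 qed
 have ext: "\<exists>H. H = Bm (\<psi> x) b ** Gp e (\<psi> x) a b \<and> (\<forall>i j. H$i$j = H$j$i) \<and>
   (\<forall>u. u \<bullet> (H *v u) = fd (%y. fd S y u) x u) \<and>
   ?z x = cdet a (Bm (\<psi> x) b)" "f x = \<iota> (\<psi> x)"
  if "open U" "x\<in>U" "(\<forall>y\<in>V1 \<inter> U. S y \<le> S x) \<or> (\<forall>y\<in>V1 \<inter> U. S x \<le> S y)" for U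
 proof -
  have "fd S x = (%v. 0)"
   by (rule differential_zero_maxmin[OF _ _ smooth_hd[OF sS V1(2)] that(3)]) (use V1 that in auto)
  thus "f x = \<iota> (\<psi> x)" by (rule crit')
  thus "\<exists>H. H = Bm (\<psi> x) b ** Gp e (\<psi> x) a b \<and> (\<forall>i j. H$i$j = H$j$i) \<and>
   (\<forall>u. u \<bullet> (H *v u) = fd (%y. fd S y u) x u) \<and>
   ?z x = cdet a (Bm (\<psi> x) b)" by (rule hess)
 qed
 show "S x \<le> 0 \<and> f x = \<iota> (\<psi> x)" if U: "open U" "x\<in>U" and max: "!!y. y\<in>U ==> S y \<le> S x"
 proof -
  have op: "open (V1 \<inter> U)" and xin: "x\<in>V1 \<inter> U" using V1 U by auto
  have m: "(\<forall>y\<in>V1 \<inter> U. S y \<le> S x) \<or> (\<forall>y\<in>V1 \<inter> U. S x \<le> S y)" using max by blast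
  obtain H where H: "H = Bm (\<psi> x) b ** Gp e (\<psi> x) a b" "\<forall>i j. H$i$j = H$j$i"
   "!!u. u \<bullet> (H *v u) = fd (%y. fd S y u) x u"
   "?z x = cdet a (Bm (\<psi> x) b)" using ext(1)[OF U m] by blast
  have "u \<bullet> (H *v u) \<le> 0" for u
   unfolding H(3) by (rule second_derivative_max[OF op xin smooth_subset[OF sS]]) (use max in auto)
  hence "Im (?z x) \<le> 0" using sgn[folded H(1)] H(2) unfolding H(4) by blast
  thus ?thesis using Im_Ln_sign(1)[OF Rez] ext(2)[OF U m] by (simp add: S_def)
 qed
 show "S x \<ge> 0 \<and> f x = \<iota> (\<psi> x)" if U: "open U" "x\<in>U" and min: "!!y. y\<in>U ==> S x \<le> S y"
 proof -
  have op: "open (V1 \<inter> U)" and xin: "x\<in>V1 \<inter> U" using V1 U by auto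
  have m: "(\<forall>y\<in>V1 \<inter> U. S y \<le> S x) \<or> (\<forall>y\<in>V1 \<inter> U. S x \<le> S y)" using min by blast
  obtain H where H: "H = Bm (\<psi> x) b ** Gp e (\<psi> x) a b" "\<forall>i j. H$i$j = H$j$i"
   "!!u. u \<bullet> (H *v u) = fd (%y. fd S y u) x u"
   "?z x = cdet a (Bm (\<psi> x) b)" using ext(1)[OF U m] by blast
  have "u \<bullet> (H *v u) \<ge> 0" for u
  proof -
   have mi: "fd (%y. - S y) y u = - fd S y u" if "y\<in>V1" for y
    using fdI[OF has_derivative_minus[OF smooth_hd[OF sS that]]] by simp
   have "fd (%y. fd (%y. - S y) y u) x u \<le> 0"
    by (rule second_derivative_max[OF op xin smooth_subset[OF smooth_minus[OF V1(1) sS]]]) (use min in auto)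
   also have "fd (%y. fd (%y. - S y) y u) x
     = fd (%y. - fd S y u) x"
    by (rule fd_cong[OF V1(1,2) mi])
   also have "\<dots> u = - fd (%y. fd S y u) x u"
    using fdI[OF has_derivative_minus[OF smooth_hd[OF smooth_deriv[OF sS] V1(2)]]] by simp
   finally show ?thesis by (simp add: H(3))
  qed
  hence "Im (?z x) \<ge> 0" using sgn[folded H(1)] H(2) unfolding H(4) by blast
  thus ?thesis using Im_Ln_sign(2)[OF Rez] ext(2)[OF U m] by (simp add: S_def)
 qed
qed

end

section \<open>Change of coordinates and the local gauge function\<close>

text \<open>Koszul's formula determines the Christoffel symbols, which gives their transformation law.\<close>

lemma Gam_transform:
 fixes Y Y' :: "(real^'m::finite) set"
 assumes K: "kaehler_chart Y J G" and K': "kaehler_chart Y' J' G'"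
  and U: "open U" "U \<subseteq> Y" and \<sigma>: "smooth_on U \<sigma>" "\<sigma> ` U \<subseteq> Y'"
  and G: "!!y u v. y\<in>U ==> u \<bullet> (G y *v v) = fd \<sigma> y u \<bullet> (G' (\<sigma> y) *v fd \<sigma> y v)"
  and surj: "!!y. y\<in>U ==> surj (fd \<sigma> y)" and y: "y\<in>U"
 shows "fd \<sigma> y (kaehler_chart.Gam G y u v)
  = kaehler_chart.Gam G' (\<sigma> y) (fd \<sigma> y u) (fd \<sigma> y v)
   + fd (%y. fd \<sigma> y v) y u"
proof -
 interpret A: kaehler_chart Y J G by (rule K)
 interpret B: kaehler_chart Y' J' G' by (rule K')
 have yY: "y\<in>Y" and sY: "\<sigma> y\<in>Y'" using y U \<sigma>(2) by auto
 let ?D = "%y. fd \<sigma> y"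
 let ?D2 = "%u v. fd (%y. ?D y v) y u"
 have sym: "?D2 u v = ?D2 v u" for u v using smooth_mixed[OF U(1) \<sigma>(1) y] by blast
 have lD: "linear (?D y)" by (rule linear_deriv[OF \<sigma>(1) y])
 have gg: "A.gg z a b = B.gg (\<sigma> z) (?D z a) (?D z b)" if "z\<in>U" for z a b
  using G[OF that] by (simp add: A.gg_def B.gg_def)
 have dG: "A.dG y w a b = B.dG (\<sigma> y) (?D y w) (?D y a) (?D y b) + B.gg (\<sigma> y) (?D2 w a) (?D y b) + B.gg (\<sigma> y) (?D y a) (?D2 w b)" for w a b
 proof -
  have h2: "((%z. ?D z c) has_derivative (%w. ?D2 w c)) (at y)" for c
   by (rule smooth_hd[OF smooth_deriv[OF \<sigma>(1)] y])
  have "((%z. G' (\<sigma> z)) has_derivative (%w. fd G' (\<sigma> y) (?D y w))) (at y)"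
   by (rule has_derivative_compose[OF smooth_hd[OF \<sigma>(1) y] smooth_hd[OF B.sG sY]])
  from has_derivative_inner[OF h2[of a] has_derivative_mv[OF this h2[of b]]]
  have "((%z. B.gg (\<sigma> z) (?D z a) (?D z b)) has_derivative (%w. B.dG (\<sigma> y) (?D y w) (?D y a) (?D y b)
    + B.gg (\<sigma> y) (?D2 w a) (?D y b) + B.gg (\<sigma> y) (?D y a) (?D2 w b))) (at y)"
   unfolding B.gg_def B.dG_def by (rule has_derivative_eq_rhs) (auto simp: inner_add_right)
  hence 1: "((%z. A.gg z a b) has_derivative (%w. B.dG (\<sigma> y) (?D y w) (?D y a) (?D y b)
    + B.gg (\<sigma> y) (?D2 w a) (?D y b) + B.gg (\<sigma> y) (?D y a) (?D2 w b))) (at y)"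
   by (rule hd_cong[OF _ U(1) y]) (simp add: gg)
  have "((%z. A.gg z a b) has_derivative (%w. A.dG y w a b)) (at y)"
   using A.has_derivative_gg[OF yY has_derivative_const[of a] has_derivative_const[of b]] by (simp add: A.gg_bil)
  from fun_cong[OF has_derivative_unique[OF this 1], of w] show ?thesis .
 qed
 have "?D y (A.Gam y u v) - ?D2 u v = B.Gam (\<sigma> y) (?D y u) (?D y v)"
 proof (rule B.Gam_unique[OF sY])
  fix z'
  obtain z where z: "z' = ?D y z" using surj[OF y] by (metis surjD)
  have "2 * B.gg (\<sigma> y) (?D y (A.Gam y u v)) (?D y z) = A.dG y u v z + A.dG y v u z - A.dG y z u v"
   using A.koszul[OF yY] gg[OF y] by metis
  thus "2 * B.gg (\<sigma> y) (?D y (A.Gam y u v) - ?D2 u v) z'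
   = B.dG (\<sigma> y) (?D y u) (?D y v) z' + B.dG (\<sigma> y) (?D y v) (?D y u) z' - B.dG (\<sigma> y) z' (?D y u) (?D y v)"
   unfolding z dG using sym[of u v] sym[of u z] sym[of v z]
    B.gg_sym[OF sY, of "?D y v" "?D2 u z"] B.gg_sym[OF sY, of "?D y u" "?D2 v z"]
   by (simp add: B.gg_bil)
 qed
 thus ?thesis by (simp add: algebra_simps)
qed

section \<open>The Hermitian form, projections and the raw gauge function\<close>

context kaehler_chart
begin

definition hh where "hh y u v = Complex (gg y u v) (- gg y (J y *v u) v)"

lemma clinear_hh: "y\<in>Y ==> clinear (J y) (%u. hh y u v)"
 unfolding clinear_def
 by (auto intro!: linearI simp: hh_def complex_eq_iff gg_bil matrix_vector_right_distrib matrix_vector_mult_scaleR JJv)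

lemma hh_cnj: "y\<in>Y ==> hh y u v = cnj (hh y v u)"
 using gg_sym[of y u v] gg_J[of y u v] gg_sym[of y u "J y *v v"] by (simp add: hh_def complex_eq_iff)

lemma hh_lin2: "linear (hh y u)"
 by (auto intro!: linearI simp: hh_def complex_eq_iff gg_bil)

lemma hh_comb2: "y\<in>Y ==> hh y u (comb (J y) e z) = (\<Sum>i\<in>UNIV. cnj (z$i) * hh y u (e i))"
proof -
 assume y: "y\<in>Y"
 have "hh y u (comb (J y) e z) = cnj (\<Sum>i\<in>UNIV. z$i * hh y (e i) u)"
  unfolding clinear_comb[OF clinear_hh[OF y], symmetric] by (rule hh_cnj[OF y])
 also have "\<dots> = (\<Sum>i\<in>UNIV. cnj (z$i) * cnj (hh y (e i) u))" by simp
 finally show ?thesis by (simp only: hh_cnj[OF y, symmetric])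
qed

definition hmat where "hmat y e = (\<chi> i j. hh y (e i) (e j))"

lemma det_hmat: "y\<in>Y ==> cbasis (J y) e ==> det (hmat y e) \<noteq> 0"
proof -
 assume y: "y\<in>Y" and e: "cbasis (J y) e"
 have "z = 0" if "transpose (hmat y e) *v z = 0" for z
 proof -
  have "hh y (comb (J y) e z) (e j) = 0" for j
  proof -
   have "(transpose (hmat y e) *v z)$j = 0" using that by simp
   thus ?thesis
    unfolding clinear_comb[OF clinear_hh[OF y]]
    by (simp add: transpose_def hmat_def matrix_vector_mult_def mult.commute)
  qed
  hence "hh y (comb (J y) e z) (comb (J y) e z) = 0" by (simp add: hh_comb2[OF y])
  hence "gg y (comb (J y) e z) (comb (J y) e z) = 0" by (simp add: hh_def complex_eq_iff)
  hence "comb (J y) e z = comb (J y) e 0"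
   using gg_pos[OF y] linear_0[OF linear_comb] by (metis less_irrefl)
  thus ?thesis using e unfolding cbasis_def bij_def by (metis injD)
 qed
 hence "invertible (transpose (hmat y e))"
  using invertible_left_inverse matrix_left_invertible_ker by blast
 thus ?thesis by (simp add: invertible_det_nz det_transpose)
qed

lemma smooth_gg:
 assumes "open S" "smooth_on S f" "!!x. x\<in>S ==> f x\<in>Y" "smooth_on S a" "smooth_on S b"
 shows "smooth_on S (%x. gg (f x) (a x) (b x))"
 unfolding gg_def by (intro smooth_inner smooth_mv smooth_compose[OF sG] assms Y)

lemma smooth_hh:
 assumes "open S" "smooth_on S f" "!!x. x\<in>S ==> f x\<in>Y" "smooth_on S a" "smooth_on S b"
 shows "smooth_on S (%x. hh (f x) (a x) (b x))"
 unfolding hh_def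
 by (intro smooth_Complex smooth_minus smooth_gg smooth_mv smooth_compose[OF sJ] assms Y)

text \<open>The complex coordinates in the frame \<open>e\<close>, obtained from the Gram matrix of
  the Hermitian form; this formula is smooth in point, frame and vector.\<close>

definition coord where "coord y e v = (\<chi> j. \<Sum>k\<in>UNIV. hh y v (e k) * matrix_inv (hmat y e)$k$j)"

lemma coord_comb:
 fixes e :: "'n::finite => real^'m"
 assumes y: "y\<in>Y" and e: "cbasis (J y) e"
 shows "coord y e (comb (J y) e z) = z"
proof -
 have inv: "hmat y e ** matrix_inv (hmat y e) = mat 1"
  using matrix_inv_right det_hmat[OF y e] invertible_det_nz by blast
 have m: "(\<Sum>k\<in>UNIV. hh y (e i) (e k) * matrix_inv (hmat y e)$k$j) = (mat 1 :: complex^'n^'n)$i$j" for i j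
  unfolding inv[symmetric] by (simp add: matrix_matrix_mult_def hmat_def)
 have "coord y e (comb (J y) e z)$j = z$j" for j
 proof -
  have "coord y e (comb (J y) e z)$j = (\<Sum>k\<in>UNIV. \<Sum>i\<in>UNIV. z$i * (hh y (e i) (e k) * matrix_inv (hmat y e)$k$j))"
   unfolding coord_def clinear_comb[OF clinear_hh[OF y]] by (simp add: sum_distrib_right mult.assoc)
  also have "\<dots> = (\<Sum>i\<in>UNIV. z$i * (\<Sum>k\<in>UNIV. hh y (e i) (e k) * matrix_inv (hmat y e)$k$j))"
   by (subst sum.swap) (simp add: sum_distrib_left)
  also have "\<dots> = z$j" unfolding m by (simp add: mat_def if_distrib cong: if_cong)
  finally show ?thesis .
 qed
 thus ?thesis by (simp add: vec_eq_iff)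
qed

lemma smooth_coord:
 assumes S: "open S" "smooth_on S f" "!!x. x\<in>S ==> f x\<in>Y" and e: "!!i. smooth_on S (%x. e x i)"
  "!!x. x\<in>S ==> cbasis (J (f x)) (e x)" and v: "smooth_on S v"
 shows "smooth_on S (%x. coord (f x) (e x) (v x))"
proof -
 have "smooth_on S (%x. matrix_inv (hmat (f x) (e x)))"
  by (intro smooth_matrix_inv S(1) det_hmat S(3) e(2)) (simp add: hmat_def, intro smooth_hh S e)
 thus ?thesis unfolding coord_def
  by (intro smooth_vec_lambda smooth_sum smooth_mult smooth_vec_nth smooth_hh S e v)
qed

lemma hh_lin1: "linear (%u. hh y u v)"
 by (auto intro!: linearI simp: hh_def complex_eq_iff gg_bil matrix_vector_right_distrib matrix_vector_mult_scaleR)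

lemma coord_lin: "linear (coord y e)"
 unfolding coord_def
 by (rule linearI) (simp_all add: vec_eq_iff linear_add[OF hh_lin1] linear_scale[OF hh_lin1] distrib_right sum.distrib scaleR_sum_right)

text \<open>For a totally real \<open>f\<close> these are the coordinates of the tangential part of
  \<open>v\<close> in the splitting of the target into the tangent space and its image under
  \<open>J\<close>.\<close>

definition Pf where "Pf f x v = (\<chi> j. Re (coord (f x) (%i. pd i f x) v$j))"

lemma Pf_lin: "linear (Pf f x)"
 unfolding Pf_def
 by (auto intro!: linearI simp: vec_eq_iff linear_add[OF coord_lin] linear_scale[OF coord_lin])

lemma Pf_frame:
 assumes "f x\<in>Y" "cbasis (J (f x)) (%i. pd i f x)"
 shows "Pf f x (pd k f x) = axis k 1" "Pf f x (J (f x) *v pd k f x) = 0"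
proof -
 let ?e = "%i. pd i f x"
 have "pd k f x = comb (J (f x)) ?e (axis k 1)" by (simp add: comb_axis cscale_def)
 hence "coord (f x) ?e (pd k f x) = axis k 1" using coord_comb[OF assms] by metis
 thus "Pf f x (pd k f x) = axis k 1" by (simp add: Pf_def vec_eq_iff axis_def)
 have "J (f x) *v pd k f x = comb (J (f x)) ?e (axis k \<i>)" by (simp add: comb_axis cscale_def)
 hence "coord (f x) ?e (J (f x) *v pd k f x) = axis k \<i>" using coord_comb[OF assms] by metis
 thus "Pf f x (J (f x) *v pd k f x) = 0" by (simp add: Pf_def vec_eq_iff axis_def)
qed

text \<open>
 The raw gauge function: to second order at the graph it is the tangential component of the
 Riemannian logarithm.
\<close>

definition rawg where "rawg f p = Pf f (fst p) ((snd p - f (fst p)) + (1/2) *\<^sub>R Gam (f (fst p)) (snd p - f (fst p)) (snd p - f (fst p)))"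

lemma smooth_Gam_field:
 assumes "open S" "smooth_on S f" "!!x. x\<in>S ==> f x\<in>Y" "smooth_on S a" "smooth_on S b"
 shows "smooth_on S (%x. Gam (f x) (a x) (b x))"
proof -
 have "smooth_on S (%x. \<Sum>i\<in>UNIV. \<Sum>j\<in>UNIV. (a x$i * b x$j) *\<^sub>R Gam (f x) (axis i 1) (axis j 1))"
  by (intro smooth_sum smooth_scaleR smooth_mult smooth_vec_nth smooth_compose[OF smooth_Gam] assms Y)
 thus ?thesis
 proof (rule smooth_cong'[OF _ assms(1)])
  fix x assume x: "x\<in>S"
  have 1: "Gam (f x) (a x) (b x) = (\<Sum>i\<in>UNIV. a x$i *\<^sub>R Gam (f x) (axis i 1) (b x))"
   by (rule axis_expansion[OF Gam_lin1[OF assms(3)[OF x]]])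
  have 2: "Gam (f x) (axis i 1) (b x) = (\<Sum>j\<in>UNIV. b x$j *\<^sub>R Gam (f x) (axis i 1) (axis j 1))" for i
   by (rule axis_expansion[OF Gam_lin2[OF assms(3)[OF x]]])
  show "Gam (f x) (a x) (b x) = (\<Sum>i\<in>UNIV. \<Sum>j\<in>UNIV. (a x$i * b x$j) *\<^sub>R Gam (f x) (axis i 1) (axis j 1))"
   unfolding 1 unfolding 2 by (simp add: scaleR_sum_right)
 qed
qed

lemma smooth_rawg:
 fixes f :: "real^'n::finite => real^'m"
 assumes X: "open X" and f: "smooth_on X f" and Y': "!!x. x\<in>X ==> f x\<in>Y"
  and cb: "!!x. x\<in>X ==> cbasis (J (f x)) (%i. pd i f x)"
 shows "smooth_on (X \<times> UNIV) (rawg f)"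
proof -
 let ?S = "X \<times> (UNIV :: (real^'m) set)"
 have S: "open ?S" using X by (simp add: open_Times)
 have ff: "smooth_on ?S (%p. f (fst p))"
  by (rule smooth_compose[OF f smooth_fst[OF S smooth_id] S X]) auto
 have pf: "smooth_on ?S (%p. pd i f (fst p))" for i
  by (rule smooth_compose[OF smooth_pd[OF f] smooth_fst[OF S smooth_id] S X]) auto
 have w: "smooth_on ?S (%p. snd p - f (fst p))"
  by (intro smooth_diff S smooth_snd smooth_id ff)
 have "smooth_on ?S (%p. coord (f (fst p)) (%i. pd i f (fst p))
   ((snd p - f (fst p)) + (1/2) *\<^sub>R Gam (f (fst p)) (snd p - f (fst p)) (snd p - f (fst p))))"
  by (intro smooth_coord S ff pf smooth_add smooth_scaleR smooth_const w smooth_Gam_field) (auto simp: Y' cb)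
 thus ?thesis unfolding rawg_def[abs_def] Pf_def
  by (intro smooth_vec_lambda smooth_bounded_linear[OF bounded_linear_Re] smooth_vec_nth S)
qed

text \<open>By symmetry of \<open>Gam\<close> the quadratic term contributes two equal halves. One
  more derivative at \<open>y = f x\<close> then gives \<open>Pf (Gam v u)\<close>, which is
  condition \<open>C3\<close> in this chart.\<close>

lemma rawg_derivative:
 assumes "f x\<in>Y"
 shows "((%y. rawg f (x, y)) has_derivative (%u. Pf f x (u + Gam (f x) (y - f x) u))) (at y)"
proof -
 note L1 = Gam_lin1[OF assms] and L2 = Gam_lin2[OF assms]
 have w: "((%y. y - f x) has_derivative (%u. u)) (at y)" by (auto intro!: derivative_eq_intros)
 have bb: "bounded_bilinear (Gam (f x))"
  unfolding bilinear_conv_bounded_bilinear[symmetric] bilinear_def using L1 L2 by auto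
 have "((%y. (y - f x) + (1/2) *\<^sub>R Gam (f x) (y - f x) (y - f x)) has_derivative
   (%u. u + (1/2) *\<^sub>R (Gam (f x) (y - f x) u + Gam (f x) u (y - f x)))) (at y)"
  by (intro has_derivative_add w has_derivative_scaleR_right bounded_bilinear.FDERIV[OF bb])
 hence "((%y. Pf f x ((y - f x) + (1/2) *\<^sub>R Gam (f x) (y - f x) (y - f x))) has_derivative
   (%u. Pf f x (u + (1/2) *\<^sub>R (Gam (f x) (y - f x) u + Gam (f x) u (y - f x))))) (at y)"
  by (intro bounded_linear.has_derivative[of "Pf f x"]) (simp_all add: Pf_lin linear_conv_bounded_linear[symmetric])
 moreover have "(1/2) *\<^sub>R (Gam (f x) (y - f x) u + Gam (f x) u (y - f x)) = Gam (f x) (y - f x) u" for u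
  using Gam_sym[OF assms, of u "y - f x"] by (simp add: scaleR_2[symmetric])
 ultimately show ?thesis by (simp add: rawg_def)
qed

end

section \<open>Charts and smooth maps\<close>

lemma chD:
 assumes "is_chart c"
 shows "open (cdom c)" "open (cimg c)"
  "p\<in>cdom c ==> ci c (cm c p) = p" "p\<in>cdom c ==> cm c p\<in>cimg c"
  "x\<in>cimg c ==> cm c (ci c x) = x" "x\<in>cimg c ==> ci c x\<in>cdom c"
  "continuous_on (cdom c) (cm c)" "continuous_on (cimg c) (ci c)"
 using assms unfolding is_chart_def homeomorphism_def by auto

lemma open_chart_vimage: "is_chart c ==> open U ==> open {p\<in>cdom c. cm c p\<in>U}"
 using continuous_open_preimage[OF chD(7,1), of c U] by (simp add: vimage_def Int_def)

lemma open_chart_image: "is_chart c ==> open U ==> open {x\<in>cimg c. ci c x\<in>U}"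
 using continuous_open_preimage[OF chD(8,2), of c U] by (simp add: vimage_def Int_def)

lemma local_dom_iff: "is_chart c ==> x\<in>ldom f c d \<longleftrightarrow> x\<in>cimg c \<and> f (ci c x)\<in>cdom d"
proof -
 assume c: "is_chart c"
 show ?thesis
 proof
  assume "x\<in>ldom f c d"
  thus "x\<in>cimg c \<and> f (ci c x)\<in>cdom d"
   unfolding local_dom_def by (auto simp: chD[OF c])
 next
  assume "x\<in>cimg c \<and> f (ci c x)\<in>cdom d"
  thus "x\<in>ldom f c d" unfolding local_dom_def
   by (intro image_eqI[of _ _ "ci c x"]) (auto simp: chD[OF c])
 qed
qed

lemma local_dom_map: "is_chart c ==> p\<in>cdom c ==> f p\<in>cdom d ==> cm c p\<in>ldom f c d"
 by (simp add: local_dom_iff chD)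

lemma local_rep_apply: "rep f c d x = cm d (f (ci c x))"
 by (simp add: local_rep_def)

lemma local_rep_map: "is_chart c ==> p\<in>cdom c ==> rep f c d (cm c p) = cm d (f p)"
 by (simp add: local_rep_def chD)

lemma open_local_dom: "is_chart c ==> is_chart d ==> continuous_on UNIV f ==> open (ldom f c d)"
proof -
 assume c: "is_chart c" and d: "is_chart d" and f: "continuous_on UNIV f"
 have "open (f -` cdom d)" using f chD(1)[OF d] by (simp add: continuous_on_open_vimage)
 moreover have "ldom f c d = {x\<in>cimg c. ci c x\<in>f -` cdom d}"
  by (auto simp: local_dom_iff[OF c])
 ultimately show ?thesis using open_chart_image[OF c, of "f -` cdom d"] by simp
qed

lemma overlap_iff: "is_chart c ==> x\<in>overlap c d \<longleftrightarrow> x\<in>cimg c \<and> ci c x\<in>cdom d"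
 using local_dom_iff[of c x "%p. p" d] by (simp add: overlap_def local_dom_def vimage_def)

lemma transition_apply: "trn c d x = cm d (ci c x)"
 by (simp add: transition_def)

lemma open_overlap: "is_chart c ==> is_chart d ==> open (overlap c d)"
proof -
 assume c: "is_chart c" and d: "is_chart d"
 have "overlap c d = {x\<in>cimg c. ci c x\<in>cdom d}"
  by (auto simp: overlap_iff[OF c])
 thus ?thesis using open_chart_image[OF c chD(1)[OF d]] by simp
qed

lemma transition_overlap:
 assumes "is_chart c" "is_chart d" "x\<in>overlap c d"
 shows "trn c d x\<in>overlap d c" "trn c d x\<in>cimg d" "trn d c (trn c d x) = x"
 using assms chD[of c] chD[of d] by (auto simp: overlap_iff transition_apply)

context
 fixes A :: "('x::{t2_space, second_countable_topology}, 'k::finite) chart set"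
 assumes A: "smooth_atlas A"
begin

lemma atlas_chart: "c\<in>A ==> is_chart c"
 using A by (simp add: smooth_atlas_def)

lemma atlas_cover: "\<exists>c\<in>A. p\<in>cdom c"
 using A unfolding smooth_atlas_def by blast

lemma chart_at_in: "chart_at A p\<in>A" "p\<in>cdom (chart_at A p)"
 using someI_ex[of "%c. c\<in>A \<and> p\<in>cdom c"] atlas_cover[of p] unfolding chart_at_def by blast+

lemma smooth_transition: "c\<in>A ==> d\<in>A ==> smooth_on (overlap c d) (trn c d)"
 using A by (simp add: smooth_atlas_def)

lemma transition_deriv_inverse:
 assumes "c\<in>A" "d\<in>A" "x\<in>overlap c d"
 shows "fd (trn d c) (trn c d x) (fd (trn c d) x v) = v"
proof -
 note cc = atlas_chart[OF assms(1)] and dd = atlas_chart[OF assms(2)]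
 have "((%x. trn d c (trn c d x)) has_derivative
   (%v. fd (trn d c) (trn c d x) (fd (trn c d) x v))) (at x)"
  by (rule has_derivative_compose[OF smooth_hd[OF smooth_transition] smooth_hd[OF smooth_transition]])
   (use assms transition_overlap[OF cc dd] in auto)
 moreover have "((%x. trn d c (trn c d x)) has_derivative (%v. v)) (at x)"
  by (rule hd_cong[OF has_derivative_ident open_overlap[OF cc dd] assms(3)])
   (simp add: transition_overlap(3)[OF cc dd])
 ultimately have "(%v. fd (trn d c) (trn c d x) (fd (trn c d) x v)) = (%v. v)"
  by (rule has_derivative_unique)
 thus ?thesis by (rule fun_cong)
qed

lemma transition_deriv_bij:
 assumes "c\<in>A" "d\<in>A" "x\<in>overlap c d"
 shows "bij (fd (trn c d) x)"
proof (rule bijI)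
 note cc = atlas_chart[OF assms(1)] and dd = atlas_chart[OF assms(2)]
 show "inj (fd (trn c d) x)"
  by (rule inj_on_inverseI[where g="fd (trn d c) (trn c d x)"])
   (rule transition_deriv_inverse[OF assms])
 show "surj (fd (trn c d) x)"
  using transition_deriv_inverse[OF assms(2,1) transition_overlap(1)[OF cc dd assms(3)]]
  unfolding transition_overlap(3)[OF cc dd assms(3)] by (metis surjI)
qed

lemma transition_linear: "c\<in>A ==> d\<in>A ==> x\<in>overlap c d ==> linear (fd (trn c d) x)"
 by (rule linear_deriv[OF smooth_transition])

lemma jacobian_transition: "c\<in>A ==> d\<in>A ==> x\<in>overlap c d ==>
  jacobian (trn c d) (at x) *v v = fd (trn c d) x v"
 unfolding jacobian_def using fun_cong[OF matrix_vector_mul(2)[OF transition_linear], of c d x v] by simp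

end

lemma local_rep_chart_change:
 assumes "is_chart c" "is_chart c'" "is_chart d" "x\<in>ldom f c' d'" "x\<in>overlap c' c" "f (ci c' x)\<in>cdom d"
 shows "rep f c' d' x = trn d d' (rep f c d (trn c' c x))"
  and "trn c' c x\<in>ldom f c d" and "rep f c d (trn c' c x)\<in>overlap d d'"
 using assms chD[OF assms(1)] chD[OF assms(2)] chD[OF assms(3)]
 by (auto simp: local_rep_apply transition_apply overlap_iff local_dom_iff)

text \<open>One pair of charts per point suffices: any other local representation arises from it by
  composition with transition maps.\<close>

lemma smooth_map_local:
 fixes A :: "('x::{t2_space, second_countable_topology}, 'k::finite) chart set"
  and B :: "('y::{t2_space, second_countable_topology}, 'm::finite) chart set"
 assumes A: "smooth_atlas A" and B: "smooth_atlas B" and cont: "continuous_on UNIV f"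
  and loc: "!!p. \<exists>c\<in>A. \<exists>d\<in>B. \<exists>U. p\<in>cdom c \<and> f p\<in>cdom d \<and> open U \<and> cm c p\<in>U \<and> smooth_on U (rep f c d)"
 shows "smooth_map A B f"
 unfolding smooth_map_def
proof (intro conjI cont ballI)
 fix c' d' assume c': "c'\<in>A" and d': "d'\<in>B"
 note C' = atlas_chart[OF A c'] and D' = atlas_chart[OF B d']
 show "smooth_on (ldom f c' d') (rep f c' d')"
 proof (rule smooth_locally)
  fix x assume x: "x\<in>ldom f c' d'"
  let ?p = "ci c' x"
  obtain c d U where cd: "c\<in>A" "d\<in>B" "?p\<in>cdom c" "f ?p\<in>cdom d" "open U" "cm c ?p\<in>U" "smooth_on U (rep f c d)"
   using loc[of ?p] by blast
  note C = atlas_chart[OF A cd(1)] and D = atlas_chart[OF B cd(2)]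
  let ?W = "ldom f c' d' \<inter> ldom f c' d \<inter> overlap c' c"
  have oW: "open ?W" by (intro open_Int open_local_dom open_overlap C' D' C D cont)
  have t: "smooth_on ?W (trn c' c)" by (rule smooth_subset[OF smooth_transition[OF A c' cd(1)]]) auto
  define V where "V = ?W \<inter> trn c' c -` (U \<inter> ldom f c d)"
  have oV: "open V" unfolding V_def
   by (intro continuous_open_preimage smooth_cont[OF t] oW open_Int cd(5) open_local_dom C D cont)
  have xW: "x\<in>?W" using x cd(3,4) by (auto simp: local_dom_iff[OF C'] overlap_iff[OF C'])
  have xV: "x\<in>V" using xW cd(6) x cd(3,4) chD[OF C] by (auto simp: V_def transition_apply local_dom_iff[OF C])
  have 1: "smooth_on V (%x. rep f c d (trn c' c x))"
   by (rule smooth_compose[OF cd(7) smooth_subset[OF t] oV cd(5)]) (auto simp: V_def)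
  have "smooth_on V (%x. trn d d' (rep f c d (trn c' c x)))"
   by (rule smooth_compose[OF smooth_transition[OF B cd(2) d'] 1 oV open_overlap[OF D D']])
    (auto simp: V_def local_dom_iff[OF C'] overlap_iff[OF C'] overlap_iff[OF D] local_rep_apply transition_apply chD[OF C] chD[OF D])
  hence "smooth_on V (rep f c' d')"
   by (rule smooth_cong'[OF _ oV])
    (auto simp: V_def local_dom_iff[OF C'] overlap_iff[OF C'] intro!: local_rep_chart_change(1)[OF C C' D])
  thus "\<exists>U. x\<in>U \<and> smooth_on U (rep f c' d')" using xV by blast
 qed
qed

lemma smooth_mapD: "smooth_map A B f ==> c\<in>A ==> d\<in>B ==> smooth_on (ldom f c d) (rep f c d)"
 and smooth_map_cont: "smooth_map A B f ==> continuous_on UNIV f"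
 by (auto simp: smooth_map_def)

section \<open>Bump functions and partitions of unity on manifolds\<close>

definition mbump :: "('x, 'k::finite) chart => real^'k => real => 'x => real" where
 "mbump c a r p = (if p\<in>cdom c then bump a r (cm c p) else 0)"

definition mball :: "('x, 'k::finite) chart => real^'k => real => 'x set" where
 "mball c a r = ci c ` cball a r"

context
 fixes A :: "('x::{t2_space, second_countable_topology}, 'k::finite) chart set" and c :: "('x, 'k) chart" and a r
 assumes A: "smooth_atlas A" and c: "c\<in>A" and r: "0 < r" and sub: "cball a r \<subseteq> cimg c"
begin

private lemma C: "is_chart c" by (rule atlas_chart[OF A c])

lemma mball_iff: "p\<in>mball c a r \<longleftrightarrow> p\<in>cdom c \<and> cm c p\<in>cball a r"
 unfolding mball_def proof
 assume "p\<in>ci c ` cball a r"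
 then obtain x where "p = ci c x" "x\<in>cball a r" by blast
 moreover from this have "x\<in>cimg c" using sub by blast
 ultimately show "p\<in>cdom c \<and> cm c p\<in>cball a r" by (simp add: chD[OF C])
next
 assume "p\<in>cdom c \<and> cm c p\<in>cball a r"
 thus "p\<in>ci c ` cball a r" by (intro image_eqI[of _ _ "cm c p"]) (simp_all add: chD[OF C])
qed

lemma compact_mball: "compact (mball c a r)"
 unfolding mball_def
 by (intro compact_continuous_image continuous_on_subset[OF chD(8)[OF C] sub] compact_cball)

lemma closed_mball: "closed (mball c a r)"
 by (rule compact_imp_closed[OF compact_mball])

lemma mbump_outside: "p \<notin> mball c a r ==> mbump c a r p = 0"
 using r by (auto simp: mball_iff mbump_def intro: bump_eq_0)

lemma mbump_pos: "p\<in>cdom c ==> dist a (cm c p) < r ==> mbump c a r p > 0"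
 by (simp add: mbump_def bump_pos)

lemma mbump_nonneg: "mbump c a r p \<ge> 0"
 by (simp add: mbump_def bump_nonneg)

text \<open>A coordinate ball is compact, hence closed in the Hausdorff space; so around a point
  outside the chart domain the function vanishes identically.\<close>

lemma smooth_mbump: "d\<in>A ==> smooth_on (cimg d) (mbump c a r \<circ> ci d)"
proof (rule smooth_locally)
 fix x assume d: "d\<in>A" and x: "x\<in>cimg d"
 note D = atlas_chart[OF A d]
 show "\<exists>U. x\<in>U \<and> smooth_on U (mbump c a r \<circ> ci d)"
 proof (cases "ci d x\<in>cdom c")
  case True
  have "smooth_on (overlap d c) (%x. bump a r (trn d c x))"
   by (rule smooth_compose[OF smooth_bump[of UNIV] smooth_transition[OF A d c] open_overlap[OF D C]]) auto
  hence "smooth_on (overlap d c) (mbump c a r \<circ> ci d)"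
   by (rule smooth_cong'[OF _ open_overlap[OF D C]]) (simp add: mbump_def overlap_iff[OF D] transition_apply)
  thus ?thesis using True x by (intro exI[of _ "overlap d c"]) (simp add: overlap_iff[OF D])
 next
  case False
  let ?U = "{x\<in>cimg d. ci d x\<in>- mball c a r}"
  have op: "open ?U" by (intro open_chart_image D open_Compl closed_mball)
  have "smooth_on ?U (mbump c a r \<circ> ci d)"
   by (rule smooth_cong'[OF smooth_const[of _ 0] op]) (simp add: mbump_outside)
  moreover have "x\<in>?U" using False x by (simp add: mball_iff)
  ultimately show ?thesis by (intro exI[of _ ?U] conjI)
 qed
qed

end

text \<open>Radii are chosen for all centres, but finitely many open coordinate balls already cover.
  The closed balls of the same radii, which carry the bump functions, still lie in the chart and in
  \<open>Ob q\<close>.\<close>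

lemma finite_bump_cover:
 fixes A :: "('x::{t2_space, second_countable_topology}, 'k::finite) chart set"
 assumes A: "smooth_atlas A" and cmp: "compact (UNIV :: 'x set)"
  and c: "!!q. c q\<in>A" "!!q. q\<in>cdom (c q)" and O: "!!q. open (Ob q)" "!!q. q\<in>Ob q"
 obtains F r where "finite F" "!!q. r q > 0" "!!q. cball (cm (c q) q) (r q) \<subseteq> cimg (c q)"
  "!!q. mball (c q) (cm (c q) q) (r q) \<subseteq> Ob q"
  "!!p. \<exists>q\<in>F. p\<in>cdom (c q) \<and> dist (cm (c q) q) (cm (c q) p) < r q"
proof -
 have "\<exists>r>0. cball (cm (c q) q) r \<subseteq> {x\<in>cimg (c q). ci (c q) x\<in>Ob q}" for q
  by (rule open_contains_cball[THEN iffD1, rule_format, OF open_chart_image[OF atlas_chart[OF A c(1)] O(1)]])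
   (use chD[OF atlas_chart[OF A c(1)]] c(2) O(2) in auto)
 then obtain r where r: "!!q. r q > 0" "!!q. cball (cm (c q) q) (r q) \<subseteq> {x\<in>cimg (c q). ci (c q) x\<in>Ob q}"
  by metis
 have sub: "cball (cm (c q) q) (r q) \<subseteq> cimg (c q)" for q using r(2)[of q] by blast
 define B where "B q = {p\<in>cdom (c q). cm (c q) p\<in>ball (cm (c q) q) (r q)}" for q
 have "open (B q)" for q unfolding B_def by (intro open_chart_vimage atlas_chart[OF A c(1)] open_ball)
 moreover have "(UNIV :: 'x set) \<subseteq> (\<Union>q\<in>UNIV. B q)" using c(2) r(1) by (auto simp: B_def)
 ultimately obtain F where F: "finite F" "(UNIV :: 'x set) \<subseteq> (\<Union>q\<in>F. B q)"
  using compactE_image[OF cmp, of UNIV B] by metis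
 show thesis
 proof (rule that[OF F(1) r(1) sub])
  show "mball (c q) (cm (c q) q) (r q) \<subseteq> Ob q" for q using r(2)[of q] by (auto simp: mball_def)
  show "\<exists>q\<in>F. p\<in>cdom (c q) \<and> dist (cm (c q) q) (cm (c q) p) < r q" for p
   using F(2) by (auto simp: B_def)
 qed
qed

lemma partition_of_unity_exists:
 fixes A :: "('x::{t2_space, second_countable_topology}, 'k::finite) chart set"
 assumes A: "smooth_atlas A" and cmp: "compact (UNIV :: 'x set)"
 shows "\<exists>P. partition_of_unity A P"
proof -
 define c where "c = chart_at A"
 have c: "!!q. c q\<in>A" "!!q. q\<in>cdom (c q)" using chart_at_in[OF A] by (auto simp: c_def)
 obtain F r where F: "finite F" "!!q. r q > 0" "!!q. cball (cm (c q) q) (r q) \<subseteq> cimg (c q)"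
  "!!p. \<exists>q\<in>F. p\<in>cdom (c q) \<and> dist (cm (c q) q) (cm (c q) p) < r q"
  using finite_bump_cover[OF A cmp c, of "%_. UNIV"] by (metis UNIV_I open_UNIV)
 define b where "b q = mbump (c q) (cm (c q) q) (r q)" for q
 define s where "s p = (\<Sum>q\<in>F. b q p)" for p
 have b0: "b q p \<ge> 0" for q p unfolding b_def by (rule mbump_nonneg[OF A c(1) F(2,3)])
 have s: "s p > 0" for p
 proof -
  obtain q where "q\<in>F" "b q p > 0"
   using F(4)[of p] mbump_pos[OF A c(1) F(2,3)] unfolding b_def by blast
  thus ?thesis unfolding s_def using F(1) b0 by (meson sum_pos2)
 qed
 \<comment> \<open>A partition of unity is indexed by charts, and several centres may share a chart;
   their bump functions are added.\<close>
 define \<theta> where "\<theta> d p = (\<Sum>q\<in>{q\<in>F. c q = d}. b q p) / s p" for d p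
 have sb: "smooth_on (cimg d) (%x. b q (ci d x))" if "d\<in>A" for q d
  using smooth_mbump[OF A c(1) F(2,3) that] by (simp add: b_def o_def)
 have "partition_of_unity A (c ` F, \<theta>)"
  unfolding partition_of_unity_def
 proof (simp, intro conjI ballI allI)
  show "finite (c ` F)" "c ` F \<subseteq> A" using F(1) c(1) by auto
  show "0 \<le> \<theta> (c q) p" for q p unfolding \<theta>_def using s[of p] b0 by (intro divide_nonneg_pos sum_nonneg) auto
  show "closure {p. \<theta> (c q) p \<noteq> 0} \<subseteq> cdom (c q)" if "q\<in>F" for q
  proof -
   let ?K = "\<Union>q'\<in>{q'\<in>F. c q' = c q}. mball (c q') (cm (c q') q') (r q')"
   have "{p. \<theta> (c q) p \<noteq> 0} \<subseteq> ?K"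
   proof
    fix p assume "p\<in>{p. \<theta> (c q) p \<noteq> 0}"
    hence "(\<Sum>q'\<in>{q'\<in>F. c q' = c q}. b q' p) \<noteq> 0" by (auto simp: \<theta>_def)
    then obtain q' where "q'\<in>{q'\<in>F. c q' = c q}" "b q' p \<noteq> 0" by (meson sum.neutral)
    thus "p\<in>?K" using mbump_outside[OF A c(1) F(2,3)] unfolding b_def by blast
   qed
   moreover have "closed ?K"
    by (intro closed_UN ballI closed_mball[OF A c(1) F(2,3)] finite_subset[OF _ F(1)] subsetI) blast
   moreover have "?K \<subseteq> cdom (c q)" 
   proof (rule UN_least)
    fix q' assume "q'\<in>{q'\<in>F. c q' = c q}"
    hence "c q' = c q" by blast
    moreover have "mball (c q') (cm (c q') q') (r q') \<subseteq> cdom (c q')"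
     using mball_iff[OF A c(1) F(2,3)] by blast
    ultimately show "mball (c q') (cm (c q') q') (r q') \<subseteq> cdom (c q)" by metis
   qed
   ultimately show ?thesis using closure_minimal by blast
  qed
  show "smooth_on (cimg d) (\<theta> (c q) \<circ> ci d)" if "d\<in>A" for q d
   unfolding \<theta>_def o_def s_def
   using s unfolding s_def
   by (intro smooth_divide chD(2)[OF atlas_chart[OF A that]] smooth_sum sb that)
    (metis less_irrefl)
  show "(\<Sum>d\<in>c ` F. \<theta> d p) = 1" for p
  proof -
   have "(\<Sum>d\<in>c ` F. \<theta> d p) = (\<Sum>d\<in>c ` F. \<Sum>q\<in>{q\<in>F. c q = d}. b q p) / s p"
    unfolding \<theta>_def by (simp add: sum_divide_distrib)
   also have "(\<Sum>d\<in>c ` F. \<Sum>q\<in>{q\<in>F. c q = d}. b q p) = s p"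
    unfolding s_def by (rule sum.image_gen[OF F(1), symmetric])
   finally show ?thesis using s[of p] by simp
  qed
 qed
 thus ?thesis by blast
qed

section \<open>Totally real immersions\<close>

text \<open>The complex combination with coefficients \<open>u + i v\<close> is
  \<open>D u + A (D v)\<close>. Its injectivity amounts to that of \<open>D\<close> together with
  the trivial intersection, its surjectivity to the spanning condition.\<close>

lemma cbasis_totally_real:
 fixes D :: "real^'n::finite => real^'m::finite"
 assumes D: "linear D" and A: "A ** A = - mat 1"
 shows "cbasis A (%i. D (axis i 1)) \<longleftrightarrow> inj D \<and> range D \<inter> (%v. A *v v) ` range D = {0} \<and>
  {u + v |u v. u\<in>range D \<and> v\<in>(%v. A *v v) ` range D} = UNIV"
proof -
 have comb: "comb A (%i. D (axis i 1)) z = D (\<chi> i. Re (z$i)) + A *v D (\<chi> i. Im (z$i))" for z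
  using axis_expansion[OF D, of "\<chi> i. Re (z$i)"] axis_expansion[OF D, of "\<chi> i. Im (z$i)"]
  by (simp add: comb_def cscale_def sum.distrib linear_sum[OF matrix_vector_mul_linear] matrix_vector_mult_scaleR)
 have comb': "comb A (%i. D (axis i 1)) (\<chi> i. Complex (u$i) (v$i)) = D u + A *v D v" for u v
  by (simp add: comb)
 have Dz: "D 0 = 0" by (rule linear_0[OF D])
 have Az: "A *v x = 0 ==> x = 0" for x
 proof -
  assume "A *v x = 0"
  hence "(A ** A) *v x = 0" by (simp add: matrix_vector_mul_assoc[symmetric])
  thus "x = 0" by (simp add: A mv_minus_left)
 qed
 show ?thesis
 proof
  assume cb: "cbasis A (%i. D (axis i 1))"
  hence inj: "inj (comb A (%i. D (axis i 1)))" and surj: "surj (comb A (%i. D (axis i 1)))"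
   by (auto simp: cbasis_def bij_def)
  have uv: "u = 0 \<and> v = 0" if "D u + A *v D v = 0" for u v
  proof -
   have "comb A (%i. D (axis i 1)) (\<chi> i. Complex (u$i) (v$i)) = comb A (%i. D (axis i 1)) 0"
    using that unfolding comb' by (simp add: linear_0[OF linear_comb])
   hence "(\<chi> i. Complex (u$i) (v$i)) = 0" by (rule injD[OF inj])
   thus ?thesis by (simp add: vec_eq_iff complex_eq_iff)
  qed
  have "inj D" using uv[of _ 0] unfolding linear_injective_0[OF D] by (simp add: Dz)
  moreover have "range D \<inter> (%v. A *v v) ` range D = {0}"
  proof
   show "{0} \<subseteq> range D \<inter> (%v. A *v v) ` range D" 
   proof -
    have "0\<in>range D" "0\<in>(%v. A *v v) ` range D" using rangeI[of D 0] imageI[OF rangeI[of D 0], of "%v. A *v v"] Dz by simp_all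
    thus ?thesis by simp
   qed
   show "range D \<inter> (%v. A *v v) ` range D \<subseteq> {0}"
   proof
    fix y assume "y\<in>range D \<inter> (%v. A *v v) ` range D"
    then obtain u v where "y = D u" "y = A *v D v" by blast
    hence "D (- u) + A *v D v = 0" by (simp add: linear_neg[OF D])
    hence "u = 0" using uv by fastforce
    thus "y\<in>{0}" using \<open>y = D u\<close> Dz by simp
   qed
  qed
  moreover have "{u + v |u v. u\<in>range D \<and> v\<in>(%v. A *v v) ` range D} = UNIV"
  proof -
   have "\<exists>u v. y = u + v \<and> u\<in>range D \<and> v\<in>(%v. A *v v) ` range D" for y
   proof -
    obtain z where "y = comb A (%i. D (axis i 1)) z" using surj by (metis surjD)
    thus ?thesis unfolding comb by blast
   qed
   thus ?thesis by auto
  qed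
  ultimately show "inj D \<and> range D \<inter> (%v. A *v v) ` range D = {0} \<and>
   {u + v |u v. u\<in>range D \<and> v\<in>(%v. A *v v) ` range D} = UNIV" by blast
 next
  assume R: "inj D \<and> range D \<inter> (%v. A *v v) ` range D = {0} \<and>
   {u + v |u v. u\<in>range D \<and> v\<in>(%v. A *v v) ` range D} = UNIV"
  have "z = 0" if "comb A (%i. D (axis i 1)) z = 0" for z
  proof -
   let ?u = "\<chi> i. Re (z$i)" and ?v = "\<chi> i. Im (z$i)"
   have "A *v D ?v = D (- ?u)" using that unfolding comb by (simp add: linear_neg[OF D] eq_neg_iff_add_eq_0 add.commute)
   hence "D (- ?u)\<in>range D \<inter> (%v. A *v v) ` range D" by (metis IntI image_eqI rangeI)
   hence 1: "D (- ?u) = 0" using R by blast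
   hence "D ?v = 0" using \<open>A *v D ?v = D (- ?u)\<close> Az by metis
   hence "?v = 0" "- ?u = 0" using R 1 linear_injective_0[OF D] by blast+
   thus "z = 0" by (simp add: vec_eq_iff complex_eq_iff)
  qed
  hence "inj (comb A (%i. D (axis i 1)))" unfolding linear_injective_0[OF linear_comb] by blast
  moreover have "\<exists>z. y = comb A (%i. D (axis i 1)) z" for y
  proof -
   have "y\<in>{u + v |u v. u\<in>range D \<and> v\<in>(%v. A *v v) ` range D}" using R by blast
   then obtain u v where "y = D u + A *v D v" by auto
   thus ?thesis using comb'[of u v] by metis
  qed
  hence "surj (comb A (%i. D (axis i 1)))" by blast
  ultimately show "cbasis A (%i. D (axis i 1))" by (simp add: cbasis_def bij_def)
 qed
qed

lemma totally_real_immersion_iff: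
 fixes AM :: "('p::topological_space, 'm::finite) chart set" and AL :: "('l::topological_space, 'n::finite) chart set"
 assumes JJ: "!!d y. d\<in>AM ==> y\<in>cimg d ==> J d y ** J d y = - mat 1"
  and charts: "!!d. d\<in>AM ==> is_chart d" "!!c. c\<in>AL ==> is_chart c"
 shows "totally_real_immersion AL AM J f \<longleftrightarrow> smooth_map AL AM f \<and>
  (\<forall>c\<in>AL. \<forall>d\<in>AM. \<forall>x\<in>ldom f c d. cbasis (J d (rep f c d x)) (%i. pd i (rep f c d) x))"
proof -
 have "cbasis (J d (rep f c d x)) (%i. pd i (rep f c d) x) \<longleftrightarrow>
   inj (fd (rep f c d) x) \<and> (let T = range (fd (rep f c d) x);
      JT = (%v. J d (rep f c d x) *v v) ` T
    in T \<inter> JT = {0} \<and> {u + v |u v. u\<in>T \<and> v\<in>JT} = UNIV)"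
  if "smooth_map AL AM f" "c\<in>AL" "d\<in>AM" "x\<in>ldom f c d" for c d x
 proof -
  have "rep f c d x\<in>cimg d"
   using that(4) charts that by (simp add: local_dom_iff local_rep_apply chD)
  from cbasis_totally_real[OF linear_deriv[OF smooth_mapD[OF that(1,2,3)] that(4)] JJ[OF that(3) this]]
  show ?thesis unfolding pd_def Let_def .
 qed
 thus ?thesis unfolding totally_real_immersion_def immersion_def by blast
qed

section \<open>The gauge function of a J-minimal immersion\<close>

lemma bilinear_form_transition:
 assumes A: "smooth_atlas A" and b: "bilinear_form_field A b" and cd: "c\<in>A" "d\<in>A" "x\<in>overlap c d"
 shows "u \<bullet> (b c x *v v) = fd (trn c d) x u \<bullet> (b d (trn c d x) *v fd (trn c d) x v)"
proof -
 let ?D = "jacobian (trn c d) (at x)"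
 have "b c x = transpose ?D ** b d (trn c d x) ** ?D"
  using b cd unfolding bilinear_form_field_def Let_def by blast
 hence "u \<bullet> (b c x *v v) = u \<bullet> (transpose ?D *v (b d (trn c d x) *v (?D *v v)))"
  by (simp add: matrix_vector_mul_assoc[symmetric] del: transpose_matrix_vector)
 thus ?thesis by (simp only: inner_transpose_mv jacobian_transition[OF A cd])
qed

lemma endomorphism_transition:
 assumes A: "smooth_atlas A" and J: "endomorphism_field A J" and cd: "c\<in>A" "d\<in>A" "x\<in>overlap c d"
 shows "fd (trn c d) x (J c x *v v) = J d (trn c d x) *v fd (trn c d) x v"
proof -
 let ?D = "jacobian (trn c d) (at x)"
 have "?D ** J c x = J d (trn c d x) ** ?D"
  using J cd unfolding endomorphism_field_def Let_def by blast
 hence "?D *v (J c x *v v) = J d (trn c d x) *v (?D *v v)"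
  by (simp add: matrix_vector_mul_assoc)
 thus ?thesis by (simp only: jacobian_transition[OF A cd])
qed

lemma kaehler_chart_of:
 assumes K: "kaehler A J g \<omega>" and d: "d\<in>A"
 shows "kaehler_chart (cimg d) (J d) (g d)"
proof -
 have A: "smooth_atlas A" and J: "complex_structure A J" and g: "riemannian_metric A g" and w: "closed_two_form A \<omega>"
  and c: "!!x. x\<in>cimg d ==> transpose (J d x) ** g d x ** J d x = g d x \<and> \<omega> d x = transpose (J d x) ** g d x"
  using K d unfolding kaehler_def by auto
 note D = atlas_chart[OF A d]
 show ?thesis
 proof
  fix i j k y assume y: "y\<in>cimg d"
  have "pd i (%y. (transpose (J d y) ** g d y)$j$k) y = pd i (%y. \<omega> d y$j$k) y" for i j k
   unfolding pd_def using fd_cong[OF chD(2)[OF D] y, of "%y. \<omega> d y$j$k" "%y. (transpose (J d y) ** g d y)$j$k"] c by simp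
  thus "pd i (%y. (transpose (J d y) ** g d y)$j$k) y
   + pd j (%y. (transpose (J d y) ** g d y)$k$i) y + pd k (%y. (transpose (J d y) ** g d y)$i$j) y = 0"
   using w d y unfolding closed_two_form_def by simp
 qed (use J g c d chD(2)[OF D] in \<open>auto simp: complex_structure_def riemannian_metric_def endomorphism_field_def bilinear_form_field_def\<close>)
qed

locale kaehler_negative =
 fixes AM :: "('p::{t2_space, second_countable_topology}, 'm::finite) chart set"
  and J g \<omega> :: "('p, 'm) tensor2"
  and AL :: "('l::{t2_space, second_countable_topology}, 'n::finite) chart set"
 assumes dims: "CARD('m) = 2 * CARD('n)" and kae: "kaehler AM J g \<omega>" and neg: "negative_ricci AM g"
  and cmp: "compact (UNIV :: 'l set)" and ori: "oriented_atlas AL"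
begin

lemma aM: "smooth_atlas AM" and aL: "smooth_atlas AL"
 using kae ori by (auto simp: kaehler_def oriented_atlas_def)

lemmas chM = atlas_chart[OF aM] and chL = atlas_chart[OF aL]

lemma KC: "d\<in>AM ==> kaehler_chart (cimg d) (J d) (g d)"
 by (rule kaehler_chart_of[OF kae])

lemma g_transition: "d\<in>AM ==> d'\<in>AM ==> y\<in>overlap d d' ==>
  u \<bullet> (g d y *v v) = fd (trn d d') y u \<bullet> (g d' (trn d d' y) *v fd (trn d d') y v)"
 using kae by (intro bilinear_form_transition[OF aM]) (auto simp: kaehler_def riemannian_metric_def)

lemma J_transition: "d\<in>AM ==> d'\<in>AM ==> y\<in>overlap d d' ==>
  fd (trn d d') y (J d y *v v) = J d' (trn d d' y) *v fd (trn d d') y v"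
 using kae by (intro endomorphism_transition[OF aM]) (auto simp: kaehler_def complex_structure_def)

text \<open>
 The Euler-Lagrange equation of the J-volume, written with the real-linear Christoffel symbols of
 the target chart.
\<close>

definition maslov_zero :: "('l => 'p) => bool" where
 "maslov_zero f \<longleftrightarrow> smooth_map AL AM f \<and> (\<forall>c\<in>AL. \<forall>d\<in>AM. \<forall>x\<in>ldom f c d.
   cbasis (J d (rep f c d x)) (%i. pd i (rep f c d) x) \<and>
   kaehler_chart.xi0 (J d) (g d) (rep f c d) x)"

end

text \<open>The data from which the gauge function is patched: around every \<open>q\<close> a
  closed coordinate ball that \<open>\<iota>\<close> maps into a single target chart, such that the
  open balls with centres in \<open>F\<close> cover \<open>L\<close>.\<close>

locale gauge_data = kaehler_negative AM J g \<omega> AL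
 for AM :: "('p::{t2_space, second_countable_topology}, 'm::finite) chart set"
  and J g \<omega> :: "('p, 'm) tensor2"
  and AL :: "('l::{t2_space, second_countable_topology}, 'n::finite) chart set" +
 fixes \<iota> :: "'l => 'p" and F :: "'l set" and r :: "'l => real"
 assumes mi: "maslov_zero \<iota>" and finF: "finite F" and r: "r q > 0"
  and balls: "cball (cm (chart_at AL q) q) (r q) \<subseteq> cimg (chart_at AL q)"
  and ball_dom: "mball (chart_at AL q) (cm (chart_at AL q) q) (r q) \<subseteq> \<iota> -` cdom (chart_at AM (\<iota> q))"
  and cover: "\<exists>q\<in>F. p\<in>cdom (chart_at AL q) \<and> dist (cm (chart_at AL q) q) (cm (chart_at AL q) p) < r q"

lemma (in kaehler_negative) gauge_data_exists:
 assumes "maslov_zero \<iota>"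
 shows "\<exists>F r. gauge_data AM J g \<omega> AL \<iota> F r"
proof -
 have sm: "continuous_on UNIV \<iota>" using assms by (simp add: maslov_zero_def smooth_map_def)
 have "open (\<iota> -` cdom (chart_at AM (\<iota> q)))" for q
  using chD(1)[OF chM[OF chart_at_in(1)[OF aM]]] sm by (simp add: continuous_on_open_vimage)
 moreover have "q\<in>\<iota> -` cdom (chart_at AM (\<iota> q))" for q using chart_at_in(2)[OF aM] by blast
 ultimately show ?thesis
 proof (rule finite_bump_cover[OF aL cmp chart_at_in[OF aL]])
  fix F r
  assume "finite F" "!!q. r q > 0" "!!q. cball (cm (chart_at AL q) q) (r q) \<subseteq> cimg (chart_at AL q)"
   "!!q. mball (chart_at AL q) (cm (chart_at AL q) q) (r q) \<subseteq> \<iota> -` cdom (chart_at AM (\<iota> q))"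
   "!!p. \<exists>q\<in>F. p\<in>cdom (chart_at AL q) \<and> dist (cm (chart_at AL q) q) (cm (chart_at AL q) p) < r q"
  hence "gauge_data AM J g \<omega> AL \<iota> F r" using assms by unfold_locales assumption+
  thus ?thesis by blast
 qed
qed

section \<open>Patching the raw gauge functions\<close>

context gauge_data
begin

definition cq where "cq q = chart_at AL q"
definition dq where "dq q = chart_at AM (\<iota> q)"
definition ctr where "ctr q = cm (cq q) q"
definition Kq where "Kq q = mball (cq q) (ctr q) (r q)"
definition bq where "bq q = mbump (cq q) (ctr q) (r q)"
definition \<theta> where "\<theta> q p = bq q p / (\<Sum>q\<in>F. bq q p)"

lemma cq: "cq q\<in>AL" and dq: "dq q\<in>AM"
 by (simp_all add: cq_def dq_def chart_at_in aL aM)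

lemmas chc = chL[OF cq] and chd = chM[OF dq]

lemma sm\<iota>: "smooth_map AL AM \<iota>" and cont\<iota>: "continuous_on UNIV \<iota>"
 using mi by (auto simp: maslov_zero_def smooth_map_def)

lemma balls': "cball (ctr q) (r q) \<subseteq> cimg (cq q)"
 using balls by (simp add: cq_def ctr_def)

lemma Kq_iff: "p\<in>Kq q \<longleftrightarrow> p\<in>cdom (cq q) \<and> cm (cq q) p\<in>cball (ctr q) (r q)"
 unfolding Kq_def by (rule mball_iff[OF aL cq r balls'])

lemma Kq_dom: "p\<in>Kq q ==> p\<in>cdom (cq q)"
 by (simp add: Kq_iff)

lemma Kq_\<iota>: "p\<in>Kq q ==> \<iota> p\<in>cdom (dq q)"
 using ball_dom[of q] by (auto simp: Kq_def dq_def cq_def ctr_def)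

lemma closed_Kq: "closed (Kq q)"
 unfolding Kq_def by (rule closed_mball[OF aL cq r balls'])

lemma bq_sum_pos: "(\<Sum>q\<in>F. bq q p) > 0"
proof -
 obtain q where "q\<in>F" "bq q p > 0"
  using cover[of p] mbump_pos[OF aL cq r balls', folded cq_def] unfolding bq_def cq_def ctr_def by blast
 thus ?thesis using finF mbump_nonneg[OF aL cq r balls'] unfolding bq_def by (meson sum_pos2)
qed

lemma \<theta>_sum: "(\<Sum>q\<in>F. \<theta> q p) = 1"
 using bq_sum_pos[of p] by (simp add: \<theta>_def sum_divide_distrib[symmetric])

lemma \<theta>_0: "p \<notin> Kq q ==> \<theta> q p = 0"
 using mbump_outside[OF aL cq r balls'] by (simp add: \<theta>_def bq_def Kq_def)

lemma smooth_\<theta>: "c\<in>AL ==> smooth_on (cimg c) (%x. \<theta> q (ci c x))"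
proof -
 assume c: "c\<in>AL"
 have b: "smooth_on (cimg c) (%x. bq q (ci c x))" for q
  using smooth_mbump[OF aL cq r balls' c] by (simp add: bq_def o_def)
 show ?thesis unfolding \<theta>_def
  using bq_sum_pos by (intro smooth_divide chD(2)[OF chL[OF c]] smooth_sum b) (metis less_irrefl)
qed

lemma \<theta>_sum': "(\<Sum>q\<in>{q\<in>F. p\<in>Kq q}. \<theta> q p) = 1"
 unfolding \<theta>_sum[of p, symmetric] by (rule sum.mono_neutral_left) (auto simp: finF \<theta>_0)

text \<open>The raw gauge function in the charts at \<open>q\<close> yields a tangent vector at
  \<open>p\<close> in the coordinates of \<open>cq q\<close>. The derivative of the transition
  writes it in the chart \<open>c\<close>, where the contributions of different \<open>q\<close> can
  be added.\<close>

definition raw where "raw q c p y = fd (trn (cq q) c) (cm (cq q) p)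
  (kaehler_chart.rawg (J (dq q)) (g (dq q)) (rep \<iota> (cq q) (dq q)) (cm (cq q) p, cm (dq q) y))"

definition Phi where "Phi c p y = (\<Sum>q\<in>F. \<theta> q p *\<^sub>R raw q c p y)"

text \<open>A centre with \<open>p \<notin> Kq q\<close> has weight 0, so only the target charts of
  the remaining centres have to contain \<open>y\<close>. The set is open because the
  \<open>Kq q\<close> are closed.\<close>

definition \<Omega> where "\<Omega> = {(p, y). \<forall>q\<in>F. p\<in>Kq q --> y\<in>cdom (dq q)}"

definition Ph where "Ph c d = (%(x, z). Phi c (ci c x) (ci d z))"

definition Wcd where "Wcd c d = {(x, z). x\<in>ldom \<iota> c d \<and> z\<in>cimg d \<and> (ci c x, ci d z)\<in>\<Omega>}"

lemma open_\<Omega>: "open \<Omega>"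
proof -
 have "\<Omega> = (\<Inter>q\<in>F. (- Kq q) \<times> UNIV \<union> UNIV \<times> cdom (dq q))"
  by (auto simp: \<Omega>_def)
 thus ?thesis
  using finF by (auto intro!: open_INT open_Un open_Times closed_Kq chD(1)[OF chd])
qed

lemma graph_\<Omega>: "(p, \<iota> p)\<in>\<Omega>"
 using Kq_\<iota> by (auto simp: \<Omega>_def)

lemma open_Wcd:
 assumes c: "c\<in>AL" and d: "d\<in>AM"
 shows "open (Wcd c d)"
proof -
 note C = chL[OF c] and D = chM[OF d]
 let ?S = "ldom \<iota> c d \<times> cimg d"
 have oS: "open ?S" by (intro open_Times open_local_dom C D cont\<iota> chD(2))
 have "continuous_on ?S (%(x, z). (ci c x, ci d z))"
  unfolding split_beta
  by (intro continuous_on_Pair continuous_on_compose2[OF chD(8)[OF C]] continuous_on_compose2[OF chD(8)[OF D]] continuous_intros)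
   (auto simp: local_dom_iff[OF C])
 from continuous_open_preimage[OF this oS open_\<Omega>]
 have "open (?S \<inter> (%(x, z). (ci c x, ci d z)) -` \<Omega>)" .
 moreover have "?S \<inter> (%(x, z). (ci c x, ci d z)) -` \<Omega> = Wcd c d" by (auto simp: Wcd_def)
 ultimately show ?thesis by simp
qed

context
 fixes c d assumes c: "c\<in>AL" and d: "d\<in>AM"
begin

private lemma C: "is_chart c" and D: "is_chart d" using chL[OF c] chM[OF d] by auto

definition dom2 where "dom2 q = {x\<in>overlap c (cq q). ci c x\<in>\<iota> -` cdom (dq q)}"

lemma dom2_iff: "x\<in>dom2 q \<longleftrightarrow> x\<in>cimg c \<and> ci c x\<in>cdom (cq q) \<and> \<iota> (ci c x)\<in>cdom (dq q)"
 by (auto simp: dom2_def overlap_iff[OF C])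

lemma open_dom2: "open (dom2 q)"
proof -
 have "dom2 q = overlap c (cq q) \<inter> {x\<in>cimg c. ci c x\<in>\<iota> -` cdom (dq q)}"
  by (auto simp: dom2_iff overlap_iff[OF C])
 moreover have "open (\<iota> -` cdom (dq q))"
  using chD(1)[OF chd] cont\<iota> by (simp add: continuous_on_open_vimage)
 ultimately show ?thesis using open_overlap[OF C chc, of q] open_chart_image[OF C, of "\<iota> -` cdom (dq q)"] by (simp add: open_Int)
qed

lemma dom2_trans: "x\<in>dom2 q ==> trn c (cq q) x\<in>ldom \<iota> (cq q) (dq q)"
 by (auto simp: dom2_iff local_dom_iff[OF chc] transition_apply chD[OF chc])

lemma smooth_rep_q: "smooth_on (ldom \<iota> (cq q) (dq q)) (rep \<iota> (cq q) (dq q))"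
 by (rule smooth_mapD[OF sm\<iota> cq dq])

lemma rep_q_img: "x\<in>ldom \<iota> (cq q) (dq q) ==> rep \<iota> (cq q) (dq q) x\<in>cimg (dq q)"
 by (simp add: local_dom_iff[OF chc] local_rep_apply chD[OF chd])

lemma cbasis_q: "x\<in>ldom \<iota> (cq q) (dq q) ==>
  cbasis (J (dq q) (rep \<iota> (cq q) (dq q) x)) (%i. pd i (rep \<iota> (cq q) (dq q)) x)"
 using mi cq dq by (simp add: maslov_zero_def)

lemma smooth_raw: "smooth_on (dom2 q \<times> overlap d (dq q)) (%(x, z). raw q c (ci c x) (ci d z))"
proof -
 interpret K: kaehler_chart "cimg (dq q)" "J (dq q)" "g (dq q)" by (rule KC[OF dq])
 let ?S = "dom2 q \<times> overlap d (dq q)" and ?f = "rep \<iota> (cq q) (dq q)"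
 have S: "open ?S" by (intro open_Times open_dom2 open_overlap D chd)
 have t: "smooth_on ?S (%p. trn c (cq q) (fst p))"
  by (rule smooth_compose[OF smooth_transition[OF aL c cq] smooth_fst[OF S smooth_id] S open_overlap[OF C chc]])
   (auto simp: dom2_def)
 have s: "smooth_on ?S (%p. trn d (dq q) (snd p))"
  by (rule smooth_compose[OF smooth_transition[OF aM d dq] smooth_snd[OF S smooth_id] S open_overlap[OF D chd]]) auto
 have oX: "open (ldom \<iota> (cq q) (dq q))" by (rule open_local_dom[OF chc chd cont\<iota>])
 have R: "smooth_on ?S (%p. K.rawg ?f (trn c (cq q) (fst p), trn d (dq q) (snd p)))"
  by (rule smooth_compose[OF K.smooth_rawg[OF oX smooth_rep_q rep_q_img cbasis_q] smooth_Pair[OF S t s] S])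
   (auto intro: open_Times oX dom2_trans)
 have Dt: "smooth_on ?S (%p. fd (trn (cq q) c) (trn c (cq q) (fst p)) v)" for v
  by (rule smooth_compose[OF smooth_deriv[OF smooth_transition[OF aL cq c]] t S open_overlap[OF chc C]])
   (use transition_overlap(1)[OF C chc] in \<open>auto simp: dom2_def\<close>)
 have "smooth_on ?S (%p. \<Sum>i\<in>UNIV. K.rawg ?f (trn c (cq q) (fst p), trn d (dq q) (snd p))$i *\<^sub>R
   fd (trn (cq q) c) (trn c (cq q) (fst p)) (axis i 1))"
  by (intro smooth_sum smooth_scaleR smooth_vec_nth S R Dt)
 thus ?thesis
 proof (rule smooth_cong'[OF _ S])
  fix p assume p: "p\<in>?S"
  hence 1: "trn c (cq q) (fst p)\<in>overlap (cq q) c" using transition_overlap(1)[OF C chc] by (auto simp: dom2_def)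
  show "(case p of (x, z) => raw q c (ci c x) (ci d z)) =
   (\<Sum>i\<in>UNIV. K.rawg ?f (trn c (cq q) (fst p), trn d (dq q) (snd p))$i *\<^sub>R
    fd (trn (cq q) c) (trn c (cq q) (fst p)) (axis i 1))"
   by (subst axis_expansion[OF transition_linear[OF aL cq c 1], symmetric]) (simp add: split_beta raw_def transition_apply)
 qed
qed

lemma smooth_Ph: "smooth_on (Wcd c d) (Ph c d)"
proof -
 have W: "open (Wcd c d)" by (rule open_Wcd[OF c d])
 have "smooth_on (Wcd c d) (%p. \<theta> q (ci c (fst p)) *\<^sub>R raw q c (ci c (fst p)) (ci d (snd p)))" if q: "q\<in>F" for q
 proof (rule smooth_locally)
  fix p0 assume p0: "p0\<in>Wcd c d"
  let ?t = "%p. \<theta> q (ci c (fst p)) *\<^sub>R raw q c (ci c (fst p)) (ci d (snd p))"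
  show "\<exists>U. p0\<in>U \<and> smooth_on U ?t"
  proof (cases "ci c (fst p0)\<in>Kq q")
   case True
   let ?S = "dom2 q \<times> overlap d (dq q)"
   have S: "open ?S" by (intro open_Times open_dom2 open_overlap D chd)
   have "smooth_on ?S (%p. \<theta> q (ci c (fst p)))"
    by (rule smooth_compose[OF smooth_\<theta>[OF c] smooth_fst[OF S smooth_id] S chD(2)[OF C]]) (auto simp: dom2_iff)
   hence "smooth_on ?S ?t" using smooth_raw[of q] by (intro smooth_scaleR S) (simp_all add: case_prod_unfold)
   moreover have "p0\<in>?S"
   proof -
    obtain x z where xz: "p0 = (x, z)" by (cases p0)
    have "x\<in>cimg c" "z\<in>cimg d" "ci d z\<in>cdom (dq q)"
     using p0 True q unfolding xz Wcd_def \<Omega>_def by (simp_all add: local_dom_iff[OF C])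
    thus ?thesis using Kq_dom[OF True] Kq_\<iota>[OF True] unfolding xz by (simp add: dom2_iff overlap_iff[OF D])
   qed
   ultimately show ?thesis by (intro exI[of _ ?S] conjI)
  next
   case False
   let ?S = "{x\<in>cimg c. ci c x\<in>- Kq q} \<times> (UNIV :: (real^'m) set)"
   have S: "open ?S" by (intro open_Times open_chart_image C open_Compl closed_Kq open_UNIV)
   have "smooth_on ?S ?t" by (rule smooth_cong'[OF smooth_const[of _ 0] S]) (auto simp: \<theta>_0)
   moreover have "p0\<in>?S" using p0 False by (auto simp: Wcd_def local_dom_iff[OF C])
   ultimately show ?thesis by (intro exI[of _ ?S] conjI)
  qed
 qed
 hence "smooth_on (Wcd c d) (%p. Phi c (ci c (fst p)) (ci d (snd p)))"
  unfolding Phi_def by (intro smooth_sum W)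
 thus ?thesis by (simp add: Ph_def case_prod_unfold)
qed

context
 fixes x assumes x: "x\<in>ldom \<iota> c d"
begin

private abbreviation "y0 \<equiv> rep \<iota> c d x"
private abbreviation "\<sigma> q \<equiv> trn d (dq q)"
private abbreviation "D\<sigma> q z \<equiv> fd (trn d (dq q)) z"
private abbreviation "xq q \<equiv> trn c (cq q) x"
private abbreviation "fq q \<equiv> rep \<iota> (cq q) (dq q)"
private abbreviation "Gq q \<equiv> kaehler_chart.Gam (g (dq q)) (fq q (xq q))"
text \<open>\<open>E q\<close> is the tangential projection in the charts at \<open>q\<close>,
  transported to \<open>c\<close>; \<open>D1 q z\<close> is the derivative of the contribution of
  \<open>q\<close> in the target variable.\<close>

private definition "E q v = fd (trn (cq q) c) (xq q) (kaehler_chart.Pf (J (dq q)) (g (dq q)) (fq q) (xq q) v)"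
private definition "D1 q z u = E q (D\<sigma> q z u + Gq q (\<sigma> q z - fq q (xq q)) (D\<sigma> q z u))"
private definition "Fx = {q\<in>F. ci c x\<in>Kq q}"
private definition "Z = {z. (x, z)\<in>Wcd c d}"

private lemma y0: "y0\<in>cimg d" "y0\<in>Z"
 using x graph_\<Omega>[of "ci c x"]
 by (auto simp: Z_def Wcd_def local_dom_iff[OF C] local_rep_apply chD[OF D])

private lemma oZ: "open Z"
proof -
 have "continuous_on UNIV (%z. (x, z))" by (intro continuous_intros)
 from open_vimage[OF open_Wcd[OF c d] this] show ?thesis by (simp add: Z_def vimage_def)
qed

private lemma Fx: "finite Fx" by (simp add: Fx_def finF)

private lemma Fx_dom:
 assumes q: "q\<in>Fx"
 shows "x\<in>dom2 q" "z\<in>Z ==> z\<in>overlap d (dq q)" "xq q\<in>ldom \<iota> (cq q) (dq q)"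
  "xq q\<in>overlap (cq q) c" "fq q (xq q)\<in>cimg (dq q)" "fq q (xq q) = \<sigma> q y0"
  "x\<in>overlap c (cq q)"
proof -
 have k: "ci c x\<in>Kq q" "q\<in>F" using q by (auto simp: Fx_def)
 show 1: "x\<in>dom2 q" using x Kq_dom[OF k(1)] Kq_\<iota>[OF k(1)] by (auto simp: dom2_iff local_dom_iff[OF C])
 show "z\<in>Z ==> z\<in>overlap d (dq q)" using k by (auto simp: Z_def Wcd_def \<Omega>_def overlap_iff[OF D])
 show 2: "xq q\<in>ldom \<iota> (cq q) (dq q)" by (rule dom2_trans[OF 1])
 show 3: "x\<in>overlap c (cq q)" using 1 by (simp add: dom2_def)
 show "xq q\<in>overlap (cq q) c" by (rule transition_overlap(1)[OF C chc 3])
 show "fq q (xq q)\<in>cimg (dq q)" by (rule rep_q_img[OF 2])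
 have "ci c x\<in>cdom (cq q)" "\<iota> (ci c x)\<in>cdom d"
  using 1 x by (auto simp: dom2_iff local_dom_iff[OF C])
 thus "fq q (xq q) = \<sigma> q y0"
  by (simp add: local_rep_apply transition_apply chD[OF chc] chD[OF D])
qed

private lemma linE: "q\<in>Fx ==> linear (E q)"
proof -
 assume q: "q\<in>Fx"
 interpret K: kaehler_chart "cimg (dq q)" "J (dq q)" "g (dq q)" by (rule KC[OF dq])
 show ?thesis unfolding E_def[abs_def]
  using linear_compose[OF K.Pf_lin transition_linear[OF aL cq c Fx_dom(4)[OF q]]] by (simp add: o_def)
qed

text \<open>In the charts at \<open>q\<close> this is \<open>Pf_frame\<close>. The chain rule for
  the two representations of \<open>\<iota>\<close> and the complex linearity of the target
  transition carry it over to \<open>c\<close> and \<open>d\<close>.\<close>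

private lemma E_frame:
 assumes q: "q\<in>Fx"
 shows "E q (D\<sigma> q y0 (pd k (rep \<iota> c d) x)) = axis k 1"
  "E q (D\<sigma> q y0 (J d y0 *v pd k (rep \<iota> c d) x)) = 0"
proof -
 interpret K: kaehler_chart "cimg (dq q)" "J (dq q)" "g (dq q)" by (rule KC[OF dq])
 let ?P = "K.Pf (fq q) (xq q)" and ?D = "fd (trn c (cq q)) x (axis k 1)"
 have yo: "y0\<in>overlap d (dq q)" by (rule Fx_dom(2)[OF q y0(2)])
 have h: "(fq q has_derivative fd (fq q) (xq q)) (at (xq q))"
  by (rule smooth_hd[OF smooth_rep_q Fx_dom(3)[OF q]])
 have "((%x. \<sigma> q (rep \<iota> c d x)) has_derivative (%v. D\<sigma> q y0 (fd (rep \<iota> c d) x v))) (at x)"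
  by (rule has_derivative_compose[OF smooth_hd[OF smooth_mapD[OF sm\<iota> c d] x] smooth_hd[OF smooth_transition[OF aM d dq] yo]])
 moreover have "((%x. \<sigma> q (rep \<iota> c d x)) has_derivative (%v. fd (fq q) (xq q) (fd (trn c (cq q)) x v))) (at x)"
 proof (rule hd_cong[where s="dom2 q \<inter> ldom \<iota> c d"])
  show "((%x. fq q (trn c (cq q) x)) has_derivative (%v. fd (fq q) (xq q) (fd (trn c (cq q)) x v))) (at x)"
   by (rule has_derivative_compose[OF smooth_hd[OF smooth_transition[OF aL c cq] Fx_dom(7)[OF q]] h])
  show "open (dom2 q \<inter> ldom \<iota> c d)" by (intro open_Int open_dom2 open_local_dom C D cont\<iota>)
  show "x\<in>dom2 q \<inter> ldom \<iota> c d" using x Fx_dom(1)[OF q] by simp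
 qed (simp add: dom2_iff local_dom_iff[OF C] local_rep_apply transition_apply chD[OF chc] chD[OF D])
 ultimately have "(%v. D\<sigma> q y0 (fd (rep \<iota> c d) x v)) = (%v. fd (fq q) (xq q) (fd (trn c (cq q)) x v))"
  by (rule has_derivative_unique)
 from trans[OF fun_cong[OF this, of "axis k 1"] frechet_pd[OF smooth_rep_q Fx_dom(3)[OF q]]]
 have 1: "D\<sigma> q y0 (pd k (rep \<iota> c d) x) = (\<Sum>i\<in>UNIV. ?D$i *\<^sub>R pd i (fq q) (xq q))"
  unfolding pd_def .
 note fr = K.Pf_frame[OF Fx_dom(5)[OF q] cbasis_q[OF Fx_dom(3)[OF q]]]
 have "?P (\<Sum>i\<in>UNIV. ?D$i *\<^sub>R pd i (fq q) (xq q)) = (\<Sum>i\<in>UNIV. ?D$i *\<^sub>R axis i 1)"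
  by (simp add: linear_sum[OF K.Pf_lin] linear_scale[OF K.Pf_lin] fr)
 also have "\<dots> = ?D" by (simp add: vec_eq_iff axis_def if_distrib cong: if_cong)
 finally show "E q (D\<sigma> q y0 (pd k (rep \<iota> c d) x)) = axis k 1"
  unfolding 1 E_def by (simp add: transition_deriv_inverse[OF aL c cq Fx_dom(7)[OF q]])
 have "J (dq q) (\<sigma> q y0) *v (\<Sum>i\<in>UNIV. ?D$i *\<^sub>R pd i (fq q) (xq q)) = (\<Sum>i\<in>UNIV. ?D$i *\<^sub>R (J (dq q) (fq q (xq q)) *v pd i (fq q) (xq q)))"
  by (simp add: linear_sum[OF matrix_vector_mul_linear] matrix_vector_mult_scaleR Fx_dom(6)[OF q])
 hence "D\<sigma> q y0 (J d y0 *v pd k (rep \<iota> c d) x) = (\<Sum>i\<in>UNIV. ?D$i *\<^sub>R (J (dq q) (fq q (xq q)) *v pd i (fq q) (xq q)))"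
  unfolding J_transition[OF d dq yo] 1 .
 hence "?P (D\<sigma> q y0 (J d y0 *v pd k (rep \<iota> c d) x)) = 0"
  by (simp add: linear_sum[OF K.Pf_lin] linear_scale[OF K.Pf_lin] fr)
 thus "E q (D\<sigma> q y0 (J d y0 *v pd k (rep \<iota> c d) x)) = 0"
  unfolding E_def by (simp add: linear_0[OF transition_linear[OF aL cq c Fx_dom(4)[OF q]]])
qed

private lemma term_deriv1:
 assumes q: "q\<in>Fx" and z: "z\<in>Z"
 shows "((%z. raw q c (ci c x) (ci d z)) has_derivative D1 q z) (at z)"
proof -
 interpret K: kaehler_chart "cimg (dq q)" "J (dq q)" "g (dq q)" by (rule KC[OF dq])
 have zo: "z\<in>overlap d (dq q)" by (rule Fx_dom(2)[OF q z])
 have "((%z. K.rawg (fq q) (xq q, \<sigma> q z)) has_derivative (%u. K.Pf (fq q) (xq q) (D\<sigma> q z u + Gq q (\<sigma> q z - fq q (xq q)) (D\<sigma> q z u)))) (at z)"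
  by (rule has_derivative_compose[OF smooth_hd[OF smooth_transition[OF aM d dq] zo] K.rawg_derivative[of "fq q" "xq q", OF Fx_dom(5)[OF q]]])
 from bounded_linear.has_derivative[OF transition_linear[OF aL cq c Fx_dom(4)[OF q], unfolded linear_conv_bounded_linear] this]
 have "((%z. fd (trn (cq q) c) (xq q) (K.rawg (fq q) (xq q, \<sigma> q z))) has_derivative D1 q z) (at z)"
  unfolding D1_def[abs_def] E_def .
 thus ?thesis by (simp add: raw_def transition_apply)
qed

text \<open>The second derivative of the transition and the Christoffel symbols of the chart at
  \<open>q\<close> combine into those of \<open>d\<close> by their transformation law. The Hessian
  condition is therefore independent of the chart in which a contribution was built.\<close>

private lemma term_deriv2:
 assumes q: "q\<in>Fx"
 shows "((%z. D1 q z u) has_derivative (%v. E q (D\<sigma> q y0 (kaehler_chart.Gam (g d) y0 v u)))) (at y0)"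
proof -
 interpret K: kaehler_chart "cimg (dq q)" "J (dq q)" "g (dq q)" by (rule KC[OF dq])
 note yq = Fx_dom(5)[OF q]
 have yo: "y0\<in>overlap d (dq q)" by (rule Fx_dom(2)[OF q y0(2)])
 have bb: "bounded_bilinear (Gq q)"
  unfolding bilinear_conv_bounded_bilinear[symmetric] bilinear_def using K.Gam_lin1[OF yq] K.Gam_lin2[OF yq] by auto
 have s1: "((%z. \<sigma> q z - fq q (xq q)) has_derivative D\<sigma> q y0) (at y0)"
  using has_derivative_diff[OF smooth_hd[OF smooth_transition[OF aM d dq] yo] has_derivative_const] by simp
 have s2: "((%z. D\<sigma> q z u) has_derivative fd (%z. D\<sigma> q z u) y0) (at y0)"
  by (rule smooth_hd[OF smooth_deriv[OF smooth_transition[OF aM d dq]] yo])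
 have "((%z. D\<sigma> q z u + Gq q (\<sigma> q z - fq q (xq q)) (D\<sigma> q z u)) has_derivative
   (%v. fd (%z. D\<sigma> q z u) y0 v + (Gq q (\<sigma> q y0 - fq q (xq q)) (fd (%z. D\<sigma> q z u) y0 v) + Gq q (D\<sigma> q y0 v) (D\<sigma> q y0 u)))) (at y0)"
  by (intro has_derivative_add s2 bounded_bilinear.FDERIV[OF bb s1])
 moreover have "fd (%z. D\<sigma> q z u) y0 v + (Gq q (\<sigma> q y0 - fq q (xq q)) (fd (%z. D\<sigma> q z u) y0 v) + Gq q (D\<sigma> q y0 v) (D\<sigma> q y0 u))
   = D\<sigma> q y0 (kaehler_chart.Gam (g d) y0 v u)" for v
 proof -
  have "D\<sigma> q y0 (kaehler_chart.Gam (g d) y0 v u) = kaehler_chart.Gam (g (dq q)) (\<sigma> q y0) (D\<sigma> q y0 v) (D\<sigma> q y0 u) + fd (%z. D\<sigma> q z u) y0 v"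
  proof (rule Gam_transform[OF KC[OF d] KC[OF dq] open_overlap[OF D chd] _ smooth_transition[OF aM d dq] _ g_transition[OF d dq] _ yo])
   show "overlap d (dq q) \<subseteq> cimg d" by (auto simp: overlap_iff[OF D])
   show "\<sigma> q ` overlap d (dq q) \<subseteq> cimg (dq q)" using transition_overlap(2)[OF D chd] by blast
   show "surj (D\<sigma> q y)" if "y\<in>overlap d (dq q)" for y
    by (rule bij_is_surj[OF transition_deriv_bij[OF aM d dq that]])
  qed
  thus ?thesis by (simp add: Fx_dom(6)[OF q] linear_0[OF K.Gam_lin1[OF yq[unfolded Fx_dom(6)[OF q]]]] add.commute)
 qed
 ultimately have "((%z. D\<sigma> q z u + Gq q (\<sigma> q z - fq q (xq q)) (D\<sigma> q z u)) has_derivative (%v. D\<sigma> q y0 (kaehler_chart.Gam (g d) y0 v u))) (at y0)"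
  by simp
 from bounded_linear.has_derivative[OF linE[OF q, unfolded linear_conv_bounded_linear] this]
 show ?thesis unfolding D1_def .
qed

private lemma Ph_eq: "Ph c d (x, z) = (\<Sum>q\<in>Fx. \<theta> q (ci c x) *\<^sub>R raw q c (ci c x) (ci d z))"
 unfolding Ph_def Phi_def Fx_def split_conv
 by (rule sum.mono_neutral_right) (auto simp: finF \<theta>_0)

private definition "DD z u = (\<Sum>q\<in>Fx. \<theta> q (ci c x) *\<^sub>R D1 q z u)"

private lemma Ph_deriv: "z\<in>Z ==> fd (Ph c d) (x, z) (0, u) = DD z u"
proof -
 assume z: "z\<in>Z"
 have "((%z. Ph c d (x, z)) has_derivative DD z) (at z)"
  unfolding Ph_eq DD_def[abs_def] by (intro has_derivative_sum has_derivative_scaleR_right term_deriv1 z)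
 moreover have "((%z. Ph c d (x, z)) has_derivative (%u. fd (Ph c d) (x, z) (0, u))) (at z)"
  by (rule has_derivative_compose[OF has_derivative_Pair[OF has_derivative_const has_derivative_ident] smooth_hd[OF smooth_Ph]])
   (use z in \<open>simp add: Z_def\<close>)
 ultimately have "DD z = (%u. fd (Ph c d) (x, z) (0, u))" by (rule has_derivative_unique)
 thus ?thesis by simp
qed

text \<open>The weights depend on \<open>p\<close> only, so vertical derivatives pass through them.
  Each contribution satisfies the four conditions, and sums with weights of total 1 preserve
  them.\<close>

lemma Ph_graph:
 shows "Ph c d (x, rep \<iota> c d x) = 0"
  and "fd (Ph c d) (x, rep \<iota> c d x) (0, pd k (rep \<iota> c d) x) = axis k 1"
  and "fd (Ph c d) (x, rep \<iota> c d x) (0, J d (rep \<iota> c d x) *v pd k (rep \<iota> c d) x) = 0"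
  and "fd (%p. fd (Ph c d) p (0, u)) (x, rep \<iota> c d x) (0, v)
   = fd (Ph c d) (x, rep \<iota> c d x) (0, kaehler_chart.Gam (g d) (rep \<iota> c d x) v u)"
proof -
 have D1_y0: "D1 q y0 u = E q (D\<sigma> q y0 u)" if q: "q\<in>Fx" for q u
 proof -
  interpret K: kaehler_chart "cimg (dq q)" "J (dq q)" "g (dq q)" by (rule KC[OF dq])
  show ?thesis unfolding D1_def
   using linear_0[OF K.Gam_lin1[OF Fx_dom(5)[OF q]]] by (simp add: Fx_dom(6)[OF q])
 qed
 have s1: "(\<Sum>q\<in>Fx. \<theta> q (ci c x) *\<^sub>R w) = w" for w :: "real^'n"
  using \<theta>_sum'[of "ci c x"] by (simp add: Fx_def scaleR_sum_left[symmetric])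
 have raw0: "raw q c (ci c x) (ci d y0) = 0" if q: "q\<in>Fx" for q
 proof -
  interpret K: kaehler_chart "cimg (dq q)" "J (dq q)" "g (dq q)" by (rule KC[OF dq])
  have 0: "cm (dq q) (ci d y0) = fq q (xq q)" unfolding Fx_dom(6)[OF q] by (rule transition_apply[symmetric])
  have "K.rawg (fq q) (xq q, fq q (xq q)) = 0"
   by (simp add: K.rawg_def linear_0[OF K.Gam_lin1[OF Fx_dom(5)[OF q]]] linear_0[OF K.Pf_lin])
  thus ?thesis
   unfolding raw_def 0 by (simp add: transition_apply[symmetric] linear_0[OF transition_linear[OF aL cq c Fx_dom(4)[OF q]]])
 qed
 show "Ph c d (x, y0) = 0" by (simp add: Ph_eq raw0)
 show "fd (Ph c d) (x, y0) (0, pd k (rep \<iota> c d) x) = axis k 1"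
  unfolding Ph_deriv[OF y0(2)] DD_def by (simp add: D1_y0 E_frame s1)
 show "fd (Ph c d) (x, y0) (0, J d y0 *v pd k (rep \<iota> c d) x) = 0"
  unfolding Ph_deriv[OF y0(2)] DD_def by (simp add: D1_y0 E_frame)
 have "((%z. DD z u) has_derivative (%v. DD y0 (kaehler_chart.Gam (g d) y0 v u))) (at y0)"
 proof -
  have "((%z. DD z u) has_derivative (%v. \<Sum>q\<in>Fx. \<theta> q (ci c x) *\<^sub>R E q (D\<sigma> q y0 (kaehler_chart.Gam (g d) y0 v u)))) (at y0)"
   unfolding DD_def by (intro has_derivative_sum has_derivative_scaleR_right term_deriv2)
  thus ?thesis by (simp add: DD_def D1_y0)
 qed
 hence "((%z. fd (Ph c d) (x, z) (0, u)) has_derivative (%v. DD y0 (kaehler_chart.Gam (g d) y0 v u))) (at y0)"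
  by (rule hd_cong[OF _ oZ y0(2)]) (simp add: Ph_deriv)
 moreover have "((%z. fd (Ph c d) (x, z) (0, u)) has_derivative (%v. fd (%p. fd (Ph c d) p (0, u)) (x, y0) (0, v))) (at y0)"
  by (rule has_derivative_compose[OF has_derivative_Pair[OF has_derivative_const has_derivative_ident] smooth_hd[OF smooth_deriv[OF smooth_Ph]]])
   (use y0 in \<open>simp add: Z_def\<close>)
 ultimately have "(%v. DD y0 (kaehler_chart.Gam (g d) y0 v u)) = (%v. fd (%p. fd (Ph c d) p (0, u)) (x, y0) (0, v))"
  by (rule has_derivative_unique)
 from fun_cong[OF this, of v]
 show "fd (%p. fd (Ph c d) p (0, u)) (x, y0) (0, v)
   = fd (Ph c d) (x, y0) (0, kaehler_chart.Gam (g d) y0 v u)"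
  by (simp add: Ph_deriv[OF y0(2)])
qed

end

lemma gauge_Ph: "gauge (cimg d) (J d) (g d) (ldom \<iota> c d) (rep \<iota> c d) (Wcd c d) (Ph c d)"
proof -
 interpret K: kaehler_chart "cimg d" "J d" "g d" by (rule KC[OF d])
 show ?thesis
 proof unfold_locales
  show "CARD('m) = 2 * CARD('n)" by (rule dims)
  show "open (ldom \<iota> c d)" by (rule open_local_dom[OF C D cont\<iota>])
  show "smooth_on (ldom \<iota> c d) (rep \<iota> c d)" by (rule smooth_mapD[OF sm\<iota> c d])
  show "K.xi0 (rep \<iota> c d) x" if "x\<in>ldom \<iota> c d" for x
   using mi c d that by (simp add: maslov_zero_def)
  show "Wcd c d \<subseteq> ldom \<iota> c d \<times> cimg d" by (auto simp: Wcd_def)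
  show "(x, rep \<iota> c d x)\<in>Wcd c d" if "x\<in>ldom \<iota> c d" for x
   using that graph_\<Omega>[of "ci c x"]
   by (auto simp: Wcd_def local_dom_iff[OF C] local_rep_apply chD[OF D])
  show "v \<bullet> (ricci (g d) y *v v) < 0" if "y\<in>cimg d" "v \<noteq> 0" for y v
   using neg d that by (simp add: negative_ricci_def)
 qed (use open_Wcd[OF c d] smooth_Ph Ph_graph in auto)
qed

end

text \<open>The chain rule for transition maps is the transformation law of a tangent vector at
  \<open>p\<close>. In particular the zeros of \<open>Phi\<close> do not depend on the
  chart.\<close>

lemma Phi_change:
 assumes c: "c\<in>AL" "c'\<in>AL" and p: "p\<in>cdom c" "p\<in>cdom c'"
 shows "Phi c' p y = fd (trn c c') (cm c p) (Phi c p y)"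
proof -
 note C = chL[OF c(1)] and C' = chL[OF c(2)]
 have l: "linear (fd (trn c c') (cm c p))"
  by (rule transition_linear[OF aL c]) (use p in \<open>simp add: overlap_iff[OF C] chD[OF C]\<close>)
 have "\<theta> q p *\<^sub>R raw q c' p y = \<theta> q p *\<^sub>R fd (trn c c') (cm c p) (raw q c p y)" for q
 proof (cases "p\<in>Kq q")
  case True
  let ?x = "cm (cq q) p"
  have pd: "p\<in>cdom (cq q)" by (rule Kq_dom[OF True])
  have xo: "?x\<in>overlap (cq q) c" "?x\<in>overlap (cq q) c'" using p pd by (simp_all add: overlap_iff[OF chc] chD[OF chc])
  have e: "trn (cq q) c ?x = cm c p" using pd by (simp add: transition_apply chD[OF chc])
  have po: "cm c p\<in>overlap c c'" using p by (simp add: overlap_iff[OF C] chD[OF C])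
  have "((%x. trn c c' (trn (cq q) c x)) has_derivative
    (%v. fd (trn c c') (cm c p) (fd (trn (cq q) c) ?x v))) (at ?x)"
   by (rule has_derivative_compose[OF smooth_hd[OF smooth_transition[OF aL cq c(1)] xo(1)], of "trn c c'", unfolded e])
    (rule smooth_hd[OF smooth_transition[OF aL c] po])
  hence "(trn (cq q) c' has_derivative
    (%v. fd (trn c c') (cm c p) (fd (trn (cq q) c) ?x v))) (at ?x)"
   by (rule hd_cong[OF _ open_overlap[OF chc C] xo(1)])
    (simp add: overlap_iff[OF chc] transition_apply chD[OF C])
  from fun_cong[OF fdI[OF this]] show ?thesis by (simp add: raw_def)
 qed (simp add: \<theta>_0)
 thus ?thesis unfolding Phi_def linear_sum[OF l] linear_scale[OF l] by (rule sum.cong[OF refl])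
qed

end

section \<open>The J-volume density\<close>

lemma smooth_sqrt: "smooth_on {0::real<..} sqrt"
proof -
 have d: "(sqrt has_derivative (%v. v * (inverse (sqrt x) * (1/2)))) (at x)" if "x\<in>{0<..}" for x :: real
  by (rule has_derivative_eq_rhs[OF DERIV_real_sqrt[unfolded has_field_derivative_def]]) (use that in \<open>auto simp: fun_eq_iff\<close>)
 have "kdiff k {0::real<..} sqrt" for k
 proof (induction k)
  case (Suc k)
  have "kdiff k {0<..} (%x. fd sqrt x v)" for v :: real
  proof (rule kdiff_cong[rotated 2])
   have 1: "kdiff k {0<..} (%x. inverse (sqrt x))" by (rule kdiff_inverse) (auto intro: Suc)
   show "kdiff k {0<..} (%x. v * (inverse (sqrt x) * (1/2)))"
    by (intro kdiff_bilinear[OF bounded_bilinear_mult] kdiff_const 1) auto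
   show "v * (inverse (sqrt x) * (1/2)) = fd sqrt x v" if "x\<in>{0<..}" for x
    using fun_cong[OF fdI[OF d[OF that]], of v] by simp
  qed simp
  moreover have "\<forall>x\<in>{0::real<..}. sqrt differentiable (at x)" using d differentiable_def by blast
  ultimately show ?case by simp
 qed simp
 thus ?thesis by (simp add: smooth_kdiff)
qed

section \<open>Gram determinants of complex frames and their derivatives\<close>

context kaehler_chart
begin

lemma hh_sum_scale:
 "hh y (\<Sum>i\<in>I. c i *\<^sub>R u i) v = (\<Sum>i\<in>I. of_real (c i) * hh y (u i) v)"
 "hh y v (\<Sum>i\<in>I. c i *\<^sub>R u i) = (\<Sum>i\<in>I. of_real (c i) * hh y v (u i))"
 by (simp_all add: linear_sum[OF hh_lin1] linear_scale[OF hh_lin1] linear_sum[OF hh_lin2] linear_scale[OF hh_lin2] scaleR_conv_of_real[where 'a=complex])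

lemma hmat_change:
 fixes A :: "real^'n::finite^'n"
 shows "det (hmat y (%i. \<Sum>l\<in>UNIV. A$i$l *\<^sub>R e l)) = of_real ((det A)\<^sup>2) * det (hmat y e)"
proof -
 have "hmat y (%i. \<Sum>l\<in>UNIV. A$i$l *\<^sub>R e l) = cmat A ** hmat y e ** transpose (cmat A)"
  by (simp add: vec_eq_iff hmat_def matrix_matrix_mult_def transpose_def hh_sum_scale)
   (simp add: mult.commute)
 thus ?thesis by (simp add: det_mul det_cmat power2_eq_square mult_ac)
qed

text \<open>A segment of positive definite Hermitian matrices joins the Gram matrix to the identity.
  The determinants along it are real and nonzero, so the sign is that of
  \<open>det 1\<close>.\<close>

lemma det_hmat_pos:
 fixes e :: "'n::finite => real^'m"
 assumes y: "y\<in>Y" and e: "cbasis (J y) e"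
 shows "Im (det (hmat y e)) = 0" "Re (det (hmat y e)) > 0"
proof -
 define A where "A t = (\<chi> i j. of_real (1 - t) * (mat 1 :: complex^'n^'n)$i$j + of_real t * hmat y e$i$j)" for t
 have herm: "hmat y e$i$j = cnj (hmat y e$j$i)" for i j using hh_cnj[OF y, of "e i" "e j"] by (simp add: hmat_def)
 have im: "Im (det (A t)) = 0" for t
 proof -
  have "transpose (A t) = (\<chi> i j. cnj (A t$i$j))"
   by (simp add: vec_eq_iff A_def transpose_def mat_def herm[symmetric])
  hence "det (A t) = cnj (det (A t))"
   using det_transpose[of "A t"] det_cnj[of "A t"] by simp
  thus ?thesis by (simp add: complex_eq_iff)
 qed
 have nz: "det (A t) \<noteq> 0" if t: "0 \<le> t" "t \<le> 1" for t
 proof -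
  have "z = 0" if z: "transpose (A t) *v z = 0" for z
  proof (rule ccontr)
   assume "z \<noteq> 0"
   have "(\<Sum>i\<in>UNIV. A t$i$j * z$i) = 0" for j
    using arg_cong[OF z, of "%v. v$j"] by (simp add: matrix_vector_mult_def transpose_def)
   hence "0 = (\<Sum>j\<in>UNIV. cnj (z$j) * (\<Sum>i\<in>UNIV. A t$i$j * z$i))" by simp
   also have "(%j. \<Sum>i\<in>UNIV. A t$i$j * z$i) = (%j. of_real (1 - t) * z$j + of_real t * (\<Sum>i\<in>UNIV. z$i * hh y (e i) (e j)))"
   proof
    fix j
    have "A t$i$j * z$i = (if i = j then of_real (1 - t) * z$j else 0) + of_real t * (z$i * hh y (e i) (e j))" for i
     by (simp add: A_def mat_def hmat_def distrib_right)
    thus "(\<Sum>i\<in>UNIV. A t$i$j * z$i) = of_real (1 - t) * z$j + of_real t * (\<Sum>i\<in>UNIV. z$i * hh y (e i) (e j))"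
     by (simp add: sum.distrib sum_distrib_left)
   qed
   also have "(\<Sum>j\<in>UNIV. cnj (z$j) * (of_real (1 - t) * z$j + of_real t * (\<Sum>i\<in>UNIV. z$i * hh y (e i) (e j)))) = of_real (1 - t) * (\<Sum>j\<in>UNIV. cnj (z$j) * z$j) + of_real t * (\<Sum>j\<in>UNIV. cnj (z$j) * (\<Sum>i\<in>UNIV. z$i * hh y (e i) (e j)))"
    by (simp only: distrib_left sum.distrib sum_distrib_left mult.left_commute)
   also have "(\<Sum>j\<in>UNIV. cnj (z$j) * (\<Sum>i\<in>UNIV. z$i * hh y (e i) (e j))) = hh y (comb (J y) e z) (comb (J y) e z)"
    by (simp add: hh_comb2[OF y] clinear_comb[OF clinear_hh[OF y]])
   finally have "0 = (1 - t) * (\<Sum>j\<in>UNIV. (norm (z$j))\<^sup>2) + t * gg y (comb (J y) e z) (comb (J y) e z)"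
    unfolding cmod_power2 unfolding power2_eq_square by (simp add: complex_eq_iff hh_def)
   moreover have "(\<Sum>j\<in>UNIV. (norm (z$j))\<^sup>2) > 0"
   proof -
    obtain j where "z$j \<noteq> 0" using \<open>z \<noteq> 0\<close> by (auto simp: vec_eq_iff)
    thus ?thesis by (intro sum_pos2[of _ j]) auto
   qed
   moreover have "gg y (comb (J y) e z) (comb (J y) e z) > 0"
   proof (rule gg_pos[OF y])
    show "comb (J y) e z \<noteq> 0"
     using \<open>z \<noteq> 0\<close> e linear_0[OF linear_comb, of "J y" e] unfolding cbasis_def bij_def by (metis injD)
   qed
   ultimately show False using t
    by (smt (verit, best) mult_nonneg_nonneg mult_pos_pos)
  qed
  hence "invertible (transpose (A t))" using invertible_left_inverse matrix_left_invertible_ker by blast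
  thus ?thesis by (simp add: invertible_det_nz det_transpose)
 qed
 have A1: "A 1 = hmat y e" by (simp add: A_def vec_eq_iff)
 have A0: "A 0 = mat 1" by (simp add: A_def vec_eq_iff)
 show "Im (det (hmat y e)) = 0" using im[of 1] by (simp add: A1)
 show "Re (det (hmat y e)) > 0"
 proof (rule ccontr)
  assume "\<not> ?thesis"
  moreover have "continuous_on {0..1} (%t. Re (det (A t)))"
   unfolding A_def by (intro continuous_on_Re continuous_on_det) (auto intro!: continuous_intros)
  ultimately obtain t where "0 \<le> t" "t \<le> 1" "Re (det (A t)) = 0"
   using IVT2'[of "%t. Re (det (A t))" 1 0 0] by (auto simp: A0 A1)
  thus False using im[of t] nz[of t] by (simp add: complex_eq_iff)
 qed
qed

text \<open>Together with \<open>det_hmat\<close> this describes complex frames by a nonvanishing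
  determinant, which is visibly an open condition.\<close>

lemma cbasis_hmat:
 fixes e :: "'n::finite => real^'m"
 assumes "CARD('m) = 2 * CARD('n)" "y\<in>Y" "det (hmat y e) \<noteq> 0"
 shows "cbasis (J y) e"
 by (rule cbasis_if_det[OF assms(1), where T="%j u. hh y u (e j)"])
  (use assms in \<open>auto simp: hmat_def clinear_hh\<close>)

text \<open>Expressed by covariant derivatives along \<open>P\<close>, the product rule loses the
  derivative of \<open>G\<close> by metric compatibility. The parallelism of \<open>J\<close>
  carries this over to the Hermitian form.\<close>

lemma has_derivative_gg_curve:
 assumes P: "(P has_derivative P') (at x)" "P x\<in>Y" and a: "(a has_derivative a') (at x)" and b: "(b has_derivative b') (at x)"
 shows "((%x. gg (P x) (a x) (b x)) has_derivative (%h. gg (P x) (a' h + Gam (P x) (P' h) (a x)) (b x)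
  + gg (P x) (a x) (b' h + Gam (P x) (P' h) (b x)))) (at x)"
proof -
 have "((%x. G (P x)) has_derivative (%h. fd G (P x) (P' h))) (at x)"
  by (rule has_derivative_compose[OF P(1) smooth_hd[OF sG P(2)]])
 from has_derivative_inner[OF a has_derivative_mv[OF this b]]
 show ?thesis unfolding gg_def[symmetric]
  by (rule has_derivative_eq_rhs)
   (auto simp: inner_add_right gg_def[symmetric] gg_bil dG_def[symmetric] metric_compat[OF P(2)])
qed

lemma has_derivative_J_curve:
 assumes P: "(P has_derivative P') (at x)" "P x\<in>Y" and a: "(a has_derivative a') (at x)"
 shows "((%x. J (P x) *v a x) has_derivative (%h. J (P x) *v (a' h + Gam (P x) (P' h) (a x)) - Gam (P x) (P' h) (J (P x) *v a x))) (at x)"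
proof -
 have "((%x. J (P x)) has_derivative (%h. fd J (P x) (P' h))) (at x)"
  by (rule has_derivative_compose[OF P(1) smooth_hd[OF sJ P(2)]])
 from has_derivative_mv[OF this a] show ?thesis
  by (rule has_derivative_eq_rhs)
   (auto simp: DJ_def[symmetric] DJ_eq[OF P(2)] matrix_vector_right_distrib)
qed

lemma has_derivative_hh_curve:
 assumes P: "(P has_derivative P') (at x)" "P x\<in>Y" and a: "(a has_derivative a') (at x)" and b: "(b has_derivative b') (at x)"
 shows "((%x. hh (P x) (a x) (b x)) has_derivative (%h. hh (P x) (a' h + Gam (P x) (P' h) (a x)) (b x)
  + hh (P x) (a x) (b' h + Gam (P x) (P' h) (b x)))) (at x)"
proof -
 have "((%x. Complex (gg (P x) (a x) (b x)) (- gg (P x) (J (P x) *v a x) (b x))) has_derivative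
   (%h. Complex (gg (P x) (a' h + Gam (P x) (P' h) (a x)) (b x) + gg (P x) (a x) (b' h + Gam (P x) (P' h) (b x)))
   (- (gg (P x) (J (P x) *v (a' h + Gam (P x) (P' h) (a x)) - Gam (P x) (P' h) (J (P x) *v a x) + Gam (P x) (P' h) (J (P x) *v a x)) (b x)
    + gg (P x) (J (P x) *v a x) (b' h + Gam (P x) (P' h) (b x)))))) (at x)"
  unfolding Complex_eq
  by (intro has_derivative_add has_derivative_of_real has_derivative_mult_right has_derivative_minus has_derivative_gg_curve has_derivative_J_curve P a b)
 thus ?thesis unfolding hh_def[symmetric]
  by (rule has_derivative_eq_rhs) (auto simp: hh_def complex_eq_iff)
qed

text \<open>If the frame has covariant derivative \<open>B\<close> times the frame, the Gram matrix
  \<open>M\<close> has derivative \<open>B ** M + M ** Bs\<close> with the adjoint \<open>Bs\<close>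
  of \<open>B\<close>. Jacobi's formula adds a trace and its conjugate.\<close>

lemma hmat_derivative:
 fixes a :: "'n::finite => real => real^'m" and B :: "complex^'n^'n"
 assumes P: "(P has_derivative P') (at s)" "P s\<in>Y" and a: "!!i. (a i has_derivative a' i) (at s)"
  and cb: "cbasis (J (P s)) (%i. a i s)"
  and B: "!!i. a' i 1 + Gam (P s) (P' 1) (a i s) = comb (J (P s)) (%i. a i s) (B$i)"
 shows "((%s. det (hmat (P s) (%i. a i s))) has_derivative (%h. h *\<^sub>R (of_real (2 * Re (trace B)) * det (hmat (P s) (%i. a i s))))) (at s)"
proof -
 let ?M = "hmat (P s) (%i. a i s)"
 let ?E = "%h. \<chi> i j. hh (P s) (a' i h + Gam (P s) (P' h) (a i s)) (a j s) + hh (P s) (a i s) (a' j h + Gam (P s) (P' h) (a j s))"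
 have d: "((%s. det (hmat (P s) (%i. a i s))) has_derivative (%h. det_deriv ?M (?E h))) (at s)"
  by (rule has_derivative_det) (simp add: hmat_def, rule has_derivative_hh_curve[OF P a a])
 define Bs where "Bs = (\<chi> i j. cnj (B$j$i))"
 have "?E 1 = B ** ?M + ?M ** Bs"
  by (simp add: vec_eq_iff B Bs_def matrix_matrix_mult_def hmat_def hh_comb2[OF P(2)] clinear_comb[OF clinear_hh[OF P(2)]] mult.commute)
 hence "det_deriv ?M (?E 1) = trace B * det ?M + trace Bs * det ?M"
  using det_hmat[OF P(2) cb] by (simp add: det_deriv_add det_deriv_mult_left det_deriv_mult_right)
 also have "\<dots> = of_real (2 * Re (trace B)) * det ?M"
  by (simp add: Bs_def trace_def complex_eq_iff algebra_simps sum_negf)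
 finally have 1: "det_deriv ?M (?E 1) = of_real (2 * Re (trace B)) * det ?M" .
 have "det_deriv ?M (?E h) = h *\<^sub>R det_deriv ?M (?E 1)" for h
  using linear_scale[OF has_derivative_linear[OF d], of h 1] by simp
 thus ?thesis using d unfolding 1 by simp
qed

end

context kaehler_negative
begin

abbreviation "Hm d \<equiv> kaehler_chart.hmat (J d) (g d)"

lemma hermitian_form_hh: "d\<in>AM ==> y\<in>cimg d ==> hermitian_form g \<omega> d y u v = kaehler_chart.hh (J d) (g d) y u v"
proof -
 assume d: "d\<in>AM" and y: "y\<in>cimg d"
 interpret K: kaehler_chart "cimg d" "J d" "g d" by (rule KC[OF d])
 have "\<omega> d y = transpose (J d y) ** g d y" using kae d y by (simp add: kaehler_def)
 hence "u \<bullet> (\<omega> d y *v v) = (J d y *v u) \<bullet> (g d y *v v)"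
  by (simp add: matrix_vector_mul_assoc[symmetric] inner_transpose_mv del: transpose_matrix_vector)
 thus ?thesis by (simp add: hermitian_form_def K.hh_def K.gg_def)
qed

lemma hmat_transition:
 assumes d: "d\<in>AM" "d'\<in>AM" "y\<in>overlap d d'"
 shows "Hm d' (trn d d' y) (%i. fd (trn d d') y (e i)) = Hm d y e"
proof -
 interpret K: kaehler_chart "cimg d" "J d" "g d" by (rule KC[OF d(1)])
 interpret K': kaehler_chart "cimg d'" "J d'" "g d'" by (rule KC[OF d(2)])
 show ?thesis
  by (simp add: vec_eq_iff K.hmat_def K'.hmat_def K.hh_def K'.hh_def K.gg_def K'.gg_def g_transition[OF d] J_transition[OF d])
qed

lemma pd_target_change:
 assumes f: "smooth_map AL AM f" and c: "c\<in>AL" and d: "d\<in>AM" "d'\<in>AM" and x: "x\<in>ldom f c d" "x\<in>ldom f c d'"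
 shows "rep f c d x\<in>overlap d d'" "rep f c d' x = trn d d' (rep f c d x)"
  "fd (rep f c d') x v
   = fd (trn d d') (rep f c d x) (fd (rep f c d) x v)"
proof -
 note C = chL[OF c] and D = chM[OF d(1)] and D' = chM[OF d(2)]
 show y: "rep f c d x\<in>overlap d d'"
  using x by (simp add: local_dom_iff[OF C] overlap_iff[OF D] local_rep_apply chD[OF D])
 have e: "rep f c d' z = trn d d' (rep f c d z)" if "z\<in>ldom f c d" for z
  using that by (simp add: local_dom_iff[OF C] local_rep_apply transition_apply chD[OF D])
 show "rep f c d' x = trn d d' (rep f c d x)" by (rule e[OF x(1)])
 have "((%x. trn d d' (rep f c d x)) has_derivative
   (%v. fd (trn d d') (rep f c d x) (fd (rep f c d) x v))) (at x)"
  by (rule has_derivative_compose[OF smooth_hd[OF smooth_mapD[OF f c d(1)] x(1)] smooth_hd[OF smooth_transition[OF aM d] y]])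
 hence "(rep f c d' has_derivative
   (%v. fd (trn d d') (rep f c d x) (fd (rep f c d) x v))) (at x)"
  by (rule hd_cong[OF _ open_local_dom[OF C D smooth_map_cont[OF f]] x(1)]) (simp add: e)
 from fun_cong[OF fdI[OF this], of v] show "fd (rep f c d') x v
   = fd (trn d d') (rep f c d x) (fd (rep f c d) x v)" .
qed

lemma pd_source_change:
 assumes f: "smooth_map AL AM f" and c: "c\<in>AL" "c'\<in>AL" and d: "d\<in>AM" and x: "x\<in>ldom f c' d" "x\<in>overlap c' c"
 shows "trn c' c x\<in>ldom f c d" "rep f c' d x = rep f c d (trn c' c x)"
  "fd (rep f c' d) x v
   = fd (rep f c d) (trn c' c x) (fd (trn c' c) x v)"
proof -
 note C = chL[OF c(1)] and C' = chL[OF c(2)] and D = chM[OF d]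
 show y: "trn c' c x\<in>ldom f c d"
  using x by (simp add: local_dom_iff[OF C] local_dom_iff[OF C'] overlap_iff[OF C'] transition_apply chD[OF C])
 have e: "rep f c' d z = rep f c d (trn c' c z)" if "z\<in>overlap c' c" for z
  using that by (simp add: overlap_iff[OF C'] local_rep_apply transition_apply chD[OF C])
 show "rep f c' d x = rep f c d (trn c' c x)" by (rule e[OF x(2)])
 have "((%x. rep f c d (trn c' c x)) has_derivative
   (%v. fd (rep f c d) (trn c' c x) (fd (trn c' c) x v))) (at x)"
  by (rule has_derivative_compose[OF smooth_hd[OF smooth_transition[OF aL c(2,1)] x(2)] smooth_hd[OF smooth_mapD[OF f c(1) d] y]])
 hence "(rep f c' d has_derivative
   (%v. fd (rep f c d) (trn c' c x) (fd (trn c' c) x v))) (at x)"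
  by (rule hd_cong[OF _ open_overlap[OF C' C] x(2)]) (simp add: e)
 from fun_cong[OF fdI[OF this], of v] show "fd (rep f c' d) x v
   = fd (rep f c d) (trn c' c x) (fd (trn c' c) x v)" .
qed

lemma rep_img: "c\<in>AL ==> d\<in>AM ==> x\<in>ldom f c d ==> rep f c d x\<in>cimg d"
 by (simp add: local_dom_iff[OF chL] local_rep_apply chD[OF chM])

lemma det_hmat_target:
 assumes f: "smooth_map AL AM f" and c: "c\<in>AL" and d: "d\<in>AM" "d'\<in>AM" and x: "x\<in>ldom f c d" "x\<in>ldom f c d'"
 shows "Hm d' (rep f c d' x) (%i. pd i (rep f c d') x) = Hm d (rep f c d x) (%i. pd i (rep f c d) x)"
 unfolding pd_def pd_target_change(2,3)[OF f c d x]
 by (rule hmat_transition[OF d pd_target_change(1)[OF f c d x]])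

lemma det_hmat_source:
 assumes f: "smooth_map AL AM f" and c: "c\<in>AL" "c'\<in>AL" and d: "d\<in>AM" and x: "x\<in>ldom f c' d" "x\<in>overlap c' c"
 shows "det (Hm d (rep f c' d x) (%i. pd i (rep f c' d) x))
  = of_real ((det (jacobian (trn c' c) (at x)))\<^sup>2) * det (Hm d (rep f c d (trn c' c x)) (%i. pd i (rep f c d) (trn c' c x)))"
proof -
 interpret K: kaehler_chart "cimg d" "J d" "g d" by (rule KC[OF d])
 note s = pd_source_change[OF f c d x]
 have "pd i (rep f c' d) x = (\<Sum>l\<in>UNIV. transpose (jacobian (trn c' c) (at x))$i$l *\<^sub>R pd l (rep f c d) (trn c' c x))" for i
  unfolding pd_def[of i] s(3) frechet_pd[OF smooth_mapD[OF f c(1) d] s(1)]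
  by (simp add: jacobian_def matrix_def transpose_def)
 thus ?thesis unfolding s(2) by (simp add: K.hmat_change)
qed

lemma totally_real_iff:
 "totally_real_immersion AL AM J f \<longleftrightarrow> smooth_map AL AM f \<and>
  (\<forall>c\<in>AL. \<forall>d\<in>AM. \<forall>x\<in>ldom f c d. cbasis (J d (rep f c d x)) (%i. pd i (rep f c d) x))"
 by (rule totally_real_immersion_iff) (use kaehler_chart.JJ[OF KC] chM chL in auto)

text \<open>Under changes of charts the Gram determinant is multiplied by the square of a nonzero
  Jacobian, so one pair of charts per point decides.\<close>

lemma totally_real_local:
 assumes f: "smooth_map AL AM f"
  and loc: "!!p. \<exists>c\<in>AL. \<exists>d\<in>AM. p\<in>cdom c \<and> f p\<in>cdom d \<and>
   cbasis (J d (rep f c d (cm c p))) (%i. pd i (rep f c d) (cm c p))"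
 shows "totally_real_immersion AL AM J f"
 unfolding totally_real_iff
proof (intro conjI f ballI)
 fix c' d' x assume c': "c'\<in>AL" and d': "d'\<in>AM" and x: "x\<in>ldom f c' d'"
 let ?p = "ci c' x"
 obtain c d where c: "c\<in>AL" and d: "d\<in>AM" and p: "?p\<in>cdom c" "f ?p\<in>cdom d"
  and cb: "cbasis (J d (rep f c d (cm c ?p))) (%i. pd i (rep f c d) (cm c ?p))"
  using loc[of ?p] by blast
 note C' = chL[OF c']
 have x2: "x\<in>ldom f c' d" "x\<in>overlap c' c" using x p by (simp_all add: local_dom_iff[OF C'] overlap_iff[OF C'])
 interpret K: kaehler_chart "cimg d" "J d" "g d" by (rule KC[OF d])
 interpret K': kaehler_chart "cimg d'" "J d'" "g d'" by (rule KC[OF d'])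
 have "det (Hm d (rep f c d (trn c' c x)) (%i. pd i (rep f c d) (trn c' c x))) \<noteq> 0"
  unfolding transition_apply
  by (rule K.det_hmat[OF rep_img[OF c d] cb]) (use pd_source_change(1)[OF f c c' d x2] in \<open>simp add: transition_apply\<close>)
 moreover have "det (jacobian (trn c' c) (at x)) \<noteq> 0"
  using ori c c' x2(2) unfolding oriented_atlas_def by fastforce
 ultimately have "det (Hm d' (rep f c' d' x) (%i. pd i (rep f c' d') x)) \<noteq> 0"
  unfolding det_hmat_target[OF f c' d d' x2(1) x] det_hmat_source[OF f c c' d x2] by simp
 thus "cbasis (J d' (rep f c' d' x)) (%i. pd i (rep f c' d') x)"
  by (rule K'.cbasis_hmat[OF dims rep_img[OF c' d' x]])
qed

text \<open>Passing to the orthonormal basis \<open>e\<close> multiplies the Gram determinant by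
  \<open>(det e)^2\<close>, the reciprocal of the determinant of the induced metric. The two factors
  cancel, and the choices of \<open>e\<close> and of the target chart disappear from the
  density.\<close>

lemma vol_J_form_eq:
 assumes tr: "totally_real_immersion AL AM J f" and c: "c\<in>AL" and d: "d\<in>AM" and x: "x\<in>ldom f c d"
 shows "vol_J_form AM g \<omega> f c x = sqrt (Re (det (Hm d (rep f c d x) (%i. pd i (rep f c d) x))))"
proof -
 have f: "smooth_map AL AM f" using tr by (simp add: totally_real_iff)
 note C = chL[OF c]
 define d1 where "d1 = chart_at AM (f (ci c x))"
 have d1: "d1\<in>AM" by (simp add: d1_def chart_at_in[OF aM])
 have x1: "x\<in>ldom f c d1" using x by (simp add: d1_def chart_at_in[OF aM] local_dom_iff[OF C])
 interpret K: kaehler_chart "cimg d1" "J d1" "g d1" by (rule KC[OF d1])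
 let ?f = "rep f c d1"
 let ?D = "fd ?f x" and ?I = "induced_metric AM g f c x"
 have y: "?f x\<in>cimg d1" by (rule rep_img[OF c d1 x1])
 have lD: "linear ?D" by (rule linear_deriv[OF smooth_mapD[OF f c d1] x1])
 have jac: "jacobian ?f (at x) *v v = ?D v" for v
  unfolding jacobian_def using fun_cong[OF matrix_vector_mul(2)[OF lD], of v] by simp
 have I: "u \<bullet> (?I *v v) = K.gg (?f x) (?D u) (?D v)" for u v
  unfolding induced_metric_def Let_def d1_def[symmetric]
  by (simp add: matrix_vector_mul_assoc[symmetric] inner_transpose_mv K.gg_def jac del: transpose_matrix_vector)
 have cb: "cbasis (J d1 (?f x)) (%i. pd i ?f x)" using tr c d1 x1 by (simp add: totally_real_iff)
 have inj: "inj ?D" using tr c d1 x1 unfolding totally_real_immersion_def immersion_def by blast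
 obtain e0 :: "'n => real^'n" where e0: "!!i j. e0 i \<bullet> (?I *v e0 j) = (if i = j then 1 else 0)"
 proof (rule gram_schmidt_form)
  show "transpose ?I = ?I"
  proof -
   have "u \<bullet> (transpose ?I *v v) = u \<bullet> (?I *v v)" for u v
    unfolding inner_transpose_mv inner_commute[of "?I *v u"] I by (rule K.gg_sym[OF y])
   thus ?thesis by (metis matrix_eq vector_eq_ldot)
  qed
  show "v \<bullet> (?I *v v) > 0" if "v \<noteq> 0" for v
   unfolding I by (rule K.gg_pos[OF y]) (use that inj lD linear_injective_0 in blast)
 qed blast
 define e where "e = (SOME e :: real^'n^'n. \<forall>i j. e$i \<bullet> (?I *v e$j) = (if i = j then 1 else 0))"
 have e: "e$i \<bullet> (?I *v e$j) = (if i = j then 1 else 0)" for i j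
  using someI[of "%e :: real^'n^'n. \<forall>i j. e$i \<bullet> (?I *v e$j) = (if i = j then 1 else 0)" "\<chi> i. e0 i"] e0
  unfolding e_def by simp
 have "e ** ?I ** transpose e = mat 1"
 proof -
  have "(e ** ?I ** transpose e)$i$j = e$i \<bullet> (?I *v e$j)" for i j
   by (simp add: matrix_matrix_mult_def matrix_vector_mult_def transpose_def inner_vec_def sum_distrib_left sum_distrib_right mult_ac)
    (subst sum.swap, simp)
  thus ?thesis by (simp add: vec_eq_iff e mat_def)
 qed
 from arg_cong[OF this, of det] have dI: "(det e)\<^sup>2 * det ?I = 1" by (simp add: det_mul power2_eq_square mult_ac)
 let ?M = "Hm d1 (?f x) (%i. pd i ?f x)"
 have "(\<chi> i j. hermitian_form g \<omega> d1 (?f x) (?D (e$i)) (?D (e$j))) = Hm d1 (?f x) (%i. \<Sum>l\<in>UNIV. e$i$l *\<^sub>R pd l ?f x)"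
  by (simp add: vec_eq_iff K.hmat_def hermitian_form_hh[OF d1 y] frechet_pd[OF smooth_mapD[OF f c d1] x1])
 hence "det (\<chi> i j. hermitian_form g \<omega> d1 (?f x) (?D (e$i)) (?D (e$j))) = of_real ((det e)\<^sup>2) * det ?M"
  by (simp only: K.hmat_change)
 hence "rho_J AM g \<omega> f c x = sqrt ((det e)\<^sup>2 * Re (det ?M))"
  unfolding rho_J_def Let_def d1_def[symmetric] e_def[symmetric] by simp
 hence "vol_J_form AM g \<omega> f c x = sqrt (((det e)\<^sup>2 * det ?I) * Re (det ?M))"
  unfolding vol_J_form_def by (simp add: real_sqrt_mult[symmetric] mult_ac del: real_sqrt_mult_self)
 thus ?thesis unfolding dI det_hmat_target[OF f c d1 d x1 x] by simp
qed

end

section \<open>The first variation of the J-volume\<close>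

lemma frechet_slice_snd:
 assumes "smooth_on S h" "(s, x)\<in>S"
 shows "((%x. h (s, x)) has_derivative (%v. fd h (s, x) (0, v))) (at x)"
 by (rule has_derivative_compose[OF has_derivative_Pair[OF has_derivative_const has_derivative_ident] smooth_hd[OF assms]])

lemma frechet_slice_fst:
 assumes "smooth_on S h" "(s, x)\<in>S"
 shows "((%s. h (s, x)) has_derivative (%r. fd h (s, x) (r, 0))) (at s)"
 by (rule has_derivative_compose[OF has_derivative_Pair[OF has_derivative_ident has_derivative_const] smooth_hd[OF assms]])

context kaehler_chart
begin

lemma comb_coord:
 assumes y: "y\<in>Y" and e: "cbasis (J y) e"
 shows "comb (J y) e (coord y e v) = v"
proof -
 obtain z where z: "v = comb (J y) e z" using e unfolding cbasis_def bij_def by (metis surjD)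
 show ?thesis unfolding z coord_comb[OF y e] ..
qed

text \<open>Covariant differentiation of the frame along \<open>N\<close> gives the matrix
  \<open>i (d\<beta> + \<beta> C)\<close>, where the symmetry of second derivatives brings in the
  connection matrix \<open>C\<close> of direction \<open>k\<close>. The term with
  \<open>d\<beta>\<close> has imaginary trace, so the first variation of the density is pointwise in
  \<open>\<beta>\<close>.\<close>

lemma variation_derivative:
 fixes f :: "real^'n::finite => real^'m"
 assumes X: "open X" "x\<in>X" and f: "smooth_on X f" and fY: "f x\<in>Y"
  and cb: "cbasis (J (f x)) (%i. pd i f x)" and \<beta>: "smooth_on X \<beta>"
  and C: "!!i. nab f k i x = comb (J (f x)) (%i. pd i f x) (C$i)"
 defines "N \<equiv> %x. \<beta> x *\<^sub>R (J (f x) *v pd k f x)"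
 shows "((%s. det (hmat (f x + s *\<^sub>R N x) (%i. pd i f x + s *\<^sub>R pd i N x))) has_derivative
  (%h. h *\<^sub>R (of_real (2 * (- (\<beta> x * Im (trace C)))) * det (hmat (f x) (%i. pd i f x))))) (at 0)"
proof -
 let ?e = "%i. pd i f x"
 have hf: "(f has_derivative fd f x) (at x)" by (rule smooth_hd[OF f X(2)])
 have pdN: "pd i N x = pd i \<beta> x *\<^sub>R (J (f x) *v pd k f x)
   + \<beta> x *\<^sub>R (J (f x) *v (pd i (pd k f) x + Gam (f x) (pd i f x) (pd k f x)) - Gam (f x) (pd i f x) (J (f x) *v pd k f x))" for i
 proof -
  have "(N has_derivative (%h. \<beta> x *\<^sub>R (J (f x) *v (fd (pd k f) x h + Gam (f x) (fd f x h) (pd k f x)) - Gam (f x) (fd f x h) (J (f x) *v pd k f x))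
    + fd \<beta> x h *\<^sub>R (J (f x) *v pd k f x))) (at x)"
   unfolding N_def
   by (intro has_derivative_scaleR smooth_hd[OF \<beta> X(2)] has_derivative_J_curve[OF hf fY has_derivative_pd[OF f X(2)]])
  from fun_cong[OF fdI[OF this], of "axis i 1"] show ?thesis
   by (simp add: pd_def[of i] add.commute)
 qed
 have nsym: "pd i (pd k f) x + Gam (f x) (pd i f x) (pd k f x) = nab f k i x" for i
  unfolding nab_def using smooth_mixed[OF X(1) f X(2), of "axis k 1" "axis i 1"] Gam_sym[OF fY, of "pd i f x" "pd k f x"]
  by (simp add: pd_def[abs_def])
 define B where "B = (\<chi> i l. \<i> * (of_real (pd i \<beta> x) * (if l = k then 1 else 0) + of_real (\<beta> x) * C$i$l))"
 have JJf: "J (f x) ** J (f x) = - mat 1" by (rule JJ[OF fY])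
 have B: "pd i N x + Gam (f x) (N x) (pd i f x) = comb (J (f x)) ?e (B$i)" for i
 proof -
  have "pd i N x + Gam (f x) (N x) (pd i f x) = J (f x) *v (pd i \<beta> x *\<^sub>R pd k f x + \<beta> x *\<^sub>R nab f k i x)"
   unfolding pdN nsym Gam_sym[OF fY, of "N x"]
   by (simp add: N_def linear_scale[OF Gam_lin2[OF fY]] matrix_vector_right_distrib matrix_vector_mult_scaleR algebra_simps)
  also have "pd i \<beta> x *\<^sub>R pd k f x + \<beta> x *\<^sub>R nab f k i x = comb (J (f x)) ?e (of_real (pd i \<beta> x) *s axis k 1 + of_real (\<beta> x) *s (C$i))"
   unfolding C by (simp add: linear_add[OF linear_comb] cscale_comb[OF JJf, symmetric] comb_axis) (simp add: cscale_def)
  also have "J (f x) *v \<dots> = comb (J (f x)) ?e (B$i)"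
   unfolding J_comb[OF JJf]
   by (rule arg_cong[where f="comb (J (f x)) ?e"]) (simp add: vec_eq_iff B_def axis_def distrib_left)
  finally show ?thesis .
 qed
 have tr: "Re (trace B) = - (\<beta> x * Im (trace C))"
 proof -
  have "Re (B$i$i) = - (\<beta> x * Im (C$i$i))" for i by (cases "i = k") (simp_all add: B_def)
  thus ?thesis by (simp add: trace_def sum_negf sum_distrib_left)
 qed
 have "((%s. det (hmat (f x + s *\<^sub>R N x) (%i. pd i f x + s *\<^sub>R pd i N x))) has_derivative
   (%h. h *\<^sub>R (of_real (2 * Re (trace B)) * det (hmat (f x + 0 *\<^sub>R N x) (%i. pd i f x + 0 *\<^sub>R pd i N x))))) (at 0)"
 proof (rule hmat_derivative)
  show "((%s. f x + s *\<^sub>R N x) has_derivative (%h. h *\<^sub>R N x)) (at 0)"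
   by (auto intro!: derivative_eq_intros)
  show "((%s. pd i f x + s *\<^sub>R pd i N x) has_derivative (%h. h *\<^sub>R pd i N x)) (at 0)" for i
   by (auto intro!: derivative_eq_intros)
 qed (use fY cb B in auto)
 thus ?thesis by (simp add: tr)
qed

end

context kaehler_negative
begin

lemma open_family_dom:
 assumes F: "continuous_on (I \<times> UNIV) (%(s, p). F s p)" and I: "open I" and c: "c\<in>AL" and d: "d\<in>AM"
 shows "open {(s :: real, x). s\<in>I \<and> x\<in>ldom (F s) c d}"
proof -
 note C = chL[OF c] and D = chM[OF d]
 let ?S = "I \<times> cimg c"
 have "continuous_on ?S (%q. (%(s, p). F s p) (fst q, ci c (snd q)))"
  by (rule continuous_on_compose2[OF F, where f="%q. (fst q, ci c (snd q))"])
   (auto intro!: continuous_on_Pair continuous_on_compose2[OF chD(8)[OF C]] continuous_intros)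
 from continuous_open_preimage[OF this open_Times[OF I chD(2)[OF C]] chD(1)[OF D]]
 have "open (?S \<inter> (%q. (%(s, p). F s p) (fst q, ci c (snd q))) -` cdom d)" .
 moreover have "?S \<inter> (%q. (%(s, p). F s p) (fst q, ci c (snd q))) -` cdom d = {(s, x). s\<in>I \<and> x\<in>ldom (F s) c d}"
  by (auto simp: local_dom_iff[OF C])
 ultimately show ?thesis by simp
qed

context
 fixes f \<epsilon> F assumes var: "totally_real_variation AL AM J f \<epsilon> F"
begin

private abbreviation "T \<equiv> {-\<epsilon><..<\<epsilon>}"

lemma smooth_variation_vol:
 assumes c: "c\<in>AL"
 shows "smooth_on (T \<times> cimg c) (%(s, x). vol_J_form AM g \<omega> (F s) c x)"
proof (rule smooth_locally, clarify)
 fix s0 x0 assume s0: "s0\<in>T" and x0: "x0\<in>cimg c"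
 note C = chL[OF c]
 define d where "d = chart_at AM (F s0 (ci c x0))"
 have d: "d\<in>AM" by (simp add: d_def chart_at_in[OF aM])
 interpret K: kaehler_chart "cimg d" "J d" "g d" by (rule KC[OF d])
 let ?V = "{(s, x). s\<in>T \<and> x\<in>ldom (F s) c d}"
 define h where "h = (%(s, x). rep (F s) c d x)"
 have V: "open ?V" using var by (intro open_family_dom open_greaterThanLessThan c d) (simp add: totally_real_variation_def)
 have h: "smooth_on ?V h" using var c d by (simp add: totally_real_variation_def h_def)
 have tr: "totally_real_immersion AL AM J (F s)" if "s\<in>T" for s using var that by (simp add: totally_real_variation_def)
 have hY: "h q\<in>cimg d" if "q\<in>?V" for q using that by (auto simp: h_def intro!: rep_img[OF c d])
 have pd: "pd i (rep (F s) c d) x = fd h (s, x) (0, axis i 1)" if "(s, x)\<in>?V" for s x i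
  using fun_cong[OF fdI[OF frechet_slice_snd[OF h that]], of "axis i 1"]
  by (simp add: pd_def h_def)
 let ?H = "%q. K.hmat (h q) (%i. fd h q (0, axis i 1))"
 have det: "smooth_on ?V (%q. det (?H q))"
  by (rule smooth_det[OF V]) (unfold K.hmat_def vec_lambda_beta, intro K.smooth_hh V h hY smooth_deriv)
 have pos: "Re (det (?H q)) > 0" if q: "q\<in>?V" for q
 proof -
  obtain s x where q': "q = (s, x)" "s\<in>T" "x\<in>ldom (F s) c d" using q by auto
  have "cbasis (J d (rep (F s) c d x)) (%i. pd i (rep (F s) c d) x)"
   using tr[OF q'(2)] c d q'(3) by (simp add: totally_real_iff)
  from K.det_hmat_pos(2)[OF rep_img[OF c d q'(3)] this] show ?thesis
   using pd q' by (simp add: h_def)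
 qed
 have "smooth_on ?V (%q. sqrt (Re (det (?H q))))"
  by (rule smooth_compose[OF smooth_sqrt smooth_bounded_linear[OF bounded_linear_Re V det] V]) (use pos in auto)
 hence "smooth_on ?V (%(s, x). vol_J_form AM g \<omega> (F s) c x)"
  by (rule smooth_cong'[OF _ V]) (auto simp: vol_J_form_eq[OF tr c d] pd h_def)
 moreover have "(s0, x0)\<in>?V" using s0 x0 by (simp add: local_dom_iff[OF C] d_def chart_at_in[OF aM])
 ultimately show "\<exists>U. (s0, x0)\<in>U \<and> smooth_on U (%(s, x). vol_J_form AM g \<omega> (F s) c x)" by (intro exI conjI)
qed

text \<open>After differentiation under the integral sign the derivative of the volume is a sum of
  integrals of continuous nonpositive functions, one of which is negative at the coordinates of
  \<open>p0\<close>.\<close>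

lemma Vol_J_decreasing:
 assumes \<epsilon>: "\<epsilon> > 0"
  and v: "!!c x. c\<in>AL ==> x\<in>cimg c ==> ((%s. vol_J_form AM g \<omega> (F s) c x) has_real_derivative v c x) (at 0)"
  and le: "!!c x. c\<in>AL ==> x\<in>cimg c ==> v c x \<le> 0"
  and less: "!!c. c\<in>AL ==> p0\<in>cdom c ==> v c (cm c p0) < 0"
 shows "\<not> ((%s. Vol_J AL AM g \<omega> (F s)) has_real_derivative 0) (at 0)"
proof -
 \<comment> \<open>The same choice as in \<open>form_integral\<close>, so that \<open>Vol_J\<close>
   unfolds into a sum over \<open>Fp\<close>.\<close>
 define P where "P = (SOME P. partition_of_unity AL P)"
 obtain Fp \<theta> where P: "P = (Fp, \<theta>)" by (cases P)
 have "partition_of_unity AL P" unfolding P_def by (rule someI_ex[OF partition_of_unity_exists[OF aL cmp]])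
 hence fin: "finite Fp" and Fp: "Fp \<subseteq> AL" and \<theta>0: "!!c p. c\<in>Fp ==> \<theta> c p \<ge> 0"
  and cl: "!!c. c\<in>Fp ==> closure {p. \<theta> c p \<noteq> 0} \<subseteq> cdom c"
  and sm: "!!c. c\<in>Fp ==> smooth_on (cimg c) (\<theta> c \<circ> ci c)" and sum1: "!!p. (\<Sum>c\<in>Fp. \<theta> c p) = 1"
  unfolding P partition_of_unity_def by auto
 \<comment> \<open>The weight has compact support inside the chart, so the extension by 0 is smooth
   on the whole space and integrals over the coordinate domain become integrals over a box.\<close>
 define \<phi> where "\<phi> c s x = (if x\<in>cimg c then \<theta> c (ci c x) * vol_J_form AM g \<omega> (F s) c x else 0)" for c s x
 define Kc where "Kc c = cm c ` closure {p. \<theta> c p \<noteq> 0}" for c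
 have Kc: "compact (Kc c)" "x\<in>cimg c ==> x \<notin> Kc c ==> \<theta> c (ci c x) = 0" if c: "c\<in>Fp" for c x
 proof -
  have cA: "c\<in>AL" using Fp c by blast
  note C = chL[OF cA]
  have "compact (closure {p. \<theta> c p \<noteq> 0})" using compact_Int_closed[OF cmp closed_closure] by simp
  thus "compact (Kc c)" unfolding Kc_def
   by (rule compact_continuous_image[OF continuous_on_subset[OF chD(7)[OF C] cl[OF c]]])
  show "\<theta> c (ci c x) = 0" if "x\<in>cimg c" "x \<notin> Kc c"
  proof (rule ccontr)
   assume "\<theta> c (ci c x) \<noteq> 0"
   hence "ci c x\<in>closure {p. \<theta> c p \<noteq> 0}" by (intro subsetD[OF closure_subset] CollectI)
   hence "cm c (ci c x)\<in>Kc c" unfolding Kc_def by (rule imageI)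
   thus False using that by (simp add: chD[OF C])
  qed
 qed
 have "\<exists>a. Kc c \<subseteq> box (- a) a" if "c\<in>Fp" for c
  using bounded_subset_box_symmetric[OF compact_imp_bounded[OF Kc(1)[OF that]]] by blast
 then obtain a where a: "!!c. c\<in>Fp ==> Kc c \<subseteq> box (- a c) (a c)" by metis
 define bx where "bx c = cbox (- a c) (a c)" for c
 have \<phi>sm: "smooth_on (T \<times> UNIV) (%(s, x). \<phi> c s x)" if c: "c\<in>Fp" for c
 proof (rule smooth_locally, clarify)
  fix s x assume s: "s\<in>T"
  have cA: "c\<in>AL" using Fp c by blast
  note C = chL[OF cA]
  show "\<exists>U. (s, x)\<in>U \<and> smooth_on U (%(s, x). \<phi> c s x)"
  proof (cases "x\<in>cimg c")
   case True
   let ?S = "T \<times> cimg c"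
   have S: "open ?S" by (intro open_Times open_greaterThanLessThan chD(2)[OF C])
   have "smooth_on ?S (%q. (\<theta> c \<circ> ci c) (snd q))"
    by (rule smooth_compose[OF sm[OF c] smooth_snd[OF S smooth_id] S chD(2)[OF C]]) auto
   from smooth_mult[OF S this smooth_variation_vol[OF cA]] have "smooth_on ?S (%(s, x). \<phi> c s x)"
    by (rule smooth_cong'[OF _ S]) (auto simp: \<phi>_def)
   thus ?thesis using True s by (intro exI[of _ ?S]) simp
  next
   case False
   let ?S = "T \<times> (- Kc c)"
   have S: "open ?S" by (intro open_Times open_greaterThanLessThan open_Compl compact_imp_closed Kc(1)[OF c])
   have "x \<notin> Kc c"
   proof
    assume "x\<in>Kc c"
    then obtain p where "x = cm c p" "p\<in>closure {p. \<theta> c p \<noteq> 0}" unfolding Kc_def by blast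
    thus False using cl[OF c] chD(4)[OF C] False by blast
   qed
   moreover have "smooth_on ?S (%(s, x). \<phi> c s x)"
    by (rule smooth_cong'[OF smooth_const[of _ 0] S]) (auto simp: \<phi>_def Kc(2)[OF c])
   ultimately show ?thesis using s by (intro exI[of _ ?S]) simp
  qed
 qed
 define fx where "fx c s x = fd (%(s, x). \<phi> c s x) (s, x) (1, 0)" for c s x
 have \<phi>d: "((%s. \<phi> c s x) has_real_derivative fx c s x) (at s)" if "c\<in>Fp" "s\<in>T" for c s x
 proof -
  have "((%s. \<phi> c s x) has_derivative (%r. fd (%(s, x). \<phi> c s x) (s, x) (r, 0))) (at s)"
   using frechet_slice_fst[OF \<phi>sm[OF that(1)], of s x] that(2) by simp
  moreover have "fd (%(s, x). \<phi> c s x) (s, x) (r, 0) = fx c s x * r" for r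
   using linear_scale[OF linear_deriv[OF \<phi>sm[OF that(1)], of "(s, x)"], of r "(1, 0)"] that(2)
   by (simp add: fx_def mult.commute)
  ultimately show ?thesis by (simp add: has_field_derivative_def)
 qed
 have cfx: "continuous_on (T \<times> UNIV) (%(s, x). fx c s x)" if "c\<in>Fp" for c
  using smooth_cont[OF smooth_deriv[OF \<phi>sm[OF that]], of "(1, 0)"]
  by (simp add: fx_def case_prod_unfold)
 have cx: "continuous_on S (fx c 0)" if "c\<in>Fp" for c S
 proof -
  have "Pair 0 ` S \<subseteq> T \<times> UNIV" using \<epsilon> by auto
  from continuous_on_compose2[OF cfx[OF that] continuous_on_Pair[OF continuous_on_const continuous_on_id] this]
  show ?thesis by simp
 qed
 have "((%s. integral (bx c) (\<phi> c s)) has_real_derivative integral (bx c) (fx c 0)) (at 0)" if c: "c\<in>Fp" for c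
 proof -
  have "((%s. integral (bx c) (\<phi> c s)) has_real_derivative integral (bx c) (fx c 0)) (at 0 within T)"
   unfolding bx_def
  proof (rule leibniz_rule_field_derivative)
   show "((%s. \<phi> c s t) has_real_derivative fx c s t) (at s within T)" if "s\<in>T" for s t
    using \<phi>d[OF c that] has_field_derivative_at_within by blast
   show "\<phi> c s integrable_on cbox (- a c) (a c)" if "s\<in>T" for s
   proof -
    have "Pair s ` cbox (- a c) (a c) \<subseteq> T \<times> UNIV" using that by auto
    from continuous_on_compose2[OF smooth_cont[OF \<phi>sm[OF c]] continuous_on_Pair[OF continuous_on_const continuous_on_id] this]
    show ?thesis by (intro integrable_continuous) simp
   qed
   show "continuous_on (T \<times> cbox (- a c) (a c)) (%(s, x). fx c s x)"
    by (rule continuous_on_subset[OF cfx[OF c]]) auto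
  qed (use \<epsilon> in auto)
  thus ?thesis using at_within_open[of 0 T] \<epsilon> by simp
 qed
 from DERIV_sum[OF this]
 have D: "((%s. \<Sum>c\<in>Fp. integral (bx c) (\<phi> c s)) has_real_derivative (\<Sum>c\<in>Fp. integral (bx c) (fx c 0))) (at 0)" .
 have Vol: "Vol_J AL AM g \<omega> (F s) = (\<Sum>c\<in>Fp. integral (bx c) (\<phi> c s))" for s
 proof -
  have "integral (cimg c) (%x. \<theta> c (ci c x) * vol_J_form AM g \<omega> (F s) c x) = integral (bx c) (\<phi> c s)" if c: "c\<in>Fp" for c
  proof -
   have "integral (cimg c) (%x. \<theta> c (ci c x) * vol_J_form AM g \<omega> (F s) c x) = integral UNIV (\<phi> c s)"
    unfolding \<phi>_def by (rule Henstock_Kurzweil_Integration.integral_restrict_UNIV[symmetric])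
   also have "\<phi> c s = (%x. if x\<in>bx c then \<phi> c s x else 0)"
    using Kc(2)[OF c] a[OF c] box_subset_cbox[of "- a c" "a c"] by (auto simp: \<phi>_def bx_def fun_eq_iff)
   finally show ?thesis by (simp add: Henstock_Kurzweil_Integration.integral_restrict_UNIV)
  qed
  thus ?thesis unfolding Vol_J_def form_integral_def P_def[symmetric] P by simp
 qed
 have fx0: "fx c 0 x = (if x\<in>cimg c then \<theta> c (ci c x) * v c x else 0)" if c: "c\<in>Fp" for c x
 proof -
  have "((%s. \<phi> c s x) has_real_derivative (if x\<in>cimg c then \<theta> c (ci c x) * v c x else 0)) (at 0)"
   unfolding \<phi>_def using v[of c x] Fp c by (auto intro!: DERIV_cmult)
  thus ?thesis using DERIV_unique[OF \<phi>d[OF c]] \<epsilon> by auto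
 qed
 have fxle: "fx c 0 x \<le> 0" if c: "c\<in>Fp" for c x
  unfolding fx0[OF c] using \<theta>0[OF c] le[of c x] Fp c by (auto intro: mult_nonneg_nonpos)
 have int: "fx c 0 integrable_on bx c" if "c\<in>Fp" for c
  unfolding bx_def by (rule integrable_continuous[OF cx[OF that]])
 have ile: "integral (bx c) (fx c 0) \<le> 0" if c: "c\<in>Fp" for c
  using integral_le[OF int[OF c] integrable_0] fxle[OF c] by simp
 obtain c1 where c1: "c1\<in>Fp" "\<theta> c1 p0 \<noteq> 0"
  using sum1[of p0] by (metis (mono_tags, lifting) sum.neutral zero_neq_one)
 have c1A: "c1\<in>AL" using Fp c1 by blast
 note C1 = chL[OF c1A]
 have p0: "p0\<in>closure {p. \<theta> c1 p \<noteq> 0}" using c1(2) by (intro subsetD[OF closure_subset] CollectI)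
 hence p0d: "p0\<in>cdom c1" using cl[OF c1(1)] by blast
 let ?x = "cm c1 p0"
 have xb: "?x\<in>box (- a c1) (a c1)" using a[OF c1(1)] p0 by (auto simp: Kc_def)
 have "fx c1 0 ?x < 0"
  unfolding fx0[OF c1(1)] using less[OF c1A p0d] c1(2) \<theta>0[OF c1(1), of p0]
  by (simp add: chD[OF C1] p0d mult_pos_neg)
 moreover have "integral (bx c1) (fx c1 0) \<noteq> 0"
 proof
  assume "integral (bx c1) (fx c1 0) = 0"
  hence "((%x. - fx c1 0 x) has_integral 0) (cbox (- a c1) (a c1))"
   using has_integral_neg[OF integrable_integral[OF int[OF c1(1)]]] by (simp add: bx_def)
  hence "- fx c1 0 ?x = 0"
   by (rule has_integral_0_cbox_imp_0[rotated 2])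
    (use xb box_subset_cbox fxle[OF c1(1)] cx[OF c1(1)] in \<open>auto intro!: continuous_intros\<close>)
  thus False using \<open>fx c1 0 ?x < 0\<close> by simp
 qed
 ultimately have "integral (bx c1) (fx c1 0) < 0" using ile[OF c1(1)] by simp
 hence "(\<Sum>c\<in>Fp. integral (bx c) (fx c 0)) < (\<Sum>c\<in>Fp. 0)"
  using ile c1(1) fin by (intro sum_strict_mono_ex1) auto
 thus ?thesis using DERIV_unique[OF D] unfolding Vol[abs_def] by force
qed

end

end

section \<open>A volume-decreasing variation supported in one coordinate ball\<close>

context kaehler_negative
begin

context
 fixes f :: "'l => 'p" and c0 d0 and k :: 'n and x0 :: "real^'n" and \<sigma> :: real
 assumes tr: "totally_real_immersion AL AM J f" and c0: "c0\<in>AL" and d0: "d0\<in>AM" and x0: "x0\<in>ldom f c0 d0"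
begin

interpretation K: kaehler_chart "cimg d0" "J d0" "g d0" by (rule KC[OF d0])

private abbreviation "X \<equiv> ldom f c0 d0"
private abbreviation "fh \<equiv> rep f c0 d0"

private lemma smf: "smooth_map AL AM f" using tr by (simp add: totally_real_iff)
private lemmas contf = smooth_map_cont[OF smf] and C0 = chL[OF c0] and D0 = chM[OF d0]
private lemma X: "open X" by (rule open_local_dom[OF C0 D0 contf])
private lemma sfh: "smooth_on X fh" by (rule smooth_mapD[OF smf c0 d0])
private lemma fhY: "x\<in>X ==> fh x\<in>cimg d0" by (rule rep_img[OF c0 d0])
private lemma cb: "x\<in>X ==> cbasis (J d0 (fh x)) (%i. pd i fh x)" using tr c0 d0 by (simp add: totally_real_iff)

text \<open>The connection matrix of the frame in the direction \<open>k\<close>;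
  \<open>\<xi>\<close> is the \<open>k\<close>-th component of the Maslov form.\<close>

private definition "Cx x = (\<chi> i. K.coord (fh x) (%l. pd l fh x) (K.nab fh k i x))"
private definition "\<xi> x = Im (trace (Cx x))"

private lemma nab_Cx: "x\<in>X ==> K.nab fh k i x = comb (J d0 (fh x)) (%l. pd l fh x) (Cx x$i)"
 by (simp add: Cx_def K.comb_coord[OF fhY cb])

private lemma cont_\<xi>: "continuous_on X \<xi>"
proof -
 have "smooth_on X (K.nab fh k i)" for i
  unfolding K.nab_def[abs_def] by (intro smooth_add X smooth_pd sfh K.smooth_Gam_field fhY)
 hence "smooth_on X Cx"
  unfolding Cx_def[abs_def] by (intro smooth_vec_lambda X K.smooth_coord sfh fhY smooth_pd cb) auto
 hence "continuous_on X Cx" by (rule smooth_cont)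
 thus ?thesis unfolding \<xi>_def[abs_def] trace_def by (intro continuous_intros)
qed

context
 fixes r :: real
 assumes r: "r > 0" and ball: "cball x0 r \<subseteq> X" and \<sigma>\<xi>: "!!x. x\<in>cball x0 r ==> \<sigma> * \<xi> x > 0"
begin

text \<open>The factor \<open>\<sigma>\<close> makes \<open>\<beta> * \<xi>\<close> nonnegative, so
  the volume decreases along the field \<open>\<beta> J pd k f\<close>. The variation follows
  straight lines of the target chart and leaves \<open>f\<close> unchanged outside the ball.\<close>

private definition "\<beta> x = \<sigma> * bump x0 r x"
private definition "N x = \<beta> x *\<^sub>R (J d0 (fh x) *v pd k fh x)"
private definition "\<Psi> = (%(s, x). fh x + s *\<^sub>R N x)"
private definition "P0 = {p\<in>cdom c0. cm c0 p\<in>X}"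
private definition "F s p = (if p\<in>P0 then ci d0 (\<Psi> (s, cm c0 p)) else f p)" for s
private definition "Kb = mball c0 x0 r"

private lemma ball': "cball x0 r \<subseteq> cimg c0"
 using ball by (auto simp: local_dom_iff[OF C0])

private lemma s\<beta>: "smooth_on X \<beta>"
 unfolding \<beta>_def by (intro smooth_mult X smooth_const smooth_bump)

private lemma sN: "smooth_on X N"
 unfolding N_def by (intro smooth_scaleR X s\<beta> smooth_mv smooth_compose[OF K.sJ] sfh K.Y fhY smooth_pd)

private lemma oX2: "open ((UNIV :: real set) \<times> X)"
 by (intro open_Times open_UNIV X)

private lemma s\<Psi>: "smooth_on (UNIV \<times> X) \<Psi>"
proof -
 note fst = smooth_fst[OF oX2 smooth_id] and snd = smooth_snd[OF oX2 smooth_id]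
 show ?thesis unfolding \<Psi>_def case_prod_unfold
  by (intro smooth_add smooth_scaleR oX2 fst smooth_compose[OF sfh snd] smooth_compose[OF sN snd] X) auto
qed

private lemma \<Psi>_outside: "x \<notin> cball x0 r ==> \<Psi> (s, x) = fh x"
 using bump_eq_0[of r x0 x] r by (simp add: \<Psi>_def N_def \<beta>_def)

private lemma pd_\<Psi>: "x\<in>X ==> fd \<Psi> (s, x) (0, axis i 1) = pd i fh x + s *\<^sub>R pd i N x"
proof -
 assume x: "x\<in>X"
 have "((%x. \<Psi> (s, x)) has_derivative (%v. fd fh x v + s *\<^sub>R fd N x v)) (at x)"
  unfolding \<Psi>_def split_conv
  by (intro has_derivative_add has_derivative_scaleR_right smooth_hd[OF sfh x] smooth_hd[OF sN x])
 from has_derivative_unique[OF frechet_slice_snd[OF s\<Psi>] this] x show ?thesis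
  by (simp add: pd_def fun_eq_iff)
qed

private definition "HM q = K.hmat (\<Psi> q) (%i. fd \<Psi> q (0, axis i 1))"
text \<open>The parameters and points at which \<open>\<Psi>\<close> stays in the target chart and
  remains totally real; the determinant makes the latter an open condition.\<close>

private definition "Good = {q\<in>UNIV \<times> X. \<Psi> q\<in>cimg d0 \<and> det (HM q) \<noteq> 0}"

private lemma open_Good: "open Good"
proof -
 let ?O1 = "UNIV \<times> X \<inter> \<Psi> -` cimg d0"
 have o1: "open ?O1" by (rule continuous_open_preimage[OF smooth_cont[OF s\<Psi>] oX2 K.Y])
 have s1: "smooth_on ?O1 \<Psi>" by (rule smooth_subset[OF s\<Psi>]) auto
 have "smooth_on ?O1 (%q. det (HM q))"
  by (rule smooth_det[OF o1]) (unfold HM_def K.hmat_def vec_lambda_beta, intro K.smooth_hh o1 s1 smooth_deriv, auto)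
 from continuous_open_preimage[OF smooth_cont[OF this] o1, of "- {0}"]
 have "open (?O1 \<inter> (%q. det (HM q)) -` (- {0}))" by (simp add: open_Compl)
 moreover have "?O1 \<inter> (%q. det (HM q)) -` (- {0}) = Good" by (auto simp: Good_def)
 ultimately show ?thesis by simp
qed

private lemma Good_0: "x\<in>X ==> (0, x)\<in>Good"
 using K.det_hmat[OF fhY cb] fhY by (simp add: Good_def HM_def pd_\<Psi>) (simp add: \<Psi>_def)

private lemma Good_outside: "x\<in>X ==> x \<notin> cball x0 r ==> (s, x)\<in>Good"
proof -
 assume x: "x\<in>X" "x \<notin> cball x0 r"
 have "((%x. 0) has_derivative (%v. 0)) (at x)" by simp
 hence "(N has_derivative (%v. 0)) (at x)"
 proof (rule hd_cong)
  show "open (- cball x0 r)" "x\<in>- cball x0 r" using x by auto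
  show "0 = N y" if "y\<in>- cball x0 r" for y using that bump_eq_0[of r x0 y] r by (simp add: N_def \<beta>_def)
 qed
 hence "pd i N x = 0" for i using fun_cong[OF fdI, of N "%v. 0" x "axis i 1"] by (simp add: pd_def)
 thus ?thesis
  using K.det_hmat[OF fhY cb, OF x(1) x(1)] fhY[OF x(1)] x by (simp add: Good_def HM_def pd_\<Psi> \<Psi>_outside)
qed

text \<open>Outside the ball nothing moves, and over the compact ball the tube lemma gives one
  \<open>\<epsilon>\<close> for the open set \<open>Good\<close>.\<close>

private lemma tube: "\<exists>\<epsilon>>0. \<forall>s x. s\<in>{-\<epsilon><..<\<epsilon>} --> x\<in>X --> (s, x)\<in>Good"
proof -
 have op: "open {q. (snd q, fst q)\<in>Good}"
  using open_vimage[OF open_Good, of "%q. (snd q, fst q)"] by (simp add: vimage_def continuous_on_Pair continuous_on_fst continuous_on_snd continuous_on_id)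
 let ?U = "cball x0 r \<times> UNIV \<inter> {q. (snd q, fst q)\<in>Good}"
 obtain V where V: "openin (top_of_set UNIV) V" "0\<in>V" "cball x0 r \<times> V \<subseteq> ?U"
 proof (rule tube_lemma[where S="cball x0 r" and a="0::real" and U="?U" and T=UNIV])
  show "compact (cball x0 r)" "cball x0 r \<noteq> {}" using r by auto
  show "(%x. (x, 0)) ` cball x0 r \<subseteq> ?U" using Good_0 ball by auto
  show "openin (top_of_set (cball x0 r \<times> UNIV)) ?U"
   using op by (auto simp: openin_open)
 qed auto
 have "open V" using V(1) by simp
 then obtain \<epsilon> where "\<epsilon> > 0" and \<epsilon>: "ball 0 \<epsilon> \<subseteq> V" using V(2) open_contains_ball by blast
 have "(s, x)\<in>Good" if "s\<in>{-\<epsilon><..<\<epsilon>}" "x\<in>X" for s x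
 proof (cases "x\<in>cball x0 r")
  case True
  have "s\<in>V" using that(1) by (intro subsetD[OF \<epsilon>]) (auto simp: dist_real_def)
  hence "(x, s)\<in>?U" using V(3) True by blast
  thus ?thesis by simp
 qed (use Good_outside that(2) in blast)
 thus ?thesis using \<open>\<epsilon> > 0\<close> by blast
qed

private lemma P0_iff: "p\<in>P0 \<longleftrightarrow> p\<in>cdom c0 \<and> f p\<in>cdom d0"
 by (auto simp: P0_def local_dom_iff[OF C0] chD[OF C0])

private lemma open_P0: "open P0" unfolding P0_def by (rule open_chart_vimage[OF C0 X])

private lemma Kb_iff: "p\<in>Kb \<longleftrightarrow> p\<in>cdom c0 \<and> cm c0 p\<in>cball x0 r"
 unfolding Kb_def by (rule mball_iff[OF aL c0 r ball'])

private lemma closed_Kb: "closed Kb" unfolding Kb_def by (rule closed_mball[OF aL c0 r ball'])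

private lemma Kb_P0: "Kb \<subseteq> P0" using ball by (auto simp: Kb_iff P0_def)

private lemma F_outside: "p \<notin> Kb ==> F s p = f p"
 by (auto simp: F_def Kb_iff P0_iff \<Psi>_outside local_rep_map[OF C0] chD[OF D0])

private lemma F_0: "F 0 = f"
 by (auto simp: F_def fun_eq_iff P0_iff \<Psi>_def local_rep_map[OF C0] chD[OF D0])

context
 fixes \<epsilon> :: real
 assumes \<epsilon>: "\<epsilon> > 0" and tb: "!!s x. s\<in>{-\<epsilon><..<\<epsilon>} ==> x\<in>X ==> (s, x)\<in>Good"
begin

private abbreviation "Ts \<equiv> {-\<epsilon><..<\<epsilon>}"

private lemma F_P0: "s\<in>Ts ==> p\<in>P0 ==> F s p\<in>cdom d0 \<and> cm d0 (F s p) = \<Psi> (s, cm c0 p)"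
 using tb[of s "cm c0 p"] by (simp add: F_def Good_def P0_def chD[OF D0])

private lemma cont_F: "continuous_on (Ts \<times> UNIV) (%(s, p). F s p)"
proof -
 have "continuous_on (Ts \<times> P0) (%q. ci d0 (\<Psi> (fst q, cm c0 (snd q))))"
 proof (rule continuous_on_compose2[OF chD(8)[OF D0]])
  show "continuous_on (Ts \<times> P0) (%q. \<Psi> (fst q, cm c0 (snd q)))"
   by (rule continuous_on_compose2[OF smooth_cont[OF s\<Psi>]])
    (auto intro!: continuous_on_Pair continuous_on_compose2[OF chD(7)[OF C0]] continuous_intros simp: P0_def)
  show "(%q. \<Psi> (fst q, cm c0 (snd q))) ` (Ts \<times> P0) \<subseteq> cimg d0" using tb by (auto simp: Good_def P0_def)
 qed
 hence 1: "continuous_on (Ts \<times> P0) (%(s, p). F s p)"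
  by (rule continuous_on_cong[THEN iffD1, rotated 2]) (auto simp: F_def)
 have "continuous_on (Ts \<times> (- Kb)) (%q. f (snd q))"
  by (intro continuous_on_compose2[OF contf] continuous_intros) auto
 hence 2: "continuous_on (Ts \<times> (- Kb)) (%(s, p). F s p)"
  by (rule continuous_on_cong[THEN iffD1, rotated 2]) (auto simp: F_outside)
 have "Ts \<times> UNIV = Ts \<times> P0 \<union> Ts \<times> (- Kb)" using Kb_P0 by auto
 thus ?thesis
  using continuous_on_open_Un[OF _ _ 1 2] by (simp add: open_Times open_P0 closed_Kb open_Compl)
qed

private lemmas open_dom = open_family_dom[OF cont_F open_greaterThanLessThan]

private lemma smooth_F:
 assumes c: "c\<in>AL" and d: "d\<in>AM"
 shows "smooth_on {(s, x). s\<in>Ts \<and> x\<in>ldom (F s) c d} (%(s, x). rep (F s) c d x)"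
proof (rule smooth_locally)
 note C = chL[OF c] and D = chM[OF d]
 let ?V = "{(s, x). s\<in>Ts \<and> x\<in>ldom (F s) c d}" and ?h = "%(s, x). rep (F s) c d x"
 fix q assume q: "q\<in>?V"
 show "\<exists>U. q\<in>U \<and> smooth_on U ?h"
 proof (cases "ci c (snd q)\<in>P0")
  case True
  let ?X = "{x\<in>cimg c. ci c x\<in>P0}"
  let ?U = "?V \<inter> UNIV \<times> ?X"
  have U: "open ?U" by (intro open_Int open_dom c d open_Times open_UNIV open_chart_image[OF C open_P0])
  have t: "smooth_on ?U (%q. trn c c0 (snd q))"
   by (rule smooth_compose[OF smooth_transition[OF aL c c0] smooth_snd[OF U smooth_id] U open_overlap[OF C C0]])
    (auto simp: overlap_iff[OF C] P0_iff)
  have p: "smooth_on ?U (%q. \<Psi> (fst q, trn c c0 (snd q)))"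
   by (rule smooth_compose[OF s\<Psi> smooth_Pair[OF U smooth_fst[OF U smooth_id] t] U oX2])
    (auto simp: transition_apply P0_def)
  have e: "\<Psi> (s, trn c c0 x)\<in>overlap d0 d \<and> rep (F s) c d x = trn d0 d (\<Psi> (s, trn c c0 x))"
   if "(s, x)\<in>?U" for s x
  proof -
   from that have s: "s\<in>Ts" and x: "ci c x\<in>P0" and Fd: "F s (ci c x)\<in>cdom d" by (auto simp: local_dom_iff[OF C])
   have 1: "F s (ci c x)\<in>cdom d0" "\<Psi> (s, trn c c0 x) = cm d0 (F s (ci c x))"
    using F_P0[OF s x] by (simp_all add: transition_apply)
   show ?thesis unfolding 1(2)
    using Fd 1(1) by (simp add: overlap_iff[OF D0] local_rep_apply transition_apply chD[OF D0])
  qed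
  have "smooth_on ?U (%q. trn d0 d (\<Psi> (fst q, trn c c0 (snd q))))"
   by (rule smooth_compose[OF smooth_transition[OF aM d0 d] p U open_overlap[OF D0 D]]) (use e in force)
  hence "smooth_on ?U ?h" by (rule smooth_cong'[OF _ U]) (use e in force)
  moreover have "q\<in>?U" using q True by (auto simp: local_dom_iff[OF C])
  ultimately show ?thesis by (intro exI conjI)
 next
  case False
  let ?X = "{x\<in>cimg c. ci c x\<in>- Kb} \<inter> ldom f c d"
  let ?U = "(UNIV :: real set) \<times> ?X"
  have U: "open ?U" by (intro open_Times open_UNIV open_Int open_chart_image[OF C] open_Compl closed_Kb open_local_dom[OF C D contf])
  have "smooth_on ?U (%q. rep f c d (snd q))"
   by (rule smooth_compose[OF smooth_mapD[OF smf c d] smooth_snd[OF U smooth_id] U open_local_dom[OF C D contf]]) auto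
  hence "smooth_on ?U ?h" by (rule smooth_cong'[OF _ U]) (auto simp: local_rep_apply F_outside)
  moreover have "q\<in>?U"
  proof -
   obtain s x where qq: "q = (s, x)" by (cases q)
   have "ci c x \<notin> Kb" using False Kb_P0 by (auto simp: qq)
   thus ?thesis using q F_outside[of "ci c x" s] by (simp add: qq local_dom_iff[OF C])
  qed
  ultimately show ?thesis by (intro exI conjI)
 qed
qed

private lemma rep_F0:
 assumes s: "s\<in>Ts" and x: "x\<in>X"
 shows "x\<in>ldom (F s) c0 d0" "rep (F s) c0 d0 x = \<Psi> (s, x)"
  "pd i (rep (F s) c0 d0) x = pd i fh x + s *\<^sub>R pd i N x"
proof -
 have P: "ci c0 z\<in>P0" "z\<in>cimg c0" if "z\<in>X" for z
  using that by (auto simp: P0_def local_dom_iff[OF C0] chD[OF C0])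
 have e: "rep (F s) c0 d0 z = \<Psi> (s, z)" if "z\<in>X" for z
  using F_P0[OF s P(1)[OF that]] P(2)[OF that] by (simp add: local_rep_apply chD[OF C0])
 show "x\<in>ldom (F s) c0 d0" using F_P0[OF s P(1)[OF x]] P(2)[OF x] by (simp add: local_dom_iff[OF C0])
 show "rep (F s) c0 d0 x = \<Psi> (s, x)" by (rule e[OF x])
 have "pd i (rep (F s) c0 d0) x = pd i (%z. \<Psi> (s, z)) x"
  unfolding pd_def by (rule fun_cong[OF fd_cong[OF X x e]])
 also have "\<dots> = fd \<Psi> (s, x) (0, axis i 1)"
  unfolding pd_def using x by (intro fun_cong[OF fdI[OF frechet_slice_snd[OF s\<Psi>]]]) auto
 also have "\<dots> = pd i fh x + s *\<^sub>R pd i N x" by (rule pd_\<Psi>[OF x])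
 finally show "pd i (rep (F s) c0 d0) x = pd i fh x + s *\<^sub>R pd i N x" .
qed

private lemma rep_F_out:
 assumes c: "c\<in>AL" and d: "d\<in>AM" and x: "x\<in>ldom f c d" and K: "ci c x \<notin> Kb"
 shows "rep (F s) c d x = rep f c d x" "pd i (rep (F s) c d) x = pd i (rep f c d) x"
  "x\<in>ldom (F s) c d"
proof -
 note C = chL[OF c] and D = chM[OF d]
 let ?X = "{x\<in>cimg c. ci c x\<in>- Kb}"
 have X: "open ?X" by (intro open_chart_image[OF C] open_Compl closed_Kb)
 have xX: "x\<in>?X" using x K by (simp add: local_dom_iff[OF C])
 show "rep (F s) c d x = rep f c d x" using K by (simp add: local_rep_apply F_outside)
 show "pd i (rep (F s) c d) x = pd i (rep f c d) x" unfolding pd_def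
  by (rule fun_cong[OF fd_cong[OF X xX]]) (simp add: local_rep_apply F_outside)
 show "x\<in>ldom (F s) c d" using x K by (simp add: local_dom_iff[OF C] F_outside)
qed

private lemma smooth_Fs: "s\<in>Ts ==> smooth_map AL AM (F s)"
 unfolding smooth_map_def
proof (intro conjI ballI)
 assume s: "s\<in>Ts"
 have "continuous_on UNIV (%p. (s, p))" by (intro continuous_intros)
 moreover have "Pair s ` UNIV \<subseteq> Ts \<times> UNIV" using s by auto
 ultimately show cF: "continuous_on UNIV (F s)" using continuous_on_compose2[OF cont_F] by fastforce
 fix c d assume c: "c\<in>AL" and d: "d\<in>AM"
 let ?V = "{(s, x). s\<in>Ts \<and> x\<in>ldom (F s) c d}"
 have o: "open (ldom (F s) c d)" by (rule open_local_dom[OF chL[OF c] chM[OF d] cF])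
 have "smooth_on (ldom (F s) c d) (%x. (%(s, x). rep (F s) c d x) (s, x))"
  by (rule smooth_compose[OF smooth_F[OF c d] smooth_Pair[OF o smooth_const smooth_id] o open_dom[OF c d]]) (use s in auto)
 thus "smooth_on (ldom (F s) c d) (rep (F s) c d)" by simp
qed

private lemma var: "totally_real_variation AL AM J f \<epsilon> F"
 unfolding totally_real_variation_def
proof (intro conjI ballI F_0 cont_F smooth_F)
 fix s assume s: "s\<in>Ts"
 show "totally_real_immersion AL AM J (F s)"
 proof (rule totally_real_local[OF smooth_Fs[OF s]])
  fix p
  show "\<exists>c\<in>AL. \<exists>d\<in>AM. p\<in>cdom c \<and> F s p\<in>cdom d \<and>
   cbasis (J d (rep (F s) c d (cm c p))) (%i. pd i (rep (F s) c d) (cm c p))"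
  proof (cases "p\<in>P0")
   case True
   let ?x = "cm c0 p"
   have x: "?x\<in>X" "p\<in>cdom c0" using True by (auto simp: P0_def)
   have "cbasis (J d0 (\<Psi> (s, ?x))) (%i. pd i fh ?x + s *\<^sub>R pd i N ?x)"
    using tb[OF s x(1)] by (intro K.cbasis_hmat[OF dims]) (auto simp: Good_def HM_def pd_\<Psi>)
   thus ?thesis
    using rep_F0[OF s x(1)] F_P0[OF s True] x(2) by (intro bexI[OF _ c0] bexI[OF _ d0]) simp
  next
   case False
   define c where "c = chart_at AL p"
   define d where "d = chart_at AM (f p)"
   have c: "c\<in>AL" "p\<in>cdom c" and d: "d\<in>AM" "f p\<in>cdom d"
    by (auto simp: c_def d_def chart_at_in[OF aL] chart_at_in[OF aM])
   note C = chL[OF c(1)]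
   have K: "p \<notin> Kb" using False Kb_P0 by blast
   have x: "cm c p\<in>ldom f c d" using c d by (simp add: local_dom_map[OF C])
   have "cbasis (J d (rep f c d (cm c p))) (%i. pd i (rep f c d) (cm c p))"
    using tr c d x by (simp add: totally_real_iff)
   thus ?thesis
    using rep_F_out[OF c(1) d(1) x, where s=s] K c d
    by (intro bexI[OF _ c(1)] bexI[OF _ d(1)]) (simp add: chD[OF C] F_outside)
  qed
 qed
qed

text \<open>In the chart \<open>c\<close> the density is the root of a Gram determinant in
  \<open>c0\<close> times a squared Jacobian that is constant in \<open>s\<close>. The root halves
  the factor 2 of \<open>variation_derivative\<close>.\<close>

private lemma vol_derivative:
 assumes c: "c\<in>AL" and x: "x\<in>cimg c"
 shows "((%s. vol_J_form AM g \<omega> (F s) c x) has_real_derivative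
  (if ci c x\<in>P0 then - (\<beta> (trn c c0 x) * \<xi> (trn c c0 x)) * vol_J_form AM g \<omega> f c x else 0)) (at 0)"
proof (cases "ci c x\<in>P0")
 case True
 note C = chL[OF c]
 let ?x = "trn c c0 x" and ?m = "(det (jacobian (trn c c0) (at x)))\<^sup>2"
 have xo: "x\<in>overlap c c0" using True x by (simp add: overlap_iff[OF C] P0_iff)
 have xX: "?x\<in>X" using True by (simp add: transition_apply P0_def)
 let ?D = "%s. det (K.hmat (fh ?x + s *\<^sub>R N ?x) (%i. pd i fh ?x + s *\<^sub>R pd i N ?x))"
 have vol: "vol_J_form AM g \<omega> (F s) c x = sqrt (?m * Re (?D s))" if s: "s\<in>Ts" for s
 proof -
  have tr': "totally_real_immersion AL AM J (F s)" using var s by (simp add: totally_real_variation_def)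
  have xd: "x\<in>ldom (F s) c d0" using F_P0[OF s True] x by (simp add: local_dom_iff[OF C])
  show ?thesis
   unfolding vol_J_form_eq[OF tr' c d0 xd] det_hmat_source[OF smooth_Fs[OF s] c0 c d0 xd xo] rep_F0(2,3)[OF s xX]
   by (simp add: \<Psi>_def)
 qed
 have D0: "Re (?D 0) > 0" using K.det_hmat_pos(2)[OF fhY cb, OF xX xX] by simp
 have "?m \<noteq> 0" using ori c c0 xo unfolding oriented_atlas_def by fastforce
 hence m: "?m > 0" by simp
 have "(?D has_derivative (%h. h *\<^sub>R (of_real (2 * (- (\<beta> ?x * \<xi> ?x))) * ?D 0))) (at 0)"
  using K.variation_derivative[OF X xX sfh fhY[OF xX] cb[OF xX] s\<beta> nab_Cx[OF xX]] by (simp add: N_def[abs_def] \<xi>_def)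
 hence "((%s. Re (?D s)) has_derivative (%h. Re (h *\<^sub>R (of_real (2 * (- (\<beta> ?x * \<xi> ?x))) * ?D 0)))) (at 0)"
  by (rule bounded_linear.has_derivative[OF bounded_linear_Re])
 hence "((%s. Re (?D s)) has_real_derivative (2 * (- (\<beta> ?x * \<xi> ?x)) * Re (?D 0))) (at 0)"
  unfolding has_field_derivative_def by (rule has_derivative_eq_rhs) (auto simp: fun_eq_iff)
 from DERIV_cmult[OF this, of ?m]
 have 1: "((%s. ?m * Re (?D s)) has_real_derivative (?m * (2 * (- (\<beta> ?x * \<xi> ?x)) * Re (?D 0)))) (at 0)" .
 have p: "?m * Re (?D 0) > 0" using m D0 by simp
 have 2: "((%s. sqrt (?m * Re (?D s))) has_real_derivative (inverse (sqrt (?m * Re (?D 0))) / 2) * (?m * (2 * (- (\<beta> ?x * \<xi> ?x)) * Re (?D 0)))) (at 0)"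
  by (rule DERIV_chain2[OF DERIV_real_sqrt[OF p] 1])
 have "inverse (sqrt (m * R)) / 2 * (m * (2 * b * R)) = b * sqrt (m * R)" if "m * R > 0" for m R b :: real
 proof -
  have "m * (2 * b * R) = 2 * b * (sqrt (m * R) * sqrt (m * R))" using that by simp
  thus ?thesis using that by (simp only:) (simp add: field_simps del: real_sqrt_mult_self)
 qed
 from 2[unfolded this[OF p]]
 have "((%s. sqrt (?m * Re (?D s))) has_real_derivative - (\<beta> ?x * \<xi> ?x) * vol_J_form AM g \<omega> f c x) (at 0)"
  using vol[of 0] \<epsilon> by (simp add: F_0)
 hence "((%s. vol_J_form AM g \<omega> (F s) c x) has_real_derivative - (\<beta> ?x * \<xi> ?x) * vol_J_form AM g \<omega> f c x) (at 0)"
  by (rule has_field_derivative_transform_within_open[of _ _ _ Ts]) (use vol \<epsilon> in auto)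
 thus ?thesis using True by simp
next
 case False
 note C = chL[OF c]
 define d where "d = chart_at AM (f (ci c x))"
 have d: "d\<in>AM" "x\<in>ldom f c d" using x by (auto simp: d_def chart_at_in[OF aM] local_dom_iff[OF C])
 have K: "ci c x \<notin> Kb" using False Kb_P0 by blast
 have "vol_J_form AM g \<omega> (F s) c x = vol_J_form AM g \<omega> f c x" if s: "s\<in>Ts" for s
 proof -
  have tr': "totally_real_immersion AL AM J (F s)" using var s by (simp add: totally_real_variation_def)
  show ?thesis
   unfolding vol_J_form_eq[OF tr' c d(1) rep_F_out(3)[OF c d K]] vol_J_form_eq[OF tr c d] rep_F_out(1,2)[OF c d K] ..
 qed
 hence "((%s. vol_J_form AM g \<omega> (F s) c x) has_real_derivative 0) (at 0)"
  using has_field_derivative_transform_within_open[of "%s. vol_J_form AM g \<omega> f c x" 0 0 Ts "%s. vol_J_form AM g \<omega> (F s) c x"] \<epsilon> by auto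
 thus ?thesis using False by simp
qed

private lemma vol_pos:
 assumes c: "c\<in>AL" and x: "x\<in>cimg c"
 shows "vol_J_form AM g \<omega> f c x > 0"
proof -
 define d where "d = chart_at AM (f (ci c x))"
 have d: "d\<in>AM" "x\<in>ldom f c d" using x by (auto simp: d_def chart_at_in[OF aM] local_dom_iff[OF chL[OF c]])
 interpret K': kaehler_chart "cimg d" "J d" "g d" by (rule KC[OF d(1)])
 have "cbasis (J d (rep f c d x)) (%i. pd i (rep f c d) x)" using tr c d by (simp add: totally_real_iff)
 from K'.det_hmat_pos(2)[OF rep_img[OF c d] this] show ?thesis unfolding vol_J_form_eq[OF tr c d] by simp
qed

private lemma \<beta>\<xi>: "\<beta> x * \<xi> x \<ge> 0" "\<beta> x0 * \<xi> x0 > 0"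
proof -
 have e: "\<beta> x * \<xi> x = bump x0 r x * (\<sigma> * \<xi> x)" for x by (simp add: \<beta>_def)
 show "\<beta> x * \<xi> x \<ge> 0"
 proof (cases "x\<in>cball x0 r")
  case True
  show ?thesis unfolding e by (rule mult_nonneg_nonneg[OF bump_nonneg less_imp_le[OF \<sigma>\<xi>[OF True]]])
 next
  case False
  hence "bump x0 r x = 0" using r by (intro bump_eq_0) auto
  thus ?thesis by (simp add: e)
 qed
 show "\<beta> x0 * \<xi> x0 > 0" unfolding e by (rule mult_pos_pos[OF bump_pos \<sigma>\<xi>]) (use r in auto)
qed

lemma not_J_minimal_aux: "\<not> J_minimal AL AM J g \<omega> f"
proof
 assume "J_minimal AL AM J g \<omega> f"
 hence "((%s. Vol_J AL AM g \<omega> (F s)) has_real_derivative 0) (at 0)"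
  unfolding J_minimal_def using var \<epsilon> by blast
 moreover have "\<not> ((%s. Vol_J AL AM g \<omega> (F s)) has_real_derivative 0) (at 0)"
 proof (rule Vol_J_decreasing[OF var \<epsilon> vol_derivative])
  show "(if ci c x\<in>P0 then - (\<beta> (trn c c0 x) * \<xi> (trn c c0 x)) * vol_J_form AM g \<omega> f c x else 0) \<le> 0"
   if "c\<in>AL" "x\<in>cimg c" for c x
   using mult_nonneg_nonneg[OF \<beta>\<xi>(1) less_imp_le[OF vol_pos[OF that]], of "trn c c0 x"] by simp
  fix c assume c: "c\<in>AL" "ci c0 x0\<in>cdom c"
  note C = chL[OF c(1)]
  have p: "ci c0 x0\<in>P0" "x0\<in>cimg c0"
   using x0 by (auto simp: P0_def local_dom_iff[OF C0] chD[OF C0])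
  have "trn c c0 (cm c (ci c0 x0)) = x0"
   using p(2) c(2) by (simp add: transition_apply chD[OF C] chD[OF C0])
  moreover have "ci c (cm c (ci c0 x0)) = ci c0 x0" using c(2) by (simp add: chD[OF C])
  ultimately show "(if ci c (cm c (ci c0 x0))\<in>P0 then - (\<beta> (trn c c0 (cm c (ci c0 x0)))
    * \<xi> (trn c c0 (cm c (ci c0 x0)))) * vol_J_form AM g \<omega> f c (cm c (ci c0 x0)) else 0) < 0"
   using mult_pos_pos[OF \<beta>\<xi>(2) vol_pos[OF c(1) chD(4)[OF C c(2)]]] p(1) by simp
 qed
 ultimately show False by blast
qed

end

lemma not_J_minimal_ball: "\<not> J_minimal AL AM J g \<omega> f"
 using tube not_J_minimal_aux by metis

end

text \<open>If \<open>\<sigma> * \<xi>\<close> is positive at \<open>x0\<close>, it is positive on a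
  small ball, and a variation supported there lowers the volume to first order. The values 1 and -1
  of \<open>\<sigma>\<close> together make the component vanish.\<close>

lemma J_minimal_xi0_aux:
 assumes "J_minimal AL AM J g \<omega> f"
 shows "\<sigma> * Im (trace (\<chi> i. K.coord (fh x0) (%l. pd l fh x0) (K.nab fh k i x0))) \<le> 0"
proof (rule ccontr)
 assume "\<not> ?thesis"
 hence pos: "\<sigma> * \<xi> x0 > 0" by (simp add: \<xi>_def Cx_def)
 have "continuous_on X (%x. \<sigma> * \<xi> x)" by (intro continuous_intros cont_\<xi>)
 from continuous_open_preimage[OF this X open_greaterThan[of 0]]
 have "open (X \<inter> (%x. \<sigma> * \<xi> x) -` {0<..})" .
 moreover have "x0\<in>X \<inter> (%x. \<sigma> * \<xi> x) -` {0<..}" using x0 pos by simp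
 ultimately obtain r where "r > 0" "cball x0 r \<subseteq> X \<inter> (%x. \<sigma> * \<xi> x) -` {0<..}"
  using open_contains_cball by blast
 hence "\<not> J_minimal AL AM J g \<omega> f" by (intro not_J_minimal_ball[of r]) auto
 thus False using assms by blast
qed

lemma nab_coord: "K.nab fh k i x0 = comb (J d0 (fh x0)) (%l. pd l fh x0) ((\<chi> i. K.coord (fh x0) (%l. pd l fh x0) (K.nab fh k i x0))$i)"
 using nab_Cx[OF x0] by (simp add: Cx_def)

end

theorem J_minimal_maslov_zero:
 assumes min: "J_minimal AL AM J g \<omega> f"
 shows "maslov_zero f"
proof -
 have tr: "totally_real_immersion AL AM J f" using min by (simp add: J_minimal_def)
 have "kaehler_chart.xi0 (J d) (g d) (rep f c d) x" if c: "c\<in>AL" and d: "d\<in>AM" and x: "x\<in>ldom f c d" for c d x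
 proof -
  interpret K: kaehler_chart "cimg d" "J d" "g d" by (rule KC[OF d])
  show ?thesis unfolding K.xi0_def
  proof
   fix k
   let ?C = "\<chi> i. K.coord (rep f c d x) (%l. pd l (rep f c d) x) (K.nab (rep f c d) k i x)"
   have "Im (trace ?C) = 0"
    using J_minimal_xi0_aux[OF tr c d x min, of 1 k] J_minimal_xi0_aux[OF tr c d x min, of "-1" k] by simp
   thus "\<exists>C. (\<forall>i. K.nab (rep f c d) k i x = comb (J d (rep f c d x)) (%l. pd l (rep f c d) x) (C$i)) \<and> Im (trace C) = 0"
    using nab_coord[OF tr c d x] by (intro exI[of _ ?C]) blast
  qed
 qed
 thus ?thesis using tr by (simp add: maslov_zero_def totally_real_iff)
qed

end

section \<open>Convergence in the Hoelder topology\<close>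

lemma cSUP_nonneg:
 fixes h :: "'a => real"
 assumes "bdd_above (h ` K)" "K \<noteq> {}" "!!x. x\<in>K ==> 0 \<le> h x"
 shows "0 \<le> (SUP x\<in>K. h x)"
proof -
 obtain x where "x\<in>K" using assms(2) by blast
 thus ?thesis using cSUP_upper[OF _ assms(1), of x] assms(3)[of x] by linarith
qed

lemma bdd_above_smooth_norm:
 fixes u :: "'a::euclidean_space => 'b::real_normed_vector"
 assumes "smooth_on S u" "compact K" "K \<subseteq> S"
 shows "bdd_above ((%x. norm (u x)) ` K)"
 by (intro bounded_imp_bdd_above compact_imp_bounded compact_continuous_image continuous_on_norm
   continuous_on_subset[OF smooth_cont[OF assms(1)] assms(3)] assms(2))

text \<open>The supremum of an unbounded set of reals bounds nothing, so boundedness must be known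
  before \<open>C2_hoelder_norm\<close> yields estimates. On the convex ball \<open>w\<close> is
  Lipschitz, and the excess power \<open>dist x y powr (1 - a)\<close> is bounded.\<close>

lemma hoelder_quotient_bdd:
 fixes w :: "real^'n::finite => real^'m::finite"
 assumes w: "smooth_on S w" and ball: "cball x0 r \<subseteq> S" and a: "0 < a" "a < 1"
 shows "bdd_above ((%(x, y). norm (w x - w y) / dist x y powr a) ` (cball x0 r \<times> cball x0 r))"
proof -
 let ?K = "cball x0 r"
 have "\<exists>B. \<forall>x\<in>?K. norm (pd i w x) \<le> B" for i
  using bdd_above_smooth_norm[OF smooth_pd[OF w] compact_cball ball] by (auto simp: bdd_above_def)
 then obtain B where B: "!!i x. x\<in>?K ==> norm (pd i w x) \<le> B i" by metis
 have lip: "norm (w x - w y) \<le> (\<Sum>i\<in>UNIV. B i) * norm (x - y)" if "x\<in>?K" "y\<in>?K" for x y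
 proof (rule differentiable_bound[OF convex_cball _ _ that])
  show "(w has_derivative fd w x) (at x within ?K)" if "x\<in>?K" for x
   using smooth_hd[OF w] that ball has_derivative_at_withinI by blast
  show "onorm (fd w x) \<le> (\<Sum>i\<in>UNIV. B i)" if x: "x\<in>?K" for x
  proof (rule onorm_le)
   fix v
   have "norm (fd w x v) \<le> (\<Sum>i\<in>UNIV. norm (v$i *\<^sub>R pd i w x))"
    unfolding frechet_pd[OF w subsetD[OF ball x]] by (rule norm_sum)
   also have "\<dots> \<le> (\<Sum>i\<in>UNIV. norm v * B i)"
    unfolding norm_scaleR by (intro sum_mono mult_mono B x component_le_norm_cart) auto
   finally show "norm (fd w x v) \<le> (\<Sum>i\<in>UNIV. B i) * norm v"
    by (simp add: sum_distrib_left mult.commute)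
  qed
 qed
 have "norm (w x - w y) / dist x y powr a \<le> \<bar>\<Sum>i\<in>UNIV. B i\<bar> * (2 * r) powr (1 - a)" if "x\<in>?K" "y\<in>?K" for x y
 proof (cases "x = y")
  case False
  have d: "dist x y \<le> 2 * r" using that dist_triangle3[of x y x0] by (simp add: dist_commute)
  have "norm (w x - w y) \<le> \<bar>\<Sum>i\<in>UNIV. B i\<bar> * dist x y"
   unfolding dist_norm by (rule order_trans[OF lip[OF that] mult_right_mono]) auto
  also have "dist x y = dist x y powr (1 - a) * dist x y powr a"
   using False by (simp add: powr_add[symmetric])
  finally have "norm (w x - w y) / dist x y powr a \<le> \<bar>\<Sum>i\<in>UNIV. B i\<bar> * dist x y powr (1 - a)"
   using False by (simp add: field_simps)
  also have "\<dots> \<le> \<bar>\<Sum>i\<in>UNIV. B i\<bar> * (2 * r) powr (1 - a)"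
   using d a by (intro mult_left_mono powr_mono2) auto
  finally show ?thesis .
 qed simp
 thus ?thesis unfolding bdd_above_def by fastforce
qed

lemma C2_hoelder_norm_bounds:
 fixes u :: "real^'n::finite => real^'m::finite"
 assumes u: "smooth_on S u" and ball: "cball x0 r \<subseteq> S" "r > 0" and a: "0 < a" "a < 1" and x: "x\<in>cball x0 r"
 shows "norm (u x) \<le> C2_hoelder_norm a (cball x0 r) u" "norm (pd i u x) \<le> C2_hoelder_norm a (cball x0 r) u"
proof -
 let ?K = "cball x0 r"
 note b = bdd_above_smooth_norm[OF _ compact_cball ball(1)]
 have ne: "?K \<noteq> {}" "?K \<times> ?K \<noteq> {}" using x by blast+
 note b0 = b[OF u] and b1 = b[OF smooth_pd[OF u]] and b2 = b[OF smooth_pd[OF smooth_pd[OF u]]]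
  and bh = hoelder_quotient_bdd[OF smooth_pd[OF smooth_pd[OF u]] ball(1) a]
 have n0: "0 \<le> (SUP x\<in>?K. norm (u x))" by (rule cSUP_nonneg[OF b0 ne(1)]) simp
 have n1: "0 \<le> (SUP x\<in>?K. norm (pd i u x))" for i by (rule cSUP_nonneg[OF b1 ne(1)]) simp
 have n2: "0 \<le> (SUP x\<in>?K. norm (pd i (pd j u) x))" for i j by (rule cSUP_nonneg[OF b2 ne(1)]) simp
 have n3: "0 \<le> (SUP (x, y)\<in>?K \<times> ?K. norm (pd i (pd j u) x - pd i (pd j u) y) / dist x y powr a)" for i j
  by (rule cSUP_nonneg[OF bh ne(2)]) auto
 have s1: "0 \<le> (\<Sum>i\<in>UNIV. SUP x\<in>?K. norm (pd i u x))" by (intro sum_nonneg n1)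
 have s2: "0 \<le> (\<Sum>i\<in>UNIV. \<Sum>j\<in>UNIV. (SUP x\<in>?K. norm (pd i (pd j u) x)) +
    (SUP (x, y)\<in>?K \<times> ?K. norm (pd i (pd j u) x - pd i (pd j u) y) / dist x y powr a))"
  by (intro sum_nonneg add_nonneg_nonneg n2 n3)
 have m: "norm (pd i u x) \<le> (\<Sum>i\<in>UNIV. SUP x\<in>?K. norm (pd i u x))"
  using cSUP_upper[OF x b1, of i] member_le_sum[of i UNIV "%i. SUP x\<in>?K. norm (pd i u x)"] n1 by fastforce
 show "norm (u x) \<le> C2_hoelder_norm a ?K u" "norm (pd i u x) \<le> C2_hoelder_norm a ?K u"
  unfolding C2_hoelder_norm_def using cSUP_upper[OF x b0] n0 s1 s2 m by linarith+
qed

context kaehler_negative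
begin

text \<open>A basic set over a one-point compact set contains its own centre: all suprema are those
  of the constant 0.\<close>

lemma topspace_C2:
 assumes "smooth_map AL AM f"
 shows "f\<in>topspace (C2_hoelder_topology AL AM a)"
proof -
 obtain p :: 'l where True by simp
 define c where "c = chart_at AL p"
 define d where "d = chart_at AM (f p)"
 have c: "c\<in>AL" "p\<in>cdom c" and d: "d\<in>AM" "f p\<in>cdom d"
  by (auto simp: c_def d_def chart_at_in[OF aL] chart_at_in[OF aM])
 have "pd i (%x. 0 :: real^'m) = (%x. 0)" for i :: 'n
  by (simp add: pd_def fun_eq_iff fdI[OF has_derivative_const])
 hence "f\<in>C2_hoelder_basic AL AM a f c d {p} 1"
  using assms d by (simp add: C2_hoelder_basic_def C2_hoelder_norm_def case_prod_unfold)
 moreover have "openin (C2_hoelder_topology AL AM a) (C2_hoelder_basic AL AM a f c d {p} 1)"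
  unfolding C2_hoelder_topology_def
  by (intro topology_generated_by_Basis CollectI exI[of _ f] exI[of _ c] exI[of _ d] exI[of _ "{p}"] exI[of _ "1::real"])
   (use assms c d in auto)
 ultimately show ?thesis using openin_subset by blast
qed

text \<open>Convergence of order one, locally uniform, is all that is used of the \<open>C\<^sup>2\<^sup>,\<^sup>a\<close> topology.\<close>

lemma C2_close:
 assumes \<iota>: "smooth_map AL AM \<iota>" and a: "0 < a" "a < 1" and c: "c\<in>AL" "p0\<in>cdom c"
  and d: "d\<in>AM" "\<iota> p0\<in>cdom d" and e: "e > 0"
 shows "\<forall>\<^sub>F (f, p) in nhdsin (C2_hoelder_topology AL AM a) \<iota> \<times>\<^sub>F nhds p0.
  smooth_map AL AM f \<and> p\<in>cdom c \<and> f p\<in>cdom d \<and> \<iota> p\<in>cdom d \<and>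
  norm (rep f c d (cm c p) - rep \<iota> c d (cm c p)) < e \<and>
  (\<forall>i. norm (pd i (rep f c d) (cm c p) - pd i (rep \<iota> c d) (cm c p)) < e)"
proof -
 note C = chL[OF c(1)] and D = chM[OF d(1)] and cont = smooth_map_cont[OF \<iota>]
 let ?x0 = "cm c p0"
 have oX: "open (ldom \<iota> c d)" by (rule open_local_dom[OF C D cont])
 have "?x0\<in>ldom \<iota> c d" using c d by (intro local_dom_map C)
 then obtain r where r: "r > 0" "cball ?x0 r \<subseteq> ldom \<iota> c d" using oX open_contains_cball by blast
 have rc: "cball ?x0 r \<subseteq> cimg c" using r(2) by (auto simp: local_dom_iff[OF C])
 \<comment> \<open>A closed coordinate ball is taken as the compact set because the bound on the
   Hoelder quotients uses convexity.\<close>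
 let ?K = "mball c ?x0 r"
 note Kiff = mball_iff[OF aL c(1) r(1) rc]
 have cK: "cm c ` ?K = cball ?x0 r"
  unfolding mball_def using rc by (force simp: chD[OF C] image_iff)
 define N where "N = C2_hoelder_basic AL AM a \<iota> c d ?K e"
 have K\<iota>: "\<iota> ` ?K \<subseteq> cdom d"
 proof clarify
  fix p assume "p\<in>?K"
  hence "p\<in>cdom c" "cm c p\<in>ldom \<iota> c d" using r(2) by (auto simp: Kiff)
  thus "\<iota> p\<in>cdom d" by (simp add: local_dom_iff[OF C] chD[OF C])
 qed
 have "p0\<in>?K" using c r(1) by (simp add: Kiff)
 hence ne: "?K \<noteq> {}" by blast
 have oN: "openin (C2_hoelder_topology AL AM a) N"
  unfolding C2_hoelder_topology_def N_def
  by (intro topology_generated_by_Basis CollectI exI[of _ \<iota>] exI[of _ c] exI[of _ d] exI[of _ ?K] exI[of _ e])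
   (use \<iota> c d e K\<iota> compact_mball[OF aL c(1) r(1) rc] Kiff ne in auto)
 have N: "smooth_map AL AM f \<and> p\<in>cdom c \<and> f p\<in>cdom d \<and> \<iota> p\<in>cdom d \<and>
  norm (rep f c d (cm c p) - rep \<iota> c d (cm c p)) < e \<and>
  (\<forall>i. norm (pd i (rep f c d) (cm c p) - pd i (rep \<iota> c d) (cm c p)) < e)"
  if f: "f\<in>N" and p: "p\<in>?K" for f p
 proof -
  let ?u = "%x. rep f c d x - rep \<iota> c d x" and ?z = "cm c p"
  have sf: "smooth_map AL AM f" and fK: "f ` ?K \<subseteq> cdom d" and n: "C2_hoelder_norm a (cball ?x0 r) ?u < e"
   using f unfolding N_def C2_hoelder_basic_def cK by auto
  let ?S = "ldom f c d \<inter> ldom \<iota> c d"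
  have S: "open ?S" by (intro open_Int oX open_local_dom[OF C D smooth_map_cont[OF sf]])
  have u1: "smooth_on ?S (rep f c d)" and u2: "smooth_on ?S (rep \<iota> c d)"
   using smooth_subset[OF smooth_mapD[OF sf c(1) d(1)]] smooth_subset[OF smooth_mapD[OF \<iota> c(1) d(1)]] by auto
  have u: "smooth_on ?S ?u" by (intro smooth_diff S u1 u2)
  have sub: "cball ?x0 r \<subseteq> ?S"
  proof
   fix x assume x: "x\<in>cball ?x0 r"
   have "ci c x\<in>?K" unfolding mball_def using x by (rule imageI)
   hence "f (ci c x)\<in>cdom d" using fK by blast
   thus "x\<in>?S" using x rc r(2) by (auto simp: local_dom_iff[OF C])
  qed
  have x: "?z\<in>cball ?x0 r" using p by (simp add: Kiff)
  have xS: "?z\<in>?S" using sub x by blast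
  have "pd i ?u ?z = pd i (rep f c d) ?z - pd i (rep \<iota> c d) ?z" for i
   unfolding pd_def
   using fun_cong[OF fdI[OF has_derivative_diff[OF smooth_hd[OF u1 xS] smooth_hd[OF u2 xS]]]] .
  hence "norm (pd i (rep f c d) ?z - pd i (rep \<iota> c d) ?z) < e" for i
   using le_less_trans[OF C2_hoelder_norm_bounds(2)[OF u sub r(1) a x, of i] n] by simp
  moreover have "p\<in>cdom c" using p by (simp add: Kiff)
  moreover have "f p\<in>cdom d" "\<iota> p\<in>cdom d" using p fK K\<iota> by blast+
  ultimately show ?thesis using sf le_less_trans[OF C2_hoelder_norm_bounds(1)[OF u sub r(1) a x] n] by blast
 qed
 have "\<forall>\<^sub>F f in nhdsin (C2_hoelder_topology AL AM a) \<iota>. f\<in>N"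
 proof -
  have "C2_hoelder_norm a (cball ?x0 r) (%x. 0 :: real^'m) = 0"
  proof -
   have z: "pd i (%x. 0 :: real^'m) = (%x. 0)" for i :: 'n
    by (simp add: pd_def fun_eq_iff fdI[OF has_derivative_const])
   have "cball ?x0 r \<noteq> {}" using r(1) by simp
   thus ?thesis by (simp add: C2_hoelder_norm_def z case_prod_unfold)
  qed
  hence "\<iota>\<in>N" using \<iota> K\<iota> e by (simp add: N_def C2_hoelder_basic_def cK)
  thus ?thesis using oN by (auto simp: eventually_nhdsin)
 qed
 moreover have "\<forall>\<^sub>F p in nhds p0. p\<in>?K"
 proof -
  have "open {p\<in>cdom c. cm c p\<in>ball ?x0 r}" by (rule open_chart_vimage[OF C open_ball])
  moreover have "p0\<in>{p\<in>cdom c. cm c p\<in>ball ?x0 r}" using c r(1) by simp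
  ultimately show ?thesis unfolding eventually_nhds by (intro exI conjI) (auto simp: Kiff)
 qed
 ultimately show ?thesis unfolding eventually_prod_filter using N by (intro exI conjI) auto
qed

end

text \<open>For one and the same \<open>f\<close> the property is thus available on a whole
  neighbourhood of the point, as derivatives and extrema at this point require.\<close>

lemma eventually_prod_nhds_nested:
 assumes "\<forall>\<^sub>F (f, q) in F \<times>\<^sub>F nhds q0. P f q"
 shows "\<forall>\<^sub>F (f, q) in F \<times>\<^sub>F nhds q0. \<exists>U. open U \<and> q\<in>U \<and> (\<forall>q'\<in>U. P f q')"
proof -
 obtain Pf Pg where P: "eventually Pf F" "eventually Pg (nhds q0)" "!!f q. Pf f ==> Pg q ==> P f q"
  using assms unfolding eventually_prod_filter by auto
 obtain U where U: "open U" "q0\<in>U" "!!q. q\<in>U ==> Pg q" using P(2) unfolding eventually_nhds by auto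
 show ?thesis unfolding eventually_prod_filter
 proof (intro exI conjI allI impI)
  show "eventually Pf F" by (rule P(1))
  show "eventually (%q. q\<in>U) (nhds q0)" using U eventually_nhds by blast
  fix f q assume "Pf f" "q\<in>U"
  thus "case (f, q) of (f, q) => \<exists>U. open U \<and> q\<in>U \<and> (\<forall>q'\<in>U. P f q')" using U(1,3) P(3) by (auto intro!: exI[of _ U])
 qed
qed

text \<open>A tube lemma for filters: finitely many of the neighbourhoods \<open>U q0\<close> cover,
  and finitely many conditions on \<open>f\<close> hold simultaneously.\<close>

lemma eventually_all_compact:
 fixes P :: "'f => 'x::topological_space => bool"
 assumes cmp: "compact (UNIV :: 'x set)" and ev: "!!q0. \<forall>\<^sub>F (f, q) in F \<times>\<^sub>F nhds q0. P f q"
 shows "\<forall>\<^sub>F f in F. \<forall>q. P f q"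
proof -
 have "\<exists>Pf U. eventually Pf F \<and> open U \<and> q0\<in>U \<and> (\<forall>f q. Pf f --> q\<in>U --> P f q)" for q0
 proof -
  obtain Pf Pg where "eventually Pf F" "eventually Pg (nhds q0)" "!!f q. Pf f ==> Pg q ==> P f q"
   using ev[of q0] unfolding eventually_prod_filter by auto
  thus ?thesis unfolding eventually_nhds by blast
 qed
 then obtain Pf U where PU: "!!q0. eventually (Pf q0) F" "!!q0. open (U q0)" "!!q0. q0\<in>U q0" "!!q0 f q. Pf q0 f ==> q\<in>U q0 ==> P f q"
  by metis
 have cov: "UNIV \<subseteq> (\<Union>q0\<in>UNIV. U q0)" using PU(3) by blast
 obtain Q where Q: "finite Q" "UNIV \<subseteq> (\<Union>q0\<in>Q. U q0)"
  using compactE_image[OF cmp PU(2) cov] by metis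
 have "\<forall>\<^sub>F f in F. \<forall>q0\<in>Q. Pf q0 f" by (intro eventually_ball_finite Q(1) ballI PU(1))
 thus ?thesis by (rule eventually_mono) (use Q(2) PU(4) in blast)
qed

section \<open>The phase of a nearby immersion\<close>

lemma tendsto_isCont_eventually:
 fixes h :: "'a::t2_space => 'b::topological_space"
 assumes "isCont h a" "eventually P (nhds (h a))"
 shows "\<forall>\<^sub>F t in nhds a. P (h t)"
 using tendsto_nhds_isCont[OF assms(1)] assms(2) unfolding filterlim_iff by blast

context gauge
begin

text \<open>Differentiating \<open>\<Phi> (x, \<iota> x) = 0\<close> and inserting \<open>C2\<close>
  shows that on the graph the derivative of \<open>\<Phi>\<close> in the first variable is minus the
  identity.\<close>

lemma implicit_exists:
 assumes x0: "x0\<in>X"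
 obtains U V \<pi> where "open U" "open V" "x0\<in>U" "\<iota> x0\<in>V" "U \<times> V \<subseteq> W" "smooth_on V \<pi>" "\<pi> ` V \<subseteq> U"
  "!!x y. x\<in>U ==> y\<in>V ==> \<Phi> (x, y) = 0 \<longleftrightarrow> x = \<pi> y"
proof -
 have "v = 0" if v: "fd \<Phi> (x0, \<iota> x0) (v, 0) = 0" for v
 proof -
  let ?D = "fd \<Phi> (x0, \<iota> x0)"
  have lin: "linear ?D" by (rule linear_deriv[OF s\<Phi> graph[OF x0]])
  have "((%x. \<Phi> (x, \<iota> x)) has_derivative (%v. ?D (v, fd \<iota> x0 v))) (at x0)"
   by (rule has_derivative_compose[OF has_derivative_Pair[OF has_derivative_ident smooth_hd[OF s\<iota> x0]] smooth_hd[OF s\<Phi> graph[OF x0]]])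
  moreover have "((%x. \<Phi> (x, \<iota> x)) has_derivative (%v. 0)) (at x0)"
   by (rule hd_cong[OF has_derivative_const X x0]) (simp add: C1)
  ultimately have "(%v. ?D (v, fd \<iota> x0 v)) = (%v. 0)" by (rule has_derivative_unique)
  from fun_cong[OF this, of v] have "?D (v, 0) + ?D (0, fd \<iota> x0 v) = 0"
   by (simp add: linear_add[OF lin, symmetric])
  hence 0: "?D (0, fd \<iota> x0 v) = 0" using v by simp
  have "?D (0, fd \<iota> x0 v) = (\<Sum>i\<in>UNIV. v$i *\<^sub>R ?D (0, pd i \<iota> x0))"
   unfolding frechet_pd[OF s\<iota> x0] Dy_def[symmetric]
   by (simp add: linear_sum[OF linear_Dy[OF graph[OF x0]]] linear_scale[OF linear_Dy[OF graph[OF x0]]])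
  also have "\<dots> = v" by (simp add: C2[OF x0] vec_eq_iff axis_def if_distrib cong: if_cong)
  finally show "v = 0" using 0 by simp
 qed
 from smooth_implicit_function[OF W s\<Phi> graph[OF x0] C1[OF x0] this] that show thesis by blast
qed

text \<open>Here \<open>t\<close> is a first jet of \<open>f\<close>: its value and the rows
  \<open>pd k f\<close>. With \<open>\<psi> = \<pi> \<circ> f\<close> the three functions give
  \<open>d\<psi>\<close>, the deviation \<open>b\<close> and the phase in terms of \<open>t\<close>,
  so that closeness to \<open>\<iota>\<close> is needed for the jet only.\<close>

definition jetA :: "(real^'m => real^'n) => (real^'m) \<times> (real^'m^'n) => real^'n^'n" where
 "jetA \<pi> t = (\<chi> k. fd \<pi> (fst t) (snd t$k))"

definition jetB :: "(real^'m => real^'n) => (real^'m) \<times> (real^'m^'n) => real^'m^'n" where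
 "jetB \<pi> t = (\<chi> k. snd t$k - (\<Sum>l\<in>UNIV. jetA \<pi> t$k$l *\<^sub>R pd l \<iota> (\<pi> (fst t))))"

definition jetph :: "(real^'m => real^'n) => (real^'m) \<times> (real^'m^'n) => complex" where
 "jetph \<pi> t = det (\<chi> i j. T (\<pi> (fst t), fst t) j (snd t$i))"

text \<open>
 The conditions on the first jet of a map near \<open>\<iota>\<close> under which the maximum principle at the point
 applies; they hold near the jet of \<open>\<iota>\<close>.
\<close>

definition good_jet where
 "good_jet x0 V \<pi> t \<longleftrightarrow> fst t\<in>V \<and> (\<pi> (fst t), fst t)\<in>We (%i. pd i \<iota> x0) \<and> Re (jetph \<pi> t) > 0 \<and>
  det (jetA \<pi> t) > 0 \<and> (\<forall>i j. \<bar>(jetA \<pi> t - mat 1)$i$j\<bar> < 1 / (2 * real CARD('n) * real CARD('n))) \<and>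
  (let p = (\<pi> (fst t), fst t - \<iota> (\<pi> (fst t))); a = jetA \<pi> t; b = jetB \<pi> t; x = \<pi> (fst t); e = %i. pd i \<iota> x0 in
  (crit_cond e p a b) \<and>
  (sign_cond e x a b))"

context
 fixes x0 U V \<pi>
 assumes x0: "x0\<in>X" and UV: "open U" "open V" "x0\<in>U" "\<iota> x0\<in>V" "U \<times> V \<subseteq> W" and \<pi>: "smooth_on V \<pi>" "\<pi> ` V \<subseteq> U"
  and zero: "!!x y. x\<in>U ==> y\<in>V ==> \<Phi> (x, y) = 0 \<longleftrightarrow> x = \<pi> y"
begin

lemma UX: "x\<in>U ==> x\<in>X"
 using UV(4,5) WXY by blast

lemma \<pi>_graph: "x\<in>U ==> \<iota> x\<in>V ==> \<pi> (\<iota> x) = x"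
 using zero[of x "\<iota> x"] C1[OF UX] by simp

text \<open>At the jet of \<open>\<iota>\<close> itself \<open>jetA\<close> is the identity,
  \<open>jetB\<close> is 0 and the phase is 1. Since all three are continuous in the jet, the local
  results about these values apply.\<close>

lemma good_jet_near: "\<forall>\<^sub>F t in nhds (\<iota> x0, \<chi> k. pd k \<iota> x0). good_jet x0 V \<pi> t"
proof -
 let ?S = "V \<times> (UNIV :: (real^'m^'n) set)" and ?e = "%i. pd i \<iota> x0"
 let ?t = "(\<iota> x0, \<chi> k. pd k \<iota> x0) :: (real^'m) \<times> (real^'m^'n)"
 have S: "open ?S" by (intro open_Times UV(2) open_UNIV)
 have tS: "?t\<in>?S" using UV(4) by simp
 note f1 = smooth_fst[OF S smooth_id] and f2 = smooth_snd[OF S smooth_id]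
 have sp: "smooth_on ?S (%t. \<pi> (fst t))" by (rule smooth_compose[OF \<pi>(1) f1 S UV(2)]) auto
 have pU: "\<pi> (fst t)\<in>U" if "t\<in>?S" for t using that \<pi>(2) by auto
 have sP: "smooth_on ?S (%t. (\<pi> (fst t), fst t))" by (intro smooth_Pair S sp f1)
 have PW: "(\<pi> (fst t), fst t)\<in>W" if "t\<in>?S" for t using that pU[OF that] UV(5) by auto
 have row: "smooth_on ?S (%t. snd t$k)" for k by (intro smooth_vec_nth S f2)
 have sA: "smooth_on ?S (jetA \<pi>)"
 proof (rule smooth_cong'[OF _ S])
  show "smooth_on ?S (%t. \<chi> k. \<Sum>i\<in>UNIV. snd t$k$i *\<^sub>R fd \<pi> (fst t) (axis i 1))"
   by (intro smooth_vec_lambda smooth_sum smooth_scaleR S smooth_vec_nth[OF S row]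
    smooth_compose[OF smooth_deriv[OF \<pi>(1)] f1 S UV(2)]) auto
  show "jetA \<pi> t = (\<chi> k. \<Sum>i\<in>UNIV. snd t$k$i *\<^sub>R fd \<pi> (fst t) (axis i 1))" if "t\<in>?S" for t
   unfolding jetA_def using that by (subst axis_expansion[OF linear_deriv[OF \<pi>(1)]]) auto
 qed
 have si: "smooth_on ?S (%t. pd l \<iota> (\<pi> (fst t)))" for l
  by (rule smooth_compose[OF smooth_pd[OF s\<iota>] sp S X]) (use pU UX in blast)
 have sB: "smooth_on ?S (jetB \<pi>)"
  unfolding jetB_def[abs_def]
  by (intro smooth_vec_lambda smooth_diff row smooth_sum smooth_scaleR S smooth_vec_nth sA si)
 have sph: "smooth_on ?S (jetph \<pi>)"
  unfolding jetph_def[abs_def]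
  by (rule smooth_det[OF S]) (unfold vec_lambda_beta, rule smooth_T_field[OF S sP PW row])
 have sw: "smooth_on ?S (%t. fst t - \<iota> (\<pi> (fst t)))"
  by (intro smooth_diff S f1 smooth_compose[OF s\<iota> sp S X]) (use pU UX in blast)
 have A0: "jetA \<pi> ?t = mat 1"
 proof -
  let ?N = "U \<inter> (U \<inter> \<iota> -` V)"
  have "continuous_on U \<iota>" using smooth_cont[OF s\<iota>] continuous_on_subset UX by blast
  from continuous_open_preimage[OF this UV(1,2)] have N: "open ?N" using UV(1) by blast
  have x0N: "x0\<in>?N" using UV(3,4) by simp
  have "((%x. \<pi> (\<iota> x)) has_derivative (%v. fd \<pi> (\<iota> x0) (fd \<iota> x0 v))) (at x0)"
   by (rule has_derivative_compose[OF smooth_hd[OF s\<iota> x0] smooth_hd[OF \<pi>(1) UV(4)]])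
  moreover have "((%x. \<pi> (\<iota> x)) has_derivative (%v. v)) (at x0)"
   by (rule hd_cong[OF has_derivative_ident N x0N]) (simp add: \<pi>_graph)
  ultimately have "(%v. fd \<pi> (\<iota> x0) (fd \<iota> x0 v)) = (%v. v)"
   by (rule has_derivative_unique)
  hence "fd \<pi> (\<iota> x0) (pd k \<iota> x0) = axis k 1" for k
   unfolding pd_def by (rule fun_cong)
  thus ?thesis by (simp add: jetA_def vec_eq_iff mat_def axis_def)
 qed
 have p0: "\<pi> (\<iota> x0) = x0" by (rule \<pi>_graph[OF UV(3,4)])
 have B0: "jetB \<pi> ?t = 0"
 proof -
  have "(\<Sum>l\<in>UNIV. (mat 1 :: real^'n^'n)$k$l *\<^sub>R pd l \<iota> x0) = pd k \<iota> x0" for k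
   by (simp add: mat_def if_distrib[of "%c. c *\<^sub>R _"] cong: if_cong)
  thus ?thesis unfolding jetB_def A0 by (simp add: p0 vec_eq_iff)
 qed
 have ph0: "jetph \<pi> ?t = 1"
 proof -
  have "(\<chi> i j. T (x0, \<iota> x0) j (pd i \<iota> x0)) = mat 1" by (simp add: T_graph[OF x0] mat_def vec_eq_iff)
  thus ?thesis by (simp add: jetph_def p0)
 qed
 note ct = smooth_isCont[OF _ tS]
 have E1: "\<forall>\<^sub>F t in nhds ?t. fst t\<in>V"
  by (rule eventually_nhds_in_open[OF S tS, THEN eventually_mono]) auto
 have "(x0, \<iota> x0)\<in>We ?e" using base_in_Q[OF x0] by (simp add: Q_def shear_def)
 hence E2: "\<forall>\<^sub>F t in nhds ?t. (\<pi> (fst t), fst t)\<in>We ?e"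
  by (intro tendsto_isCont_eventually[OF ct[OF sP]] eventually_nhds_in_open open_We) (simp add: p0)
 have "open {z::complex. Re z > 0}" by (simp add: open_halfspace_Re_gt)
 hence E3: "\<forall>\<^sub>F t in nhds ?t. Re (jetph \<pi> t) > 0"
  using tendsto_isCont_eventually[OF ct[OF sph], of "%z. Re z > 0"] eventually_nhds_in_open[of "{z. Re z > 0}" "1::complex"] by (simp add: ph0)
 have sdA: "smooth_on ?S (%t. det (jetA \<pi> t))" by (intro smooth_det S smooth_vec_nth sA)
 have E4: "\<forall>\<^sub>F t in nhds ?t. det (jetA \<pi> t) > 0"
  using tendsto_isCont_eventually[OF ct[OF sdA], of "%z. z > 0"] eventually_nhds_in_open[of "{0<..}" "1::real"] by (simp add: A0)
 have E5: "\<forall>\<^sub>F t in nhds ?t. \<forall>i j. \<bar>(jetA \<pi> t - mat 1)$i$j\<bar> < 1 / (2 * real CARD('n) * real CARD('n))"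
 proof (intro eventually_all_finite)
  fix i j
  have "smooth_on ?S (%t. (jetA \<pi> t - mat 1)$i$j)" by (intro smooth_vec_nth smooth_diff S sA smooth_const)
  from tendsto_rabs[OF tendsto_nhds_isCont[OF ct[OF this]]]
  have "((%t. \<bar>(jetA \<pi> t - mat 1)$i$j\<bar>) \<longlongrightarrow> 0) (nhds ?t)" by (simp add: A0)
  from order_tendstoD(2)[OF this, of "1 / (2 * real CARD('n) * real CARD('n))"]
  show "\<forall>\<^sub>F t in nhds ?t. \<bar>(jetA \<pi> t - mat 1)$i$j\<bar> < 1 / (2 * real CARD('n) * real CARD('n))" by simp
 qed
 let ?h1 = "%t. ((\<pi> (fst t), fst t - \<iota> (\<pi> (fst t))), jetA \<pi> t, jetB \<pi> t)"
 have s1: "smooth_on ?S ?h1" by (intro smooth_Pair S sp sw sA sB)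
 have h1: "?h1 ?t = ((x0, 0), (mat 1, 0))" by (simp add: A0 B0 p0)
 have E6: "\<forall>\<^sub>F t in nhds ?t. case ?h1 t of (p, a, b) => crit_cond ?e p a b"
  by (rule tendsto_isCont_eventually[OF ct[OF s1]], unfold h1, rule critical_imp_zero[OF x0])
 let ?h2 = "%t. (\<pi> (fst t), jetA \<pi> t, jetB \<pi> t)"
 have s2: "smooth_on ?S ?h2" by (intro smooth_Pair S sp sA sB)
 have h2: "?h2 ?t = (x0, (mat 1, 0))" by (simp add: A0 B0 p0)
 have E7: "\<forall>\<^sub>F t in nhds ?t. case ?h2 t of (x, a, b) =>
   sign_cond ?e x a b"
  by (rule tendsto_isCont_eventually[OF ct[OF s2]], unfold h2, rule extremum_sign[OF x0])
 show ?thesis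
  using E1 E2 E3 E4 E5 E6 E7
 proof eventually_elim
  case (elim t)
  thus ?case unfolding good_jet_def Let_def split_conv by blast
 qed
qed

context
 fixes N f x
 assumes N: "open N" "x\<in>N" and f: "smooth_on N f" and fV: "!!y. y\<in>N ==> f y\<in>V" and xi: "!!y. y\<in>N ==> xi0 f y"
  and gj: "good_jet x0 V \<pi> (f x, \<chi> k. pd k f x)"
begin

lemma smooth_\<pi>_comp: "smooth_on N (%y. \<pi> (f y))"
 by (rule smooth_compose[OF \<pi>(1) f N(1) UV(2) fV])

lemma pd_\<pi>_comp: "pd k (%y. \<pi> (f y)) x = jetA \<pi> (f x, \<chi> k. pd k f x)$k"
 using fun_cong[OF fdI[OF has_derivative_compose[OF smooth_hd[OF f N(2)] smooth_hd[OF \<pi>(1) fV[OF N(2)]]]], of "axis k 1"]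
 by (simp add: pd_def jetA_def)

lemma comp_W: "y\<in>N ==> (\<pi> (f y), f y)\<in>W"
 using fV[of y] \<pi>(2) UV(5) by blast

lemma smooth_phase: "smooth_on N (phase f (%y. \<pi> (f y)))"
 unfolding phase_def[abs_def]
 by (rule smooth_det[OF N(1)])
  (unfold vec_lambda_beta, rule smooth_T_field[OF N(1) smooth_Pair[OF N(1) smooth_\<pi>_comp f] comp_W smooth_pd[OF f]])

lemma phase_jetph: "phase f (%y. \<pi> (f y)) x = jetph \<pi> (f x, \<chi> k. pd k f x)"
 by (simp add: phase_def jetph_def)

lemma jet_extremum:
 defines "S \<equiv> %y. Im (Ln (phase f (%y. \<pi> (f y)) y))"
 shows "open R ==> x\<in>R ==> (!!y. y\<in>R ==> S y \<le> S x) ==> S x \<le> 0 \<and> f x = \<iota> (\<pi> (f x))"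
  and "open R ==> x\<in>R ==> (!!y. y\<in>R ==> S x \<le> S y) ==> S x \<ge> 0 \<and> f x = \<iota> (\<pi> (f x))"
proof -
 let ?t = "(f x, \<chi> k. pd k f x)"
 have A: "(\<chi> k. pd k (%y. \<pi> (f y)) x) = jetA \<pi> ?t" by (simp add: vec_eq_iff pd_\<pi>_comp)
 have B: "(\<chi> k. pd k f x - (\<Sum>l\<in>UNIV. pd k (%y. \<pi> (f y)) x$l *\<^sub>R pd l \<iota> (\<pi> (f x)))) = jetB \<pi> ?t"
  by (simp add: vec_eq_iff pd_\<pi>_comp jetB_def)
 have P0: "\<Phi> (\<pi> (f y), f y) = 0" if "y\<in>N" for y
  using zero[of "\<pi> (f y)" "f y"] fV[OF that] \<pi>(2) by blast
 note g = gj[unfolded good_jet_def Let_def fst_conv]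
 have Rz: "Re (phase f (%y. \<pi> (f y)) x) > 0" using g by (simp only: phase_jetph)
 note est = phase_max[OF x0 N f smooth_\<pi>_comp comp_W P0 xi, unfolded A B] phase_min[OF x0 N f smooth_\<pi>_comp comp_W P0 xi, unfolded A B]
 show "open R ==> x\<in>R ==> (!!y. y\<in>R ==> S y \<le> S x) ==> S x \<le> 0 \<and> f x = \<iota> (\<pi> (f x))"
  unfolding S_def by (rule est(1)) (use g Rz in blast)+
 show "open R ==> x\<in>R ==> (!!y. y\<in>R ==> S x \<le> S y) ==> S x \<ge> 0 \<and> f x = \<iota> (\<pi> (f x))"
  unfolding S_def by (rule est(2)) (use g Rz in blast)+
qed

end

end

end

section \<open>The projection along the gauge function and the global phase\<close>

context gauge_data
begin

definition valid :: "('l, 'n) chart => ('p, 'm) chart => 'l => 'p => bool" where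
 "valid c d p y \<longleftrightarrow> p\<in>cdom c \<and> \<iota> p\<in>cdom d \<and> y\<in>cdom d \<and> (p, y)\<in>\<Omega>"

abbreviation "Tg c d \<equiv> gauge.T (J d) (Ph c d)"

text \<open>Here \<open>q\<close> is the point at which \<open>f\<close> is differentiated and
  \<open>p\<close> the base point of the gauge function, later \<open>\<psi> f q\<close>. One source
  chart serves for both points.\<close>

definition phs :: "('l, 'n) chart => ('p, 'm) chart => ('l => 'p) => 'l => 'l => complex" where
 "phs c d f p q = det (\<chi> i j. Tg c d (cm c p, cm d (f q)) j (pd i (rep f c d) (cm c q)))"

lemma valid_W: "c\<in>AL ==> d\<in>AM ==> valid c d p y ==> (cm c p, cm d y)\<in>Wcd c d"
 by (simp add: valid_def Wcd_def local_dom_iff[OF chL] chD[OF chL] chD[OF chM])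

lemma Tg_eq:
 assumes "c\<in>AL" "d\<in>AM"
 shows "Tg c d p j u = Complex (fd (Ph c d) p (0, u)$j) (- (fd (Ph c d) p (0, J d (snd p) *v u)$j))"
 using gauge.T_def[OF gauge_Ph[OF assms]] gauge.Dy_def[OF gauge_Ph[OF assms]] by simp

lemma Tg_target:
 assumes c: "c\<in>AL" and d: "d\<in>AM" "d'\<in>AM" and v: "valid c d p y" "valid c d' p y"
 shows "Tg c d' (cm c p, cm d' y) j (fd (trn d d') (cm d y) u)
  = Tg c d (cm c p, cm d y) j u"
proof -
 note D = chM[OF d(1)] and D' = chM[OF d(2)]
 let ?x = "cm c p" and ?z = "cm d y"
 have zo: "?z\<in>overlap d d'" using v by (simp add: valid_def overlap_iff[OF D] chD[OF D])
 have sz: "trn d d' ?z = cm d' y" using v by (simp add: valid_def transition_apply chD[OF D])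
 have "((%z. Ph c d' (?x, trn d d' z)) has_derivative
   (%u. fd (Ph c d') (?x, cm d' y) (0, fd (trn d d') ?z u))) (at ?z)"
  using has_derivative_compose[OF smooth_hd[OF smooth_transition[OF aM d] zo]
   frechet_slice_snd[OF smooth_Ph[OF c d(2)], of ?x "trn d d' ?z"]] valid_W[OF c d(2) v(2)] by (simp add: sz)
 hence "((%z. Ph c d (?x, z)) has_derivative
   (%u. fd (Ph c d') (?x, cm d' y) (0, fd (trn d d') ?z u))) (at ?z)"
  by (rule hd_cong[OF _ open_overlap[OF D D'] zo])
   (simp add: Ph_def overlap_iff[OF D] transition_apply chD[OF D'])
 from has_derivative_unique[OF frechet_slice_snd[OF smooth_Ph[OF c d(1)] valid_W[OF c d(1) v(1)]] this]
 have "fd (Ph c d) (?x, ?z) (0, u) = fd (Ph c d') (?x, cm d' y) (0, fd (trn d d') ?z u)" for u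
  by (rule fun_cong)
 thus ?thesis by (simp add: Tg_eq[OF c d(1)] Tg_eq[OF c d(2)] J_transition[OF d zo] sz)
qed

lemma Tg_source:
 assumes c: "c\<in>AL" "c'\<in>AL" and d: "d\<in>AM" and v: "valid c d p y" "valid c' d p y"
 shows "Tg c' d (cm c' p, cm d y) j u
  = (\<Sum>l\<in>UNIV. of_real (jacobian (trn c c') (at (cm c p))$j$l) * Tg c d (cm c p, cm d y) l u)"
proof -
 note C = chL[OF c(1)] and D = chM[OF d]
 let ?A = "jacobian (trn c c') (at (cm c p))" and ?z = "cm d y"
 have po: "cm c p\<in>overlap c c'" using v by (simp add: valid_def overlap_iff[OF C] chD[OF C])
 let ?Z = "{z. (cm c p, z)\<in>Wcd c d}"
 have Z: "open ?Z"
  using open_vimage[OF open_Wcd[OF c(1) d], of "Pair (cm c p)"] by (simp add: vimage_def continuous_on_Pair continuous_on_id)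
 have zZ: "?z\<in>?Z" using valid_W[OF c(1) d v(1)] by simp
 have "((%z. ?A *v Ph c d (cm c p, z)) has_derivative (%u. ?A *v fd (Ph c d) (cm c p, ?z) (0, u))) (at ?z)"
  by (rule bounded_linear.has_derivative[OF matrix_vector_mul_bounded_linear frechet_slice_snd[OF smooth_Ph[OF c(1) d] valid_W[OF c(1) d v(1)]]])
 hence "((%z. Ph c' d (cm c' p, z)) has_derivative (%u. ?A *v fd (Ph c d) (cm c p, ?z) (0, u))) (at ?z)"
  by (rule hd_cong[OF _ Z zZ])
   (use v Phi_change[OF c] in \<open>simp add: Ph_def valid_def chD[OF C] chD[OF chL[OF c(2)]] jacobian_transition[OF aL c po]\<close>)
 from has_derivative_unique[OF frechet_slice_snd[OF smooth_Ph[OF c(2) d] valid_W[OF c(2) d v(2)]] this]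
 have "fd (Ph c' d) (cm c' p, ?z) (0, u) = ?A *v fd (Ph c d) (cm c p, ?z) (0, u)" for u
  by (rule fun_cong)
 thus ?thesis
  by (simp add: Tg_eq[OF c(1) d] Tg_eq[OF c(2) d] complex_eq_iff matrix_vector_mult_def sum_negf)
qed

text \<open>The target chart has no influence, and the source chart contributes one Jacobian at
  \<open>p\<close> and one at \<open>q\<close>, both positive in an oriented atlas. So the argument
  of the phase is well defined.\<close>

lemma phs_change:
 assumes c: "c\<in>AL" "c'\<in>AL" and d: "d\<in>AM" "d'\<in>AM" and f: "smooth_map AL AM f"
  and v: "valid c d p (f q)" "valid c' d' p (f q)" and q: "q\<in>cdom c" "q\<in>cdom c'"
 shows "\<exists>t>0. phs c' d' f p q = of_real t * phs c d f p q"
proof -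
 note C = chL[OF c(1)] and C' = chL[OF c(2)]
 have v2: "valid c' d p (f q)" using v by (simp add: valid_def)
 have x': "cm c' q\<in>ldom f c' d" "cm c' q\<in>ldom f c' d'"
  using q v by (auto simp: valid_def intro!: local_dom_map[OF C'])
 have tgt: "phs c' d' f p q = phs c' d f p q"
  unfolding phs_def pd_def pd_target_change(3)[OF f c(2) d x'] local_rep_map[OF C' q(2)]
  by (simp add: Tg_target[OF c(2) d v2 v(2)])
 have qo: "cm c' q\<in>overlap c' c" using q by (simp add: overlap_iff[OF C'] chD[OF C'])
 have po: "cm c p\<in>overlap c c'" using v by (simp add: valid_def overlap_iff[OF C] chD[OF C])
 let ?A = "jacobian (trn c c') (at (cm c p))" and ?B = "jacobian (trn c' c) (at (cm c' q))"
 have tq: "trn c' c (cm c' q) = cm c q" using q by (simp add: transition_apply chD[OF C'])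
 have xd: "cm c q\<in>ldom f c d" using q v by (auto simp: valid_def intro!: local_dom_map[OF C])
 let ?M = "\<chi> i j. Tg c d (cm c p, cm d (f q)) j (pd i (rep f c d) (cm c q))"
 have lin: "linear (Tg c d (cm c p, cm d (f q)) l)" for l
  by (rule gauge.linear_T[OF gauge_Ph[OF c(1) d(1)] valid_W[OF c(1) d(1) v(1)]])
 have pdB: "pd i (rep f c' d) (cm c' q) = (\<Sum>k\<in>UNIV. ?B$k$i *\<^sub>R pd k (rep f c d) (cm c q))" for i
  unfolding pd_def[of i] pd_source_change(3)[OF f c d(1) x'(1) qo] tq frechet_pd[OF smooth_mapD[OF f c(1) d(1)] xd]
  by (simp add: jacobian_def matrix_def)
 have "(\<chi> i j. Tg c' d (cm c' p, cm d (f q)) j (pd i (rep f c' d) (cm c' q)))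
   = transpose (cmat ?B) ** ?M ** transpose (cmat ?A)"
  by (simp add: vec_eq_iff Tg_source[OF c d(1) v(1) v2] pdB linear_sum[OF lin] linear_scale[OF lin]
    matrix_matrix_mult_def transpose_def scaleR_conv_of_real[where 'a=complex] mult.commute)
 hence "phs c' d f p q = of_real (det ?B * det ?A) * phs c d f p q"
  unfolding phs_def by (simp add: det_mul det_transpose det_cmat)
 moreover have "det ?B * det ?A > 0"
  using ori c po qo unfolding oriented_atlas_def by (intro mult_pos_pos) blast+
 ultimately show ?thesis unfolding tgt by blast
qed

text \<open>The result of the implicit function theorem for the gauge equation in the charts at
  \<open>q\<close>, bundled so that one choice yields \<open>Uq\<close>, \<open>Vq\<close> and
  \<open>\<pi>q\<close>.\<close>

definition impl :: "'l => (real^'n) set \<times> (real^'m) set \<times> (real^'m => real^'n) => bool" where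
 "impl q = (%(U, V, \<pi>). open U \<and> open V \<and> ctr q\<in>U \<and> rep \<iota> (cq q) (dq q) (ctr q)\<in>V \<and> U \<times> V \<subseteq> Wcd (cq q) (dq q) \<and>
  smooth_on V \<pi> \<and> \<pi> ` V \<subseteq> U \<and> (\<forall>x\<in>U. \<forall>y\<in>V. Ph (cq q) (dq q) (x, y) = 0 \<longleftrightarrow> x = \<pi> y))"

definition Uq where "Uq q = fst (SOME t. impl q t)"
definition Vq where "Vq q = fst (snd (SOME t. impl q t))"
definition \<pi>q where "\<pi>q q = snd (snd (SOME t. impl q t))"

lemma cq_dom: "q\<in>cdom (cq q)" and dq_dom: "\<iota> q\<in>cdom (dq q)"
 by (simp_all add: cq_def dq_def chart_at_in aL aM)

lemma ctr_dom: "ctr q\<in>ldom \<iota> (cq q) (dq q)"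
 unfolding ctr_def by (rule local_dom_map[OF chc cq_dom dq_dom])

lemmas Gq = gauge_Ph[OF cq dq]

lemma impl: "open (Uq q)" "open (Vq q)" "ctr q\<in>Uq q" "rep \<iota> (cq q) (dq q) (ctr q)\<in>Vq q"
  "Uq q \<times> Vq q \<subseteq> Wcd (cq q) (dq q)" "smooth_on (Vq q) (\<pi>q q)" "\<pi>q q ` Vq q \<subseteq> Uq q"
  "!!x y. x\<in>Uq q ==> y\<in>Vq q ==> Ph (cq q) (dq q) (x, y) = 0 \<longleftrightarrow> x = \<pi>q q y"
proof -
 interpret G: gauge "cimg (dq q)" "J (dq q)" "g (dq q)" "ldom \<iota> (cq q) (dq q)" "rep \<iota> (cq q) (dq q)" "Wcd (cq q) (dq q)" "Ph (cq q) (dq q)"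
  by (rule Gq)
 have "\<exists>t. impl q t"
 proof (rule G.implicit_exists[OF ctr_dom])
  fix U V \<pi>
  assume "open U" "open V" "ctr q\<in>U" "rep \<iota> (cq q) (dq q) (ctr q)\<in>V" "U \<times> V \<subseteq> Wcd (cq q) (dq q)"
   "smooth_on V \<pi>" "\<pi> ` V \<subseteq> U" "!!x y. x\<in>U ==> y\<in>V ==> Ph (cq q) (dq q) (x, y) = 0 \<longleftrightarrow> x = \<pi> y"
  hence "impl q (U, V, \<pi>)" unfolding impl_def split_conv by (intro conjI ballI)
  thus ?thesis ..
 qed
 hence "impl q (SOME t. impl q t)" by (rule someI_ex)
 hence i: "impl q (Uq q, Vq q, \<pi>q q)" by (simp add: Uq_def Vq_def \<pi>q_def)
 show "open (Uq q)" "open (Vq q)" "ctr q\<in>Uq q" "rep \<iota> (cq q) (dq q) (ctr q)\<in>Vq q"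
  "Uq q \<times> Vq q \<subseteq> Wcd (cq q) (dq q)" "smooth_on (Vq q) (\<pi>q q)" "\<pi>q q ` Vq q \<subseteq> Uq q"
  "!!x y. x\<in>Uq q ==> y\<in>Vq q ==> Ph (cq q) (dq q) (x, y) = 0 \<longleftrightarrow> x = \<pi>q q y"
  using i unfolding impl_def split_conv by blast+
qed

lemma Uq_dom: "x\<in>Uq q ==> x\<in>ldom \<iota> (cq q) (dq q)"
 using impl(4,5)[of q] by (auto simp: Wcd_def)

lemma Uq_img: "x\<in>Uq q ==> x\<in>cimg (cq q)"
 using Uq_dom[of x q] by (simp add: local_dom_iff[OF chc])

definition VM where "VM q = {y\<in>cdom (dq q). cm (dq q) y\<in>Vq q}"
definition UL where "UL q = {p\<in>cdom (cq q). cm (cq q) p\<in>Uq q}"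
definition Oq where "Oq q = UL q \<inter> \<iota> -` VM q"
text \<open>The solution \<open>p\<close> of the gauge equation for the point \<open>f q\<close>
  that is found in the charts at \<open>i\<close>.\<close>

definition \<psi>i where "\<psi>i i f q = ci (cq i) (\<pi>q i (cm (dq i) (f q)))"

lemma open_VM: "open (VM q)" and open_UL: "open (UL q)"
 unfolding VM_def UL_def by (intro open_chart_vimage chd chc impl)+

lemma open_Oq: "open (Oq q)"
 unfolding Oq_def using open_VM cont\<iota> by (intro open_Int open_UL) (simp add: continuous_on_open_vimage)

lemma Oq_self: "q\<in>Oq q"
 using impl(3,4)[of q] by (simp add: Oq_def UL_def VM_def cq_dom dq_dom ctr_def local_rep_map[OF chc])

lemma \<pi>q_U: "y\<in>VM q ==> \<pi>q q (cm (dq q) y)\<in>Uq q"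
 using impl(7)[of q] by (auto simp: VM_def)

lemma \<psi>i_UL: "f q\<in>VM i ==> \<psi>i i f q\<in>UL i" "f q\<in>VM i ==> cm (cq i) (\<psi>i i f q) = \<pi>q i (cm (dq i) (f q))"
 using \<pi>q_U[of "f q" i] Uq_img by (auto simp: \<psi>i_def UL_def chD[OF chc])

lemma \<psi>i_zero: "f q\<in>VM i ==> Phi (cq i) (\<psi>i i f q) (f q) = 0"
proof -
 assume v: "f q\<in>VM i"
 have "Ph (cq i) (dq i) (\<pi>q i (cm (dq i) (f q)), cm (dq i) (f q)) = 0"
  using impl(8)[OF \<pi>q_U[OF v]] v by (simp add: VM_def)
 thus ?thesis using v by (simp add: Ph_def \<psi>i_def VM_def chD[OF chd])
qed

lemma zero_\<psi>i: "p\<in>UL i ==> f q\<in>VM i ==> Phi (cq i) p (f q) = 0 ==> p = \<psi>i i f q"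
 using impl(8)[of "cm (cq i) p" i "cm (dq i) (f q)"]
 by (simp add: UL_def VM_def Ph_def \<psi>i_def chD[OF chc] chD[OF chd]) (metis chD(3)[OF chc])

text \<open>By \<open>Phi_change\<close> the zero found at \<open>i\<close> is also a zero in the
  charts at \<open>j\<close>; once it lies in \<open>UL j\<close>, uniqueness there identifies
  it.\<close>

lemma \<psi>i_agree: "f q\<in>VM i ==> f q\<in>VM j ==> \<psi>i i f q\<in>UL j ==> \<psi>i i f q = \<psi>i j f q"
proof -
 assume v: "f q\<in>VM i" "f q\<in>VM j" and u: "\<psi>i i f q\<in>UL j"
 let ?p = "\<psi>i i f q"
 have d: "?p\<in>cdom (cq i)" "?p\<in>cdom (cq j)" using \<psi>i_UL(1)[of f q i] v(1) u by (auto simp: UL_def)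
 have "cm (cq i) ?p\<in>overlap (cq i) (cq j)" using d by (simp add: overlap_iff[OF chc] chD[OF chc])
 from linear_0[OF transition_linear[OF aL cq cq this]]
 have "Phi (cq j) ?p (f q) = 0" unfolding Phi_change[OF cq cq d] \<psi>i_zero[of f q i, OF v(1)] .
 thus ?thesis by (rule zero_\<psi>i[where f=f and q=q, OF u v(2)])
qed

end

section \<open>The global projection and phase of a nearby map\<close>

context gauge_data
begin

context
 fixes a :: real
 assumes a: "0 < a" "a < 1"
begin

abbreviation nb where "nb \<equiv> nhdsin (C2_hoelder_topology AL AM a) \<iota>"

definition jet where "jet c d f p = (rep f c d (cm c p), \<chi> k. pd k (rep f c d) (cm c p))"
 for f :: "'l => 'p" and c d

lemma near_dom:
 assumes "c\<in>AL" "q\<in>cdom c" "d\<in>AM" "\<iota> q\<in>cdom d"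
 shows "\<forall>\<^sub>F (f, p) in nb \<times>\<^sub>F nhds q. smooth_map AL AM f \<and> p\<in>cdom c \<and> f p\<in>cdom d \<and> \<iota> p\<in>cdom d"
 by (rule eventually_mono[OF C2_close[OF sm\<iota> a assms, of 1]]) auto

text \<open>\<open>C2_close\<close> makes the jets of \<open>f\<close> and \<open>\<iota>\<close>
  close at all \<open>p\<close> near \<open>q\<close>; the jet of \<open>\<iota>\<close> is
  continuous in \<open>p\<close>. Hence the limit is a joint one in \<open>f\<close> and
  \<open>p\<close>.\<close>

lemma jet_tendsto:
 assumes c: "c\<in>AL" "q\<in>cdom c" and d: "d\<in>AM" "\<iota> q\<in>cdom d"
 shows "((%(f, p). jet c d f p) \<longlongrightarrow> jet c d \<iota> q) (nb \<times>\<^sub>F nhds q)"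
proof -
 note C = chL[OF c(1)]
 let ?x = "cm c q" and ?F = "nb \<times>\<^sub>F nhds q"
 have x: "?x\<in>ldom \<iota> c d" by (rule local_dom_map[of c q \<iota> d, OF C c(2) d(2)])
 have "isCont (cm c) q" using chD(7,1)[OF C] c(2) by (simp add: continuous_on_eq_continuous_at)
 from tendsto_nhds_isCont[OF this] have cm: "((%(f, p). cm c p) \<longlongrightarrow> ?x) ?F"
  unfolding case_prod_unfold by (rule filterlim_compose[OF _ filterlim_snd])
 have sub: "((%(f, p). h f (cm c p)) \<longlongrightarrow> h \<iota> ?x) ?F"
  if h: "isCont (h \<iota>) ?x" and e: "!!e. e > 0 ==> \<forall>\<^sub>F (f, p) in ?F. norm (h f (cm c p) - h \<iota> (cm c p)) < e"
  for h :: "('l => 'p) => real^'n => real^'m"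
 proof -
  have "((%(f, p). h f (cm c p) - h \<iota> (cm c p)) \<longlongrightarrow> 0) ?F"
   by (rule tendstoI) (use e in \<open>simp add: dist_norm case_prod_unfold\<close>)
  from tendsto_add[OF this isCont_tendsto_compose[OF h cm]] show ?thesis by (simp add: case_prod_unfold)
 qed
 note cl = C2_close[OF sm\<iota> a c d]
 have 1: "((%(f, p). rep f c d (cm c p)) \<longlongrightarrow> rep \<iota> c d ?x) ?F"
  by (rule sub[of "%f. rep f c d", OF smooth_isCont[OF smooth_mapD[OF sm\<iota> c(1) d(1)] x]]) (rule eventually_mono[OF cl], auto)
 have 2: "((%(f, p). pd k (rep f c d) (cm c p)) \<longlongrightarrow> pd k (rep \<iota> c d) ?x) ?F" for k
  by (rule sub[of "%f. pd k (rep f c d)", OF smooth_isCont[OF smooth_pd[OF smooth_mapD[OF sm\<iota> c(1) d(1)]] x]])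
   (rule eventually_mono[OF cl], auto)
 have "((%fp. (rep (fst fp) c d (cm c (snd fp)), \<chi> k. pd k (rep (fst fp) c d) (cm c (snd fp))))
   \<longlongrightarrow> (rep \<iota> c d ?x, \<chi> k. pd k (rep \<iota> c d) ?x)) ?F"
  using 1 2 unfolding case_prod_unfold by (intro tendsto_Pair tendsto_vec_lambda)
 thus ?thesis by (simp add: jet_def case_prod_unfold)
qed

lemma f_tendsto: "((%(f, p). f p) \<longlongrightarrow> \<iota> q) (nb \<times>\<^sub>F nhds q)"
proof -
 let ?c = "cq q" and ?d = "dq q"
 have i: "isCont (ci ?d) (cm ?d (\<iota> q))"
  using chD(8,2)[OF chd] chD(4)[OF chd dq_dom] by (simp add: continuous_on_eq_continuous_at)
 have "((%fp. fst (case fp of (f, p) => jet ?c ?d f p)) \<longlongrightarrow> fst (jet ?c ?d \<iota> q)) (nb \<times>\<^sub>F nhds q)"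
  by (rule tendsto_fst[OF jet_tendsto[OF cq cq_dom dq dq_dom]])
 hence "((%(f, p). rep f ?c ?d (cm ?c p)) \<longlongrightarrow> cm ?d (\<iota> q)) (nb \<times>\<^sub>F nhds q)"
  by (simp add: jet_def case_prod_unfold local_rep_map[OF chc cq_dom])
 from isCont_tendsto_compose[OF i this]
 have "((%fp. ci ?d (case fp of (f, p) => rep f ?c ?d (cm ?c p))) \<longlongrightarrow> \<iota> q) (nb \<times>\<^sub>F nhds q)"
  by (simp add: chD[OF chd] dq_dom)
 thus ?thesis
 proof (rule Lim_transform_eventually)
  show "\<forall>\<^sub>F fp in nb \<times>\<^sub>F nhds q. ci ?d (case fp of (f, p) => rep f ?c ?d (cm ?c p)) = (case fp of (f, p) => f p)"
   by (rule eventually_mono[OF near_dom[OF cq cq_dom dq dq_dom]]) (auto simp: local_rep_map[OF chc] chD[OF chd])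
 qed
qed

lemma p_tendsto: "((%(f, p). p) \<longlongrightarrow> q) (nb \<times>\<^sub>F nhds q)"
 unfolding case_prod_unfold by (rule filterlim_snd)

lemma near_VM: "q\<in>Oq i ==> \<forall>\<^sub>F (f, p) in nb \<times>\<^sub>F nhds q. f p\<in>VM i"
 using topological_tendstoD[OF f_tendsto open_VM, of q i] by (simp add: Oq_def case_prod_unfold)

lemma \<psi>i_tendsto:
 assumes q: "q\<in>Oq i"
 shows "((%(f, p). \<psi>i i f p) \<longlongrightarrow> q) (nb \<times>\<^sub>F nhds q)"
proof -
 have dom: "q\<in>cdom (cq i)" "cm (cq i) q\<in>Uq i" "\<iota> q\<in>cdom (dq i)" "cm (dq i) (\<iota> q)\<in>Vq i"
  using q by (auto simp: Oq_def UL_def VM_def)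
 have x: "cm (cq i) q\<in>ldom \<iota> (cq i) (dq i)" by (rule Uq_dom[OF dom(2)])
 have r: "rep \<iota> (cq i) (dq i) (cm (cq i) q) = cm (dq i) (\<iota> q)" by (rule local_rep_map[OF chc dom(1)])
 have p: "\<pi>q i (cm (dq i) (\<iota> q)) = cm (cq i) q"
  using impl(8)[OF dom(2,4)] Ph_graph(1)[OF cq dq x] unfolding r by simp
 have c1: "isCont (cm (dq i)) (\<iota> q)"
  using chD(7,1)[OF chd] dom(3) by (simp add: continuous_on_eq_continuous_at)
 have c2: "isCont (\<pi>q i) (cm (dq i) (\<iota> q))" by (rule smooth_isCont[OF impl(6) dom(4)])
 have c3: "isCont (ci (cq i)) (cm (cq i) q)"
  using chD(8,2)[OF chc] chD(4)[OF chc dom(1)] by (simp add: continuous_on_eq_continuous_at)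
 have "((%fp. ci (cq i) (\<pi>q i (cm (dq i) (case fp of (f, p) => f p)))) \<longlongrightarrow> ci (cq i) (cm (cq i) q)) (nb \<times>\<^sub>F nhds q)"
  by (rule isCont_tendsto_compose[OF c3 isCont_tendsto_compose[OF c2 isCont_tendsto_compose[OF c1 f_tendsto], unfolded p]])
 thus ?thesis by (simp add: \<psi>i_def case_prod_unfold chD[OF chc] dom)
qed

text \<open>
 The projection \<open>\<psi>i i f\<close> does not depend on the chart \<open>i\<close>, so that a choice from a finite closed
 cover gives a well-defined smooth map.
\<close>

context
 fixes I :: "'l set" and B :: "'l => 'l set"
 assumes I: "finite I" and B: "!!i. closed (B i)" "!!i. B i \<subseteq> Oq i" and cov: "!!q. \<exists>i\<in>I. q\<in>B i"
begin

definition idx where "idx q = (SOME i. i\<in>I \<and> q\<in>B i)"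
definition \<psi> where "\<psi> f q = \<psi>i (idx q) f q"
definition S where "S f q = Im (Ln (phs (cq (idx q)) (dq (idx q)) f (\<psi> f q) q))"

lemma idx: "idx q\<in>I" "q\<in>B (idx q)"
 using someI_ex[of "%i. i\<in>I \<and> q\<in>B i"] cov[of q] unfolding idx_def by blast+

text \<open>If \<open>q\<close> is outside the closed set \<open>B i\<close>, so are all nearby
  \<open>p\<close> and nothing is claimed. Otherwise \<open>q\<close> lies in the open set
  \<open>Oq i\<close>, where the projection found at \<open>i\<close> tends to \<open>q\<close> and
  therefore enters \<open>UL q\<close>.\<close>

lemma agree_near: "\<forall>\<^sub>F (f, p) in nb \<times>\<^sub>F nhds q. \<forall>i\<in>I. p\<in>B i -->
  \<psi>i i f p = \<psi>i q f p \<and> valid (cq i) (dq i) (\<psi>i q f p) (f p) \<and> p\<in>cdom (cq i)"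
 unfolding case_prod_unfold
proof (rule eventually_ball_finite[OF I], rule ballI)
 fix i
 show "\<forall>\<^sub>F fp in nb \<times>\<^sub>F nhds q. snd fp\<in>B i --> \<psi>i i (fst fp) (snd fp) = \<psi>i q (fst fp) (snd fp) \<and>
   valid (cq i) (dq i) (\<psi>i q (fst fp) (snd fp)) (fst fp (snd fp)) \<and> snd fp\<in>cdom (cq i)"
 proof (cases "q\<in>B i")
  case False
  have "\<forall>\<^sub>F fp in nb \<times>\<^sub>F nhds q. (case fp of (f, p) => p)\<in>- B i"
   by (rule topological_tendstoD[OF p_tendsto]) (use B(1) False in auto)
  thus ?thesis by (rule eventually_mono) (auto simp: case_prod_unfold)
 next
  case True
  hence qi: "q\<in>Oq i" using B(2) by blast
  have d: "q\<in>cdom (cq i)" "\<iota> q\<in>cdom (dq i)" using qi by (auto simp: Oq_def UL_def VM_def)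
  have 1: "\<forall>\<^sub>F fp in nb \<times>\<^sub>F nhds q. (case fp of (f, p) => \<psi>i i f p)\<in>UL q"
   by (rule topological_tendstoD[OF \<psi>i_tendsto[OF qi] open_UL]) (use Oq_self[of q] in \<open>simp add: Oq_def\<close>)
  have "open (\<iota> -` cdom (dq i))" using chD(1)[OF chd] cont\<iota> by (simp add: continuous_on_open_vimage)
  hence 2: "\<forall>\<^sub>F fp in nb \<times>\<^sub>F nhds q. (case fp of (f, p) => \<psi>i i f p)\<in>\<iota> -` cdom (dq i)"
   by (rule topological_tendstoD[OF \<psi>i_tendsto[OF qi]]) (use d in simp)
  have 3: "\<forall>\<^sub>F fp in nb \<times>\<^sub>F nhds q. (case fp of (f, p) => \<psi>i i f p, case fp of (f, p) => f p)\<in>\<Omega>"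
   by (rule topological_tendstoD[OF tendsto_Pair[OF \<psi>i_tendsto[OF qi] f_tendsto] open_\<Omega> graph_\<Omega>])
  show ?thesis
   using 1 2 3 near_VM[OF qi] near_VM[OF Oq_self[of q]] near_dom[OF cq d(1) dq d(2)]
  proof eventually_elim
   case (elim fp)
   obtain f p where fp: "fp = (f, p)" by (cases fp)
   have v: "f p\<in>VM i" "f p\<in>VM q" and u: "\<psi>i i f p\<in>UL q" using elim by (auto simp: fp)
   have e: "\<psi>i i f p = \<psi>i q f p" by (rule \<psi>i_agree[where f=f and q=p, OF v u])
   have "\<psi>i i f p\<in>cdom (cq i)" using \<psi>i_UL(1)[where f=f and q=p, OF v(1)] by (simp add: UL_def)
   thus ?case using elim e by (auto simp: fp valid_def)
  qed
 qed
qed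

abbreviation (input) "fhq q f \<equiv> rep f (cq q) (dq q)"
abbreviation (input) "phq q f \<equiv> gauge.phase (J (dq q)) (Ph (cq q) (dq q)) (fhq q f) (%y. \<pi>q q (fhq q f y))"
abbreviation (input) "gjq q \<equiv> gauge.good_jet (J (dq q)) (g (dq q)) (rep \<iota> (cq q) (dq q)) (Wcd (cq q) (dq q)) (Ph (cq q) (dq q)) (ctr q) (Vq q) (\<pi>q q)"

text \<open>The index in the definitions of \<open>\<psi>\<close> and \<open>S\<close> may jump from
  point to point; here both are given in the fixed charts at \<open>q\<close>, which makes them
  smooth.\<close>

definition locform where
 "locform q f p \<longleftrightarrow> smooth_map AL AM f \<and> p\<in>cdom (cq q) \<and> f p\<in>cdom (dq q) \<and> f p\<in>VM q \<and> \<psi> f p = \<psi>i q f p \<and>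
  S f p = Im (Ln (phq q f (cm (cq q) p))) \<and> gjq q (jet (cq q) (dq q) f p)"

lemma locform_near: "\<forall>\<^sub>F (f, p) in nb \<times>\<^sub>F nhds q. locform q f p"
proof -
 interpret G: gauge "cimg (dq q)" "J (dq q)" "g (dq q)" "ldom \<iota> (cq q) (dq q)" "rep \<iota> (cq q) (dq q)" "Wcd (cq q) (dq q)" "Ph (cq q) (dq q)"
  by (rule Gq)
 have "\<forall>\<^sub>F t in nhds (jet (cq q) (dq q) \<iota> q). G.good_jet (ctr q) (Vq q) (\<pi>q q) t"
  using G.good_jet_near[OF ctr_dom impl(1-8)] unfolding jet_def ctr_def[symmetric] by simp
 hence 1: "\<forall>\<^sub>F fp in nb \<times>\<^sub>F nhds q. G.good_jet (ctr q) (Vq q) (\<pi>q q) (case fp of (f, p) => jet (cq q) (dq q) f p)"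
  using jet_tendsto[OF cq cq_dom dq dq_dom] unfolding filterlim_iff by blast
 have 2: "\<forall>\<^sub>F fp in nb \<times>\<^sub>F nhds q. (case fp of (f, p) => \<psi>i q f p, case fp of (f, p) => f p)\<in>\<Omega>"
  by (rule topological_tendstoD[OF tendsto_Pair[OF \<psi>i_tendsto[OF Oq_self] f_tendsto] open_\<Omega> graph_\<Omega>])
 show ?thesis
  using 1 2 near_VM[OF Oq_self[of q]] near_dom[OF cq cq_dom dq dq_dom] agree_near
 proof eventually_elim
  case (elim fp)
  obtain f p where fp: "fp = (f, p)" by (cases fp)
  let ?x = "cm (cq q) p"
  have e: "\<psi>i (idx p) f p = \<psi>i q f p" and v: "valid (cq (idx p)) (dq (idx p)) (\<psi>i q f p) (f p)" "p\<in>cdom (cq (idx p))"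
   using elim idx[of p] by (auto simp: fp)
  have fV: "f p\<in>VM q" and sm: "smooth_map AL AM f" and pd: "p\<in>cdom (cq q)" and fd: "f p\<in>cdom (dq q)"
   and gj: "G.good_jet (ctr q) (Vq q) (\<pi>q q) (jet (cq q) (dq q) f p)" and om: "(\<psi>i q f p, f p)\<in>\<Omega>"
   using elim by (auto simp: fp)
  note pu = \<psi>i_UL(1)[where f=f and q=p, OF fV] and pe = \<psi>i_UL(2)[where f=f and q=p, OF fV]
  have vq: "valid (cq q) (dq q) (\<psi>i q f p) (f p)"
   using pu fd om Uq_dom[of "cm (cq q) (\<psi>i q f p)" q]
   by (simp add: valid_def UL_def local_dom_iff[OF chc] chD[OF chc])
  have r: "rep f (cq q) (dq q) ?x = cm (dq q) (f p)" by (rule local_rep_map[OF chc pd])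
  have ph: "phs (cq q) (dq q) f (\<psi>i q f p) p = phq q f ?x"
   by (simp add: phs_def G.phase_def pe r)
  have jp: "phq q f ?x = G.jetph (\<pi>q q) (jet (cq q) (dq q) f p)"
   by (simp add: G.phase_def G.jetph_def jet_def)
  have nz: "phq q f ?x \<noteq> 0" using gj unfolding jp G.good_jet_def by (auto simp: Let_def)
  obtain t where t: "t > 0" "phs (cq (idx p)) (dq (idx p)) f (\<psi>i q f p) p = of_real t * phs (cq q) (dq q) f (\<psi>i q f p) p"
   using phs_change[OF cq cq dq dq sm vq v(1) pd v(2)] by blast
  \<comment> \<open>By \<open>phs_change\<close> the two determinants differ by a positive factor,
    which changes the logarithm by a real number.\<close>
  have "S f p = Im (Ln (phq q f ?x))"
   unfolding S_def \<psi>_def e t(2) ph using Ln_times_of_real[OF t(1) nz] t(1) by (simp add: Ln_of_real)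
  thus ?case using e sm pd fd fV gj by (simp add: fp locform_def \<psi>_def)
 qed
qed

text \<open>What a chart at \<open>q\<close> has to provide for \<open>\<psi> f\<close> to be a
  reparametrisation; the last condition is the hypothesis of \<open>near_identity\<close>.\<close>

definition psi_regular where
 "psi_regular q f p \<longleftrightarrow> p\<in>cdom (cq q) \<and> \<psi> f p\<in>cdom (cq q) \<and> isCont (\<psi> f) p \<and>
  (\<exists>R. open R \<and> cm (cq q) p\<in>R \<and> smooth_on R (rep (\<psi> f) (cq q) (cq q))) \<and>
  det (jacobian (rep (\<psi> f) (cq q) (cq q)) (at (cm (cq q) p))) > 0 \<and>
  (\<forall>i j. \<bar>pd i (rep (\<psi> f) (cq q) (cq q)) (cm (cq q) p)$j - mat 1$i$j\<bar> < 1 / (2 * real CARD('n) * real CARD('n)))"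

lemma local_conclusions:
 assumes f: "maslov_zero f" and U: "open U" "p\<in>U" "!!p'. p'\<in>U ==> locform q f p'"
 shows "(\<forall>p'. S f p' \<le> S f p) ==> S f p \<le> 0 \<and> f p = \<iota> (\<psi> f p)" "(\<forall>p'. S f p \<le> S f p') ==> S f p \<ge> 0"
  "isCont (S f) p" "psi_regular q f p"
proof -
 interpret G: gauge "cimg (dq q)" "J (dq q)" "g (dq q)" "ldom \<iota> (cq q) (dq q)" "rep \<iota> (cq q) (dq q)" "Wcd (cq q) (dq q)" "Ph (cq q) (dq q)"
  by (rule Gq)
 let ?c = "cq q" and ?d = "dq q" and ?\<pi> = "\<pi>q q"
 let ?f = "rep f ?c ?d"
 let ?z = "cm ?c p" and ?N = "{x\<in>cimg ?c. ci ?c x\<in>U}"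
 have lf: "locform q f p" by (rule U(3)[OF U(2)])
 have pd: "p\<in>cdom ?c" using lf by (simp add: locform_def)
 have sm: "smooth_map AL AM f" using f by (simp add: maslov_zero_def)
 have N: "open ?N" by (rule open_chart_image[OF chc U(1)])
 have zN: "?z\<in>?N" using pd U(2) by (simp add: chD[OF chc])
 have NU: "locform q f (ci ?c y)" "y\<in>cimg ?c" if "y\<in>?N" for y using that U(3) by auto
 have dom: "y\<in>ldom f ?c ?d" if "y\<in>?N" for y
  using NU[OF that] by (simp add: locform_def local_dom_iff[OF chc])
 have sf: "smooth_on ?N ?f" by (rule smooth_subset[OF smooth_mapD[OF sm cq dq]]) (use dom in blast)
 have fV: "?f y\<in>Vq q" if "y\<in>?N" for y
  using NU[OF that] by (simp add: locform_def VM_def local_rep_apply)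
 have xi: "G.xi0 ?f y" if "y\<in>?N" for y using f dom[OF that] cq dq by (simp add: maslov_zero_def)
 have gj: "G.good_jet (ctr q) (Vq q) ?\<pi> (?f y, \<chi> k. pd k ?f y)" if "y\<in>?N" for y
  using NU[OF that] by (simp add: locform_def jet_def chD[OF chc])
 have Sy: "S f (ci ?c y) = Im (Ln (phq q f y))" if "y\<in>?N" for y
  using NU[OF that] by (simp add: locform_def chD[OF chc])
 have Sp: "S f p = Im (Ln (phq q f ?z))" using Sy[OF zN] by (simp add: chD[OF chc] pd)
 note ctx = ctr_dom impl(1-8) N zN sf fV xi gj[OF zN]
 have fV': "f p'\<in>VM q" if "p'\<in>U" for p' using U(3)[OF that] by (simp add: locform_def)
 have \<psi>p: "\<psi> f p' = \<psi>i q f p'" if "p'\<in>U" for p' using U(3)[OF that] by (simp add: locform_def)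
 have \<psi>y: "\<psi> f (ci ?c y)\<in>cdom ?c \<and> cm ?c (\<psi> f (ci ?c y)) = ?\<pi> (?f y)" if "y\<in>?N" for y
  using \<psi>i_UL[where f=f and q="ci ?c y" and i=q] fV' \<psi>p that by (simp add: UL_def local_rep_apply)
 have graph: "f p = \<iota> (\<psi> f p)" if "?f ?z = rep \<iota> ?c ?d (?\<pi> (?f ?z))"
 proof -
  have \<psi>z: "\<psi> f p\<in>cdom ?c" "cm ?c (\<psi> f p) = ?\<pi> (?f ?z)" using \<psi>y[OF zN] by (simp_all add: chD[OF chc] pd)
  have "cm ?c (\<psi> f p)\<in>Uq q" using \<psi>i_UL(1)[where f=f and q=p, OF fV'[OF U(2)]] by (simp add: \<psi>p[OF U(2)] UL_def)
  hence id: "\<iota> (\<psi> f p)\<in>cdom ?d" using Uq_dom[of "cm ?c (\<psi> f p)" q] \<psi>z(1) by (simp add: local_dom_iff[OF chc] chD[OF chc])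
  have "cm ?d (f p) = cm ?d (\<iota> (\<psi> f p))"
   using trans[OF that arg_cong[OF \<psi>z(2)[symmetric], of "rep \<iota> ?c ?d"]] unfolding local_rep_map[OF chc pd] local_rep_map[OF chc \<psi>z(1)] .
  from arg_cong[OF this, of "ci ?d"] show ?thesis using lf by (simp add: chD(3)[OF chd] id locform_def)
 qed
 show "S f p \<le> 0 \<and> f p = \<iota> (\<psi> f p)" if m: "\<forall>p'. S f p' \<le> S f p"
 proof -
  have "Im (Ln (phq q f y)) \<le> Im (Ln (phq q f ?z))" if "y\<in>?N" for y
   unfolding Sy[OF that, symmetric] Sp[symmetric] using m by blast
  note le = this
  have "Im (Ln (phq q f ?z)) \<le> 0 \<and> ?f ?z = rep \<iota> ?c ?d (?\<pi> (?f ?z))"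
   by (rule G.jet_extremum(1)[OF ctx N zN le])
  thus ?thesis using graph unfolding Sp by blast
 qed
 show "S f p \<ge> 0" if m: "\<forall>p'. S f p \<le> S f p'"
 proof -
  have "Im (Ln (phq q f ?z)) \<le> Im (Ln (phq q f y))" if "y\<in>?N" for y
   unfolding Sy[OF that, symmetric] Sp[symmetric] using m by blast
  note le = this
  have "Im (Ln (phq q f ?z)) \<ge> 0 \<and> ?f ?z = rep \<iota> ?c ?d (?\<pi> (?f ?z))"
   by (rule G.jet_extremum(2)[OF ctx N zN le])
  thus ?thesis unfolding Sp by blast
 qed
 have cin: "\<forall>\<^sub>F p' in nhds p. p'\<in>U \<and> p'\<in>cdom ?c"
  using eventually_conj[OF eventually_nhds_in_open[OF U(1,2)] eventually_nhds_in_open[OF chD(1)[OF chc] pd]] .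
 have cc: "isCont (cm ?c) p" using chD(7,1)[OF chc] pd by (simp add: continuous_on_eq_continuous_at)
 show "isCont (S f) p"
 proof -
  have "isCont (phq q f) ?z"
   by (rule smooth_isCont[OF G.smooth_phase[OF ctx] zN])
  moreover have "Re (phq q f ?z) > 0"
  proof -
   have "phq q f ?z = G.jetph ?\<pi> (?f ?z, \<chi> k. pd k ?f ?z)" by (rule G.phase_jetph[OF ctx])
   thus ?thesis using gj[OF zN] unfolding G.good_jet_def by simp
  qed
  ultimately have "isCont (%y. Im (Ln (phq q f y))) ?z"
   by (intro isCont_Im isCont_Ln') (auto simp: complex_nonpos_Reals_iff)
  from isCont_o2[OF cc this] have "isCont (%p'. Im (Ln (phq q f (cm ?c p')))) p" .
  moreover have "\<forall>\<^sub>F p' in nhds p. Im (Ln (phq q f (cm ?c p'))) = S f p'"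
   using cin by eventually_elim (simp add: Sy[symmetric] chD[OF chc])
  ultimately show ?thesis by (rule isCont_cong[THEN iffD1, rotated])
 qed
 have s\<pi>: "smooth_on ?N (%y. ?\<pi> (?f y))"
  by (rule G.smooth_\<pi>_comp[OF ctx])
 have rep: "rep (\<psi> f) ?c ?c y = ?\<pi> (?f y)" if "y\<in>?N" for y using \<psi>y[OF that] by (simp add: local_rep_apply)
 have s\<psi>: "smooth_on ?N (rep (\<psi> f) ?c ?c)" by (rule smooth_cong'[OF s\<pi> N rep])
 have pdA: "pd k (rep (\<psi> f) ?c ?c) ?z = G.jetA ?\<pi> (?f ?z, \<chi> k. pd k ?f ?z)$k" for k
 proof -
  have "pd k (%y. ?\<pi> (?f y)) ?z = G.jetA ?\<pi> (?f ?z, \<chi> k. pd k ?f ?z)$k" by (rule G.pd_\<pi>_comp[OF ctx])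
  moreover have "fd (rep (\<psi> f) ?c ?c) ?z = fd (%y. ?\<pi> (?f y)) ?z"
   by (rule fd_cong[OF N zN rep])
  ultimately show ?thesis by (simp add: pd_def)
 qed
 have jac: "jacobian (rep (\<psi> f) ?c ?c) (at ?z) = transpose (G.jetA ?\<pi> (?f ?z, \<chi> k. pd k ?f ?z))"
  using pdA by (simp add: jacobian_def matrix_def vec_eq_iff transpose_def pd_def)
 have "isCont (\<psi> f) p"
 proof -
  have "isCont (ci ?c) (rep (\<psi> f) ?c ?c ?z)"
   using chD(8,2)[OF chc] \<psi>y[OF zN] rep[OF zN] chD(4)[OF chc] by (simp add: continuous_on_eq_continuous_at) metis
  from isCont_o2[OF isCont_o2[OF cc smooth_isCont[OF s\<psi> zN]] this]
  have "isCont (%p'. ci ?c (rep (\<psi> f) ?c ?c (cm ?c p'))) p" .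
  moreover have "\<forall>\<^sub>F p' in nhds p. ci ?c (rep (\<psi> f) ?c ?c (cm ?c p')) = \<psi> f p'"
   using cin
  proof eventually_elim
   case (elim p')
   hence "\<psi> f p'\<in>cdom ?c" using \<psi>y[of "cm ?c p'"] by (simp add: chD[OF chc])
   thus ?case using elim by (simp add: local_rep_map[OF chc] chD[OF chc])
  qed
  ultimately show ?thesis by (rule isCont_cong[THEN iffD1, rotated])
 qed
 moreover have "\<psi> f p\<in>cdom ?c" using \<psi>y[OF zN] by (simp add: chD[OF chc] pd)
 ultimately show "psi_regular q f p"
  unfolding psi_regular_def
  using pd s\<psi> N zN gj[OF zN] by (auto simp: jac det_transpose pdA G.good_jet_def intro!: exI[of _ ?N])
qed

end

end

end

section \<open>Reparametrisations\<close>

text \<open>A continuous bijection of a compact Hausdorff space has a continuous inverse. The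
  implicit function theorem for \<open>h x = y\<close> makes it smooth, and positivity of the
  Jacobian passes to other charts because the atlas is oriented.\<close>

lemma reparametrisation_criterion:
 fixes A :: "('x::{t2_space, second_countable_topology}, 'k::finite) chart set"
 assumes A: "oriented_atlas A" and cmp: "compact (UNIV :: 'x set)" and bij: "bij \<psi>" and cont: "continuous_on UNIV \<psi>"
  and loc: "!!p. \<exists>c\<in>A. \<exists>R. p\<in>cdom c \<and> \<psi> p\<in>cdom c \<and> open R \<and> cm c p\<in>R \<and>
   smooth_on R (rep \<psi> c c) \<and> det (jacobian (rep \<psi> c c) (at (cm c p))) > 0"
 shows "reparametrisation A \<psi>"
proof -
 have sA: "smooth_atlas A" using A by (simp add: oriented_atlas_def)
 note ch = atlas_chart[OF sA]
 have inv: "inv \<psi> (\<psi> p) = p" "\<psi> (inv \<psi> p) = p" for p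
  using bij by (simp_all add: bij_is_inj bij_is_surj surj_f_inv_f)
 have sm: "smooth_map A A \<psi>" by (rule smooth_map_local[OF sA sA cont]) (use loc in blast)
 have jac: "jacobian h (at x) *v v = fd h x v" if "smooth_on R h" "x\<in>R" for h :: "real^'k => real^'k" and R x v
  unfolding jacobian_def using fun_cong[OF matrix_vector_mul(2)[OF linear_deriv[OF that]], of v] by simp
 have icont: "continuous_on UNIV (inv \<psi>)"
  using continuous_on_inv[OF cont cmp, of "inv \<psi>"] inv(1) bij by (simp add: bij_is_surj)
 have ismooth: "smooth_map A A (inv \<psi>)"
 proof (rule smooth_map_local[OF sA sA icont])
  fix p1
  obtain c R where c: "c\<in>A" "inv \<psi> p1\<in>cdom c" "p1\<in>cdom c" and R: "open R" "cm c (inv \<psi> p1)\<in>R"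
   "smooth_on R (rep \<psi> c c)" "det (jacobian (rep \<psi> c c) (at (cm c (inv \<psi> p1)))) > 0"
   using loc[of "inv \<psi> p1"] by (auto simp: inv)
  note C = ch[OF c(1)]
  let ?h = "rep \<psi> c c" and ?z = "cm c (inv \<psi> p1)" and ?y = "cm c p1"
  have hz: "?h ?z = ?y" by (simp add: local_rep_map[OF C c(2)] inv)
  let ?W = "R \<times> (UNIV :: (real^'k) set)" and ?\<Phi> = "%q. ?h (fst q) - snd q"
  have W: "open ?W" by (intro open_Times R open_UNIV)
  have s: "smooth_on ?W ?\<Phi>"
   by (intro smooth_diff W smooth_compose[OF R(3) smooth_fst[OF W smooth_id] W R(1)] smooth_snd[OF W smooth_id]) auto
  have zW: "(?z, ?y)\<in>?W" using R(2) by simp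
  have z0: "?\<Phi> (?z, ?y) = 0" by (simp add: hz)
  have inj: "v = 0" if v: "fd ?\<Phi> (?z, ?y) (v, 0) = 0" for v
  proof -
   have "(?\<Phi> has_derivative (%q. fd ?h ?z (fst q) - snd q)) (at (?z, ?y))"
    using has_derivative_diff[OF has_derivative_compose[OF has_derivative_fst[OF has_derivative_ident], of ?h "fd ?h ?z" "(?z, ?y)"]
     has_derivative_snd[OF has_derivative_ident]] smooth_hd[OF R(3,2)] by simp
   from fun_cong[OF fdI[OF this], of "(v, 0)"] v
   have "jacobian ?h (at ?z) *v v = 0" by (simp add: jac[OF R(3,2)])
   moreover have "invertible (jacobian ?h (at ?z))" using R(4) by (simp add: invertible_det_nz)
   ultimately show "v = 0" using invertible_left_inverse matrix_left_invertible_ker by blast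
  qed
  show "\<exists>c\<in>A. \<exists>d\<in>A. \<exists>U. p1\<in>cdom c \<and> inv \<psi> p1\<in>cdom d \<and> open U \<and> cm c p1\<in>U \<and> smooth_on U (rep (inv \<psi>) c d)"
  proof (rule smooth_implicit_function[OF W s zW z0 inj])
   fix U V \<pi>
   assume U: "open U" "open V" "?z\<in>U" "?y\<in>V" "U \<times> V \<subseteq> ?W" and \<pi>: "smooth_on V \<pi>"
    and zero: "!!x y. x\<in>U ==> y\<in>V ==> ?\<Phi> (x, y) = 0 \<longleftrightarrow> x = \<pi> y"
   let ?V = "V \<inter> {y\<in>cimg c. ci c y\<in>inv \<psi> -` {q\<in>cdom c. cm c q\<in>U}}"
   have oV: "open ?V"
    by (intro open_Int U(2) open_chart_image[OF C] open_vimage open_chart_vimage[OF C] U(1) icont)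
   have yV: "?y\<in>?V" using U(3,4) c by (simp add: chD[OF C])
   have "rep (inv \<psi>) c c y = \<pi> y" if y: "y\<in>?V" for y
   proof -
    let ?q = "inv \<psi> (ci c y)"
    have "?h (cm c ?q) = y" using y by (simp add: local_rep_apply inv chD[OF C])
    thus ?thesis using zero[of "cm c ?q" y] y by (simp add: local_rep_apply)
   qed
   hence "smooth_on ?V (rep (inv \<psi>) c c)"
    using smooth_cong'[OF smooth_subset[OF \<pi>, of ?V] oV] by blast
   thus ?thesis using c oV yV by blast
  qed
 qed
 have pos: "det (jacobian (rep \<psi> c' d') (at x)) > 0" if cd: "c'\<in>A" "d'\<in>A" "x\<in>ldom \<psi> c' d'" for c' d' x
 proof -
  note C' = ch[OF cd(1)] and D' = ch[OF cd(2)]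
  obtain c R where c: "c\<in>A" "ci c' x\<in>cdom c" "\<psi> (ci c' x)\<in>cdom c"
   and pc: "det (jacobian (rep \<psi> c c) (at (cm c (ci c' x)))) > 0"
   using loc[of "ci c' x"] by blast
  note C = ch[OF c(1)]
  let ?t = "trn c' c" and ?u = "trn c d'" and ?h = "rep \<psi> c c"
  have x: "x\<in>overlap c' c" "?t x\<in>ldom \<psi> c c" "?h (?t x)\<in>overlap c d'"
   using c cd(3) by (simp_all add: overlap_iff[OF C'] overlap_iff[OF C] local_dom_iff[OF C] local_dom_iff[OF C'] transition_apply local_rep_apply chD[OF C])
  note st = smooth_transition[OF sA cd(1) c(1)] and su = smooth_transition[OF sA c(1) cd(2)] and sh = smooth_mapD[OF sm c(1) c(1)]
  have "((%x. ?u (?h (?t x))) has_derivative (%v. fd ?u (?h (?t x)) (fd ?h (?t x) (fd ?t x v)))) (at x)"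
   by (rule has_derivative_compose[OF has_derivative_compose[OF smooth_hd[OF st x(1)] smooth_hd[OF sh x(2)]] smooth_hd[OF su x(3)]])
  hence "(rep \<psi> c' d' has_derivative (%v. fd ?u (?h (?t x)) (fd ?h (?t x) (fd ?t x v)))) (at x)"
  proof (rule hd_cong)
   show "open (ldom \<psi> c' c \<inter> overlap c' c)" by (intro open_Int open_local_dom[OF C' C cont] open_overlap[OF C' C])
   show "x\<in>ldom \<psi> c' c \<inter> overlap c' c" using x(1) c cd(3) by (simp add: local_dom_iff[OF C'])
  qed (auto simp: local_dom_iff[OF C'] overlap_iff[OF C'] local_rep_apply transition_apply chD[OF C])
  from fdI[OF this]
  have "jacobian (rep \<psi> c' d') (at x) *v v = (jacobian ?u (at (?h (?t x))) ** jacobian ?h (at (?t x)) ** jacobian ?t (at x)) *v v" for v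
   using jac[OF smooth_mapD[OF sm cd(1,2)] cd(3)] jac[OF su x(3)] jac[OF sh x(2)] jac[OF st x(1)]
   by (simp add: matrix_vector_mul_assoc[symmetric])
  hence "jacobian (rep \<psi> c' d') (at x) = jacobian ?u (at (?h (?t x))) ** jacobian ?h (at (?t x)) ** jacobian ?t (at x)"
   by (simp add: matrix_eq)
  moreover have "det (jacobian ?u (at (?h (?t x)))) > 0" "det (jacobian ?t (at x)) > 0"
   using A cd c x unfolding oriented_atlas_def by blast+
  ultimately show ?thesis using pc by (simp add: det_mul transition_apply)
 qed
 show ?thesis unfolding reparametrisation_def using bij sm ismooth pos by blast
qed

text \<open>Each of the \<open>n * n\<close> entries of the derivative of \<open>h - id\<close> is
  below \<open>1 / (2 n^2)\<close>, so \<open>h - id\<close> is Lipschitz with constant 1/2 on the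
  ball. This gives injectivity directly and surjectivity by a fixed point argument.\<close>

lemma near_identity:
 fixes h :: "real^'k::finite => real^'k"
 assumes dif: "!!x. x\<in>cball x0 r ==> h differentiable (at x)"
  and small: "!!x i j. x\<in>cball x0 r ==> \<bar>pd i h x$j - mat 1$i$j\<bar> < 1 / (2 * real CARD('k) * real CARD('k))"
 shows "inj_on h (cball x0 r)"
  and "r > 0 ==> norm (h x0 - x0) \<le> r / 4 ==> ball x0 (r / 4) \<subseteq> h ` cball x0 r"
proof -
 have est: "norm ((h x - x) - (h y - y)) \<le> 1/2 * norm (x - y)" if xy: "x\<in>cball x0 r" "y\<in>cball x0 r" for x y
 proof (rule differentiable_bound[OF convex_cball _ _ xy, of "%x. h x - x" "%x v. fd h x v - v"])
  fix x assume x: "x\<in>cball x0 r"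
  have hd: "(h has_derivative fd h x) (at x)" by (rule fd_works[OF dif[OF x]])
  show "((%x. h x - x) has_derivative (%v. fd h x v - v)) (at x within cball x0 r)"
   by (rule has_derivative_at_withinI[OF has_derivative_diff[OF hd has_derivative_ident]])
  show "onorm (%v. fd h x v - v) \<le> 1/2"
  proof (rule onorm_le)
   fix v
   have "fd h x v = (\<Sum>i\<in>UNIV. v$i *\<^sub>R pd i h x)"
    unfolding pd_def by (rule axis_expansion[OF has_derivative_linear[OF hd]])
   moreover have "v = (\<Sum>i\<in>UNIV. v$i *\<^sub>R mat 1$i)"
    by (simp add: vec_eq_iff mat_def if_distrib cong: if_cong)
   ultimately have "fd h x v - v = (\<Sum>i\<in>UNIV. v$i *\<^sub>R pd i h x) - (\<Sum>i\<in>UNIV. v$i *\<^sub>R mat 1$i)"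
    by (rule arg_cong2)
   also have "\<dots> = (\<Sum>i\<in>UNIV. v$i *\<^sub>R (pd i h x - mat 1$i))"
    by (simp only: scaleR_diff_right sum_subtractf)
   also have "norm \<dots> \<le> (\<Sum>i\<in>(UNIV :: 'k set). norm v * (\<Sum>j\<in>(UNIV :: 'k set). 1 / (2 * real CARD('k) * real CARD('k))))"
   proof (rule order_trans[OF norm_sum], rule sum_mono)
    fix i
    have "norm (pd i h x - mat 1$i) \<le> (\<Sum>j\<in>UNIV. \<bar>pd i h x$j - mat 1$i$j\<bar>)"
     using norm_vec_le_sum[of "pd i h x - mat 1$i"] by simp
    also have "\<dots> \<le> (\<Sum>j\<in>(UNIV :: 'k set). 1 / (2 * real CARD('k) * real CARD('k)))"
     by (intro sum_mono less_imp_le small x)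
    finally show "norm (v$i *\<^sub>R (pd i h x - mat 1$i)) \<le> norm v * (\<Sum>j\<in>(UNIV :: 'k set). 1 / (2 * real CARD('k) * real CARD('k)))"
     unfolding norm_scaleR using component_le_norm_cart[of v i] by (intro mult_mono) auto
   qed
   finally show "norm (fd h x v - v) \<le> 1/2 * norm v" by (simp add: field_simps)
  qed
 qed
 show "inj_on h (cball x0 r)"
 proof (rule inj_onI)
  fix x y assume "x\<in>cball x0 r" "y\<in>cball x0 r" "h x = h y"
  with est[of x y] have "norm (x - y) \<le> 1/2 * norm (x - y)" by (simp add: norm_minus_commute)
  thus "x = y" by simp
 qed
 show "ball x0 (r / 4) \<subseteq> h ` cball x0 r" if r: "r > 0" and c: "norm (h x0 - x0) \<le> r / 4"
 proof
  fix y assume y: "y\<in>ball x0 (r / 4)"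
  have ch: "continuous_on (cball x0 r) h"
   using dif by (intro differentiable_imp_continuous_on) (auto simp: differentiable_on_def intro: differentiable_at_withinI)
  \<comment> \<open>Brouwer's theorem applies since \<open>y + (x - h x)\<close> stays in the ball:
    \<open>r/4\<close> comes from \<open>y\<close>, \<open>r/2\<close> from the Lipschitz bound and
    \<open>r/4\<close> from the displacement of the centre.\<close>
  have "\<exists>x\<in>cball x0 r. h x = y"
  proof (rule brouwer_surjective_cball[OF ch r y])
   fix y x assume y: "y\<in>ball x0 (r / 4)" and x: "x\<in>cball x0 r"
   have "norm (h x - x) \<le> norm ((h x - x) - (h x0 - x0)) + norm (h x0 - x0)" using norm_triangle_sub[of "h x - x" "h x0 - x0"] by (simp only: add.commute)
   also have "\<dots> \<le> 1/2 * r + r / 4"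
    using est[OF x, of x0] x r c by (auto simp: dist_norm norm_minus_commute)
   finally have "norm (x - h x) \<le> 1/2 * r + r / 4" by (simp add: norm_minus_commute)
   moreover have "norm (y - x0) < r / 4" using y by (simp add: dist_norm norm_minus_commute)
   ultimately have "norm ((y - x0) + (x - h x)) \<le> r" using norm_triangle_ineq[of "y - x0" "x - h x"] by linarith
   thus "y + (x - h x)\<in>cball x0 r" by (simp add: dist_norm norm_minus_commute algebra_simps)
  qed
  thus "y\<in>h ` cball x0 r" by blast
 qed
qed

section \<open>Local uniqueness\<close>

text \<open>Each property of \<open>\<psi>\<close> and \<open>S\<close> is known for
  \<open>f\<close> near \<open>\<iota>\<close> and \<open>p\<close> near a given \<open>q\<close>,
  and compactness makes it hold on all of \<open>L\<close> at once. Injectivity concerns pairs of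
  points and uses the compactness of \<open>L \<times> L\<close>.\<close>

lemma (in gauge_data) eventually_reparametrised:
 assumes a: "0 < a" "a < 1"
 shows "\<forall>\<^sub>F f in nhdsin (C2_hoelder_topology AL AM a) \<iota>. maslov_zero f --> (\<exists>\<phi>. reparametrisation AL \<phi> \<and> f = \<iota> \<circ> \<phi>)"
proof -
 obtain I and \<rho> :: "'l => real" where I: "finite I" and \<rho>: "!!q. \<rho> q > 0" "!!q. cball (ctr q) (\<rho> q) \<subseteq> cimg (cq q)"
  "!!q. mball (cq q) (ctr q) (\<rho> q) \<subseteq> Oq q" "!!p. \<exists>q\<in>I. p\<in>cdom (cq q) \<and> dist (ctr q) (cm (cq q) p) < \<rho> q"
  using finite_bump_cover[OF aL cmp cq cq_dom open_Oq Oq_self] unfolding ctr_def by metis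
 define B where "B q = mball (cq q) (ctr q) (\<rho> q)" for q
 have Bc: "closed (B q)" for q unfolding B_def by (rule closed_mball[OF aL cq \<rho>(1,2)])
 have BO: "B q \<subseteq> Oq q" for q unfolding B_def by (rule \<rho>(3))
 have cov: "\<exists>q\<in>I. p\<in>B q" for p
  using \<rho>(4)[of p] unfolding B_def mball_iff[OF aL cq \<rho>(1,2)] by (force intro: less_imp_le)
 note H = a I Bc BO cov
 let ?F = "nhdsin (C2_hoelder_topology AL AM a) \<iota>"
 let ?\<psi> = "\<psi> I B" and ?S = "S I B" and ?reg = "psi_regular I B"
 have near: "\<forall>\<^sub>F (f, p) in ?F \<times>\<^sub>F nhds q. \<exists>U. open U \<and> p\<in>U \<and> (\<forall>p'\<in>U. locform I B q f p')" for q
  by (rule eventually_prod_nhds_nested[OF locform_near[OF H]])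
 have reg: "\<forall>\<^sub>F (f, p) in ?F \<times>\<^sub>F nhds q. maslov_zero f --> ?reg q f p" for q
  by (rule eventually_mono[OF near]) (auto dest: local_conclusions(4)[OF H])
 have E1: "\<forall>\<^sub>F f in ?F. \<forall>p. maslov_zero f -->
   ((\<forall>p'. ?S f p' \<le> ?S f p) --> ?S f p \<le> 0 \<and> f p = \<iota> (?\<psi> f p)) \<and> ((\<forall>p'. ?S f p \<le> ?S f p') --> ?S f p \<ge> 0) \<and>
   isCont (?S f) p \<and> (\<exists>q. ?reg q f p)"
  by (rule eventually_all_compact[OF cmp], rule eventually_mono[OF near])
   (auto dest: local_conclusions[OF H])
 have psi_tend: "((%(f, p). ?\<psi> f p) \<longlongrightarrow> q) (?F \<times>\<^sub>F nhds q)" for q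
  by (rule Lim_transform_eventually[OF \<psi>i_tendsto[OF a Oq_self]])
   (rule eventually_mono[OF locform_near[OF H]], auto simp: locform_def[OF H])
 have ball: "\<exists>r>0. cball (ctr q) r \<subseteq> cimg (cq q) \<and>
   (\<forall>\<^sub>F f in ?F. maslov_zero f --> (\<forall>x\<in>cball (ctr q) r. ?reg q f (ci (cq q) x)))" for q
 proof -
  obtain Pf Pg where P: "eventually Pf ?F" "eventually Pg (nhds q)" "!!f p. Pf f ==> Pg p ==> maslov_zero f --> ?reg q f p"
   using reg[of q] unfolding eventually_prod_filter by auto
  obtain U where U: "open U" "q\<in>U" "!!p. p\<in>U ==> Pg p" using P(2) unfolding eventually_nhds by auto
  have "open {x\<in>cimg (cq q). ci (cq q) x\<in>U}" by (rule open_chart_image[OF chc U(1)])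
  moreover have "ctr q\<in>{x\<in>cimg (cq q). ci (cq q) x\<in>U}" using U(2) cq_dom by (simp add: ctr_def chD[OF chc])
  ultimately obtain r where r: "r > 0" "cball (ctr q) r \<subseteq> {x\<in>cimg (cq q). ci (cq q) x\<in>U}"
   using open_contains_cball by blast
  have "\<forall>\<^sub>F f in ?F. maslov_zero f --> (\<forall>x\<in>cball (ctr q) r. ?reg q f (ci (cq q) x))"
   by (rule eventually_mono[OF P(1)]) (use P(3) U(3) r(2) in blast)
  thus ?thesis using r by blast
 qed
 have ident: "inj_on (rep (?\<psi> f) (cq q) (cq q)) (cball (ctr q) r)
   \<and> (norm (rep (?\<psi> f) (cq q) (cq q) (ctr q) - ctr q) \<le> r / 4 --> ball (ctr q) (r / 4) \<subseteq> rep (?\<psi> f) (cq q) (cq q) ` cball (ctr q) r)"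
  if r: "r > 0" "cball (ctr q) r \<subseteq> cimg (cq q)" and rg: "\<forall>x\<in>cball (ctr q) r. ?reg q f (ci (cq q) x)" for f q r
 proof -
  have d: "rep (?\<psi> f) (cq q) (cq q) differentiable (at x)"
   and s: "\<bar>pd i (rep (?\<psi> f) (cq q) (cq q)) x$j - mat 1$i$j\<bar> < 1 / (2 * real CARD('n) * real CARD('n))"
   if "x\<in>cball (ctr q) r" for x i j
   using rg[rule_format, OF that] subsetD[OF r(2) that] smooth_differentiable
   unfolding psi_regular_def[OF H] by (auto simp: chD[OF chc])
  show ?thesis using near_identity[OF d s] r(1) by blast
 qed
 \<comment> \<open>Near a pair of distinct points the images stay in disjoint neighbourhoods because
   \<open>\<psi> f p\<close> tends to \<open>q\<close> as \<open>f\<close> tends to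
   \<open>\<iota>\<close> and \<open>p\<close> to \<open>q\<close>. Near the diagonal both points
   lie in a ball on which \<open>\<psi> f\<close> is injective.\<close>
 have inj: "\<forall>\<^sub>F (f, w) in ?F \<times>\<^sub>F nhds w0. maslov_zero f --> ?\<psi> f (fst w) = ?\<psi> f (snd w) --> fst w = snd w" for w0 :: "'l \<times> 'l"
 proof (cases "fst w0 = snd w0")
  case False
  then obtain U1 U2 where U: "open U1" "open U2" "fst w0\<in>U1" "snd w0\<in>U2" "U1 \<inter> U2 = {}" by (metis hausdorff)
  have t: "((%fw. ?\<psi> (fst fw) (h (snd fw))) \<longlongrightarrow> h w0) (?F \<times>\<^sub>F nhds w0)" if h: "(h \<longlongrightarrow> h w0) (nhds w0)" for h :: "'l \<times> 'l => 'l"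
  proof -
   have "filterlim (%fw. (fst fw, h (snd fw))) (?F \<times>\<^sub>F nhds (h w0)) (?F \<times>\<^sub>F nhds w0)"
    by (intro filterlim_Pair filterlim_fst filterlim_compose[OF h filterlim_snd])
   from filterlim_compose[OF psi_tend this] show ?thesis by simp
  qed
  have f1: "((%w. fst w) \<longlongrightarrow> fst w0) (nhds w0)" and f2: "((%w. snd w) \<longlongrightarrow> snd w0) (nhds w0)"
   by (intro tendsto_fst tendsto_snd filterlim_ident)+
  have "\<forall>\<^sub>F fw in ?F \<times>\<^sub>F nhds w0. ?\<psi> (fst fw) (fst (snd fw))\<in>U1" by (rule topological_tendstoD[OF t[OF f1] U(1,3)])
  moreover have "\<forall>\<^sub>F fw in ?F \<times>\<^sub>F nhds w0. ?\<psi> (fst fw) (snd (snd fw))\<in>U2" by (rule topological_tendstoD[OF t[OF f2] U(2,4)])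
  ultimately show ?thesis by eventually_elim (use U(5) in auto)
 next
  case True
  let ?q = "fst w0" and ?h = "%f. rep (?\<psi> f) (cq (fst w0)) (cq (fst w0))"
  obtain r where r: "r > 0" "cball (ctr ?q) r \<subseteq> cimg (cq ?q)"
   and ev: "\<forall>\<^sub>F f in ?F. maslov_zero f --> (\<forall>x\<in>cball (ctr ?q) r. ?reg ?q f (ci (cq ?q) x))"
   using ball by blast
  let ?U = "{p\<in>cdom (cq ?q). cm (cq ?q) p\<in>ball (ctr ?q) r}"
  have oU: "open ?U" by (rule open_chart_vimage[OF chc open_ball])
  have qU: "?q\<in>?U" using r(1) cq_dom by (simp add: ctr_def)
  have "w0\<in>?U \<times> ?U" using qU True unfolding mem_Times_iff by metis
  hence evU: "\<forall>\<^sub>F w in nhds w0. w\<in>?U \<times> ?U" by (rule eventually_nhds_in_open[OF open_Times[OF oU oU]])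
  have key: "fst w = snd w"
   if f: "maslov_zero f --> (\<forall>x\<in>cball (ctr ?q) r. ?reg ?q f (ci (cq ?q) x))" "maslov_zero f"
    and w: "w\<in>?U \<times> ?U" and e: "?\<psi> f (fst w) = ?\<psi> f (snd w)" for f w
  proof -
   have rg: "\<forall>x\<in>cball (ctr ?q) r. ?reg ?q f (ci (cq ?q) x)" using f by blast
   have ij: "inj_on (?h f) (cball (ctr ?q) r)" using ident[OF r rg] by blast
   have w': "fst w\<in>cdom (cq ?q)" "snd w\<in>cdom (cq ?q)" "cm (cq ?q) (fst w)\<in>cball (ctr ?q) r" "cm (cq ?q) (snd w)\<in>cball (ctr ?q) r"
    using w by (auto simp: mem_Times_iff)
   have "?h f (cm (cq ?q) (fst w)) = ?h f (cm (cq ?q) (snd w))" using e w' by (simp add: local_rep_map[OF chc])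
   from inj_onD[OF ij this w'(3,4)] have "ci (cq ?q) (cm (cq ?q) (fst w)) = ci (cq ?q) (cm (cq ?q) (snd w))" by (rule arg_cong)
   thus ?thesis using w' by (simp add: chD[OF chc])
  qed
  show ?thesis unfolding eventually_prod_filter split_conv using ev evU key by blast
 qed
 have "compact (UNIV :: ('l \<times> 'l) set)" using compact_Times[OF cmp cmp] by simp
 from eventually_all_compact[OF this inj]
 have E2: "\<forall>\<^sub>F f in ?F. \<forall>w. maslov_zero f --> ?\<psi> f (fst w) = ?\<psi> f (snd w) --> fst w = snd w" .
 \<comment> \<open>The image of the ball of radius \<open>r\<close> contains the ball of radius
   \<open>r / 4\<close> once the centre moves by at most \<open>r / 4\<close>; since neither radius
   depends on \<open>f\<close>, this covers a fixed neighbourhood of \<open>q\<close>.\<close>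
 have surj: "\<forall>\<^sub>F (f, p) in ?F \<times>\<^sub>F nhds q. maslov_zero f --> p\<in>range (?\<psi> f)" for q
 proof -
  let ?h = "%f. rep (?\<psi> f) (cq q) (cq q)"
  obtain r where r: "r > 0" "cball (ctr q) r \<subseteq> cimg (cq q)"
   and ev: "\<forall>\<^sub>F f in ?F. maslov_zero f --> (\<forall>x\<in>cball (ctr q) r. ?reg q f (ci (cq q) x))"
   using ball by blast
  let ?U = "{p\<in>cdom (cq q). cm (cq q) p\<in>ball (ctr q) (r / 4)}"
  have oU: "open ?U" by (rule open_chart_vimage[OF chc open_ball])
  have qU: "q\<in>?U" using r(1) cq_dom by (simp add: ctr_def)
  have "\<forall>\<^sub>F fp in ?F \<times>\<^sub>F nhds q. (case fp of (f, p) => ?\<psi> f p)\<in>?U" by (rule topological_tendstoD[OF psi_tend oU qU])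
  from this[unfolded eventually_prod_filter split_conv]
  obtain Pf Pg where P: "eventually Pf ?F" "eventually Pg (nhds q)" "\<forall>f p. Pf f --> Pg p --> ?\<psi> f p\<in>?U"
   by (elim exE conjE)
  have Pq: "Pg q" by (rule eventually_nhds_x_imp_x[OF P(2)])
  have evq: "\<forall>\<^sub>F f in ?F. ?\<psi> f q\<in>?U"
   by (rule eventually_mono[OF P(1)]) (rule P(3)[rule_format, OF _ Pq])
  have key: "p\<in>range (?\<psi> f)"
   if rg: "\<forall>x\<in>cball (ctr q) r. ?reg q f (ci (cq q) x)" and q: "?\<psi> f q\<in>?U" and p: "p\<in>?U" for f p
  proof -
   have "?h f (ctr q) = cm (cq q) (?\<psi> f q)" unfolding ctr_def by (rule local_rep_map[OF chc cq_dom])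
   hence "norm (?h f (ctr q) - ctr q) \<le> r / 4" using q by (auto simp: dist_norm norm_minus_commute)
   hence "ball (ctr q) (r / 4) \<subseteq> ?h f ` cball (ctr q) r" using ident[OF r rg] by blast
   then obtain x where x: "x\<in>cball (ctr q) r" "cm (cq q) p = ?h f x" using p by blast
   have "?reg q f (ci (cq q) x)" using rg x(1) by blast
   hence "?\<psi> f (ci (cq q) x)\<in>cdom (cq q)" by (simp add: psi_regular_def[OF H])
   moreover have "ci (cq q) (cm (cq q) p) = ci (cq q) (cm (cq q) (?\<psi> f (ci (cq q) x)))"
    unfolding x(2) by (simp add: local_rep_apply)
   ultimately have "p = ?\<psi> f (ci (cq q) x)" using p by (simp add: chD[OF chc])
   thus ?thesis by blast
  qed
  show ?thesis unfolding eventually_prod_filter split_conv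
   by (rule exI, rule exI, rule conjI[OF eventually_conj[OF ev evq]], rule conjI[OF eventually_nhds_in_open[OF oU qU]]) (use key in blast)
 qed
 have E3: "\<forall>\<^sub>F f in ?F. \<forall>p. maslov_zero f --> p\<in>range (?\<psi> f)"
  by (rule eventually_all_compact[OF cmp surj])
 show ?thesis
  using E1 E2 E3
 proof (eventually_elim, intro impI)
  fix f
  assume m: "maslov_zero f" and e1: "\<forall>p. maslov_zero f -->
   ((\<forall>p'. ?S f p' \<le> ?S f p) --> ?S f p \<le> 0 \<and> f p = \<iota> (?\<psi> f p)) \<and> ((\<forall>p'. ?S f p \<le> ?S f p') --> ?S f p \<ge> 0) \<and>
   isCont (?S f) p \<and> (\<exists>q. ?reg q f p)"
   and e2: "\<forall>w. maslov_zero f --> ?\<psi> f (fst w) = ?\<psi> f (snd w) --> fst w = snd w"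
   and e3: "\<forall>p. maslov_zero f --> p\<in>range (?\<psi> f)"
  have cS: "continuous_on UNIV (?S f)" using e1 m by (simp add: continuous_on_eq_continuous_at)
  obtain p1 where p1: "!!p'. ?S f p' \<le> ?S f p1" using continuous_attains_sup[OF cmp _ cS] by auto
  obtain p2 where p2: "!!p'. ?S f p2 \<le> ?S f p'" using continuous_attains_inf[OF cmp _ cS] by auto
  have "?S f p1 \<le> 0" "?S f p2 \<ge> 0" using e1 m p1 p2 by blast+
  hence S0: "?S f p = 0" for p using p1[of p] p2[of p] by linarith
  have eq: "f p = \<iota> (?\<psi> f p)" for p using e1 m S0 by simp
  have bij: "bij (?\<psi> f)"
  proof (rule bijI)
   show "inj (?\<psi> f)"
   proof (rule injI)
    fix p p' assume "?\<psi> f p = ?\<psi> f p'"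
    thus "p = p'" using e2[rule_format, of "(p, p')"] m by simp
   qed
   show "surj (?\<psi> f)" using e3 m by blast
  qed
  have rg: "\<exists>q. ?reg q f p" for p using e1 m by blast
  have "reparametrisation AL (?\<psi> f)"
  proof (rule reparametrisation_criterion[OF ori cmp bij])
   show "continuous_on UNIV (?\<psi> f)" using rg by (auto simp: continuous_on_eq_continuous_at psi_regular_def[OF H])
   fix p
   obtain q where "?reg q f p" using rg by blast
   thus "\<exists>c\<in>AL. \<exists>R. p\<in>cdom c \<and> ?\<psi> f p\<in>cdom c \<and> open R \<and> cm c p\<in>R \<and>
     smooth_on R (rep (?\<psi> f) c c) \<and> det (jacobian (rep (?\<psi> f) c c) (at (cm c p))) > 0"
    unfolding psi_regular_def[OF H] using cq by blast
  qed
  moreover have "f = \<iota> \<circ> ?\<psi> f" using eq by auto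
  ultimately show "\<exists>\<phi>. reparametrisation AL \<phi> \<and> f = \<iota> \<circ> \<phi>" by blast
 qed
qed

theorem theorem5p5:
  fixes AM :: "('p::{t2_space, second_countable_topology}, 'm::finite) chart set"
    and J g \<omega> :: "('p, 'm) tensor2"
    and AL :: "('l::{t2_space, second_countable_topology}, 'n::finite) chart set"
    and \<iota> :: "'l \<Rightarrow> 'p"
    and a :: real
  assumes "CARD('m) = 2 * CARD('n)"
    and "kaehler AM J g \<omega>"
    and "negative_ricci AM g"
    and "compact (UNIV :: 'l set)"
    and "oriented_atlas AL"
    and "J_minimal AL AM J g \<omega> \<iota>"
    and "0 < a" and "a < 1"
  shows "\<exists>N. openin (C2_hoelder_topology AL AM a) N \<and> \<iota> \<in> N \<and>
           (\<forall>f\<in>N. J_minimal AL AM J g \<omega> f \<longrightarrow>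
              (\<exists>\<phi>. reparametrisation AL \<phi> \<and> f = \<iota> \<circ> \<phi>))"
proof -
 interpret kaehler_negative AM J g \<omega> AL by unfold_locales (use assms in auto)
 have mz: "maslov_zero \<iota>" by (rule J_minimal_maslov_zero[OF assms(6)])
 obtain F r where "gauge_data AM J g \<omega> AL \<iota> F r" using gauge_data_exists[OF mz] by blast
 then interpret gauge_data AM J g \<omega> AL \<iota> F r .
 have "\<iota>\<in>topspace (C2_hoelder_topology AL AM a)" by (rule topspace_C2[OF sm\<iota>])
 then obtain N where "openin (C2_hoelder_topology AL AM a) N" "\<iota>\<in>N"
  "\<forall>f\<in>N. maslov_zero f --> (\<exists>\<phi>. reparametrisation AL \<phi> \<and> f = \<iota> \<circ> \<phi>)"
  using eventually_reparametrised[OF assms(7,8)] unfolding eventually_nhdsin by blast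
 thus ?thesis using J_minimal_maslov_zero by blast
qed

end
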